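(* Let $X$ be a monoid scheme. There is a monomorphism of abelian groups $\mathsf{CaCl}(X)\to\mathsf{Pic}(X)$ (the connecting homomorphism of the short exact sequence $1\to\mathcal{O}_X^*\to\mathcal{M}_X^*\to\mathcal{M}_X^*/\mathcal{O}_X^*\to 1$), and it is an isomorphism if $X$ is cancellative.
   Context: All monoids are commutative, multiplicative, with unit (no zero element is required). An ideal of a monoid $M$ is a (possibly empty) subset $I$ with $IM\subset I$; it is prime if $M\setminus I$ is a submonoid (so $\emptyset$ is prime). $\mathrm{Spec}(M)$ is the set of prime ideals with basis of open sets $D(f)=\{\mathfrak p : f\notin\mathfrak p\}$, $f\in M$, and sheaf of monoids $\mathcal{O}_M$ with $\mathcal{O}_M(D(f))=M_f$ (the localization inverting $f$). A monoid scheme is a topological space $X$ with a sheaf of monoids $\mathcal{O}_X$ that is locally isomorphic to some $(\mathrm{Spec}(M),\mathcal{O}_M)$ (affine monoid schemes); morphisms are local, as for usual schemes. Finite products exist, with $\mathrm{Spec}(M)\times\mathrm{Spec}(N)=\mathrm{Spec}(M\times N)$. $X$ is separated if the diagonal $X\to X\times X$ is a closed immersion; here $f:Z\to Y$ is a closed immersion if for every affine open $U=\mathrm{Spec}(M)\subset Y$ the preimage $f^{-1}(U)$ is affine, $f^{-1}(U)=\mathrm{Spec}(N)$, and $M\to N$ is surjective. A monoid $M$ is cancellative if $ax=ay$ implies $x=y$. A separated monoid scheme $X$ is called cancellative if for every affine open monoid subscheme $\mathrm{Spec}(M)$ the monoid $M$ is cancellative. An element $m$ of a monoid $M$ is regular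 if $mx=my$ implies $x=y$ for all $x,y\in M$; $R(M)$ is the submonoid of regular elements. For $U\subset X$ open, $\mathcal{R}_X(U)$ is the set of $m\in\mathcal{O}_X(U)$ whose germs $m_x$ lie in $R(\mathcal{O}_{X,x})$ for all $x\in U$. $\mathcal{M}_X$ (the sheaf of meromorphic functions) is the sheaf associated to the presheaf $U\mapsto\mathcal{O}_X(U)_{\mathcal{R}_X(U)}$ (localization at the submonoid $\mathcal{R}_X(U)$). The canonical map $\mathcal{O}_X\to\mathcal{M}_X$ is injective. $\mathcal{O}_X^*$ and $\mathcal{M}_X^*$ are the subsheaves of invertible elements. A Cartier divisor is a global section of $\mathcal{M}_X^*/\mathcal{O}_X^*$; it is principal if it is the image of an element of $\mathcal{M}_X^*(X)$. $\mathsf{CaCl}(X)$ is the quotient of the group of Cartier divisors by the principal ones. $\mathsf{Pic}(X)=H^1(X,\mathcal{O}_X^* )$ is the group of isomorphism classes of line bundles (sheaves of $\mathcal{O}_X$-sets locally isomorphic to $\mathcal{O}_X$) under tensor product. *)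

theory Defs
  imports "HOL-Analysis.Product_Topology" "HOL-Algebra.Coset" "HOL-Algebra.Divisibility"
begin

section \<open>Monoids\<close>

text \<open>In this section and below, monoids are commutative monoids in the sense of \<^locale>\<open>comm_monoid\<close>.
  Homomorphisms in \<open>hom\<close> are not required to preserve the unit; this is added where it matters.\<close>

definition monoid_hom :: "('s, 'm) monoid_scheme \<Rightarrow> ('t, 'n) monoid_scheme \<Rightarrow> ('s \<Rightarrow> 't) set" where
  "monoid_hom M N = {h \<in> hom M N. h \<one>\<^bsub>M\<^esub> = \<one>\<^bsub>N\<^esub>}"

definition monoid_ideal :: "'s set \<Rightarrow> ('s, 'm) monoid_scheme \<Rightarrow> bool" where
  "monoid_ideal I M \<longleftrightarrow> I \<subseteq> carrier M \<and> (\<forall>a\<in>I. \<forall>m\<in>carrier M. a \<otimes>\<^bsub>M\<^esub> m \<in> I)"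

definition prime_monoid_ideal :: "'s set \<Rightarrow> ('s, 'm) monoid_scheme \<Rightarrow> bool" where
  "prime_monoid_ideal I M \<longleftrightarrow> monoid_ideal I M \<and> submonoid (carrier M - I) M"

definition regular_elements :: "('s, 'm) monoid_scheme \<Rightarrow> 's set" where
  "regular_elements M = {m \<in> carrier M. \<forall>x\<in>carrier M. \<forall>y\<in>carrier M.
     m \<otimes>\<^bsub>M\<^esub> x = m \<otimes>\<^bsub>M\<^esub> y \<longrightarrow> x = y}"

text \<open>The fraction \<open>m/s\<close> in the localization of \<open>M\<close> at the submonoid \<open>S\<close>.\<close>

definition fraction :: "('s, 'm) monoid_scheme \<Rightarrow> 's set \<Rightarrow> 's \<Rightarrow> 's \<Rightarrow> ('s \<times> 's) set" where
  "fraction M S m s = {(n, t). n \<in> carrier M \<and> t \<in> S \<and>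
     (\<exists>u\<in>S. u \<otimes>\<^bsub>M\<^esub> (m \<otimes>\<^bsub>M\<^esub> t) = u \<otimes>\<^bsub>M\<^esub> (n \<otimes>\<^bsub>M\<^esub> s))}"

definition localization :: "('s, 'm) monoid_scheme \<Rightarrow> 's set \<Rightarrow> ('s \<times> 's) set monoid" where
  "localization M S =
     \<lparr>carrier = {fraction M S m s | m s. m \<in> carrier M \<and> s \<in> S},
      mult = (\<lambda>A B. \<Union>(m, s)\<in>A. \<Union>(n, t)\<in>B. fraction M S (m \<otimes>\<^bsub>M\<^esub> n) (s \<otimes>\<^bsub>M\<^esub> t)),
      one = fraction M S \<one>\<^bsub>M\<^esub> \<one>\<^bsub>M\<^esub>\<rparr>"


section \<open>Sheaves of sets, germs, associated sheaves\<close>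

text \<open>A presheaf of sets on the space \<open>T\<close> is given by the sets \<open>S U\<close> of sections and the restriction
  maps \<open>\<rho> U V : S U \<rightarrow> S V\<close>; only open sets \<open>U \<supseteq> V\<close> are relevant.\<close>

definition presheaf ::
  "'a topology \<Rightarrow> ('a set \<Rightarrow> 's set) \<Rightarrow> ('a set \<Rightarrow> 'a set \<Rightarrow> 's \<Rightarrow> 's) \<Rightarrow> bool" where
  "presheaf T S \<rho> \<longleftrightarrow>
     (\<forall>U V. openin T U \<and> openin T V \<and> V \<subseteq> U \<longrightarrow> \<rho> U V \<in> S U \<rightarrow> S V) \<and>
     (\<forall>U. openin T U \<longrightarrow> (\<forall>s\<in>S U. \<rho> U U s = s)) \<and>
     (\<forall>U V W. openin T U \<and> openin T V \<and> openin T W \<and> W \<subseteq> V \<and> V \<subseteq> U \<longrightarrow>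
        (\<forall>s\<in>S U. \<rho> V W (\<rho> U V s) = \<rho> U W s))"

definition sheaf ::
  "'a topology \<Rightarrow> ('a set \<Rightarrow> 's set) \<Rightarrow> ('a set \<Rightarrow> 'a set \<Rightarrow> 's \<Rightarrow> 's) \<Rightarrow> bool" where
  "sheaf T S \<rho> \<longleftrightarrow> presheaf T S \<rho> \<and>
     (\<forall>\<C> s. (\<forall>U\<in>\<C>. openin T U \<and> s U \<in> S U) \<and>
            (\<forall>U\<in>\<C>. \<forall>V\<in>\<C>. \<rho> U (U \<inter> V) (s U) = \<rho> V (U \<inter> V) (s V)) \<longrightarrow>
            (\<exists>!t. t \<in> S (\<Union>\<C>) \<and> (\<forall>U\<in>\<C>. \<rho> (\<Union>\<C>) U t = s U)))"

text \<open>The germ at \<open>x\<close> of the section \<open>s\<close> over \<open>U\<close>.\<close>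

definition germ ::
  "'a topology \<Rightarrow> ('a set \<Rightarrow> 's set) \<Rightarrow> ('a set \<Rightarrow> 'a set \<Rightarrow> 's \<Rightarrow> 's) \<Rightarrow>
   'a \<Rightarrow> 'a set \<Rightarrow> 's \<Rightarrow> ('a set \<times> 's) set" where
  "germ T S \<rho> x U s = {(V, t). openin T V \<and> x \<in> V \<and> t \<in> S V \<and>
     (\<exists>W. openin T W \<and> x \<in> W \<and> W \<subseteq> U \<inter> V \<and> \<rho> U W s = \<rho> V W t)}"

text \<open>The sections over \<open>U\<close> of the associated sheaf: families of germs that are locally the germs of
  a section of the presheaf. Families are undefined outside \<open>U\<close>.\<close>

definition associated_sections ::
  "'a topology \<Rightarrow> ('a set \<Rightarrow> 's set) \<Rightarrow> ('a set \<Rightarrow> 'a set \<Rightarrow> 's \<Rightarrow> 's) \<Rightarrow>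
   'a set \<Rightarrow> ('a \<Rightarrow> ('a set \<times> 's) set) set" where
  "associated_sections T S \<rho> U = {\<sigma> \<in> extensional U.
     \<forall>x\<in>U. \<exists>V s. openin T V \<and> x \<in> V \<and> V \<subseteq> U \<and> s \<in> S V \<and> (\<forall>y\<in>V. \<sigma> y = germ T S \<rho> y V s)}"


section \<open>Spaces with a sheaf of monoids\<close>

text \<open>The same record carries spaces with a presheaf of monoids.\<close>

record ('a, 's) monoidal_space =
  sp :: "'a topology"
  sec :: "'a set \<Rightarrow> 's monoid"
  res :: "'a set \<Rightarrow> 'a set \<Rightarrow> 's \<Rightarrow> 's"

definition monoidal_space :: "('a, 's) monoidal_space \<Rightarrow> bool" where
  "monoidal_space X \<longleftrightarrow>
     (\<forall>U. openin (sp X) U \<longrightarrow> comm_monoid (sec X U)) \<and>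
     (\<forall>U V. openin (sp X) U \<and> openin (sp X) V \<and> V \<subseteq> U \<longrightarrow>
        res X U V \<in> monoid_hom (sec X U) (sec X V)) \<and>
     sheaf (sp X) (\<lambda>U. carrier (sec X U)) (res X)"

definition germ_at :: "('a, 's) monoidal_space \<Rightarrow> 'a \<Rightarrow> 'a set \<Rightarrow> 's \<Rightarrow> ('a set \<times> 's) set" where
  "germ_at X = germ (sp X) (\<lambda>U. carrier (sec X U)) (res X)"

definition stalk :: "('a, 's) monoidal_space \<Rightarrow> 'a \<Rightarrow> ('a set \<times> 's) set monoid" where
  "stalk X x =
     \<lparr>carrier = {germ_at X x U s | U s. openin (sp X) U \<and> x \<in> U \<and> s \<in> carrier (sec X U)},
      mult = (\<lambda>A B. \<Union>(U, s)\<in>A. \<Union>(V, t)\<in>B.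
        germ_at X x (U \<inter> V) (res X U (U \<inter> V) s \<otimes>\<^bsub>sec X (U \<inter> V)\<^esub> res X V (U \<inter> V) t)),
      one = germ_at X x (topspace (sp X)) \<one>\<^bsub>sec X (topspace (sp X))\<^esub>\<rparr>"

definition associated_sheaf ::
  "('a, 's) monoidal_space \<Rightarrow> ('a, 'a \<Rightarrow> ('a set \<times> 's) set) monoidal_space" where
  "associated_sheaf P =
     \<lparr>sp = sp P,
      sec = (\<lambda>U.
        \<lparr>carrier = associated_sections (sp P) (\<lambda>V. carrier (sec P V)) (res P) U,
         mult = (\<lambda>\<sigma> \<tau>. \<lambda>x\<in>U. \<sigma> x \<otimes>\<^bsub>stalk P x\<^esub> \<tau> x),
         one = (\<lambda>x\<in>U. \<one>\<^bsub>stalk P x\<^esub>)\<rparr>),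
      res = (\<lambda>U V \<sigma>. restrict \<sigma> V)\<rparr>"

definition to_associated_sheaf ::
  "('a, 's) monoidal_space \<Rightarrow> 'a set \<Rightarrow> 's \<Rightarrow> 'a \<Rightarrow> ('a set \<times> 's) set" where
  "to_associated_sheaf P U s = (\<lambda>x\<in>U. germ_at P x U s)"

definition open_subspace :: "('a, 's) monoidal_space \<Rightarrow> 'a set \<Rightarrow> ('a, 's) monoidal_space" where
  "open_subspace X U = X\<lparr>sp := subtopology (sp X) U\<rparr>"

text \<open>A morphism \<open>X \<rightarrow> Y\<close> is a continuous map \<open>\<phi>\<close> with maps
  \<open>\<psi> V : O\<^sub>Y(V) \<rightarrow> O\<^sub>X(\<phi>\<inverse>(V))\<close> whose stalk maps are local.\<close>

definition preim :: "('a, 's) monoidal_space \<Rightarrow> ('a \<Rightarrow> 'b) \<Rightarrow> 'b set \<Rightarrow> 'a set" where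
  "preim X \<phi> V = {x \<in> topspace (sp X). \<phi> x \<in> V}"

definition morphism ::
  "('a, 's) monoidal_space \<Rightarrow> ('b, 't) monoidal_space \<Rightarrow>
   ('a \<Rightarrow> 'b) \<Rightarrow> ('b set \<Rightarrow> 't \<Rightarrow> 's) \<Rightarrow> bool" where
  "morphism X Y \<phi> \<psi> \<longleftrightarrow>
     continuous_map (sp X) (sp Y) \<phi> \<and>
     (\<forall>V. openin (sp Y) V \<longrightarrow> \<psi> V \<in> monoid_hom (sec Y V) (sec X (preim X \<phi> V))) \<and>
     (\<forall>V W. openin (sp Y) V \<and> openin (sp Y) W \<and> W \<subseteq> V \<longrightarrow>
        (\<forall>t\<in>carrier (sec Y V).
           \<psi> W (res Y V W t) = res X (preim X \<phi> V) (preim X \<phi> W) (\<psi> V t))) \<and>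
     (\<forall>x\<in>topspace (sp X). \<forall>V. openin (sp Y) V \<and> \<phi> x \<in> V \<longrightarrow>
        (\<forall>t\<in>carrier (sec Y V).
           germ_at X x (preim X \<phi> V) (\<psi> V t) \<in> Units (stalk X x) \<longrightarrow>
           germ_at Y (\<phi> x) V t \<in> Units (stalk Y (\<phi> x))))"

definition isomorphic_spaces :: "('a, 's) monoidal_space \<Rightarrow> ('b, 't) monoidal_space \<Rightarrow> bool" where
  "isomorphic_spaces X Y \<longleftrightarrow> (\<exists>\<phi> \<psi>. morphism X Y \<phi> \<psi> \<and> homeomorphic_map (sp X) (sp Y) \<phi> \<and>
     (\<forall>V. openin (sp Y) V \<longrightarrow> \<psi> V \<in> iso (sec Y V) (sec X (preim X \<phi> V))))"


section \<open>Monoid schemes\<close>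

definition spec_points :: "('s, 'm) monoid_scheme \<Rightarrow> 's set set" where
  "spec_points M = {p. prime_monoid_ideal p M}"

definition basic_open :: "('s, 'm) monoid_scheme \<Rightarrow> 's \<Rightarrow> 's set set" where
  "basic_open M f = {p \<in> spec_points M. f \<notin> p}"

definition spec_topology :: "('s, 'm) monoid_scheme \<Rightarrow> 's set topology" where
  "spec_topology M = topology_generated_by {basic_open M f | f. f \<in> carrier M}"

definition prime_frac :: "('s, 'm) monoid_scheme \<Rightarrow> 's set \<Rightarrow> 's \<Rightarrow> 's \<Rightarrow> ('s \<times> 's) set" where
  "prime_frac M p = fraction M (carrier M - p)"

definition prime_localization :: "('s, 'm) monoid_scheme \<Rightarrow> 's set \<Rightarrow> ('s \<times> 's) set monoid" where
  "prime_localization M p = localization M (carrier M - p)"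

text \<open>The structure sheaf of \<open>Spec M\<close>: a section over \<open>U\<close> is a family of elements of the
  localizations \<open>M\<^sub>p\<close> (\<open>p \<in> U\<close>) which is locally given by one fraction. The sections over the basic
  open set of \<open>f\<close> form the localization inverting \<open>f\<close>, because every open cover of that set contains
  the set itself: it has a unique closed point, the union of all primes not containing \<open>f\<close>. See
  lemma \<open>spec_sections_basic_open\<close> below.\<close>

definition Spec :: "('s, 'm) monoid_scheme \<Rightarrow> ('s set, 's set \<Rightarrow> ('s \<times> 's) set) monoidal_space" where
  "Spec M =
     \<lparr>sp = spec_topology M,
      sec = (\<lambda>U.
        \<lparr>carrier = {\<sigma> \<in> extensional U. \<forall>p\<in>U. \<exists>V a s.
           openin (spec_topology M) V \<and> p \<in> V \<and> V \<subseteq> U \<and> a \<in> carrier M \<and> s \<in> carrier M \<and>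
           (\<forall>q\<in>V. s \<notin> q \<and> \<sigma> q = prime_frac M q a s)},
         mult = (\<lambda>\<sigma> \<tau>. \<lambda>p\<in>U. \<sigma> p \<otimes>\<^bsub>prime_localization M p\<^esub> \<tau> p),
         one = (\<lambda>p\<in>U. \<one>\<^bsub>prime_localization M p\<^esub>)\<rparr>),
      res = (\<lambda>U V \<sigma>. restrict \<sigma> V)\<rparr>"

lemma fraction_eq_iff:
  assumes "comm_monoid M" "submonoid S M"
    "m \<in> carrier M" "n \<in> carrier M" "s \<in> S" "t \<in> S"
  shows "fraction M S m s = fraction M S n t \<longleftrightarrow>
    (\<exists>u\<in>S. u \<otimes>\<^bsub>M\<^esub> (m \<otimes>\<^bsub>M\<^esub> t) = u \<otimes>\<^bsub>M\<^esub> (n \<otimes>\<^bsub>M\<^esub> s))"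
proof -
  interpret comm_monoid M by fact
  interpret S: submonoid S M by fact
  have trans: "\<exists>w\<in>S. w \<otimes>\<^bsub>M\<^esub> (a \<otimes>\<^bsub>M\<^esub> r) = w \<otimes>\<^bsub>M\<^esub> (c \<otimes>\<^bsub>M\<^esub> p)"
    if car: "a \<in> carrier M" "b \<in> carrier M" "c \<in> carrier M" "p \<in> S" "q \<in> S" "r \<in> S" "u \<in> S" "v \<in> S"
      and 1: "u \<otimes>\<^bsub>M\<^esub> (a \<otimes>\<^bsub>M\<^esub> q) = u \<otimes>\<^bsub>M\<^esub> (b \<otimes>\<^bsub>M\<^esub> p)"
      and 2: "v \<otimes>\<^bsub>M\<^esub> (b \<otimes>\<^bsub>M\<^esub> r) = v \<otimes>\<^bsub>M\<^esub> (c \<otimes>\<^bsub>M\<^esub> q)"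
    for a b c p q r u v
  proof
    have car': "p \<in> carrier M" "q \<in> carrier M" "r \<in> carrier M" "u \<in> carrier M" "v \<in> carrier M"
      using car S.subset by auto
    note [simp] = car car' m_ac
    have "(u \<otimes>\<^bsub>M\<^esub> v \<otimes>\<^bsub>M\<^esub> q) \<otimes>\<^bsub>M\<^esub> (a \<otimes>\<^bsub>M\<^esub> r) = (v \<otimes>\<^bsub>M\<^esub> r) \<otimes>\<^bsub>M\<^esub> (u \<otimes>\<^bsub>M\<^esub> (a \<otimes>\<^bsub>M\<^esub> q))"
      by simp
    also have "\<dots> = (u \<otimes>\<^bsub>M\<^esub> p) \<otimes>\<^bsub>M\<^esub> (v \<otimes>\<^bsub>M\<^esub> (b \<otimes>\<^bsub>M\<^esub> r))"
      unfolding 1 by simp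
    also have "\<dots> = (u \<otimes>\<^bsub>M\<^esub> v \<otimes>\<^bsub>M\<^esub> q) \<otimes>\<^bsub>M\<^esub> (c \<otimes>\<^bsub>M\<^esub> p)"
      unfolding 2 by simp
    finally show "(u \<otimes>\<^bsub>M\<^esub> v \<otimes>\<^bsub>M\<^esub> q) \<otimes>\<^bsub>M\<^esub> (a \<otimes>\<^bsub>M\<^esub> r) =
      (u \<otimes>\<^bsub>M\<^esub> v \<otimes>\<^bsub>M\<^esub> q) \<otimes>\<^bsub>M\<^esub> (c \<otimes>\<^bsub>M\<^esub> p)" .
    show "u \<otimes>\<^bsub>M\<^esub> v \<otimes>\<^bsub>M\<^esub> q \<in> S" using car by blast
  qed
  show ?thesis
  proof
    assume eq: "fraction M S m s = fraction M S n t"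
    have "(n, t) \<in> fraction M S n t" using assms by (auto simp: fraction_def)
    then have "(n, t) \<in> fraction M S m s" by (simp only: eq)
    then show "\<exists>u\<in>S. u \<otimes>\<^bsub>M\<^esub> (m \<otimes>\<^bsub>M\<^esub> t) = u \<otimes>\<^bsub>M\<^esub> (n \<otimes>\<^bsub>M\<^esub> s)"
      by (simp add: fraction_def)
  next
    assume "\<exists>u\<in>S. u \<otimes>\<^bsub>M\<^esub> (m \<otimes>\<^bsub>M\<^esub> t) = u \<otimes>\<^bsub>M\<^esub> (n \<otimes>\<^bsub>M\<^esub> s)"
    then obtain u where u: "u \<in> S" "u \<otimes>\<^bsub>M\<^esub> (m \<otimes>\<^bsub>M\<^esub> t) = u \<otimes>\<^bsub>M\<^esub> (n \<otimes>\<^bsub>M\<^esub> s)" by blast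
    have sub: "fraction M S b q \<subseteq> fraction M S a p"
      if "a \<in> carrier M" "b \<in> carrier M" "p \<in> S" "q \<in> S"
        and "u \<otimes>\<^bsub>M\<^esub> (a \<otimes>\<^bsub>M\<^esub> q) = u \<otimes>\<^bsub>M\<^esub> (b \<otimes>\<^bsub>M\<^esub> p)" for a b p q
    proof
      fix z assume "z \<in> fraction M S b q"
      then obtain c r v where z: "z = (c, r)" "c \<in> carrier M" "r \<in> S" "v \<in> S"
        "v \<otimes>\<^bsub>M\<^esub> (b \<otimes>\<^bsub>M\<^esub> r) = v \<otimes>\<^bsub>M\<^esub> (c \<otimes>\<^bsub>M\<^esub> q)"
        unfolding fraction_def by blast
      have "\<exists>w\<in>S. w \<otimes>\<^bsub>M\<^esub> (a \<otimes>\<^bsub>M\<^esub> r) = w \<otimes>\<^bsub>M\<^esub> (c \<otimes>\<^bsub>M\<^esub> p)"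
        by (rule trans[OF that(1,2) z(2) that(3,4) z(3) u(1) z(4) that(5) z(5)])
      with z show "z \<in> fraction M S a p" by (simp add: fraction_def)
    qed
    show "fraction M S m s = fraction M S n t"
      using sub[of m n s t] sub[of n m t s] assms u(2) by simp
  qed
qed

lemma localization_mult:
  assumes "comm_monoid M" "submonoid S M"
    "m \<in> carrier M" "n \<in> carrier M" "s \<in> S" "t \<in> S"
  shows "fraction M S m s \<otimes>\<^bsub>localization M S\<^esub> fraction M S n t
    = fraction M S (m \<otimes>\<^bsub>M\<^esub> n) (s \<otimes>\<^bsub>M\<^esub> t)"
proof -
  interpret comm_monoid M by fact
  interpret S: submonoid S M by fact
  have eq: "fraction M S (a \<otimes>\<^bsub>M\<^esub> b) (p \<otimes>\<^bsub>M\<^esub> q) = fraction M S (m \<otimes>\<^bsub>M\<^esub> n) (s \<otimes>\<^bsub>M\<^esub> t)"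
    if ab: "(a, p) \<in> fraction M S m s" "(b, q) \<in> fraction M S n t" for a b p q
  proof -
    from ab obtain u v where uv: "u \<in> S" "v \<in> S"
      "u \<otimes>\<^bsub>M\<^esub> (m \<otimes>\<^bsub>M\<^esub> p) = u \<otimes>\<^bsub>M\<^esub> (a \<otimes>\<^bsub>M\<^esub> s)"
      "v \<otimes>\<^bsub>M\<^esub> (n \<otimes>\<^bsub>M\<^esub> q) = v \<otimes>\<^bsub>M\<^esub> (b \<otimes>\<^bsub>M\<^esub> t)"
      and car: "a \<in> carrier M" "b \<in> carrier M" "p \<in> S" "q \<in> S"
      by (auto simp: fraction_def)
    have car': "p \<in> carrier M" "q \<in> carrier M" "s \<in> carrier M" "t \<in> carrier M" "u \<in> carrier M" "v \<in> carrier M"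
      using assms car uv S.subset by auto
    have "(u \<otimes>\<^bsub>M\<^esub> v) \<otimes>\<^bsub>M\<^esub> ((a \<otimes>\<^bsub>M\<^esub> b) \<otimes>\<^bsub>M\<^esub> (s \<otimes>\<^bsub>M\<^esub> t))
      = (u \<otimes>\<^bsub>M\<^esub> (a \<otimes>\<^bsub>M\<^esub> s)) \<otimes>\<^bsub>M\<^esub> (v \<otimes>\<^bsub>M\<^esub> (b \<otimes>\<^bsub>M\<^esub> t))"
      using car car' by (simp add: m_ac)
    also have "\<dots> = (u \<otimes>\<^bsub>M\<^esub> (m \<otimes>\<^bsub>M\<^esub> p)) \<otimes>\<^bsub>M\<^esub> (v \<otimes>\<^bsub>M\<^esub> (n \<otimes>\<^bsub>M\<^esub> q))"
      by (simp only: uv)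
    also have "\<dots> = (u \<otimes>\<^bsub>M\<^esub> v) \<otimes>\<^bsub>M\<^esub> ((m \<otimes>\<^bsub>M\<^esub> n) \<otimes>\<^bsub>M\<^esub> (p \<otimes>\<^bsub>M\<^esub> q))"
      using car car' assms by (simp add: m_ac)
    finally show ?thesis
      unfolding fraction_eq_iff[OF assms(1,2) m_closed[OF car(1,2)] m_closed[OF assms(3,4)]
          S.m_closed[OF car(3,4)] S.m_closed[OF assms(5,6)]]
      using S.m_closed[OF uv(1,2)] by blast
  qed
  have "fraction M S m s \<noteq> {}" "fraction M S n t \<noteq> {}"
    using assms by (auto simp: fraction_def)
  then have "(\<Union>(a, p)\<in>fraction M S m s. \<Union>(b, q)\<in>fraction M S n t.
      fraction M S (a \<otimes>\<^bsub>M\<^esub> b) (p \<otimes>\<^bsub>M\<^esub> q)) = fraction M S (m \<otimes>\<^bsub>M\<^esub> n) (s \<otimes>\<^bsub>M\<^esub> t)"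
    by (intro SUP_eq_const) (auto simp: eq split: prod.split)
  then show ?thesis by (simp add: localization_def)
qed

lemma spec_sections_basic_open:
  assumes M: "comm_monoid M" and f: "f \<in> carrier M"
  shows "localization M (range (\<lambda>n::nat. f [^]\<^bsub>M\<^esub> n)) \<cong> sec (Spec M) (basic_open M f)"
proof -
  interpret comm_monoid M by fact
  let ?S = "range (\<lambda>n::nat. f [^]\<^bsub>M\<^esub> n)"
  let ?D = "basic_open M f"
  let ?T = "\<lambda>p. carrier M - p"
  have S: "submonoid ?S M"
  proof
    show "?S \<subseteq> carrier M" using f by auto
    show "x \<otimes>\<^bsub>M\<^esub> y \<in> ?S" if "x \<in> ?S" "y \<in> ?S" for x y
      using that f by (auto simp: nat_pow_mult)
    show "\<one>\<^bsub>M\<^esub> \<in> ?S" by (rule range_eqI[of _ _ "0::nat"]) simp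
  qed
  have T: "submonoid (?T p) M" if "p \<in> ?D" for p
    using that by (auto simp: basic_open_def spec_points_def prime_monoid_ideal_def)
  have ST: "?S \<subseteq> ?T p" if p: "p \<in> ?D" for p
  proof -
    have "f [^]\<^bsub>M\<^esub> n \<in> ?T p" for n :: nat
    proof (induction n)
      case 0
      then show ?case using submonoid.one_closed[OF T[OF p]] by simp
    next
      case (Suc n)
      then show ?case using submonoid.m_closed[OF T[OF p], of "f [^]\<^bsub>M\<^esub> n" f] p f
        by (simp add: basic_open_def)
    qed
    then show ?thesis by auto
  qed
  define P where "P = {a \<in> carrier M. \<forall>b\<in>carrier M. a \<otimes>\<^bsub>M\<^esub> b \<notin> ?S}"
  have TP: "?T P = {a \<in> carrier M. \<exists>b\<in>carrier M. a \<otimes>\<^bsub>M\<^esub> b \<in> ?S}"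
    by (auto simp: P_def)
  have TPm: "a \<otimes>\<^bsub>M\<^esub> c \<in> ?T P" if ac: "a \<in> ?T P" "c \<in> ?T P" for a c
  proof -
    from ac obtain b d where bd: "b \<in> carrier M" "a \<otimes>\<^bsub>M\<^esub> b \<in> ?S" "d \<in> carrier M" "c \<otimes>\<^bsub>M\<^esub> d \<in> ?S"
      and car: "a \<in> carrier M" "c \<in> carrier M"
      unfolding TP by blast
    have "(a \<otimes>\<^bsub>M\<^esub> c) \<otimes>\<^bsub>M\<^esub> (b \<otimes>\<^bsub>M\<^esub> d) = (a \<otimes>\<^bsub>M\<^esub> b) \<otimes>\<^bsub>M\<^esub> (c \<otimes>\<^bsub>M\<^esub> d)"
      using bd car by (simp add: m_ac)
    also have "\<dots> \<in> ?S" using submonoid.m_closed[OF S] bd by blast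
    finally show ?thesis unfolding TP using bd car by blast
  qed
  have P: "P \<in> ?D"
  proof -
    have "monoid_ideal P M"
      unfolding monoid_ideal_def
    proof (intro conjI ballI)
      show "P \<subseteq> carrier M" by (auto simp: P_def)
      fix a m assume a: "a \<in> P" and m: "m \<in> carrier M"
      then have "a \<in> carrier M" by (simp add: P_def)
      moreover have "(a \<otimes>\<^bsub>M\<^esub> m) \<otimes>\<^bsub>M\<^esub> b \<notin> ?S" if "b \<in> carrier M" for b
        using a m that m_assoc[of a m b] unfolding P_def by simp
      ultimately show "a \<otimes>\<^bsub>M\<^esub> m \<in> P" unfolding P_def using m by simp
    qed
    moreover have "\<one>\<^bsub>M\<^esub> \<in> ?T P"
      unfolding TP using submonoid.one_closed[OF S] by (auto intro!: bexI[of _ "\<one>\<^bsub>M\<^esub>"])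
    then have "submonoid (?T P) M"
      using TPm by unfold_locales auto
    moreover have "f \<in> ?T P"
      unfolding TP using f by (auto intro!: bexI[of _ "\<one>\<^bsub>M\<^esub>"] range_eqI[of _ _ "1::nat"])
    ultimately show ?thesis
      using f by (auto simp: basic_open_def spec_points_def prime_monoid_ideal_def)
  qed
  have sub_P: "q \<subseteq> P" if q: "q \<in> ?D" for q
  proof
    fix a assume a: "a \<in> q"
    have id: "monoid_ideal q M"
      using q by (auto simp: basic_open_def spec_points_def prime_monoid_ideal_def)
    then have "a \<in> carrier M" using a by (auto simp: monoid_ideal_def)
    moreover have "a \<otimes>\<^bsub>M\<^esub> b \<notin> ?S" if "b \<in> carrier M" for b
    proof -
      have "a \<otimes>\<^bsub>M\<^esub> b \<in> q" using id a that by (auto simp: monoid_ideal_def)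
      then show ?thesis using ST[OF q] by auto
    qed
    ultimately show "a \<in> P" unfolding P_def by simp
  qed
  have open_P: "?D \<subseteq> V" if V: "openin (spec_topology M) V" and PV: "P \<in> V" for V
  proof
    fix q assume q: "q \<in> ?D"
    have "generate_topology_on {basic_open M f | f. f \<in> carrier M} V"
      using V unfolding spec_topology_def openin_topology_generated_by_iff .
    then have "P \<in> V \<longrightarrow> q \<in> V"
    proof induction
      case (Basis V)
      then show ?case using sub_P[OF q] q by (auto simp: basic_open_def)
    qed auto
    with PV show "q \<in> V" by simp
  qed
  have open_D: "openin (spec_topology M) ?D"
    unfolding spec_topology_def by (rule topology_generated_by_Basis) (use f in blast)
  define h where "h = (\<lambda>A. \<lambda>p\<in>?D. \<Union>(m, s)\<in>A. prime_frac M p m s)"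
  have h: "h (fraction M ?S m s) = (\<lambda>p\<in>?D. prime_frac M p m s)"
    if m: "m \<in> carrier M" and s: "s \<in> ?S" for m s
    unfolding h_def
  proof (rule restrict_ext)
    fix p assume p: "p \<in> ?D"
    have "prime_frac M p n t = prime_frac M p m s" if "(n, t) \<in> fraction M ?S m s" for n t
    proof -
      from that obtain u where nt: "n \<in> carrier M" "t \<in> ?S" and u: "u \<in> ?S"
        "u \<otimes>\<^bsub>M\<^esub> (m \<otimes>\<^bsub>M\<^esub> t) = u \<otimes>\<^bsub>M\<^esub> (n \<otimes>\<^bsub>M\<^esub> s)"
        unfolding fraction_def by blast
      have "\<exists>u\<in>?T p. u \<otimes>\<^bsub>M\<^esub> (n \<otimes>\<^bsub>M\<^esub> s) = u \<otimes>\<^bsub>M\<^esub> (m \<otimes>\<^bsub>M\<^esub> t)"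
        using u ST[OF p] by (intro bexI[of _ u]) auto
      then show ?thesis
        unfolding prime_frac_def
        using fraction_eq_iff[OF M T[OF p] nt(1) m subsetD[OF ST[OF p] nt(2)] subsetD[OF ST[OF p] s]] by blast
    qed
    moreover have "fraction M ?S m s \<noteq> {}"
      using m s submonoid.one_closed[OF S] unfolding fraction_def by blast
    ultimately show "(\<Union>(n, t)\<in>fraction M ?S m s. prime_frac M p n t) = prime_frac M p m s"
      by (intro SUP_eq_const) (auto split: prod.split)
  qed
  have Sc: "?S \<subseteq> carrier M" using submonoid.subset[OF S] .
  have "h \<in> iso (localization M ?S) (sec (Spec M) ?D)"
    unfolding iso_iff
  proof (intro conjI)
    show "h ` carrier (localization M ?S) = carrier (sec (Spec M) ?D)"
    proof (intro equalityI subsetI)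
      fix \<sigma> assume "\<sigma> \<in> h ` carrier (localization M ?S)"
      then obtain m s where ms: "m \<in> carrier M" "s \<in> ?S" "\<sigma> = h (fraction M ?S m s)"
        unfolding localization_def partial_object.simps by blast
      have "s \<notin> q" if "q \<in> ?D" for q using ST[OF that] ms by auto
      moreover have "s \<in> carrier M" using ms Sc by blast
      ultimately have "\<exists>V a s. openin (spec_topology M) V \<and> p \<in> V \<and> V \<subseteq> ?D \<and> a \<in> carrier M \<and> s \<in> carrier M \<and>
          (\<forall>q\<in>V. s \<notin> q \<and> \<sigma> q = prime_frac M q a s)" if "p \<in> ?D" for p
        using that open_D ms(1) unfolding ms(3) h[OF ms(1,2)]
        by (intro exI[of _ ?D] exI[of _ m] exI[of _ s]) simp
      moreover have "\<sigma> \<in> extensional ?D" unfolding ms(3) h[OF ms(1,2)] by simp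
      ultimately show "\<sigma> \<in> carrier (sec (Spec M) ?D)" by (simp add: Spec_def)
    next
      fix \<sigma> assume \<sigma>: "\<sigma> \<in> carrier (sec (Spec M) ?D)"
      then have "\<exists>V a s. openin (spec_topology M) V \<and> P \<in> V \<and> V \<subseteq> ?D \<and> a \<in> carrier M \<and> s \<in> carrier M \<and>
           (\<forall>q\<in>V. s \<notin> q \<and> \<sigma> q = prime_frac M q a s)"
        using P by (auto simp: Spec_def)
      then obtain V a s where V: "openin (spec_topology M) V" "P \<in> V" "V \<subseteq> ?D"
        and as: "a \<in> carrier M" "s \<in> carrier M"
        and \<sigma>V: "\<forall>q\<in>V. s \<notin> q \<and> \<sigma> q = prime_frac M q a s" by (elim exE conjE)
      have VD: "V = ?D" using open_P[OF V(1,2)] V(3) by blast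
      have "s \<in> ?T P" using bspec[OF \<sigma>V V(2)] as by blast
      then obtain b where b: "b \<in> carrier M" "s \<otimes>\<^bsub>M\<^esub> b \<in> ?S" unfolding TP by blast
      have "\<sigma> = h (fraction M ?S (a \<otimes>\<^bsub>M\<^esub> b) (s \<otimes>\<^bsub>M\<^esub> b))"
        unfolding h[OF m_closed[OF as(1) b(1)] b(2)]
      proof (rule extensionalityI)
        show "\<sigma> \<in> extensional ?D" using \<sigma> by (simp add: Spec_def)
        fix q assume q: "q \<in> ?D"
        have "\<sigma> q = prime_frac M q a s" "s \<in> ?T q" using bspec[OF \<sigma>V, of q] q VD as by auto
        moreover have "\<one>\<^bsub>M\<^esub> \<otimes>\<^bsub>M\<^esub> (a \<otimes>\<^bsub>M\<^esub> (s \<otimes>\<^bsub>M\<^esub> b)) = \<one>\<^bsub>M\<^esub> \<otimes>\<^bsub>M\<^esub> (a \<otimes>\<^bsub>M\<^esub> b \<otimes>\<^bsub>M\<^esub> s)"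
          using as b(1) by (simp add: m_ac)
        ultimately have "prime_frac M q a s = prime_frac M q (a \<otimes>\<^bsub>M\<^esub> b) (s \<otimes>\<^bsub>M\<^esub> b)"
          unfolding prime_frac_def
          using fraction_eq_iff[OF M T[OF q] as(1) m_closed[OF as(1) b(1)] _ subsetD[OF ST[OF q] b(2)], of s]
            submonoid.one_closed[OF T[OF q]] by blast
        with \<open>\<sigma> q = prime_frac M q a s\<close> show "\<sigma> q = (\<lambda>p\<in>?D. prime_frac M p (a \<otimes>\<^bsub>M\<^esub> b) (s \<otimes>\<^bsub>M\<^esub> b)) q"
          using q by simp
      qed simp
      then show "\<sigma> \<in> h ` carrier (localization M ?S)"
        using m_closed[OF as(1) b(1)] b(2) unfolding localization_def partial_object.simps by blast
    qed
    show "h \<in> hom (localization M ?S) (sec (Spec M) ?D)"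
    proof (rule homI)
      fix A assume "A \<in> carrier (localization M ?S)"
      then show "h A \<in> carrier (sec (Spec M) ?D)"
        using \<open>h ` carrier (localization M ?S) = carrier (sec (Spec M) ?D)\<close> by blast
    next
      fix A B assume "A \<in> carrier (localization M ?S)" "B \<in> carrier (localization M ?S)"
      then obtain m s n t where ms: "m \<in> carrier M" "s \<in> ?S" "A = fraction M ?S m s"
        and nt: "n \<in> carrier M" "t \<in> ?S" "B = fraction M ?S n t"
        unfolding localization_def partial_object.simps by blast
      have st: "s \<otimes>\<^bsub>M\<^esub> t \<in> ?S" using submonoid.m_closed[OF S] ms nt by blast
      have "prime_frac M p m s \<otimes>\<^bsub>prime_localization M p\<^esub> prime_frac M p n t =
        prime_frac M p (m \<otimes>\<^bsub>M\<^esub> n) (s \<otimes>\<^bsub>M\<^esub> t)" if "p \<in> ?D" for p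
        unfolding prime_frac_def prime_localization_def
        by (rule localization_mult[OF M T[OF that] ms(1) nt(1) subsetD[OF ST[OF that] ms(2)]
              subsetD[OF ST[OF that] nt(2)]])
      then show "h (A \<otimes>\<^bsub>localization M ?S\<^esub> B) = h A \<otimes>\<^bsub>sec (Spec M) ?D\<^esub> h B"
        unfolding ms(3) nt(3) localization_mult[OF M S ms(1) nt(1) ms(2) nt(2)]
          h[OF ms(1,2)] h[OF nt(1,2)] h[OF m_closed[OF ms(1) nt(1)] st]
        by (simp add: Spec_def cong: restrict_cong)
    qed
    show "inj_on h (carrier (localization M ?S))"
    proof (rule inj_onI)
      fix A B assume "A \<in> carrier (localization M ?S)" "B \<in> carrier (localization M ?S)"
        and AB: "h A = h B"
      then obtain m s n t where ms: "m \<in> carrier M" "s \<in> ?S" "A = fraction M ?S m s"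
        and nt: "n \<in> carrier M" "t \<in> ?S" "B = fraction M ?S n t"
        unfolding localization_def partial_object.simps by blast
      have "prime_frac M P m s = prime_frac M P n t"
        using fun_cong[OF AB, of P] P unfolding ms(3) nt(3) h[OF ms(1,2)] h[OF nt(1,2)] restrict_def
        by (simp only: if_True)
      then obtain u where u: "u \<in> ?T P" "u \<otimes>\<^bsub>M\<^esub> (m \<otimes>\<^bsub>M\<^esub> t) = u \<otimes>\<^bsub>M\<^esub> (n \<otimes>\<^bsub>M\<^esub> s)"
        unfolding prime_frac_def
        using fraction_eq_iff[OF M T[OF P] ms(1) nt(1) subsetD[OF ST[OF P] ms(2)] subsetD[OF ST[OF P] nt(2)]] by blast
      then obtain b where b: "b \<in> carrier M" "u \<otimes>\<^bsub>M\<^esub> b \<in> ?S" and uc: "u \<in> carrier M" unfolding TP by blast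
      have st: "s \<in> carrier M" "t \<in> carrier M" using Sc ms nt by auto
      have "(u \<otimes>\<^bsub>M\<^esub> b) \<otimes>\<^bsub>M\<^esub> (m \<otimes>\<^bsub>M\<^esub> t) = b \<otimes>\<^bsub>M\<^esub> (u \<otimes>\<^bsub>M\<^esub> (m \<otimes>\<^bsub>M\<^esub> t))"
        using b uc ms nt st by (simp add: m_ac)
      also have "\<dots> = (u \<otimes>\<^bsub>M\<^esub> b) \<otimes>\<^bsub>M\<^esub> (n \<otimes>\<^bsub>M\<^esub> s)"
        unfolding u(2) using b uc ms nt st by (simp add: m_ac)
      finally show "A = B"
        unfolding ms(3) nt(3) using fraction_eq_iff[OF M S ms(1) nt(1) ms(2) nt(2)] b(2) by blast
    qed
  qed
  then show ?thesis by (auto simp: is_iso_def)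
qed

text \<open>If a space is isomorphic to \<open>Spec M\<close>, then \<open>M\<close> is isomorphic to its monoid of global sections;
  so it is no restriction to take \<open>M\<close> in the type of sections.\<close>

definition is_affine :: "('a, 's) monoidal_space \<Rightarrow> bool" where
  "is_affine X \<longleftrightarrow> (\<exists>M :: 's monoid. comm_monoid M \<and> isomorphic_spaces X (Spec M))"

definition affine_open :: "('a, 's) monoidal_space \<Rightarrow> 'a set \<Rightarrow> bool" where
  "affine_open X U \<longleftrightarrow> openin (sp X) U \<and> is_affine (open_subspace X U)"

definition is_monoid_scheme :: "('a, 's) monoidal_space \<Rightarrow> bool" where
  "is_monoid_scheme X \<longleftrightarrow> monoidal_space X \<and> (\<forall>x\<in>topspace (sp X). \<exists>U. affine_open X U \<and> x \<in> U)"

text \<open>The product of \<open>X\<close> and \<open>Y\<close>. The prime ideals of \<open>M \<times> N\<close> are the sets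
  \<open>(p \<times> N) \<union> (M \<times> q)\<close> with \<open>p\<close>, \<open>q\<close> prime, \<open>D(f,g)\<close> corresponds to \<open>D(f) \<times> D(g)\<close>, and the localization
  of \<open>M \<times> N\<close> at this prime is \<open>M\<^sub>p \<times> N\<^sub>q\<close>. Therefore the underlying space is the product space, the
  stalk at \<open>(x, y)\<close> is the product of the stalks, and sections are the families of elements of the
  stalks that are locally given by a pair of a section of \<open>O\<^sub>X\<close> and a section of \<open>O\<^sub>Y\<close>.\<close>

definition product_space ::
  "('a, 's) monoidal_space \<Rightarrow> ('b, 't) monoidal_space \<Rightarrow>
   ('a \<times> 'b, 'a \<times> 'b \<Rightarrow> ('a set \<times> 's) set \<times> ('b set \<times> 't) set) monoidal_space" where
  "product_space X Y =
     \<lparr>sp = prod_topology (sp X) (sp Y),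
      sec = (\<lambda>W.
        \<lparr>carrier = {\<sigma> \<in> extensional W. \<forall>z\<in>W. \<exists>U V a b.
           openin (sp X) U \<and> openin (sp Y) V \<and> z \<in> U \<times> V \<and> U \<times> V \<subseteq> W \<and>
           a \<in> carrier (sec X U) \<and> b \<in> carrier (sec Y V) \<and>
           (\<forall>x\<in>U. \<forall>y\<in>V. \<sigma> (x, y) = (germ_at X x U a, germ_at Y y V b))},
         mult = (\<lambda>\<sigma> \<tau>. \<lambda>z\<in>W. \<sigma> z \<otimes>\<^bsub>stalk X (fst z) \<times>\<times> stalk Y (snd z)\<^esub> \<tau> z),
         one = (\<lambda>z\<in>W. \<one>\<^bsub>stalk X (fst z) \<times>\<times> stalk Y (snd z)\<^esub>)\<rparr>),
      res = (\<lambda>W W' \<sigma>. restrict \<sigma> W')\<rparr>"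

text \<open>The projections are \<open>fst\<close> and \<open>snd\<close> on points and the following maps on sections.\<close>

definition proj1_sections ::
  "('a, 's) monoidal_space \<Rightarrow> ('b, 't) monoidal_space \<Rightarrow> 'a set \<Rightarrow> 's \<Rightarrow>
   'a \<times> 'b \<Rightarrow> ('a set \<times> 's) set \<times> ('b set \<times> 't) set" where
  "proj1_sections X Y U a =
     (\<lambda>z \<in> U \<times> topspace (sp Y). (germ_at X (fst z) U a, \<one>\<^bsub>stalk Y (snd z)\<^esub>))"

definition proj2_sections ::
  "('a, 's) monoidal_space \<Rightarrow> ('b, 't) monoidal_space \<Rightarrow> 'b set \<Rightarrow> 't \<Rightarrow>
   'a \<times> 'b \<Rightarrow> ('a set \<times> 's) set \<times> ('b set \<times> 't) set" where
  "proj2_sections X Y V b =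
     (\<lambda>z \<in> topspace (sp X) \<times> V. (\<one>\<^bsub>stalk X (fst z)\<^esub>, germ_at Y (snd z) V b))"

text \<open>The diagonal morphism: the morphism to the product whose composition with either projection is
  the identity.\<close>

definition diagonal_morphism ::
  "('a, 's) monoidal_space \<Rightarrow> ('a \<Rightarrow> 'a \<times> 'a) \<Rightarrow>
   (('a \<times> 'a) set \<Rightarrow> ('a \<times> 'a \<Rightarrow> ('a set \<times> 's) set \<times> ('a set \<times> 's) set) \<Rightarrow> 's) \<Rightarrow> bool" where
  "diagonal_morphism X \<phi> \<psi> \<longleftrightarrow>
     morphism X (product_space X X) \<phi> \<psi> \<and>
     (\<forall>x\<in>topspace (sp X). fst (\<phi> x) = x \<and> snd (\<phi> x) = x) \<and>
     (\<forall>U a. openin (sp X) U \<and> a \<in> carrier (sec X U) \<longrightarrow>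
        \<psi> (U \<times> topspace (sp X)) (proj1_sections X X U a) = a \<and>
        \<psi> (topspace (sp X) \<times> U) (proj2_sections X X U a) = a)"

text \<open>\<open>O(U)\<close> is identified with \<open>M\<close> for an affine open subset \<open>U = Spec M\<close>.\<close>

definition closed_immersion ::
  "('a, 's) monoidal_space \<Rightarrow> ('b, 't) monoidal_space \<Rightarrow>
   ('a \<Rightarrow> 'b) \<Rightarrow> ('b set \<Rightarrow> 't \<Rightarrow> 's) \<Rightarrow> bool" where
  "closed_immersion Z Y \<phi> \<psi> \<longleftrightarrow> morphism Z Y \<phi> \<psi> \<and>
     (\<forall>U. affine_open Y U \<longrightarrow> affine_open Z (preim Z \<phi> U) \<and>
        \<psi> U ` carrier (sec Y U) = carrier (sec Z (preim Z \<phi> U)))"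

definition separated :: "('a, 's) monoidal_space \<Rightarrow> bool" where
  "separated X \<longleftrightarrow>
     (\<exists>\<phi> \<psi>. diagonal_morphism X \<phi> \<psi> \<and> closed_immersion X (product_space X X) \<phi> \<psi>)"

definition cancellative :: "('a, 's) monoidal_space \<Rightarrow> bool" where
  "cancellative X \<longleftrightarrow> is_monoid_scheme X \<and> separated X \<and>
     (\<forall>U (M :: 's monoid). openin (sp X) U \<and> comm_monoid M \<and>
        isomorphic_spaces (open_subspace X U) (Spec M) \<longrightarrow> comm_monoid_cancel M)"


section \<open>Cartier divisors\<close>

definition regular_sections :: "('a, 's) monoidal_space \<Rightarrow> 'a set \<Rightarrow> 's set" where
  "regular_sections X U =
     {m \<in> carrier (sec X U). \<forall>x\<in>U. germ_at X x U m \<in> regular_elements (stalk X x)}"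

definition meromorphic_presheaf :: "('a, 's) monoidal_space \<Rightarrow> ('a, ('s \<times> 's) set) monoidal_space" where
  "meromorphic_presheaf X =
     \<lparr>sp = sp X,
      sec = (\<lambda>U. localization (sec X U) (regular_sections X U)),
      res = (\<lambda>U V A. \<Union>(m, s)\<in>A.
        fraction (sec X V) (regular_sections X V) (res X U V m) (res X U V s))\<rparr>"

type_synonym ('a, 's) mero = "'a \<Rightarrow> ('a set \<times> ('s \<times> 's) set) set"

definition meromorphic_sheaf :: "('a, 's) monoidal_space \<Rightarrow> ('a, ('a, 's) mero) monoidal_space" where
  "meromorphic_sheaf X = associated_sheaf (meromorphic_presheaf X)"

definition to_meromorphic :: "('a, 's) monoidal_space \<Rightarrow> 'a set \<Rightarrow> 's \<Rightarrow> ('a, 's) mero" where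
  "to_meromorphic X U s = to_associated_sheaf (meromorphic_presheaf X) U
     (fraction (sec X U) (regular_sections X U) s \<one>\<^bsub>sec X U\<^esub>)"

definition unit_sheaf :: "('a, 's) monoidal_space \<Rightarrow> ('a, 's) monoidal_space" where
  "unit_sheaf X = X\<lparr>sec := (\<lambda>U. units_of (sec X U))\<rparr>"

text \<open>The presheaf \<open>U \<mapsto> B(U)/A(U)\<close>, for a sheaf of abelian groups \<open>B\<close> and a subsheaf \<open>A\<close>.\<close>

definition quotient_presheaf ::
  "('a, 's) monoidal_space \<Rightarrow> ('a set \<Rightarrow> 's set) \<Rightarrow> ('a, 's set) monoidal_space" where
  "quotient_presheaf B A =
     \<lparr>sp = sp B,
      sec = (\<lambda>U. sec B U Mod A U),
      res = (\<lambda>U V C. \<Union>b\<in>C. A V #>\<^bsub>sec B V\<^esub> res B U V b)\<rparr>"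

definition regular_units :: "('a, 's) monoidal_space \<Rightarrow> 'a set \<Rightarrow> ('a, 's) mero set" where
  "regular_units X U = to_meromorphic X U ` Units (sec X U)"

definition cartier_presheaf :: "('a, 's) monoidal_space \<Rightarrow> ('a, ('a, 's) mero set) monoidal_space" where
  "cartier_presheaf X = quotient_presheaf (unit_sheaf (meromorphic_sheaf X)) (regular_units X)"

type_synonym ('a, 's) divisor = "'a \<Rightarrow> ('a set \<times> ('a, 's) mero set) set"

definition cartier_sheaf :: "('a, 's) monoidal_space \<Rightarrow> ('a, ('a, 's) divisor) monoidal_space" where
  "cartier_sheaf X = associated_sheaf (cartier_presheaf X)"

text \<open>The image in \<open>(M\<^sub>X*/O\<^sub>X*)(U)\<close> of an element of \<open>M\<^sub>X*(U)\<close>.\<close>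

definition local_divisor :: "('a, 's) monoidal_space \<Rightarrow> 'a set \<Rightarrow> ('a, 's) mero \<Rightarrow> ('a, 's) divisor" where
  "local_divisor X U f = to_associated_sheaf (cartier_presheaf X) U
     (regular_units X U #>\<^bsub>sec (unit_sheaf (meromorphic_sheaf X)) U\<^esub> f)"

definition cartier_divisors :: "('a, 's) monoidal_space \<Rightarrow> ('a, 's) divisor monoid" where
  "cartier_divisors X = sec (cartier_sheaf X) (topspace (sp X))"

definition principal_divisors :: "('a, 's) monoidal_space \<Rightarrow> ('a, 's) divisor set" where
  "principal_divisors X = local_divisor X (topspace (sp X)) `
     carrier (sec (unit_sheaf (meromorphic_sheaf X)) (topspace (sp X)))"

definition CaCl :: "('a, 's) monoidal_space \<Rightarrow> ('a, 's) divisor set monoid" where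
  "CaCl X = cartier_divisors X Mod principal_divisors X"


section \<open>Line bundles\<close>

text \<open>Sheaves of \<open>O\<^sub>X\<close>-sets. In what follows restrictions and actions are relevant only on open sets
  and sections.\<close>

record ('a, 's, 't) oset =
  osec :: "'a set \<Rightarrow> 't set"
  ores :: "'a set \<Rightarrow> 'a set \<Rightarrow> 't \<Rightarrow> 't"
  oact :: "'a set \<Rightarrow> 's \<Rightarrow> 't \<Rightarrow> 't"

definition oset_sheaf :: "('a, 's) monoidal_space \<Rightarrow> ('a, 's, 't) oset \<Rightarrow> bool" where
  "oset_sheaf X L \<longleftrightarrow> sheaf (sp X) (osec L) (ores L) \<and>
     (\<forall>U. openin (sp X) U \<longrightarrow>
        oact L U \<in> carrier (sec X U) \<rightarrow> osec L U \<rightarrow> osec L U \<and>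
        (\<forall>l\<in>osec L U. oact L U \<one>\<^bsub>sec X U\<^esub> l = l \<and>
           (\<forall>a\<in>carrier (sec X U). \<forall>b\<in>carrier (sec X U).
              oact L U (a \<otimes>\<^bsub>sec X U\<^esub> b) l = oact L U a (oact L U b l)))) \<and>
     (\<forall>U V. openin (sp X) U \<and> openin (sp X) V \<and> V \<subseteq> U \<longrightarrow>
        (\<forall>a\<in>carrier (sec X U). \<forall>l\<in>osec L U.
           ores L U V (oact L U a l) = oact L V (res X U V a) (ores L U V l)))"

definition structure_oset :: "('a, 's) monoidal_space \<Rightarrow> ('a, 's, 's) oset" where
  "structure_oset X =
     \<lparr>osec = (\<lambda>U. carrier (sec X U)), ores = res X, oact = (\<lambda>U. mult (sec X U))\<rparr>"

definition isomorphic_on ::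
  "('a, 's) monoidal_space \<Rightarrow> 'a set \<Rightarrow> ('a, 's, 't) oset \<Rightarrow> ('a, 's, 'u) oset \<Rightarrow> bool" where
  "isomorphic_on X U L N \<longleftrightarrow> (\<exists>h.
     (\<forall>V. openin (sp X) V \<and> V \<subseteq> U \<longrightarrow>
        bij_betw (h V) (osec L V) (osec N V) \<and>
        (\<forall>a\<in>carrier (sec X V). \<forall>l\<in>osec L V. h V (oact L V a l) = oact N V a (h V l)) \<and>
        (\<forall>W. openin (sp X) W \<and> W \<subseteq> V \<longrightarrow>
           (\<forall>l\<in>osec L V. h W (ores L V W l) = ores N V W (h V l)))))"

abbreviation isomorphic_osets ::
  "('a, 's) monoidal_space \<Rightarrow> ('a, 's, 't) oset \<Rightarrow> ('a, 's, 'u) oset \<Rightarrow> bool" where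
  "isomorphic_osets X \<equiv> isomorphic_on X (topspace (sp X))"

definition line_bundle :: "('a, 's) monoidal_space \<Rightarrow> ('a, 's, 't) oset \<Rightarrow> bool" where
  "line_bundle X L \<longleftrightarrow> oset_sheaf X L \<and>
     (\<forall>x\<in>topspace (sp X). \<exists>U. openin (sp X) U \<and> x \<in> U \<and> isomorphic_on X U (structure_oset X) L)"

text \<open>The tensor product of two sheaves of \<open>O\<^sub>X\<close>-sets is the sheaf associated to
  \<open>U \<mapsto> L(U) \<otimes> N(U)\<close>, where \<open>L(U) \<otimes> N(U)\<close> is the quotient of \<open>L(U) \<times> N(U)\<close> by the equivalence relation
  generated by \<open>(a l, n) \<sim> (l, a n)\<close>.\<close>

definition tensor_rel ::
  "('a, 's) monoidal_space \<Rightarrow> ('a, 's, 't) oset \<Rightarrow> ('a, 's, 'u) oset \<Rightarrow> 'a set \<Rightarrow>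
   't \<times> 'u \<Rightarrow> 't \<times> 'u \<Rightarrow> bool" where
  "tensor_rel X L N U v w \<longleftrightarrow> (\<exists>a\<in>carrier (sec X U). \<exists>l\<in>osec L U. \<exists>n\<in>osec N U.
     v = (oact L U a l, n) \<and> w = (l, oact N U a n))"

definition pure_tensor ::
  "('a, 's) monoidal_space \<Rightarrow> ('a, 's, 't) oset \<Rightarrow> ('a, 's, 'u) oset \<Rightarrow> 'a set \<Rightarrow>
   't \<Rightarrow> 'u \<Rightarrow> ('t \<times> 'u) set" where
  "pure_tensor X L N U l n = {w. equivclp (tensor_rel X L N U) (l, n) w}"

definition tensor_presheaf ::
  "('a, 's) monoidal_space \<Rightarrow> ('a, 's, 't) oset \<Rightarrow> ('a, 's, 'u) oset \<Rightarrow>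
   ('a, 's, ('t \<times> 'u) set) oset" where
  "tensor_presheaf X L N =
     \<lparr>osec = (\<lambda>U. {pure_tensor X L N U l n | l n. l \<in> osec L U \<and> n \<in> osec N U}),
      ores = (\<lambda>U V A. \<Union>(l, n)\<in>A. pure_tensor X L N V (ores L U V l) (ores N U V n)),
      oact = (\<lambda>U a A. \<Union>(l, n)\<in>A. pure_tensor X L N U (oact L U a l) n)\<rparr>"

definition associated_oset ::
  "('a, 's) monoidal_space \<Rightarrow> ('a, 's, 't) oset \<Rightarrow> ('a, 's, 'a \<Rightarrow> ('a set \<times> 't) set) oset" where
  "associated_oset X P =
     \<lparr>osec = associated_sections (sp X) (osec P) (ores P),
      ores = (\<lambda>U V \<sigma>. restrict \<sigma> V),
      oact = (\<lambda>U a \<sigma>. \<lambda>x\<in>U. \<Union>(V, t)\<in>\<sigma> x. germ (sp X) (osec P) (ores P) x (U \<inter> V)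
        (oact P (U \<inter> V) (res X U (U \<inter> V) a) (ores P V (U \<inter> V) t)))\<rparr>"

definition tensor ::
  "('a, 's) monoidal_space \<Rightarrow> ('a, 's, 't) oset \<Rightarrow> ('a, 's, 'u) oset \<Rightarrow>
   ('a, 's, 'a \<Rightarrow> ('a set \<times> ('t \<times> 'u) set) set) oset" where
  "tensor X L N = associated_oset X (tensor_presheaf X L N)"

text \<open>For the Picard group the sections of line bundles are taken in the type \<open>'a \<Rightarrow> 's\<close>. It is large
  enough for all isomorphism classes: let \<open>L\<close> be a line bundle, with sections of any type, that is
  generated by \<open>e\<^sub>x\<close> on the open neighbourhood \<open>U\<^sub>x\<close> of \<open>x\<close>, for every point \<open>x\<close>. A section \<open>l\<close> of \<open>L\<close>
  over \<open>V\<close> is determined by the family of the \<open>s\<^sub>x \<in> O(V \<inter> U\<^sub>x)\<close> with \<open>l = s\<^sub>x e\<^sub>x\<close> on \<open>V \<inter> U\<^sub>x\<close>.\<close>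

type_synonym ('a, 's) pic_bundle = "('a, 's, 'a \<Rightarrow> 's) oset"

definition iso_class :: "('a, 's) monoidal_space \<Rightarrow> ('a, 's, 't) oset \<Rightarrow> ('a, 's) pic_bundle set" where
  "iso_class X L = {N. line_bundle X N \<and> isomorphic_osets X N L}"

definition Pic :: "('a, 's) monoidal_space \<Rightarrow> ('a, 's) pic_bundle set monoid" where
  "Pic X =
     \<lparr>carrier = {iso_class X L | L :: ('a, 's) pic_bundle. line_bundle X L},
      mult = (\<lambda>C D. \<Union>L\<in>C. \<Union>N\<in>D. iso_class X (tensor X L N)),
      one = iso_class X (structure_oset X)\<rparr>"


section \<open>First cohomology and the connecting homomorphism\<close>

text \<open>\<open>H\<^sup>1(X, A)\<close> for a sheaf of abelian groups \<open>A\<close>, as Cech cohomology, i.e. the colimit over all open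
  covers. It suffices to use the covers \<open>(U\<^sub>x)\<close> indexed by the points of \<open>X\<close> with \<open>x \<in> U\<^sub>x\<close>, which are
  cofinal and directed under \<open>W\<^sub>x \<subseteq> U\<^sub>x\<close> for all \<open>x\<close>. In degree one Cech cohomology agrees with
  derived functor cohomology on every space.\<close>

type_synonym ('a, 's) cochain = "('a \<Rightarrow> 'a set) \<times> ('a \<Rightarrow> 'a \<Rightarrow> 's)"

definition point_cover :: "'a topology \<Rightarrow> ('a \<Rightarrow> 'a set) \<Rightarrow> bool" where
  "point_cover T U \<longleftrightarrow> (\<forall>x\<in>topspace T. openin T (U x) \<and> x \<in> U x)"

definition cocycle :: "('a, 's) monoidal_space \<Rightarrow> ('a, 's) cochain \<Rightarrow> bool" where
  "cocycle A = (\<lambda>(U, g). point_cover (sp A) U \<and>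
     (\<forall>x\<in>topspace (sp A). \<forall>y\<in>topspace (sp A). g x y \<in> carrier (sec A (U x \<inter> U y))) \<and>
     (\<forall>x\<in>topspace (sp A). \<forall>y\<in>topspace (sp A). \<forall>z\<in>topspace (sp A).
        let W = U x \<inter> U y \<inter> U z in
        res A (U x \<inter> U y) W (g x y) \<otimes>\<^bsub>sec A W\<^esub> res A (U y \<inter> U z) W (g y z)
          = res A (U x \<inter> U z) W (g x z)))"

definition cohomologous ::
  "('a, 's) monoidal_space \<Rightarrow> ('a, 's) cochain \<Rightarrow> ('a, 's) cochain \<Rightarrow> bool" where
  "cohomologous A = (\<lambda>(U, g) (U', g'). \<exists>W h. point_cover (sp A) W \<and>
     (\<forall>x\<in>topspace (sp A). W x \<subseteq> U x \<inter> U' x \<and> h x \<in> carrier (sec A (W x))) \<and>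
     (\<forall>x\<in>topspace (sp A). \<forall>y\<in>topspace (sp A).
        let V = W x \<inter> W y in
        res A (U' x \<inter> U' y) V (g' x y) \<otimes>\<^bsub>sec A V\<^esub> res A (W x) V (h x)
          = res A (U x \<inter> U y) V (g x y) \<otimes>\<^bsub>sec A V\<^esub> res A (W y) V (h y)))"

definition cech_class :: "('a, 's) monoidal_space \<Rightarrow> ('a, 's) cochain \<Rightarrow> ('a, 's) cochain set" where
  "cech_class A c = {c'. cocycle A c' \<and> cohomologous A c c'}"

text \<open>The connecting homomorphism: choose local lifts \<open>f\<^sub>x \<in> M\<^sub>X*(U\<^sub>x)\<close> of the divisor \<open>D\<close>; then
  \<open>f\<^sub>y / f\<^sub>x\<close> is the image of a unit \<open>g\<^sub>x\<^sub>y \<in> O\<^sub>X*(U\<^sub>x \<inter> U\<^sub>y)\<close>. The class of \<open>g\<close> is independent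
  of the choices.\<close>

definition lifts_divisor ::
  "('a, 's) monoidal_space \<Rightarrow> ('a, 's) divisor \<Rightarrow> ('a \<Rightarrow> 'a set) \<Rightarrow> ('a \<Rightarrow> ('a, 's) mero) \<Rightarrow> bool" where
  "lifts_divisor X D U f \<longleftrightarrow> point_cover (sp X) U \<and>
     (\<forall>x\<in>topspace (sp X). f x \<in> Units (sec (meromorphic_sheaf X) (U x)) \<and>
        local_divisor X (U x) (f x) = res (cartier_sheaf X) (topspace (sp X)) (U x) D)"

definition connecting :: "('a, 's) monoidal_space \<Rightarrow> ('a, 's) divisor \<Rightarrow> ('a, 's) cochain set" where
  "connecting X D = \<Union>{cech_class (unit_sheaf X) (U, g) | U g.
     cocycle (unit_sheaf X) (U, g) \<and>
     (\<exists>f. lifts_divisor X D U f \<and>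
        (\<forall>x\<in>topspace (sp X). \<forall>y\<in>topspace (sp X).
           let V = U x \<inter> U y in
           to_meromorphic X V (g x y) \<otimes>\<^bsub>sec (meromorphic_sheaf X) V\<^esub>
               res (meromorphic_sheaf X) (U x) V (f x)
             = res (meromorphic_sheaf X) (U y) V (f y)))}"

text \<open>The identification of \<open>H\<^sup>1(X, O\<^sub>X*)\<close> with the group of isomorphism classes of line bundles: the
  class of \<open>g\<close> corresponds to the line bundles which have trivializations
  \<open>O \<rightarrow> L, a \<mapsto> a e\<^sub>x\<close> over the \<open>U\<^sub>x\<close> with transition functions \<open>g\<close>, that is
  \<open>e\<^sub>y = g\<^sub>x\<^sub>y e\<^sub>x\<close>. With the definition of \<open>connecting\<close>, the bundle of a Cartier divisor
  is the subsheaf of \<open>M\<^sub>X\<close> locally generated by the \<open>f\<^sub>x\<close>. (With the opposite sign convention, it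
  is its inverse.)\<close>

definition trivializes ::
  "('a, 's) monoidal_space \<Rightarrow> ('a, 's, 't) oset \<Rightarrow> 'a set \<Rightarrow> 't \<Rightarrow> bool" where
  "trivializes X L U e \<longleftrightarrow> e \<in> osec L U \<and>
     (\<forall>V. openin (sp X) V \<and> V \<subseteq> U \<longrightarrow>
        bij_betw (\<lambda>a. oact L V a (ores L U V e)) (carrier (sec X V)) (osec L V))"

definition has_transition_functions ::
  "('a, 's) monoidal_space \<Rightarrow> ('a, 's, 't) oset \<Rightarrow> ('a, 's) cochain \<Rightarrow> bool" where
  "has_transition_functions X L = (\<lambda>(U, g). \<exists>e.
     (\<forall>x\<in>topspace (sp X). trivializes X L (U x) (e x)) \<and>
     (\<forall>x\<in>topspace (sp X). \<forall>y\<in>topspace (sp X).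
        let V = U x \<inter> U y in
        ores L (U y) V (e y) = oact L V (g x y) (ores L (U x) V (e x))))"

definition bundles_of_class ::
  "('a, 's) monoidal_space \<Rightarrow> ('a, 's) cochain set \<Rightarrow> ('a, 's) pic_bundle set" where
  "bundles_of_class X c = {L. line_bundle X L \<and> (\<exists>(U, g)\<in>c. has_transition_functions X L (U, g))}"

text \<open>The map induced on \<open>CaCl(X)\<close>; an element of \<open>CaCl(X)\<close> is a coset of Cartier divisors on which
  the connecting homomorphism is constant.\<close>

definition cacl_to_pic ::
  "('a, 's) monoidal_space \<Rightarrow> ('a, 's) divisor set \<Rightarrow> ('a, 's) pic_bundle set" where
  "cacl_to_pic X C = bundles_of_class X (the_elem (connecting X ` C))"

end

theory Submission
  imports Defs
begin

text \<open>A line bundle with trivializations on an open cover is determined up to isomorphism by its transition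
  functions, and these are exactly the Cech cocycles of units: changing the trivializations changes the
  cocycle by a coboundary, every cocycle glues trivial bundles to a line bundle, and the tensor product
  multiplies cocycles. Hence \<open>Pic(X)\<close> is the group of cohomology classes of cocycles.

  Local equations \<open>f\<^sub>x\<close> of a Cartier divisor are unique up to units of \<open>O\<^sub>X\<close>, because \<open>O\<^sub>X \<rightarrow> M\<^sub>X\<close> is
  injective; so the quotients \<open>f\<^sub>y / f\<^sub>x\<close> form a cocycle whose class depends only on the divisor. It is
  trivial iff the \<open>f\<^sub>x\<close> can be corrected by units to glue to one global meromorphic function, i.e. iff
  the divisor is principal.

  If \<open>X\<close> is cancellative, every point has an open neighbourhood with a point \<open>\<eta>\<close> that lies in all its
  nonempty open subsets, and intersecting neighbourhoods share \<open>\<eta>\<close>. Given a cocycle \<open>g\<close>, write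
  \<open>g\<^sub>\<eta>\<^sub>x\<close> near \<open>\<eta>\<close> as a fraction \<open>a\<^sub>x / b\<^sub>x\<close> of sections near \<open>x\<close> and put \<open>f\<^sub>x = a\<^sub>x / b\<^sub>x\<close>. Then \<open>f\<^sub>y = g\<^sub>x\<^sub>y f\<^sub>x\<close>
  holds near \<open>\<eta>\<close> by the cocycle condition, and therefore everywhere.\<close>


section \<open>Presheaves of sets\<close>

text \<open>All covers in cocycles are indexed by the points of \<open>X\<close>. Local choices are
  therefore functions of points, and a generic point \<open>\<eta>\<close> is itself an index. This
  is what splits a cocycle: near \<open>\<eta>\<close> the identity
  \<open>g_\<eta>x g_xy = g_\<eta>y\<close> exhibits \<open>g\<close> as a coboundary of units, and
  cancellation makes the splitting extend, meromorphically, to all of the chosen neighbourhoods. On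
  the bundle side the obstacle is that sections of different bundles have different types (those of
  a tensor product are families of germs). Bundles are therefore compared through one standard model
  built from a cocycle, and the group laws are verified on cochains, where they hold up to
  refinement. On the divisor side the obstacle is the double sheafification in \<open>M_X\<close>
  and in \<open>M_X*/O_X*\<close>. Two criteria remove it: \<open>mero_frac_eq_iff\<close> turns
  equality in \<open>M_X\<close> into an identity of sections of \<open>O_X\<close>, and
  \<open>LD_eq_iff\<close> turns equality of local divisors into an identity in
  \<open>M_X\<close>.\<close>

locale set_presheaf =
  fixes T :: "'a topology" and S :: "'a set \<Rightarrow> 's set" and \<rho> :: "'a set \<Rightarrow> 'a set \<Rightarrow> 's \<Rightarrow> 's"
  assumes presheaf: "presheaf T S \<rho>"
begin

lemma res_closed:
  "openin T U \<Longrightarrow> openin T V \<Longrightarrow> V \<subseteq> U \<Longrightarrow> s \<in> S U \<Longrightarrow> \<rho> U V s \<in> S V"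
  using presheaf unfolding presheaf_def by (elim conjE) (metis PiE)

lemma res_id: "openin T U \<Longrightarrow> s \<in> S U \<Longrightarrow> \<rho> U U s = s"
  using presheaf unfolding presheaf_def by blast

lemma res_res:
  "openin T U \<Longrightarrow> openin T V \<Longrightarrow> openin T W \<Longrightarrow> V \<subseteq> U \<Longrightarrow> W \<subseteq> V \<Longrightarrow> s \<in> S U \<Longrightarrow>
    \<rho> V W (\<rho> U V s) = \<rho> U W s"
  using presheaf unfolding presheaf_def by blast

abbreviation gm :: "'a \<Rightarrow> 'a set \<Rightarrow> 's \<Rightarrow> ('a set \<times> 's) set" where
  "gm \<equiv> germ T S \<rho>"

lemma germ_self: "openin T U \<Longrightarrow> x \<in> U \<Longrightarrow> s \<in> S U \<Longrightarrow> (U, s) \<in> gm x U s"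
  unfolding germ_def by blast

text \<open>A germ is coded as the set of all pairs that agree with \<open>(U, s)\<close> near
  \<open>x\<close>. Equality of two such sets amounts to symmetry and transitivity of this relation;
  for transitivity the two neighbourhoods of agreement are intersected.\<close>

lemma germ_eq_iff:
  assumes "openin T U" "x \<in> U" "s \<in> S U" "openin T V" "x \<in> V" "t \<in> S V"
  shows "gm x U s = gm x V t \<longleftrightarrow>
    (\<exists>W. openin T W \<and> x \<in> W \<and> W \<subseteq> U \<inter> V \<and> \<rho> U W s = \<rho> V W t)"
proof
  assume "gm x U s = gm x V t"
  then have "(V, t) \<in> gm x U s" using germ_self assms by blast
  then show "\<exists>W. openin T W \<and> x \<in> W \<and> W \<subseteq> U \<inter> V \<and> \<rho> U W s = \<rho> V W t"
    unfolding germ_def by blast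
next
  have sub: "gm x U s \<subseteq> gm x V t"
    if a: "openin T U" "x \<in> U" "s \<in> S U" "openin T V" "x \<in> V" "t \<in> S V"
      and W: "openin T W" "x \<in> W" "W \<subseteq> U \<inter> V" "\<rho> U W s = \<rho> V W t" for U V W s t
  proof (rule subsetI)
    fix z assume "z \<in> gm x U s"
    then obtain A r B where z: "z = (A, r)" and A: "openin T A" "x \<in> A" "r \<in> S A"
      and B: "openin T B" "x \<in> B" "B \<subseteq> U \<inter> A" "\<rho> U B s = \<rho> A B r"
      unfolding germ_def by blast
    have o: "openin T (W \<inter> B)" using W B by blast
    have "\<rho> V (W \<inter> B) t = \<rho> W (W \<inter> B) (\<rho> V W t)"
      using res_res[OF a(4) W(1) o _ _ a(6)] W by auto
    also have "\<dots> = \<rho> U (W \<inter> B) s"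
      unfolding W(4)[symmetric] using res_res[OF a(1) W(1) o _ _ a(3)] W by auto
    also have "\<dots> = \<rho> B (W \<inter> B) (\<rho> U B s)"
      using res_res[OF a(1) B(1) o _ _ a(3)] B by auto
    also have "\<dots> = \<rho> A (W \<inter> B) r"
      unfolding B(4) using res_res[OF A(1) B(1) o _ _ A(3)] B by auto
    finally show "z \<in> gm x V t"
      unfolding z germ_def using A W B o by blast
  qed
  assume "\<exists>W. openin T W \<and> x \<in> W \<and> W \<subseteq> U \<inter> V \<and> \<rho> U W s = \<rho> V W t"
  then obtain W where W: "openin T W" "x \<in> W" "W \<subseteq> U \<inter> V" "\<rho> U W s = \<rho> V W t" by blast
  show "gm x U s = gm x V t"
    using sub[OF assms W] sub[OF assms(4-6,1-3) W(1,2) _ W(4)[symmetric]] W(3) by blast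
qed

lemma germ_memD:
  assumes "openin T U" "x \<in> U" "s \<in> S U" "(V, t) \<in> gm x U s"
  shows "openin T V" "x \<in> V" "t \<in> S V" "gm x V t = gm x U s"
proof -
  show "openin T V" "x \<in> V" "t \<in> S V" using assms unfolding germ_def by blast+
  then show "gm x V t = gm x U s"
    using germ_eq_iff[OF assms(1-3), of V t] assms(4) unfolding germ_def by simp
qed

lemma germ_res:
  assumes "openin T U" "openin T V" "V \<subseteq> U" "x \<in> V" "s \<in> S U"
  shows "gm x V (\<rho> U V s) = gm x U s"
proof -
  have "\<rho> V V (\<rho> U V s) = \<rho> U V s" using assms by (auto intro: res_id res_closed)
  moreover have "V \<subseteq> V \<inter> U" using assms by auto
  ultimately show ?thesis
    using assms res_closed[OF assms(1-3,5)]
    by (subst germ_eq_iff) (auto intro!: exI[of _ V])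
qed

text \<open>Operations on germs are defined as unions over all representatives. As soon as the value
  does not depend on the representative, the union collapses to that value; every well-definedness
  argument for stalks goes through this rule.\<close>

lemma UN_germ:
  assumes "openin T U" "x \<in> U" "s \<in> S U"
    and "\<And>V t. openin T V \<Longrightarrow> x \<in> V \<Longrightarrow> t \<in> S V \<Longrightarrow> gm x V t = gm x U s \<Longrightarrow> F V t = c"
  shows "(\<Union>(V, t)\<in>gm x U s. F V t) = c"
proof (rule SUP_eq_const)
  show "gm x U s \<noteq> {}" using germ_self assms(1-3) by blast
  show "(case z of (V, t) \<Rightarrow> F V t) = c" if "z \<in> gm x U s" for z
    using that germ_memD[OF assms(1-3)] assms(4) by (cases z) auto
qed

abbreviation as :: "'a set \<Rightarrow> ('a \<Rightarrow> ('a set \<times> 's) set) set" where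
  "as \<equiv> associated_sections T S \<rho>"

abbreviation to_as :: "'a set \<Rightarrow> 's \<Rightarrow> 'a \<Rightarrow> ('a set \<times> 's) set" where
  "to_as U s \<equiv> (\<lambda>x\<in>U. gm x U s)"

lemma to_as_closed: "openin T U \<Longrightarrow> s \<in> S U \<Longrightarrow> to_as U s \<in> as U"
  unfolding associated_sections_def by auto

lemma to_as_res:
  "openin T U \<Longrightarrow> openin T V \<Longrightarrow> V \<subseteq> U \<Longrightarrow> s \<in> S U \<Longrightarrow> to_as V (\<rho> U V s) = restrict (to_as U s) V"
  by (rule ext) (auto simp: restrict_def germ_res)

lemma as_locally:
  assumes "\<sigma> \<in> as U" "x \<in> U"
  obtains V s where "openin T V" "x \<in> V" "V \<subseteq> U" "s \<in> S V" "restrict \<sigma> V = to_as V s"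
  using assms unfolding associated_sections_def by (auto simp: restrict_def fun_eq_iff)

lemma as_I:
  assumes "\<sigma> \<in> extensional U"
    "\<And>x. x \<in> U \<Longrightarrow> \<exists>V s. openin T V \<and> x \<in> V \<and> V \<subseteq> U \<and> s \<in> S V \<and> (\<forall>y\<in>V. \<sigma> y = gm y V s)"
  shows "\<sigma> \<in> as U"
  using assms unfolding associated_sections_def by blast

lemma as_germ:
  assumes "\<sigma> \<in> as U" "x \<in> U"
  obtains V s where "openin T V" "x \<in> V" "V \<subseteq> U" "s \<in> S V" "\<forall>y\<in>V. \<sigma> y = gm y V s"
  using assms unfolding associated_sections_def by blast

lemma as_restrict:
  assumes "\<sigma> \<in> as U" "openin T V" "V \<subseteq> U"
  shows "restrict \<sigma> V \<in> as V"
proof (rule as_I)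
  fix x assume x: "x \<in> V"
  then obtain W s where W: "openin T W" "x \<in> W" "W \<subseteq> U" "s \<in> S W" "\<forall>y\<in>W. \<sigma> y = gm y W s"
    using as_germ[OF assms(1)] assms by (metis subsetD)
  have "openin T (V \<inter> W)" using W assms by blast
  then show "\<exists>A s. openin T A \<and> x \<in> A \<and> A \<subseteq> V \<and> s \<in> S A \<and> (\<forall>y\<in>A. restrict \<sigma> V y = gm y A s)"
    using W x assms res_closed[OF W(1) _ _ W(4), of "V \<inter> W"]
    by (intro exI[of _ "V \<inter> W"] exI[of _ "\<rho> W (V \<inter> W) s"]) (auto simp: germ_res)
qed simp

text \<open>Sections are functions on points whose defining condition is local, so they glue
  pointwise. Extensionality outside the open set is what makes the glued function unique.\<close>

lemma sheaf_as: "sheaf T as (\<lambda>U V \<sigma>. restrict \<sigma> V)"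
  unfolding sheaf_def
proof (intro conjI allI impI)
  have "restrict \<sigma> U = \<sigma>" if "\<sigma> \<in> as U" for \<sigma> U
    using that unfolding associated_sections_def by (auto intro: extensional_restrict)
  then show "presheaf T as (\<lambda>U V \<sigma>. restrict \<sigma> V)"
    unfolding presheaf_def using as_restrict by (auto simp: restrict_restrict Int_absorb1)
  fix \<C> s
  assume a: "(\<forall>U\<in>\<C>. openin T U \<and> s U \<in> as U) \<and>
    (\<forall>U\<in>\<C>. \<forall>V\<in>\<C>. restrict (s U) (U \<inter> V) = restrict (s V) (U \<inter> V))"
  have eq: "s U x = s V x" if "U \<in> \<C>" "V \<in> \<C>" "x \<in> U" "x \<in> V" for U V x
    using a that by (metis IntI restrict_apply')
  \<comment> \<open>By \<open>eq\<close> the value at \<open>x\<close> can be read off from any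
    member of the cover through \<open>x\<close>, so an arbitrary one is chosen.\<close>
  define t where "t = (\<lambda>x\<in>\<Union>\<C>. s (SOME U. U \<in> \<C> \<and> x \<in> U) x)"
  have t: "t x = s U x" if "U \<in> \<C>" "x \<in> U" for U x
  proof -
    have "(SOME U. U \<in> \<C> \<and> x \<in> U) \<in> \<C> \<and> x \<in> (SOME U. U \<in> \<C> \<and> x \<in> U)"
      by (rule someI[of _ U]) (use that in simp)
    then have "s (SOME U. U \<in> \<C> \<and> x \<in> U) x = s U x" using eq that by blast
    then show ?thesis using that unfolding t_def by auto
  qed
  show "\<exists>!t. t \<in> as (\<Union>\<C>) \<and> (\<forall>U\<in>\<C>. restrict t U = s U)"
  proof (rule ex1I[of _ t], intro conjI ballI)
    show "t \<in> as (\<Union>\<C>)"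
    proof (rule as_I)
      fix x assume "x \<in> \<Union>\<C>"
      then obtain U where U: "U \<in> \<C>" "x \<in> U" by blast
      then obtain V r where "openin T V" "x \<in> V" "V \<subseteq> U" "r \<in> S V" "\<forall>y\<in>V. s U y = gm y V r"
        using a as_germ[of "s U" U x] by metis
      then show "\<exists>V r. openin T V \<and> x \<in> V \<and> V \<subseteq> \<Union>\<C> \<and> r \<in> S V \<and> (\<forall>y\<in>V. t y = gm y V r)"
        using U by (intro exI[of _ V] exI[of _ r]) (auto simp: t subset_iff)
    qed (simp add: t_def)
    show "restrict t U = s U" if "U \<in> \<C>" for U
    proof (rule extensionalityI[of _ U])
      show "s U \<in> extensional U" using a that unfolding associated_sections_def by auto
    qed (use that t in auto)
    fix t' assume t': "t' \<in> as (\<Union>\<C>) \<and> (\<forall>U\<in>\<C>. restrict t' U = s U)"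
    show "t' = t"
    proof (rule extensionalityI[of _ "\<Union>\<C>"])
      show "t' \<in> extensional (\<Union>\<C>)" using t' unfolding associated_sections_def by auto
      fix x assume "x \<in> \<Union>\<C>"
      then obtain U where U: "U \<in> \<C>" "x \<in> U" by blast
      then have "t' x = s U x" using t' by (metis restrict_apply')
      then show "t' x = t x" using t U by simp
    qed (simp add: t_def)
  qed
qed

lemma to_as_eq_iff:
  assumes "openin T U" "s \<in> S U" "t \<in> S U"
  shows "to_as U s = to_as U t \<longleftrightarrow>
    (\<forall>x\<in>U. \<exists>W. openin T W \<and> x \<in> W \<and> W \<subseteq> U \<and> \<rho> U W s = \<rho> U W t)"
proof -
  have "to_as U s = to_as U t \<longleftrightarrow> (\<forall>x\<in>U. gm x U s = gm x U t)"
    by (auto simp: restrict_def fun_eq_iff)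
  then show ?thesis using germ_eq_iff[OF assms(1) _ assms(2) assms(1) _ assms(3)] by simp
qed

end

section \<open>Gluing and equality of sections of a sheaf\<close>

locale set_sheaf =
  fixes T :: "'a topology" and S :: "'a set \<Rightarrow> 's set" and \<rho> :: "'a set \<Rightarrow> 'a set \<Rightarrow> 's \<Rightarrow> 's"
  assumes sheaf: "sheaf T S \<rho>"
begin

sublocale set_presheaf
  using sheaf by unfold_locales (simp add: sheaf_def)

lemma ex1_glue:
  assumes "\<And>U. U \<in> \<C> \<Longrightarrow> openin T U" "\<And>U. U \<in> \<C> \<Longrightarrow> s U \<in> S U"
    and "\<And>U V. U \<in> \<C> \<Longrightarrow> V \<in> \<C> \<Longrightarrow> \<rho> U (U \<inter> V) (s U) = \<rho> V (U \<inter> V) (s V)"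
  shows "\<exists>!t. t \<in> S (\<Union>\<C>) \<and> (\<forall>U\<in>\<C>. \<rho> (\<Union>\<C>) U t = s U)"
  by (rule sheaf[unfolded sheaf_def, THEN conjunct2, rule_format])
    (use assms in \<open>intro conjI ballI; simp\<close>)

text \<open>The sheaf axiom speaks of a set of open sets, whereas a family may contain the same open
  set under several indices. Compatibility of two such indices on their intersection, which is the
  set itself, forces the two sections to be equal, so one index per open set can be chosen.\<close>

lemma glue:
  assumes "\<And>i. i \<in> I \<Longrightarrow> openin T (U i)" "\<And>i. i \<in> I \<Longrightarrow> s i \<in> S (U i)"
    and "\<And>i j. i \<in> I \<Longrightarrow> j \<in> I \<Longrightarrow> \<rho> (U i) (U i \<inter> U j) (s i) = \<rho> (U j) (U i \<inter> U j) (s j)"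
  obtains t where "t \<in> S (\<Union>i\<in>I. U i)" "\<And>i. i \<in> I \<Longrightarrow> \<rho> (\<Union>i\<in>I. U i) (U i) t = s i"
proof -
  define c where "c = (\<lambda>A. SOME i. i \<in> I \<and> U i = A)"
  have c: "c A \<in> I" "U (c A) = A" if "A \<in> U ` I" for A
    using someI_ex[of "\<lambda>i. i \<in> I \<and> U i = A"] that unfolding c_def by auto
  have sc: "s (c (U i)) = s i" if i: "i \<in> I" for i
    using assms(3)[of "c (U i)" i] c[of "U i"] assms(1)[OF i] assms(2)[of i] assms(2)[of "c (U i)"]
      i res_id[of "U i"] by simp
  have "\<exists>!t. t \<in> S (\<Union>(U ` I)) \<and> (\<forall>A\<in>U ` I. \<rho> (\<Union>(U ` I)) A t = s (c A))"
    by (rule ex1_glue) (use assms sc in auto)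
  then obtain t where "t \<in> S (\<Union>(U ` I))" "\<forall>A\<in>U ` I. \<rho> (\<Union>(U ` I)) A t = s (c A)"
    by (elim ex1E conjE)
  then show thesis using that sc by simp
qed

text \<open>Uniqueness in the sheaf axiom, applied to the cover by all open sets on which the
  restrictions of \<open>s\<close> and \<open>t\<close> agree: both sections glue the same
  family.\<close>

lemma eqI_cover:
  assumes "openin T U" "s \<in> S U" "t \<in> S U"
    and "\<And>x. x \<in> U \<Longrightarrow> \<exists>W. openin T W \<and> x \<in> W \<and> W \<subseteq> U \<and> \<rho> U W s = \<rho> U W t"
  shows "s = t"
proof -
  define \<C> where "\<C> = {W. openin T W \<and> W \<subseteq> U \<and> \<rho> U W s = \<rho> U W t}"
  have U: "\<Union>\<C> = U" using assms(4) unfolding \<C>_def by blast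
  have "\<exists>!r. r \<in> S (\<Union>\<C>) \<and> (\<forall>A\<in>\<C>. \<rho> (\<Union>\<C>) A r = \<rho> U A s)"
  proof (rule ex1_glue)
    fix A B assume A: "A \<in> \<C>" and B: "B \<in> \<C>"
    show "openin T A" using A unfolding \<C>_def by simp
    then show "\<rho> U A s \<in> S A"
      using A by (intro res_closed[OF assms(1) _ _ assms(2)]) (auto simp: \<C>_def)
    have AB: "openin T A" "openin T B" "openin T (A \<inter> B)" "A \<subseteq> U" "B \<subseteq> U"
      using A B unfolding \<C>_def by auto
    show "\<rho> A (A \<inter> B) (\<rho> U A s) = \<rho> B (A \<inter> B) (\<rho> U B s)"
      using res_res[OF assms(1) AB(1,3,4) _ assms(2)] res_res[OF assms(1) AB(2,3,5) _ assms(2)] by simp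
  qed
  from the1_equality[OF this[unfolded U], of s] the1_equality[OF this[unfolded U], of t]
  show ?thesis using assms(2,3) unfolding \<C>_def by auto
qed

lemma eqI_germ:
  assumes "openin T U" "s \<in> S U" "t \<in> S U" "\<And>x. x \<in> U \<Longrightarrow> gm x U s = gm x U t"
  shows "s = t"
  using eqI_cover[OF assms(1-3)] germ_eq_iff[OF assms(1) _ assms(2,1) _ assms(3)] assms(4) by simp

lemma eqI_family:
  assumes "openin T U" "s \<in> S U" "t \<in> S U" "U \<subseteq> (\<Union>i\<in>I. A i)" "\<And>i. i \<in> I \<Longrightarrow> openin T (A i)"
    and "\<And>i. i \<in> I \<Longrightarrow> \<rho> U (U \<inter> A i) s = \<rho> U (U \<inter> A i) t"
  shows "s = t"
proof (rule eqI_cover[OF assms(1-3)])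
  fix x assume "x \<in> U"
  then obtain i where i: "i \<in> I" "x \<in> A i" using assms(4) by blast
  then show "\<exists>W. openin T W \<and> x \<in> W \<and> W \<subseteq> U \<and> \<rho> U W s = \<rho> U W t"
    using assms(1,5,6) \<open>x \<in> U\<close> by (intro exI[of _ "U \<inter> A i"]) auto
qed

text \<open>The empty cover covers the empty set, so a sheaf has at most one section there. This
  settles disjoint neighbourhoods when a cocycle is split on a scheme that is not
  irreducible.\<close>

lemma empty_section: "s \<in> S {} \<Longrightarrow> t \<in> S {} \<Longrightarrow> s = t"
  by (rule eqI_cover[of "{}"]) auto

end

section \<open>Presheaves and sheaves of monoids\<close>

text \<open>Stated for an arbitrary structure \<open>G\<close>, so that the laws can be instantiated
  at stalks and at sections over varying open sets.\<close>

lemma comm_monoid_m_ac: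
  assumes "comm_monoid G" "x \<in> carrier G" "y \<in> carrier G" "z \<in> carrier G"
  shows "x \<otimes>\<^bsub>G\<^esub> y \<otimes>\<^bsub>G\<^esub> z = x \<otimes>\<^bsub>G\<^esub> (y \<otimes>\<^bsub>G\<^esub> z)" "x \<otimes>\<^bsub>G\<^esub> y = y \<otimes>\<^bsub>G\<^esub> x"
    "x \<otimes>\<^bsub>G\<^esub> (y \<otimes>\<^bsub>G\<^esub> z) = y \<otimes>\<^bsub>G\<^esub> (x \<otimes>\<^bsub>G\<^esub> z)"
proof -
  interpret comm_monoid G by fact
  show "x \<otimes>\<^bsub>G\<^esub> y \<otimes>\<^bsub>G\<^esub> z = x \<otimes>\<^bsub>G\<^esub> (y \<otimes>\<^bsub>G\<^esub> z)" "x \<otimes>\<^bsub>G\<^esub> y = y \<otimes>\<^bsub>G\<^esub> x"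
    "x \<otimes>\<^bsub>G\<^esub> (y \<otimes>\<^bsub>G\<^esub> z) = y \<otimes>\<^bsub>G\<^esub> (x \<otimes>\<^bsub>G\<^esub> z)"
    using assms by (auto simp: m_ac)
qed

text \<open>Stalks and associated sheaves are formed for the presheaf of fractions and for the
  quotient presheaf of units as well as for \<open>O_X\<close>. The first two need not be sheaves,
  hence the separate locale without the gluing axiom.\<close>

locale monoid_presheaf =
  fixes P :: "('a, 's) monoidal_space"
  assumes comm_monoid_sec: "openin (sp P) U \<Longrightarrow> comm_monoid (sec P U)"
    and res_hom: "openin (sp P) U \<Longrightarrow> openin (sp P) V \<Longrightarrow> V \<subseteq> U \<Longrightarrow>
      res P U V \<in> monoid_hom (sec P U) (sec P V)"
    and presheaf_sec: "presheaf (sp P) (\<lambda>U. carrier (sec P U)) (res P)"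
begin

sublocale set_presheaf "sp P" "\<lambda>U. carrier (sec P U)" "res P"
  by unfold_locales (rule presheaf_sec)

abbreviation Op :: "'a set \<Rightarrow> bool" where "Op \<equiv> openin (sp P)"

abbreviation Sec :: "'a set \<Rightarrow> 's set" where "Sec U \<equiv> carrier (sec P U)"

lemmas [simp] = openin_Int

lemma monoid_sec: "Op U \<Longrightarrow> monoid (sec P U)"
  using comm_monoid_sec by (simp add: comm_monoid.axioms)

lemma mult_closed [simp]: "Op U \<Longrightarrow> s \<in> Sec U \<Longrightarrow> t \<in> Sec U \<Longrightarrow> s \<otimes>\<^bsub>sec P U\<^esub> t \<in> Sec U"
  using monoid_sec monoid.m_closed by fast

lemma one_closed [simp]: "Op U \<Longrightarrow> \<one>\<^bsub>sec P U\<^esub> \<in> Sec U"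
  using monoid_sec monoid.one_closed by fast

lemma one_mult [simp]:
  "Op U \<Longrightarrow> s \<in> Sec U \<Longrightarrow> \<one>\<^bsub>sec P U\<^esub> \<otimes>\<^bsub>sec P U\<^esub> s = s"
  "Op U \<Longrightarrow> s \<in> Sec U \<Longrightarrow> s \<otimes>\<^bsub>sec P U\<^esub> \<one>\<^bsub>sec P U\<^esub> = s"
  using monoid_sec monoid.l_one monoid.r_one by fast+

lemma mult_res [simp]:
  "Op U \<Longrightarrow> Op V \<Longrightarrow> V \<subseteq> U \<Longrightarrow> s \<in> Sec U \<Longrightarrow> t \<in> Sec U \<Longrightarrow>
    res P U V (s \<otimes>\<^bsub>sec P U\<^esub> t) = res P U V s \<otimes>\<^bsub>sec P V\<^esub> res P U V t"
  using res_hom[of U V] by (simp add: monoid_hom_def hom_mult)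

lemma one_res [simp]:
  "Op U \<Longrightarrow> Op V \<Longrightarrow> V \<subseteq> U \<Longrightarrow> res P U V \<one>\<^bsub>sec P U\<^esub> = \<one>\<^bsub>sec P V\<^esub>"
  using res_hom[of U V] by (simp add: monoid_hom_def)

lemma ac:
  "Op U \<Longrightarrow> x \<in> Sec U \<Longrightarrow> y \<in> Sec U \<Longrightarrow> z \<in> Sec U \<Longrightarrow>
    x \<otimes>\<^bsub>sec P U\<^esub> y \<otimes>\<^bsub>sec P U\<^esub> z = x \<otimes>\<^bsub>sec P U\<^esub> (y \<otimes>\<^bsub>sec P U\<^esub> z)"
  "Op U \<Longrightarrow> x \<in> Sec U \<Longrightarrow> y \<in> Sec U \<Longrightarrow> x \<otimes>\<^bsub>sec P U\<^esub> y = y \<otimes>\<^bsub>sec P U\<^esub> x"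
  "Op U \<Longrightarrow> x \<in> Sec U \<Longrightarrow> y \<in> Sec U \<Longrightarrow> z \<in> Sec U \<Longrightarrow>
    x \<otimes>\<^bsub>sec P U\<^esub> (y \<otimes>\<^bsub>sec P U\<^esub> z) = y \<otimes>\<^bsub>sec P U\<^esub> (x \<otimes>\<^bsub>sec P U\<^esub> z)"
  by (rule comm_monoid_m_ac[OF comm_monoid_sec]; assumption)+

lemmas res_simps = le_infI1 le_infI2 subset_refl res_closed res_res res_id

section \<open>Stalks of a presheaf of monoids\<close>

abbreviation ger :: "'a \<Rightarrow> 'a set \<Rightarrow> 's \<Rightarrow> ('a set \<times> 's) set" where
  "ger \<equiv> germ_at P"

lemma germ_at_eq: "germ_at P = gm" by (simp add: germ_at_def)

text \<open>Independence of the representatives: if both factors are replaced by representatives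
  that agree with the old ones near \<open>x\<close>, the two products agree on the intersection of
  the two neighbourhoods of agreement.\<close>

lemma stalk_mult:
  assumes "Op U" "x \<in> U" "s \<in> Sec U" "Op V" "x \<in> V" "t \<in> Sec V"
  shows "ger x U s \<otimes>\<^bsub>stalk P x\<^esub> ger x V t =
    ger x (U \<inter> V) (res P U (U \<inter> V) s \<otimes>\<^bsub>sec P (U \<inter> V)\<^esub> res P V (U \<inter> V) t)"
proof -
  \<comment> \<open>The germ of a product can be computed on any smaller neighbourhood of
    \<open>x\<close>; this brings both products to the common open set
    \<open>A \<inter> B\<close>.\<close>
  have shrink: "gm x (U \<inter> V) (res P U (U \<inter> V) s \<otimes>\<^bsub>sec P (U \<inter> V)\<^esub> res P V (U \<inter> V) t) =
      gm x W (res P U W s \<otimes>\<^bsub>sec P W\<^esub> res P V W t)"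
    if "Op U" "x \<in> U" "s \<in> Sec U" "Op V" "x \<in> V" "t \<in> Sec V" "Op W" "x \<in> W" "W \<subseteq> U" "W \<subseteq> V"
    for U V W s t
  proof -
    have "Op (U \<inter> V)" "W \<subseteq> U \<inter> V" using that by auto
    then show ?thesis
      using that by (subst germ_res[symmetric, of _ W]) (simp_all add: res_simps)
  qed
  have "gm x (U' \<inter> V') (res P U' (U' \<inter> V') s' \<otimes>\<^bsub>sec P (U' \<inter> V')\<^esub> res P V' (U' \<inter> V') t') =
    gm x (U \<inter> V) (res P U (U \<inter> V) s \<otimes>\<^bsub>sec P (U \<inter> V)\<^esub> res P V (U \<inter> V) t)"
    if a: "Op U'" "x \<in> U'" "s' \<in> Sec U'" "gm x U' s' = gm x U s"
      "Op V'" "x \<in> V'" "t' \<in> Sec V'" "gm x V' t' = gm x V t" for U' V' s' t'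
  proof -
    from a(4) obtain A where A: "Op A" "x \<in> A" "A \<subseteq> U' \<inter> U" "res P U' A s' = res P U A s"
      using germ_eq_iff[OF a(1-3) assms(1-3)] by blast
    from a(8) obtain B where B: "Op B" "x \<in> B" "B \<subseteq> V' \<inter> V" "res P V' B t' = res P V B t"
      using germ_eq_iff[OF a(5-7) assms(4-6)] by blast
    have AB: "Op (A \<inter> B)" "x \<in> A \<inter> B" "A \<inter> B \<subseteq> U'" "A \<inter> B \<subseteq> V'" "A \<inter> B \<subseteq> U" "A \<inter> B \<subseteq> V"
      using A B by auto
    have "res P U' (A \<inter> B) s' = res P A (A \<inter> B) (res P U' A s')"
      using res_res[OF a(1) A(1) AB(1) _ _ a(3)] A by auto
    also have "\<dots> = res P U (A \<inter> B) s"
      unfolding A(4) using res_res[OF assms(1) A(1) AB(1) _ _ assms(3)] A by auto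
    finally have 1: "res P U' (A \<inter> B) s' = res P U (A \<inter> B) s" .
    have "res P V' (A \<inter> B) t' = res P B (A \<inter> B) (res P V' B t')"
      using res_res[OF a(5) B(1) AB(1) _ _ a(7)] B by auto
    also have "\<dots> = res P V (A \<inter> B) t"
      unfolding B(4) using res_res[OF assms(4) B(1) AB(1) _ _ assms(6)] B by auto
    finally show ?thesis
      using shrink[OF a(1-3,5-7) AB(1-4)] shrink[OF assms AB(1,2,5,6)] 1 by simp
  qed
  then show ?thesis
    unfolding stalk_def germ_at_eq monoid.simps
    by (intro UN_germ assms) blast
qed

lemma germ_mult:
  assumes "Op U" "x \<in> U" "s \<in> Sec U" "t \<in> Sec U"
  shows "ger x U s \<otimes>\<^bsub>stalk P x\<^esub> ger x U t = ger x U (s \<otimes>\<^bsub>sec P U\<^esub> t)"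
  using stalk_mult[of U x s U t] assms by (simp add: res_id)

lemma germ_one: "Op U \<Longrightarrow> x \<in> U \<Longrightarrow> ger x U \<one>\<^bsub>sec P U\<^esub> = \<one>\<^bsub>stalk P x\<^esub>"
  unfolding germ_at_eq
  using germ_res[of "topspace (sp P)" U x "\<one>\<^bsub>sec P (topspace (sp P))\<^esub>"] openin_subset[of "sp P" U]
  by (simp add: stalk_def germ_at_eq)

lemma germ_closed: "Op U \<Longrightarrow> x \<in> U \<Longrightarrow> s \<in> Sec U \<Longrightarrow> ger x U s \<in> carrier (stalk P x)"
  unfolding stalk_def by auto

lemma stalk_cases:
  assumes "A \<in> carrier (stalk P x)"
  obtains U s where "Op U" "x \<in> U" "s \<in> Sec U" "A = ger x U s"
  using assms unfolding stalk_def by auto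

lemma comm_monoid_stalk:
  assumes "x \<in> topspace (sp P)"
  shows "comm_monoid (stalk P x)"
proof -
  have T: "Op (topspace (sp P))" by simp
  \<comment> \<open>Finitely many germs have representatives over one neighbourhood
    \<open>W\<close>, so each monoid law in the stalk reduces to the same law for sections over
    \<open>W\<close>.\<close>
  have three: "\<exists>W a b c. Op W \<and> x \<in> W \<and> a \<in> Sec W \<and> b \<in> Sec W \<and> c \<in> Sec W \<and>
      A = ger x W a \<and> B = ger x W b \<and> C = ger x W c"
    if ABC: "A \<in> carrier (stalk P x)" "B \<in> carrier (stalk P x)" "C \<in> carrier (stalk P x)" for A B C
  proof -
    obtain U a where U: "Op U" "x \<in> U" "a \<in> Sec U" "A = ger x U a" using stalk_cases[OF ABC(1)] .
    obtain V b where V: "Op V" "x \<in> V" "b \<in> Sec V" "B = ger x V b" using stalk_cases[OF ABC(2)] .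
    obtain W c where W: "Op W" "x \<in> W" "c \<in> Sec W" "C = ger x W c" using stalk_cases[OF ABC(3)] .
    have I: "Op (U \<inter> V \<inter> W)" "x \<in> U \<inter> V \<inter> W" using U V W by auto
    have r: "ger x Y d = ger x (U \<inter> V \<inter> W) (res P Y (U \<inter> V \<inter> W) d)"
      "res P Y (U \<inter> V \<inter> W) d \<in> Sec (U \<inter> V \<inter> W)"
      if "Op Y" "U \<inter> V \<inter> W \<subseteq> Y" "d \<in> Sec Y" for Y d
      using that I by (simp_all add: germ_at_eq germ_res res_closed)
    show ?thesis
      using I r[OF U(1) _ U(3)] r[OF V(1) _ V(3)] r[OF W(1) _ W(3)] U(4) V(4) W(4)
      by (intro exI[of _ "U \<inter> V \<inter> W"] exI[of _ "res P U (U \<inter> V \<inter> W) a"]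
          exI[of _ "res P V (U \<inter> V \<inter> W) b"] exI[of _ "res P W (U \<inter> V \<inter> W) c"] conjI) (simp_all add: le_infI1 le_infI2)
  qed
  show ?thesis
  proof
    fix A B C assume ABC: "A \<in> carrier (stalk P x)" "B \<in> carrier (stalk P x)" "C \<in> carrier (stalk P x)"
    from three[OF this] obtain W a b c where W: "Op W" "x \<in> W" "a \<in> Sec W" "b \<in> Sec W" "c \<in> Sec W"
      and eq: "A = ger x W a" "B = ger x W b" "C = ger x W c" by blast
    show "A \<otimes>\<^bsub>stalk P x\<^esub> B \<otimes>\<^bsub>stalk P x\<^esub> C = A \<otimes>\<^bsub>stalk P x\<^esub> (B \<otimes>\<^bsub>stalk P x\<^esub> C)"
      unfolding eq using W by (simp add: germ_mult ac)
  next
    fix A B assume AB: "A \<in> carrier (stalk P x)" "B \<in> carrier (stalk P x)"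
    from three[OF this this(2)] obtain W a b where W: "Op W" "x \<in> W" "a \<in> Sec W" "b \<in> Sec W"
      and eq: "A = ger x W a" "B = ger x W b" by blast
    show "A \<otimes>\<^bsub>stalk P x\<^esub> B \<in> carrier (stalk P x)"
      unfolding eq using W by (simp add: germ_mult germ_closed)
    show "A \<otimes>\<^bsub>stalk P x\<^esub> B = B \<otimes>\<^bsub>stalk P x\<^esub> A"
      unfolding eq using W by (simp add: germ_mult ac)
  next
    show "\<one>\<^bsub>stalk P x\<^esub> \<in> carrier (stalk P x)"
      using germ_closed[OF T assms one_closed[OF T]] germ_one[OF T assms] by simp
    fix A assume A: "A \<in> carrier (stalk P x)"
    from stalk_cases[OF this] obtain W a where W: "Op W" "x \<in> W" "a \<in> Sec W" "A = ger x W a" .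
    show "\<one>\<^bsub>stalk P x\<^esub> \<otimes>\<^bsub>stalk P x\<^esub> A = A" "A \<otimes>\<^bsub>stalk P x\<^esub> \<one>\<^bsub>stalk P x\<^esub> = A"
      unfolding W(4) using W by (simp_all add: germ_mult flip: germ_one[of W])
  qed
qed

section \<open>The sheaf of monoids associated to a presheaf\<close>

abbreviation AS :: "('a, 'a \<Rightarrow> ('a set \<times> 's) set) monoidal_space" where
  "AS \<equiv> associated_sheaf P"

abbreviation to_AS :: "'a set \<Rightarrow> 's \<Rightarrow> 'a \<Rightarrow> ('a set \<times> 's) set" where
  "to_AS \<equiv> to_associated_sheaf P"

lemma AS_simps [simp]:
  "sp AS = sp P" "carrier (sec AS U) = as U" "res AS U V \<sigma> = restrict \<sigma> V"
  "\<sigma> \<otimes>\<^bsub>sec AS U\<^esub> \<tau> = (\<lambda>x\<in>U. \<sigma> x \<otimes>\<^bsub>stalk P x\<^esub> \<tau> x)"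
  "\<one>\<^bsub>sec AS U\<^esub> = (\<lambda>x\<in>U. \<one>\<^bsub>stalk P x\<^esub>)"
  by (simp_all add: associated_sheaf_def)

lemma res_AS: "res AS = (\<lambda>U V \<sigma>. restrict \<sigma> V)"
  by (simp add: associated_sheaf_def)

lemma as_stalk:
  assumes "\<sigma> \<in> as U" "x \<in> U"
  shows "\<sigma> x \<in> carrier (stalk P x)"
  using as_germ[OF assms] germ_closed germ_at_eq by metis

lemma to_AS_eq: "to_AS U s = to_as U s"
  by (simp add: to_associated_sheaf_def germ_at_eq)

lemma to_AS_mult:
  "Op U \<Longrightarrow> s \<in> Sec U \<Longrightarrow> t \<in> Sec U \<Longrightarrow> to_AS U (s \<otimes>\<^bsub>sec P U\<^esub> t) = to_AS U s \<otimes>\<^bsub>sec AS U\<^esub> to_AS U t"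
  by (rule ext) (auto simp: to_associated_sheaf_def restrict_def germ_mult)

lemma to_AS_one: "Op U \<Longrightarrow> to_AS U \<one>\<^bsub>sec P U\<^esub> = \<one>\<^bsub>sec AS U\<^esub>"
  by (rule ext) (auto simp: to_associated_sheaf_def restrict_def germ_one)

lemma to_AS_closed: "Op U \<Longrightarrow> s \<in> Sec U \<Longrightarrow> to_AS U s \<in> carrier (sec AS U)"
  by (simp add: to_AS_eq to_as_closed)

lemma to_AS_res:
  "Op U \<Longrightarrow> Op V \<Longrightarrow> V \<subseteq> U \<Longrightarrow> s \<in> Sec U \<Longrightarrow> to_AS V (res P U V s) = res AS U V (to_AS U s)"
  by (simp add: to_AS_eq to_as_res)

lemma AS_locally:
  assumes "\<sigma> \<in> carrier (sec AS U)" "x \<in> U"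
  obtains V s where "Op V" "x \<in> V" "V \<subseteq> U" "s \<in> Sec V" "res AS U V \<sigma> = to_AS V s"
  using as_locally[of \<sigma> U x] assms by (auto simp: to_AS_eq)

lemma to_AS_eq_iff:
  assumes "Op U" "s \<in> Sec U" "t \<in> Sec U"
  shows "to_AS U s = to_AS U t \<longleftrightarrow>
    (\<forall>x\<in>U. \<exists>W. Op W \<and> x \<in> W \<and> W \<subseteq> U \<and> res P U W s = res P U W t)"
  unfolding to_AS_eq using to_as_eq_iff[OF assms] .

text \<open>The monoid laws hold pointwise in the stalks. Only closure under multiplication needs
  local representatives: two of them are restricted to the intersection of their domains and
  multiplied there.\<close>

lemma monoidal_space_AS: "monoidal_space AS"
  unfolding monoidal_space_def
proof (intro conjI allI impI)
  fix U assume "openin (sp AS) U"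
  then have U: "Op U" by simp
  have st: "comm_monoid (stalk P x)" if "x \<in> U" for x
    using comm_monoid_stalk openin_subset[OF U] that by blast
  show "comm_monoid (sec AS U)"
  proof
    fix \<sigma> \<tau> \<upsilon> assume "\<sigma> \<in> carrier (sec AS U)" "\<tau> \<in> carrier (sec AS U)" "\<upsilon> \<in> carrier (sec AS U)"
    then show "\<sigma> \<otimes>\<^bsub>sec AS U\<^esub> \<tau> \<otimes>\<^bsub>sec AS U\<^esub> \<upsilon> = \<sigma> \<otimes>\<^bsub>sec AS U\<^esub> (\<tau> \<otimes>\<^bsub>sec AS U\<^esub> \<upsilon>)"
      by (simp cong: restrict_cong) (intro restrict_ext comm_monoid_m_ac(1)[OF st]; simp add: as_stalk)
  next
    fix \<sigma> \<tau> assume "\<sigma> \<in> carrier (sec AS U)" "\<tau> \<in> carrier (sec AS U)"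
    then have st2: "\<sigma> \<in> as U" "\<tau> \<in> as U" by simp_all
    then show "\<sigma> \<otimes>\<^bsub>sec AS U\<^esub> \<tau> = \<tau> \<otimes>\<^bsub>sec AS U\<^esub> \<sigma>"
      by (simp cong: restrict_cong) (intro restrict_ext comm_monoid.m_comm[OF st]; simp add: as_stalk)
    show "\<sigma> \<otimes>\<^bsub>sec AS U\<^esub> \<tau> \<in> carrier (sec AS U)"
      unfolding AS_simps
    proof (rule as_I)
      fix x assume x: "x \<in> U"
      obtain V s where V: "Op V" "x \<in> V" "V \<subseteq> U" "s \<in> Sec V" "\<forall>y\<in>V. \<sigma> y = gm y V s"
        using as_germ[OF st2(1) x] .
      obtain W t where W: "Op W" "x \<in> W" "W \<subseteq> U" "t \<in> Sec W" "\<forall>y\<in>W. \<tau> y = gm y W t"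
        using as_germ[OF st2(2) x] .
      have o: "Op (V \<inter> W)" using V W by blast
      have "res P V (V \<inter> W) s \<in> Sec (V \<inter> W)" "res P W (V \<inter> W) t \<in> Sec (V \<inter> W)"
        using V W o by (auto intro: res_closed)
      then have p: "res P V (V \<inter> W) s \<otimes>\<^bsub>sec P (V \<inter> W)\<^esub> res P W (V \<inter> W) t \<in> Sec (V \<inter> W)"
        using o by simp
      show "\<exists>A r. Op A \<and> x \<in> A \<and> A \<subseteq> U \<and> r \<in> Sec A \<and>
          (\<forall>y\<in>A. (\<lambda>x\<in>U. \<sigma> x \<otimes>\<^bsub>stalk P x\<^esub> \<tau> x) y = gm y A r)"
        by (rule exI, rule exI, intro conjI ballI, rule o, use V W in blast, use V W in blast, rule p)
          (use V W stalk_mult[unfolded germ_at_eq] in auto)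
    qed simp
  next
    show "\<one>\<^bsub>sec AS U\<^esub> \<in> carrier (sec AS U)"
      using to_AS_closed[OF U one_closed[OF U]] unfolding to_AS_one[OF U] .
    fix \<sigma> assume \<sigma>: "\<sigma> \<in> carrier (sec AS U)"
    then have e: "\<sigma> \<in> extensional U" by (simp add: associated_sections_def)
    have m: "monoid (stalk P x)" if "x \<in> U" for x using st[OF that] by (rule comm_monoid.axioms)
    show "\<one>\<^bsub>sec AS U\<^esub> \<otimes>\<^bsub>sec AS U\<^esub> \<sigma> = \<sigma>" "\<sigma> \<otimes>\<^bsub>sec AS U\<^esub> \<one>\<^bsub>sec AS U\<^esub> = \<sigma>"
      using \<sigma> monoid.l_one[OF m] monoid.r_one[OF m] as_stalk
      by (intro extensionalityI[OF _ e]; simp)+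
  qed
next
  fix U V assume "openin (sp AS) U \<and> openin (sp AS) V \<and> V \<subseteq> U"
  then have UV: "Op U" "Op V" "V \<subseteq> U" by simp_all
  show "res AS U V \<in> monoid_hom (sec AS U) (sec AS V)"
    unfolding monoid_hom_def
  proof (intro CollectI conjI homI)
    show "res AS U V \<sigma> \<in> carrier (sec AS V)" if "\<sigma> \<in> carrier (sec AS U)" for \<sigma>
      using that as_restrict UV by simp
    show "res AS U V (\<sigma> \<otimes>\<^bsub>sec AS U\<^esub> \<tau>) = res AS U V \<sigma> \<otimes>\<^bsub>sec AS V\<^esub> res AS U V \<tau>" for \<sigma> \<tau>
      using UV by (auto simp: restrict_def fun_eq_iff)
    show "res AS U V \<one>\<^bsub>sec AS U\<^esub> = \<one>\<^bsub>sec AS V\<^esub>"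
      using UV by (auto simp: restrict_def fun_eq_iff)
  qed
next
  show "sheaf (sp AS) (\<lambda>U. carrier (sec AS U)) (res AS)"
    using sheaf_as by (simp add: res_AS)
qed

end

section \<open>Units under homomorphisms and in sheaves of monoids\<close>

lemma hom_Units:
  assumes "monoid G" "h \<in> monoid_hom G H" "u \<in> Units G"
  shows "h u \<in> Units H"
proof -
  interpret monoid G by fact
  obtain v where v: "v \<in> carrier G" "v \<otimes>\<^bsub>G\<^esub> u = \<one>\<^bsub>G\<^esub>" "u \<otimes>\<^bsub>G\<^esub> v = \<one>\<^bsub>G\<^esub>" "u \<in> carrier G"
    using assms(3) unfolding Units_def by blast
  have h: "h \<in> hom G H" "h \<one>\<^bsub>G\<^esub> = \<one>\<^bsub>H\<^esub>" using assms(2) by (auto simp: monoid_hom_def)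
  have "h v \<in> carrier H" "h u \<in> carrier H" using h v hom_in_carrier by fast+
  moreover have "h v \<otimes>\<^bsub>H\<^esub> h u = \<one>\<^bsub>H\<^esub>" "h u \<otimes>\<^bsub>H\<^esub> h v = \<one>\<^bsub>H\<^esub>"
    using hom_mult[OF h(1) v(1,4)] hom_mult[OF h(1) v(4,1)] v h(2) by simp_all
  ultimately show ?thesis unfolding Units_def by blast
qed

locale monoid_sheaf =
  fixes P :: "('a, 's) monoidal_space"
  assumes monoidal_space: "monoidal_space P"
begin

sublocale monoid_presheaf P
  by (rule monoid_presheaf.intro) (use monoidal_space in \<open>auto simp: monoidal_space_def sheaf_def\<close>)

sublocale set_sheaf "sp P" "\<lambda>U. carrier (sec P U)" "res P"
  by (rule set_sheaf.intro) (use monoidal_space in \<open>simp add: monoidal_space_def\<close>)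

end

context monoid_presheaf
begin

lemma monoid_sheaf_AS: "monoid_sheaf AS"
  by unfold_locales (rule monoidal_space_AS)

lemma Units_res:
  "Op U \<Longrightarrow> Op V \<Longrightarrow> V \<subseteq> U \<Longrightarrow> u \<in> Units (sec P U) \<Longrightarrow> res P U V u \<in> Units (sec P V)"
  by (rule hom_Units[OF monoid_sec res_hom])

lemma Units_Sec: "Op U \<Longrightarrow> u \<in> Units (sec P U) \<Longrightarrow> u \<in> Sec U"
  by (simp add: Units_def)

lemma res_inv:
  assumes "Op U" "Op V" "V \<subseteq> U" "u \<in> Units (sec P U)"
  shows "res P U V (inv\<^bsub>sec P U\<^esub> u) = inv\<^bsub>sec P V\<^esub> (res P U V u)"
proof -
  interpret U: monoid "sec P U" using assms monoid_sec by blast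
  interpret V: comm_monoid "sec P V" using assms comm_monoid_sec by blast
  have c: "u \<in> Sec U" "inv\<^bsub>sec P U\<^esub> u \<in> Sec U" using assms by auto
  have "res P U V u \<otimes>\<^bsub>sec P V\<^esub> res P U V (inv\<^bsub>sec P U\<^esub> u) = \<one>\<^bsub>sec P V\<^esub>"
    using assms c by (simp flip: mult_res)
  then show ?thesis
    using assms c res_closed[OF assms(1-3)] V.inv_unique' by (metis V.m_comm)
qed

lemma comm_group_units: "Op U \<Longrightarrow> comm_group (units_of (sec P U))"
  using comm_monoid.units_comm_group comm_monoid_sec by blast

lemma unit_sheaf_simps [simp]:
  "sp (unit_sheaf P) = sp P" "sec (unit_sheaf P) U = units_of (sec P U)" "res (unit_sheaf P) = res P"
  by (simp_all add: unit_sheaf_def)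

end

context monoid_sheaf
begin

text \<open>Inverses in a commutative monoid are unique, so the inverses found locally agree on
  overlaps and glue to an inverse of \<open>s\<close>.\<close>

lemma Units_local:
  assumes U: "Op U" and s: "s \<in> Sec U"
    and loc: "\<And>x. x \<in> U \<Longrightarrow> \<exists>V. Op V \<and> x \<in> V \<and> V \<subseteq> U \<and> res P U V s \<in> Units (sec P V)"
  shows "s \<in> Units (sec P U)"
proof -
  from loc obtain V where V: "\<And>x. x \<in> U \<Longrightarrow> Op (V x) \<and> x \<in> V x \<and> V x \<subseteq> U \<and>
      res P U (V x) s \<in> Units (sec P (V x))" by metis
  have UV: "(\<Union>x\<in>U. V x) = U" using V by blast
  define t where "t = (\<lambda>x. inv\<^bsub>sec P (V x)\<^esub> (res P U (V x) s))"
  have tc: "t x \<in> Sec (V x)" if "x \<in> U" for x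
    using V[OF that] monoid.Units_inv_closed[OF monoid_sec] unfolding t_def by blast
  have tr: "res P (V x) W (t x) = inv\<^bsub>sec P W\<^esub> (res P U W s)" if "x \<in> U" "Op W" "W \<subseteq> V x" for x W
    using V[OF that(1)] that U s unfolding t_def by (simp add: res_inv res_res)
  obtain r where r: "r \<in> Sec U" "\<And>x. x \<in> U \<Longrightarrow> res P U (V x) r = t x"
  proof (rule glue[of U V t])
    show "res P (V x) (V x \<inter> V y) (t x) = res P (V y) (V x \<inter> V y) (t y)" if "x \<in> U" "y \<in> U" for x y
      using V[OF that(1)] V[OF that(2)] tr[OF that(1), of "V x \<inter> V y"] tr[OF that(2), of "V x \<inter> V y"]
      by simp
  qed (use V tc UV that in auto)
  have "s \<otimes>\<^bsub>sec P U\<^esub> r = \<one>\<^bsub>sec P U\<^esub>"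
  proof (rule eqI_cover[OF U])
    fix x assume x: "x \<in> U"
    have "res P U (V x) s \<otimes>\<^bsub>sec P (V x)\<^esub> t x = \<one>\<^bsub>sec P (V x)\<^esub>"
      using V[OF x] monoid.Units_r_inv[OF monoid_sec] unfolding t_def by blast
    then show "\<exists>W. Op W \<and> x \<in> W \<and> W \<subseteq> U \<and>
        res P U W (s \<otimes>\<^bsub>sec P U\<^esub> r) = res P U W \<one>\<^bsub>sec P U\<^esub>"
      using V[OF x] U s r x by (intro exI[of _ "V x"]) simp
  qed (use U s r in auto)
  then show ?thesis
    using s r U ac(2)[OF U] unfolding Units_def by auto
qed

end

section \<open>Meromorphic functions\<close>

lemma fraction_closed: "m \<in> carrier M \<Longrightarrow> s \<in> S \<Longrightarrow> fraction M S m s \<in> carrier (localization M S)"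
  by (auto simp: localization_def)

lemma localization_cases:
  assumes "A \<in> carrier (localization M S)"
  obtains m s where "m \<in> carrier M" "s \<in> S" "A = fraction M S m s"
  using assms by (auto simp: localization_def)

lemma comm_monoid_localization:
  assumes "comm_monoid M" "submonoid S M"
  shows "comm_monoid (localization M S)"
proof -
  interpret M: comm_monoid M by fact
  interpret S: submonoid S M by fact
  note mult = localization_mult[OF assms]
  have Sc: "s \<in> carrier M" if "s \<in> S" for s using that S.subset by blast
  have one: "\<one>\<^bsub>localization M S\<^esub> = fraction M S \<one>\<^bsub>M\<^esub> \<one>\<^bsub>M\<^esub>" by (simp add: localization_def)
  show ?thesis
  proof
    fix A B C assume "A \<in> carrier (localization M S)" "B \<in> carrier (localization M S)"
      "C \<in> carrier (localization M S)"
    then show "A \<otimes>\<^bsub>localization M S\<^esub> B \<otimes>\<^bsub>localization M S\<^esub> C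
      = A \<otimes>\<^bsub>localization M S\<^esub> (B \<otimes>\<^bsub>localization M S\<^esub> C)"
      by (elim localization_cases) (simp add: mult M.m_assoc Sc)
  next
    fix A B assume "A \<in> carrier (localization M S)" "B \<in> carrier (localization M S)"
    then show "A \<otimes>\<^bsub>localization M S\<^esub> B \<in> carrier (localization M S)"
      and "A \<otimes>\<^bsub>localization M S\<^esub> B = B \<otimes>\<^bsub>localization M S\<^esub> A"
      by (elim localization_cases, simp add: mult M.m_comm Sc fraction_closed)+
  next
    show "\<one>\<^bsub>localization M S\<^esub> \<in> carrier (localization M S)"
      unfolding one by (simp add: fraction_closed)
    fix A assume "A \<in> carrier (localization M S)"
    then show "\<one>\<^bsub>localization M S\<^esub> \<otimes>\<^bsub>localization M S\<^esub> A = A"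
      and "A \<otimes>\<^bsub>localization M S\<^esub> \<one>\<^bsub>localization M S\<^esub> = A"
      unfolding one by (elim localization_cases, simp add: mult Sc)+
  qed
qed

lemma regular_elements_mult:
  assumes "comm_monoid M" "a \<in> regular_elements M" "b \<in> regular_elements M"
  shows "a \<otimes>\<^bsub>M\<^esub> b \<in> regular_elements M"
proof -
  interpret comm_monoid M by fact
  show ?thesis
    unfolding regular_elements_def
  proof (intro CollectI conjI ballI impI)
    have ab: "a \<in> carrier M" "b \<in> carrier M" using assms(2,3) by (simp_all add: regular_elements_def)
    then show "a \<otimes>\<^bsub>M\<^esub> b \<in> carrier M" by simp
    fix x y assume "x \<in> carrier M" "y \<in> carrier M" "a \<otimes>\<^bsub>M\<^esub> b \<otimes>\<^bsub>M\<^esub> x = a \<otimes>\<^bsub>M\<^esub> b \<otimes>\<^bsub>M\<^esub> y"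
    moreover from this have "a \<otimes>\<^bsub>M\<^esub> (b \<otimes>\<^bsub>M\<^esub> x) = a \<otimes>\<^bsub>M\<^esub> (b \<otimes>\<^bsub>M\<^esub> y)"
      using ab by (simp add: m_assoc)
    moreover have cancel: "u = v"
      if "c \<in> regular_elements M" "u \<in> carrier M" "v \<in> carrier M" "c \<otimes>\<^bsub>M\<^esub> u = c \<otimes>\<^bsub>M\<^esub> v" for c u v
      using that unfolding regular_elements_def by blast
    ultimately show "x = y"
      using cancel[OF assms(3)] cancel[OF assms(2)] m_closed ab by metis
  qed
qed

section \<open>Regular sections and the presheaf of fractions\<close>

locale mero = monoid_sheaf X for X :: "('a, 's) monoidal_space"
begin

abbreviation R :: "'a set \<Rightarrow> 's set" where "R \<equiv> regular_sections X"

lemma R_Sec: "s \<in> R U \<Longrightarrow> s \<in> Sec U"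
  by (simp add: regular_sections_def)

lemma R_mult:
  assumes "Op U" "s \<in> R U" "t \<in> R U"
  shows "s \<otimes>\<^bsub>sec X U\<^esub> t \<in> R U"
proof -
  have "ger x U (s \<otimes>\<^bsub>sec X U\<^esub> t) \<in> regular_elements (stalk X x)" if "x \<in> U" for x
  proof -
    have "comm_monoid (stalk X x)" using comm_monoid_stalk openin_subset assms(1) that by blast
    from regular_elements_mult[OF this, of "ger x U s" "ger x U t"] show ?thesis
      using assms that by (simp add: germ_mult regular_sections_def)
  qed
  then show ?thesis using assms by (simp add: regular_sections_def)
qed

lemma R_one:
  assumes "Op U" shows "\<one>\<^bsub>sec X U\<^esub> \<in> R U"
proof -
  have "\<one>\<^bsub>stalk X x\<^esub> \<in> regular_elements (stalk X x)" if "x \<in> U" for x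
  proof -
    interpret comm_monoid "stalk X x" using comm_monoid_stalk openin_subset assms(1) that by blast
    show ?thesis unfolding regular_elements_def by simp
  qed
  then show ?thesis using assms by (simp add: regular_sections_def germ_one)
qed

lemma R_res: "Op U \<Longrightarrow> Op V \<Longrightarrow> V \<subseteq> U \<Longrightarrow> s \<in> R U \<Longrightarrow> res X U V s \<in> R V"
  unfolding regular_sections_def by (auto simp: germ_at_eq germ_res res_closed)

text \<open>Regularity is imposed on germs. Cancelling in every stalk shows that \<open>a\<close>
  and \<open>b\<close> have the same germs, and sections of a sheaf are determined by their
  germs.\<close>

lemma R_cancel:
  assumes "Op U" "s \<in> R U" "a \<in> Sec U" "b \<in> Sec U" "s \<otimes>\<^bsub>sec X U\<^esub> a = s \<otimes>\<^bsub>sec X U\<^esub> b"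
  shows "a = b"
proof (rule eqI_germ[OF assms(1,3,4)])
  fix x assume x: "x \<in> U"
  have "ger x U s \<otimes>\<^bsub>stalk X x\<^esub> ger x U a = ger x U s \<otimes>\<^bsub>stalk X x\<^esub> ger x U b"
    using assms x by (simp add: germ_mult R_Sec)
  then show "gm x U a = gm x U b"
    using assms x germ_closed unfolding germ_at_eq regular_sections_def regular_elements_def by blast
qed

lemma submonoid_R: "Op U \<Longrightarrow> submonoid (R U) (sec X U)"
  using R_Sec R_mult R_one by unfold_locales auto

abbreviation fr :: "'a set \<Rightarrow> 's \<Rightarrow> 's \<Rightarrow> ('s \<times> 's) set" where
  "fr U \<equiv> fraction (sec X U) (R U)"

abbreviation MP :: "('a, ('s \<times> 's) set) monoidal_space" where
  "MP \<equiv> meromorphic_presheaf X"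

text \<open>The auxiliary factor in the equality of fractions is itself a regular section and
  cancels by \<open>R_cancel\<close>; plain cross-multiplication remains.\<close>

lemma fr_eq_iff:
  assumes "Op U" "m \<in> Sec U" "n \<in> Sec U" "s \<in> R U" "t \<in> R U"
  shows "fr U m s = fr U n t \<longleftrightarrow> m \<otimes>\<^bsub>sec X U\<^esub> t = n \<otimes>\<^bsub>sec X U\<^esub> s"
proof -
  have "m \<otimes>\<^bsub>sec X U\<^esub> t \<in> Sec U" "n \<otimes>\<^bsub>sec X U\<^esub> s \<in> Sec U" using assms R_Sec by auto
  then show ?thesis
    using fraction_eq_iff[OF comm_monoid_sec[OF assms(1)] submonoid_R[OF assms(1)] assms(2-5)]
      R_cancel[OF assms(1)] R_one[OF assms(1)] by metis
qed

lemma MP_simps [simp]: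
  "sp MP = sp X" "sec MP U = localization (sec X U) (R U)"
  by (simp_all add: meromorphic_presheaf_def)

text \<open>Restriction of fractions is defined as a union over representatives. Two representatives
  of one fraction satisfy a cross-multiplied identity, which survives restriction, so all members of
  the union coincide.\<close>

lemma MP_res:
  assumes "Op U" "Op V" "V \<subseteq> U" "m \<in> Sec U" "s \<in> R U"
  shows "res MP U V (fr U m s) = fr V (res X U V m) (res X U V s)"
proof -
  have "(\<Union>(n, t)\<in>fr U m s. fr V (res X U V n) (res X U V t)) = fr V (res X U V m) (res X U V s)"
  proof (rule SUP_eq_const)
    have "(m, s) \<in> fr U m s" using assms R_one by (auto simp: fraction_def)
    then show "fr U m s \<noteq> {}" by blast
    fix z assume z: "z \<in> fr U m s"
    obtain n t where nt: "z = (n, t)" by (cases z)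
    from z obtain u where "n \<in> Sec U" "t \<in> R U" "u \<in> R U"
        "u \<otimes>\<^bsub>sec X U\<^esub> (m \<otimes>\<^bsub>sec X U\<^esub> t) = u \<otimes>\<^bsub>sec X U\<^esub> (n \<otimes>\<^bsub>sec X U\<^esub> s)"
      unfolding fraction_def nt by blast
    then have n: "n \<in> Sec U" "t \<in> R U" "m \<otimes>\<^bsub>sec X U\<^esub> t = n \<otimes>\<^bsub>sec X U\<^esub> s"
      using R_cancel[of U u] assms R_Sec by auto
    then have "res X U V m \<otimes>\<^bsub>sec X V\<^esub> res X U V t = res X U V n \<otimes>\<^bsub>sec X V\<^esub> res X U V s"
      using assms by (simp add: R_Sec flip: mult_res)
    then show "(case z of (n, t) \<Rightarrow> fr V (res X U V n) (res X U V t)) = fr V (res X U V m) (res X U V s)"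
      unfolding nt using assms n by (simp add: fr_eq_iff res_closed R_res)
  qed
  then show ?thesis by (simp add: meromorphic_presheaf_def)
qed

lemma monoid_presheaf_MP: "monoid_presheaf MP"
proof (rule monoid_presheaf.intro)
  fix U V
  show "comm_monoid (sec MP U)" if "openin (sp MP) U"
    using that comm_monoid_localization[OF comm_monoid_sec submonoid_R] by simp
  show "res MP U V \<in> monoid_hom (sec MP U) (sec MP V)"
    if "openin (sp MP) U" "openin (sp MP) V" "V \<subseteq> U"
  proof -
    have UV: "Op U" "Op V" using that by simp_all
    note [simp] = UV that(3)
    show ?thesis
      unfolding monoid_hom_def
    proof (intro CollectI conjI homI)
      fix A B assume A: "A \<in> carrier (sec MP U)"
      then obtain m s where ms: "m \<in> Sec U" "s \<in> R U" "A = fr U m s"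
        using localization_cases by (metis MP_simps(2))
      show "res MP U V A \<in> carrier (sec MP V)"
        using ms by (simp add: MP_res fraction_closed res_closed R_res)
      assume B: "B \<in> carrier (sec MP U)"
      then obtain n t where nt: "n \<in> Sec U" "t \<in> R U" "B = fr U n t"
        using localization_cases by (metis MP_simps(2))
      show "res MP U V (A \<otimes>\<^bsub>sec MP U\<^esub> B) = res MP U V A \<otimes>\<^bsub>sec MP V\<^esub> res MP U V B"
        using ms nt
        by (simp add: MP_res localization_mult comm_monoid_sec submonoid_R res_closed R_res R_mult R_Sec)
    next
      show "res MP U V \<one>\<^bsub>sec MP U\<^esub> = \<one>\<^bsub>sec MP V\<^esub>"
        using MP_res[of U V "\<one>\<^bsub>sec X U\<^esub>" "\<one>\<^bsub>sec X U\<^esub>"] R_one[of U]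
        by (simp add: localization_def)
    qed
  qed
next
  show "presheaf (sp MP) (\<lambda>U. carrier (sec MP U)) (res MP)"
    unfolding presheaf_def
  proof (intro conjI allI impI ballI funcsetI)
    fix U V A assume UV: "openin (sp MP) U \<and> openin (sp MP) V \<and> V \<subseteq> U" and A: "A \<in> carrier (sec MP U)"
    then obtain m s where ms: "m \<in> Sec U" "s \<in> R U" "A = fr U m s"
      using localization_cases by (metis MP_simps(2))
    then show "res MP U V A \<in> carrier (sec MP V)"
      using UV by (simp add: MP_res fraction_closed res_closed R_res)
  next
    fix U A assume U: "openin (sp MP) U" and A: "A \<in> carrier (sec MP U)"
    then obtain m s where ms: "m \<in> Sec U" "s \<in> R U" "A = fr U m s"
      using localization_cases by (metis MP_simps(2))
    then show "res MP U U A = A" using U by (simp add: MP_res res_id R_Sec)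
  next
    fix U V W A assume UV: "openin (sp MP) U \<and> openin (sp MP) V \<and> openin (sp MP) W \<and> W \<subseteq> V \<and> V \<subseteq> U"
      and A: "A \<in> carrier (sec MP U)"
    then obtain m s where ms: "m \<in> Sec U" "s \<in> R U" "A = fr U m s"
      using localization_cases by (metis MP_simps(2))
    then show "res MP V W (res MP U V A) = res MP U W A"
      using UV subset_trans[of W V U] by (simp add: MP_res res_closed R_res res_res R_Sec)
  qed
qed

sublocale MP: monoid_presheaf MP
  by (rule monoid_presheaf_MP)

section \<open>The sheaf of meromorphic functions\<close>

abbreviation MS :: "('a, ('a, 's) mero) monoidal_space" where
  "MS \<equiv> meromorphic_sheaf X"

sublocale MS: monoid_sheaf MS
  unfolding meromorphic_sheaf_def by (rule MP.monoid_sheaf_AS)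

lemma sp_MS [simp]: "sp MS = sp X"
  by (simp add: meromorphic_sheaf_def)

definition mero_frac :: "'a set \<Rightarrow> 's \<Rightarrow> 's \<Rightarrow> ('a, 's) mero" where
  "mero_frac U a s = to_associated_sheaf MP U (fr U a s)"

abbreviation tm :: "'a set \<Rightarrow> 's \<Rightarrow> ('a, 's) mero" where
  "tm \<equiv> to_meromorphic X"

lemma tm_eq: "tm U a = mero_frac U a \<one>\<^bsub>sec X U\<^esub>"
  by (simp add: mero_frac_def to_meromorphic_def)

lemma mero_frac_closed:
  "Op U \<Longrightarrow> a \<in> Sec U \<Longrightarrow> s \<in> R U \<Longrightarrow> mero_frac U a s \<in> carrier (sec MS U)"
  unfolding mero_frac_def meromorphic_sheaf_def by (rule MP.to_AS_closed) (auto simp: fraction_closed)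

lemma mero_frac_mult:
  assumes "Op U" "a \<in> Sec U" "s \<in> R U" "b \<in> Sec U" "t \<in> R U"
  shows "mero_frac U a s \<otimes>\<^bsub>sec MS U\<^esub> mero_frac U b t =
    mero_frac U (a \<otimes>\<^bsub>sec X U\<^esub> b) (s \<otimes>\<^bsub>sec X U\<^esub> t)"
  unfolding mero_frac_def meromorphic_sheaf_def
  using MP.to_AS_mult[of U "fr U a s" "fr U b t"] assms
  by (simp del: MP.AS_simps add: fraction_closed localization_mult comm_monoid_sec submonoid_R)

lemma mero_frac_res:
  assumes "Op U" "Op V" "V \<subseteq> U" "a \<in> Sec U" "s \<in> R U"
  shows "res MS U V (mero_frac U a s) = mero_frac V (res X U V a) (res X U V s)"
  unfolding mero_frac_def meromorphic_sheaf_def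
  using MP.to_AS_res[of U V "fr U a s"] assms by (simp del: MP.AS_simps add: fraction_closed MP_res)

text \<open>Sheafification identifies two fractions when they agree locally. Locally this is an
  identity of cross products in \<open>O_X\<close>, and since \<open>O_X\<close> is a sheaf the
  local identities give the global one. Hence no further fractions become equal in
  \<open>M_X\<close>.\<close>

lemma mero_frac_eq_iff:
  assumes "Op U" "a \<in> Sec U" "s \<in> R U" "b \<in> Sec U" "t \<in> R U"
  shows "mero_frac U a s = mero_frac U b t \<longleftrightarrow> a \<otimes>\<^bsub>sec X U\<^esub> t = b \<otimes>\<^bsub>sec X U\<^esub> s"
proof
  assume "mero_frac U a s = mero_frac U b t"
  then have loc: "\<exists>W. Op W \<and> x \<in> W \<and> W \<subseteq> U \<and> res MP U W (fr U a s) = res MP U W (fr U b t)" if "x \<in> U" for x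
    unfolding mero_frac_def using MP.to_AS_eq_iff[of U "fr U a s" "fr U b t"] assms that
    by (simp add: fraction_closed)
  show "a \<otimes>\<^bsub>sec X U\<^esub> t = b \<otimes>\<^bsub>sec X U\<^esub> s"
  proof (rule eqI_cover[OF assms(1)])
    fix x assume "x \<in> U"
    then obtain W where W: "Op W" "x \<in> W" "W \<subseteq> U" "res MP U W (fr U a s) = res MP U W (fr U b t)"
      using loc by blast
    then have "res X U W (a \<otimes>\<^bsub>sec X U\<^esub> t) = res X U W (b \<otimes>\<^bsub>sec X U\<^esub> s)"
      using assms by (simp add: MP_res fr_eq_iff res_closed R_res R_Sec)
    then show "\<exists>W. Op W \<and> x \<in> W \<and> W \<subseteq> U \<and>
        res X U W (a \<otimes>\<^bsub>sec X U\<^esub> t) = res X U W (b \<otimes>\<^bsub>sec X U\<^esub> s)" using W by blast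
  qed (use assms R_Sec in auto)
next
  assume "a \<otimes>\<^bsub>sec X U\<^esub> t = b \<otimes>\<^bsub>sec X U\<^esub> s"
  then show "mero_frac U a s = mero_frac U b t"
    unfolding mero_frac_def fr_eq_iff[OF assms(1,2,4,3,5), symmetric] by (rule arg_cong)
qed

lemma mero_frac_one: "Op U \<Longrightarrow> mero_frac U \<one>\<^bsub>sec X U\<^esub> \<one>\<^bsub>sec X U\<^esub> = \<one>\<^bsub>sec MS U\<^esub>"
  unfolding mero_frac_def meromorphic_sheaf_def
  using MP.to_AS_one[of U] by (simp del: MP.AS_simps add: localization_def)

lemma mero_frac_Units:
  assumes "Op U" "a \<in> R U" "s \<in> R U"
  shows "mero_frac U a s \<in> Units (sec MS U)"
proof -
  have c: "mero_frac U a s \<in> carrier (sec MS U)" "mero_frac U s a \<in> carrier (sec MS U)"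
    using assms mero_frac_closed R_Sec by auto
  have "mero_frac U a s \<otimes>\<^bsub>sec MS U\<^esub> mero_frac U s a = \<one>\<^bsub>sec MS U\<^esub>"
    using assms R_Sec
    by (simp add: mero_frac_mult mero_frac_eq_iff R_mult R_one ac flip: mero_frac_one)
  moreover from this have "mero_frac U s a \<otimes>\<^bsub>sec MS U\<^esub> mero_frac U a s = \<one>\<^bsub>sec MS U\<^esub>"
    using MS.ac(2)[of U "mero_frac U a s" "mero_frac U s a"] c assms by simp
  ultimately show ?thesis using c unfolding Units_def by blast
qed

lemma tm_closed [simp]: "Op U \<Longrightarrow> a \<in> Sec U \<Longrightarrow> tm U a \<in> carrier (sec MS U)"
  by (simp add: tm_eq mero_frac_closed R_one)

lemma tm_mult:
  "Op U \<Longrightarrow> a \<in> Sec U \<Longrightarrow> b \<in> Sec U \<Longrightarrow> tm U (a \<otimes>\<^bsub>sec X U\<^esub> b) = tm U a \<otimes>\<^bsub>sec MS U\<^esub> tm U b"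
  by (simp add: tm_eq mero_frac_mult R_one)

lemma tm_one: "Op U \<Longrightarrow> tm U \<one>\<^bsub>sec X U\<^esub> = \<one>\<^bsub>sec MS U\<^esub>"
  by (simp add: tm_eq mero_frac_one)

lemma tm_res:
  "Op U \<Longrightarrow> Op V \<Longrightarrow> V \<subseteq> U \<Longrightarrow> a \<in> Sec U \<Longrightarrow> res MS U V (tm U a) = tm V (res X U V a)"
  using mero_frac_res[of U V a "\<one>\<^bsub>sec X U\<^esub>"] by (simp add: tm_eq R_one)

text \<open>The injectivity of \<open>O_X \<rightarrow> M_X\<close>: cross-multiplication with both
  denominators equal to one.\<close>

lemma tm_inj: "Op U \<Longrightarrow> a \<in> Sec U \<Longrightarrow> b \<in> Sec U \<Longrightarrow> tm U a = tm U b \<longleftrightarrow> a = b"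
  by (simp add: tm_eq mero_frac_eq_iff R_one)

lemma tm_hom: "Op U \<Longrightarrow> tm U \<in> monoid_hom (sec X U) (sec MS U)"
  unfolding monoid_hom_def by (intro CollectI conjI homI) (simp_all only: tm_mult tm_one tm_closed)

lemma tm_Units: "Op U \<Longrightarrow> a \<in> Units (sec X U) \<Longrightarrow> tm U a \<in> Units (sec MS U)"
  by (rule hom_Units[OF monoid_sec tm_hom])

end

section \<open>Cartier divisors\<close>

lemma comm_group_if_Units:
  assumes "comm_monoid G" "carrier G \<subseteq> Units G"
  shows "comm_group G"
proof -
  interpret comm_monoid G by fact
  show ?thesis by unfold_locales (rule assms(2))
qed

context mero
begin

section \<open>The quotient presheaf of meromorphic units by regular units\<close>

abbreviation A :: "'a set \<Rightarrow> ('a, 's) mero set" where "A \<equiv> regular_units X"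

abbreviation UM :: "'a set \<Rightarrow> ('a, 's) mero monoid" where "UM U \<equiv> units_of (sec MS U)"

abbreviation cos :: "'a set \<Rightarrow> ('a, 's) mero \<Rightarrow> ('a, 's) mero set" where
  "cos U f \<equiv> A U #>\<^bsub>UM U\<^esub> f"

abbreviation Q :: "('a, ('a, 's) mero set) monoidal_space" where "Q \<equiv> cartier_presheaf X"

lemma comm_group_UM: "Op U \<Longrightarrow> comm_group (UM U)"
  using MS.comm_group_units by simp

lemma group_UM: "Op U \<Longrightarrow> group (UM U)"
  using comm_group_UM by (simp add: comm_group.axioms)

lemma subgroup_A:
  assumes "Op U"
  shows "subgroup (A U) (UM U)"
proof -
  have "group_hom (units_of (sec X U)) (UM U) (tm U)"
    unfolding group_hom_def group_hom_axioms_def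
    using comm_group_units[OF assms] group_UM[OF assms] tm_Units[OF assms] tm_mult[OF assms]
    by (auto simp: units_of_carrier units_of_mult comm_group.axioms Units_Sec assms intro!: homI)
  from group_hom.img_is_subgroup[OF this] show ?thesis
    by (simp add: regular_units_def units_of_carrier)
qed

lemma normal_A: "Op U \<Longrightarrow> A U \<lhd> UM U"
  using comm_group.normal_iff_subgroup[OF comm_group_UM] subgroup_A by blast

lemma cos_iff: "b \<in> cos U f \<longleftrightarrow> (\<exists>u\<in>Units (sec X U). b = tm U u \<otimes>\<^bsub>sec MS U\<^esub> f)"
  by (auto simp: r_coset_def regular_units_def units_of_mult)

lemma cos_eq_iff:
  assumes "Op U" "f \<in> Units (sec MS U)" "g \<in> Units (sec MS U)"
  shows "cos U f = cos U g \<longleftrightarrow> (\<exists>u\<in>Units (sec X U). g = tm U u \<otimes>\<^bsub>sec MS U\<^esub> f)"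
proof -
  interpret group "UM U" using group_UM assms by blast
  have "cos U f = cos U g \<longleftrightarrow> g \<in> cos U f"
    using repr_independence[of g "A U" f] rcos_self[of g "A U"] subgroup_A assms
    by (auto simp: units_of_carrier)
  then show ?thesis by (simp add: cos_iff)
qed

lemma Q_simps [simp]: "sp Q = sp X" "sec Q U = UM U Mod A U"
  by (simp_all add: cartier_presheaf_def quotient_presheaf_def unit_sheaf_def)

lemma Q_carrier: "carrier (sec Q U) = cos U ` Units (sec MS U)"
  by (simp add: carrier_FactGroup units_of_carrier)

lemma cos_closed: "f \<in> Units (sec MS U) \<Longrightarrow> cos U f \<in> carrier (sec Q U)"
  unfolding Q_carrier by blast

lemma cos_mult:
  assumes "Op U" "f \<in> Units (sec MS U)" "g \<in> Units (sec MS U)"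
  shows "cos U f \<otimes>\<^bsub>sec Q U\<^esub> cos U g = cos U (f \<otimes>\<^bsub>sec MS U\<^esub> g)"
  using normal.rcos_sum[OF normal_A[OF assms(1)], of f g] assms
  by (simp add: units_of_carrier units_of_mult)

lemma cos_one: "Op U \<Longrightarrow> cos U \<one>\<^bsub>sec MS U\<^esub> = \<one>\<^bsub>sec Q U\<^esub>"
  using group.coset_mult_one[OF group_UM, of U "A U"] subgroup.subset[OF subgroup_A, of U]
  by (simp add: units_of_one)

text \<open>Two representatives of a coset differ by the image of a unit of \<open>O_X(U)\<close>;
  the restriction of that unit is again a unit, so the restricted representatives lie in one coset
  over \<open>V\<close>.\<close>

lemma Q_res:
  assumes "Op U" "Op V" "V \<subseteq> U" "f \<in> Units (sec MS U)"
  shows "res Q U V (cos U f) = cos V (res MS U V f)"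
proof -
  have "(\<Union>b\<in>cos U f. cos V (res MS U V b)) = cos V (res MS U V f)"
  proof (rule SUP_eq_const)
    interpret group "UM U" using group_UM assms by blast
    show "cos U f \<noteq> {}" using rcos_self[of f "A U"] subgroup_A assms by (auto simp: units_of_carrier)
    fix b assume "b \<in> cos U f"
    then obtain u where u: "u \<in> Units (sec X U)" "b = tm U u \<otimes>\<^bsub>sec MS U\<^esub> f" unfolding cos_iff by blast
    have f: "res MS U V f \<in> Units (sec MS V)" using MS.Units_res assms by simp
    have tu: "tm V (res X U V u) \<in> Units (sec MS V)" "u \<in> Sec U"
      using tm_Units Units_res Units_Sec u assms by auto
    have b: "res MS U V b = tm V (res X U V u) \<otimes>\<^bsub>sec MS V\<^esub> res MS U V f"
      unfolding u(2) using assms tu(2) MS.Units_Sec[of U f] by (simp add: tm_res)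
    have "res MS U V b \<in> Units (sec MS V)"
      unfolding b using tu f monoid.Units_m_closed[OF MS.monoid_sec] assms by simp
    then show "cos V (res MS U V b) = cos V (res MS U V f)"
      using cos_eq_iff[OF assms(2) f] b Units_res[OF assms(1-3) u(1)] by metis
  qed
  then show ?thesis by (simp add: cartier_presheaf_def quotient_presheaf_def unit_sheaf_def)
qed

lemma Q_cases:
  assumes "C \<in> carrier (sec Q U)"
  obtains f where "f \<in> Units (sec MS U)" "C = cos U f"
  using assms unfolding Q_carrier by blast

lemma monoid_presheaf_Q: "monoid_presheaf Q"
proof (rule monoid_presheaf.intro)
  fix U V
  show "comm_monoid (sec Q U)" if "openin (sp Q) U"
    using that comm_group.abelian_FactGroup[OF comm_group_UM subgroup_A]
    by (simp add: comm_group.axioms)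
  show "res Q U V \<in> monoid_hom (sec Q U) (sec Q V)"
    if "openin (sp Q) U" "openin (sp Q) V" "V \<subseteq> U"
  proof -
    have UV: "Op U" "Op V" using that by simp_all
    note r = Q_res[OF UV that(3)] MS.Units_res[of U V, simplified, OF UV that(3)]
    note m = monoid.Units_m_closed[OF MS.monoid_sec, of U, simplified, OF UV(1)]
    show ?thesis
      unfolding monoid_hom_def
    proof (intro CollectI conjI homI)
      fix B C assume B: "B \<in> carrier (sec Q U)"
      then obtain f where f: "f \<in> Units (sec MS U)" "B = cos U f" by (rule Q_cases)
      show "res Q U V B \<in> carrier (sec Q V)"
        unfolding f(2) r(1)[OF f(1)] by (rule cos_closed) (rule r(2)[OF f(1)])
      assume C: "C \<in> carrier (sec Q U)"
      then obtain g where g: "g \<in> Units (sec MS U)" "C = cos U g" by (rule Q_cases)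
      show "res Q U V (B \<otimes>\<^bsub>sec Q U\<^esub> C) = res Q U V B \<otimes>\<^bsub>sec Q V\<^esub> res Q U V C"
        unfolding f(2) g(2) cos_mult[OF UV(1) f(1) g(1)] r(1)[OF f(1)] r(1)[OF g(1)]
          r(1)[OF m[OF f(1) g(1)]] cos_mult[OF UV(2) r(2)[OF f(1)] r(2)[OF g(1)]]
        using UV that(3) MS.Units_Sec[of U] f g by simp
    next
      have one: "\<one>\<^bsub>sec MS U\<^esub> \<in> Units (sec MS U)"
        using monoid.Units_one_closed[OF MS.monoid_sec] UV by simp
      show "res Q U V \<one>\<^bsub>sec Q U\<^esub> = \<one>\<^bsub>sec Q V\<^esub>"
        unfolding cos_one[OF UV(1), symmetric] r(1)[OF one] using UV that(3) cos_one[OF UV(2)] by simp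
    qed
  qed
next
  show "presheaf (sp Q) (\<lambda>U. carrier (sec Q U)) (res Q)"
    unfolding presheaf_def
  proof (intro conjI allI impI ballI funcsetI)
    fix U V C assume UV: "openin (sp Q) U \<and> openin (sp Q) V \<and> V \<subseteq> U" and C: "C \<in> carrier (sec Q U)"
    then obtain f where f: "f \<in> Units (sec MS U)" "C = cos U f" by (metis Q_cases)
    then show "res Q U V C \<in> carrier (sec Q V)"
      using UV Q_res[of U V f] cos_closed[of "res MS U V f" V] MS.Units_res[of U V f]
      by (simp del: Q_simps(2) add: Q_simps(1))
  next
    fix U C assume U: "openin (sp Q) U" and C: "C \<in> carrier (sec Q U)"
    then obtain f where f: "f \<in> Units (sec MS U)" "C = cos U f" by (metis Q_cases)
    then show "res Q U U C = C" using U by (simp add: Q_res MS.res_id MS.Units_Sec)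
  next
    fix U V W C assume UV: "openin (sp Q) U \<and> openin (sp Q) V \<and> openin (sp Q) W \<and> W \<subseteq> V \<and> V \<subseteq> U"
      and C: "C \<in> carrier (sec Q U)"
    then obtain f where f: "f \<in> Units (sec MS U)" "C = cos U f" by (metis Q_cases)
    then show "res Q V W (res Q U V C) = res Q U W C"
      using UV subset_trans[of W V U] MS.Units_res[of U V f]
      by (simp add: Q_res MS.res_res MS.Units_Sec)
  qed
qed

sublocale Q: monoid_presheaf Q
  by (rule monoid_presheaf_Q)

section \<open>Local equations of Cartier divisors\<close>

abbreviation CS :: "('a, ('a, 's) divisor) monoidal_space" where
  "CS \<equiv> cartier_sheaf X"

sublocale CS: monoid_sheaf CS
  unfolding cartier_sheaf_def by (rule Q.monoid_sheaf_AS)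

lemma sp_CS [simp]: "sp CS = sp X"
  by (simp add: cartier_sheaf_def)

abbreviation LD :: "'a set \<Rightarrow> ('a, 's) mero \<Rightarrow> ('a, 's) divisor" where
  "LD \<equiv> local_divisor X"

lemma LD_eq: "LD U f = to_associated_sheaf Q U (cos U f)"
  by (simp add: local_divisor_def unit_sheaf_def)

lemma LD_closed:
  assumes "Op U" "f \<in> Units (sec MS U)"
  shows "LD U f \<in> carrier (sec CS U)"
  unfolding LD_eq cartier_sheaf_def by (rule Q.to_AS_closed) (use assms cos_closed in auto)

lemma LD_mult:
  assumes "Op U" "f \<in> Units (sec MS U)" "g \<in> Units (sec MS U)"
  shows "LD U (f \<otimes>\<^bsub>sec MS U\<^esub> g) = LD U f \<otimes>\<^bsub>sec CS U\<^esub> LD U g"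
  using Q.to_AS_mult[of U "cos U f" "cos U g"] cos_closed[OF assms(2)] cos_closed[OF assms(3)] cos_mult[OF assms]
  unfolding LD_eq cartier_sheaf_def by (simp only: Q_simps(1) assms)

lemma LD_one: "Op U \<Longrightarrow> LD U \<one>\<^bsub>sec MS U\<^esub> = \<one>\<^bsub>sec CS U\<^esub>"
  using Q.to_AS_one[of U] unfolding LD_eq cartier_sheaf_def by (simp only: Q_simps(1) cos_one)

lemma LD_res:
  assumes "Op U" "Op V" "V \<subseteq> U" "f \<in> Units (sec MS U)"
  shows "res CS U V (LD U f) = LD V (res MS U V f)"
  using Q.to_AS_res[of U V "cos U f"] cos_closed[OF assms(4)] Q_res[OF assms]
  unfolding LD_eq cartier_sheaf_def by (simp only: Q_simps(1) assms)

lemma CS_locally: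
  assumes "D \<in> carrier (sec CS U)" "x \<in> U"
  obtains V f where "Op V" "x \<in> V" "V \<subseteq> U" "f \<in> Units (sec MS V)" "res CS U V D = LD V f"
proof -
  obtain V C where "openin (sp Q) V" "x \<in> V" "V \<subseteq> U" "C \<in> carrier (sec Q V)"
      "res Q.AS U V D = Q.to_AS V C"
    using Q.AS_locally[of D U x] assms unfolding cartier_sheaf_def by blast
  moreover from this obtain f where "f \<in> Units (sec MS V)" "C = cos V f" by (metis Q_cases)
  ultimately show thesis using that[of V f] unfolding cartier_sheaf_def LD_eq by simp
qed

text \<open>Exactness of \<open>1 \<rightarrow> O_X* \<rightarrow> M_X* \<rightarrow> M_X*/O_X*
  \<rightarrow> 1\<close> in the middle, over any open set. Equality of divisors gives units
  \<open>u x\<close> of \<open>O_X\<close> locally with \<open>g = u x f\<close>. They are unique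
  because \<open>f\<close> is invertible and \<open>O_X\<close> embeds into \<open>M_X\<close>, so
  they glue; the result is a unit because being a unit is a local property.\<close>

lemma LD_eq_iff:
  assumes U: "Op U" and f: "f \<in> Units (sec MS U)" and g: "g \<in> Units (sec MS U)"
  shows "LD U f = LD U g \<longleftrightarrow> (\<exists>u\<in>Units (sec X U). g = tm U u \<otimes>\<^bsub>sec MS U\<^esub> f)"
proof
  assume "\<exists>u\<in>Units (sec X U). g = tm U u \<otimes>\<^bsub>sec MS U\<^esub> f"
  then show "LD U f = LD U g" using cos_eq_iff[OF assms] unfolding LD_eq by simp
next
  assume "LD U f = LD U g"
  have fg: "f \<in> carrier (sec MS U)" "g \<in> carrier (sec MS U)" using f g MS.Units_Sec U by auto
  have "\<exists>W u. Op W \<and> x \<in> W \<and> W \<subseteq> U \<and> u \<in> Units (sec X W) \<and>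
      res MS U W g = tm W u \<otimes>\<^bsub>sec MS W\<^esub> res MS U W f" if x: "x \<in> U" for x
  proof -
    obtain W where W: "Op W" "x \<in> W" "W \<subseteq> U" "res Q U W (cos U f) = res Q U W (cos U g)"
      using \<open>LD U f = LD U g\<close> Q.to_AS_eq_iff[of U "cos U f" "cos U g"] cos_closed[OF f] cos_closed[OF g] x U
      unfolding LD_eq by (metis Q_simps(1))
    have "cos W (res MS U W f) = cos W (res MS U W g)"
      using W(4) Q_res[OF U W(1,3) f] Q_res[OF U W(1,3) g] by simp
    then show ?thesis
      using cos_eq_iff[OF W(1)] MS.Units_res[of U W] U W f g by auto
  qed
  then obtain W u where Wu: "\<And>x. x \<in> U \<Longrightarrow> Op (W x) \<and> x \<in> W x \<and> W x \<subseteq> U \<and> u x \<in> Units (sec X (W x)) \<and>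
      res MS U (W x) g = tm (W x) (u x) \<otimes>\<^bsub>sec MS (W x)\<^esub> res MS U (W x) f" by metis
  have UW: "(\<Union>x\<in>U. W x) = U" using Wu by blast
  have uS: "u x \<in> Sec (W x)" if "x \<in> U" for x using Wu[OF that] Units_Sec by blast
  have rest: "res MS U V g = tm V (res X (W x) V (u x)) \<otimes>\<^bsub>sec MS V\<^esub> res MS U V f"
    if "x \<in> U" "Op V" "V \<subseteq> W x" for x V
  proof -
    have "res MS U V g = res MS (W x) V (res MS U (W x) g)"
      by (rule MS.res_res[symmetric]) (use Wu[OF that(1)] that U fg in auto)
    also have "\<dots> = res MS (W x) V (tm (W x) (u x) \<otimes>\<^bsub>sec MS (W x)\<^esub> res MS U (W x) f)"
      using Wu[OF that(1)] by simp
    also have "\<dots> = tm V (res X (W x) V (u x)) \<otimes>\<^bsub>sec MS V\<^esub> res MS U V f"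
      using Wu[OF that(1)] that U fg uS by (simp add: MS.res_closed MS.res_res tm_res)
    finally show ?thesis .
  qed
  obtain v where v: "v \<in> Sec U" "\<And>x. x \<in> U \<Longrightarrow> res X U (W x) v = u x"
  proof (rule glue[of U W u])
    fix x y assume xy: "x \<in> U" "y \<in> U"
    define V where "V = W x \<inter> W y"
    have V: "Op V" "V \<subseteq> W x" "V \<subseteq> W y" "V \<subseteq> U" using Wu xy unfolding V_def by auto
    have c: "res X (W x) V (u x) \<in> Sec V" "res X (W y) V (u y) \<in> Sec V"
      using V Wu xy uS res_closed by auto
    have fV: "res MS U V f \<in> Units (sec MS V)" using MS.Units_res U V f by simp
    then have fVc: "res MS U V f \<in> carrier (sec MS V)" using MS.Units_Sec V by simp
    \<comment> \<open>On an overlap both local units carry the same \<open>f\<close> to the same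
      \<open>g\<close>. Cancelling the invertible \<open>f\<close> and using injectivity of
      \<open>tm\<close> shows that they agree.\<close>
    have "tm V (res X (W x) V (u x)) \<otimes>\<^bsub>sec MS V\<^esub> res MS U V f =
        tm V (res X (W y) V (u y)) \<otimes>\<^bsub>sec MS V\<^esub> res MS U V f"
      using rest[OF xy(1) V(1,2)] rest[OF xy(2) V(1,3)] by simp
    then have "tm V (res X (W x) V (u x)) = tm V (res X (W y) V (u y))"
      using monoid.Units_l_cancel[OF MS.monoid_sec fV] c V fVc MS.ac(2)[of V _ "res MS U V f"] by simp
    then show "res X (W x) (W x \<inter> W y) (u x) = res X (W y) (W x \<inter> W y) (u y)"
      using tm_inj[OF V(1) c] unfolding V_def by simp
  qed (use Wu uS UW in auto)
  have "v \<in> Units (sec X U)"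
    by (rule Units_local[OF U v(1)]) (use Wu v(2) in metis)
  moreover have "g = tm U v \<otimes>\<^bsub>sec MS U\<^esub> f"
  proof (rule MS.eqI_cover[of U])
    fix x assume x: "x \<in> U"
    have "res MS U (W x) (tm U v \<otimes>\<^bsub>sec MS U\<^esub> f) = tm (W x) (u x) \<otimes>\<^bsub>sec MS (W x)\<^esub> res MS U (W x) f"
      using Wu[OF x] U v x fg by (simp add: tm_res)
    then show "\<exists>W. openin (sp MS) W \<and> x \<in> W \<and> W \<subseteq> U \<and>
        res MS U W g = res MS U W (tm U v \<otimes>\<^bsub>sec MS U\<^esub> f)"
      using Wu[OF x] by (intro exI[of _ "W x"]) simp
  qed (use U v fg in auto)
  ultimately show "\<exists>u\<in>Units (sec X U). g = tm U u \<otimes>\<^bsub>sec MS U\<^esub> f" by blast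
qed

lemma LD_Units:
  assumes "Op U" "f \<in> Units (sec MS U)"
  shows "LD U f \<in> Units (sec CS U)"
proof -
  interpret M: monoid "sec MS U" using MS.monoid_sec assms by simp
  have i: "inv\<^bsub>sec MS U\<^esub> f \<in> Units (sec MS U)" using assms by simp
  have "LD U f \<otimes>\<^bsub>sec CS U\<^esub> LD U (inv\<^bsub>sec MS U\<^esub> f) = \<one>\<^bsub>sec CS U\<^esub>"
    "LD U (inv\<^bsub>sec MS U\<^esub> f) \<otimes>\<^bsub>sec CS U\<^esub> LD U f = \<one>\<^bsub>sec CS U\<^esub>"
    using assms i by (simp_all add: LD_one flip: LD_mult)
  then show ?thesis using LD_closed[OF assms(1)] assms(2) i unfolding Units_def by blast
qed

text \<open>Every section is locally the divisor of an invertible meromorphic function, hence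
  locally invertible, and local invertibility suffices in a sheaf of monoids.\<close>

lemma comm_group_CS:
  assumes "Op U" shows "comm_group (sec CS U)"
proof (rule comm_group_if_Units)
  show "comm_monoid (sec CS U)" using CS.comm_monoid_sec assms by simp
  show "carrier (sec CS U) \<subseteq> Units (sec CS U)"
  proof
    fix D assume D: "D \<in> carrier (sec CS U)"
    show "D \<in> Units (sec CS U)"
    proof (rule CS.Units_local)
      fix x assume "x \<in> U"
      then obtain V f where "Op V" "x \<in> V" "V \<subseteq> U" "f \<in> Units (sec MS V)" "res CS U V D = LD V f"
        using CS_locally[OF D] by blast
      then show "\<exists>V. openin (sp CS) V \<and> x \<in> V \<and> V \<subseteq> U \<and> res CS U V D \<in> Units (sec CS V)"
        using LD_Units by auto
    qed (use assms D in auto)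
  qed
qed

end

section \<open>Cech cocycles of units\<close>

context monoid_sheaf
begin

abbreviation T :: "'a set" where "T \<equiv> topspace (sp P)"

abbreviation UO :: "'a set \<Rightarrow> 's set" where "UO U \<equiv> Units (sec P U)"

abbreviation cover :: "('a \<Rightarrow> 'a set) \<Rightarrow> bool" where "cover \<equiv> point_cover (sp P)"

lemma coverD: "cover U \<Longrightarrow> x \<in> T \<Longrightarrow> Op (U x)" "cover U \<Longrightarrow> x \<in> T \<Longrightarrow> x \<in> U x"
  by (simp_all add: point_cover_def)

lemma UO_mult: "Op U \<Longrightarrow> u \<in> UO U \<Longrightarrow> v \<in> UO U \<Longrightarrow> u \<otimes>\<^bsub>sec P U\<^esub> v \<in> UO U"
  using monoid.Units_m_closed[OF monoid_sec] by blast

lemma UO_one: "Op U \<Longrightarrow> \<one>\<^bsub>sec P U\<^esub> \<in> UO U"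
  using monoid.Units_one_closed[OF monoid_sec] by blast

lemma UO_inv: "Op U \<Longrightarrow> u \<in> UO U \<Longrightarrow> inv\<^bsub>sec P U\<^esub> u \<in> UO U"
  using monoid.Units_inv_Units[OF monoid_sec] by blast

lemma UO_inv_mult:
  "Op U \<Longrightarrow> u \<in> UO U \<Longrightarrow> inv\<^bsub>sec P U\<^esub> u \<otimes>\<^bsub>sec P U\<^esub> u = \<one>\<^bsub>sec P U\<^esub>"
  "Op U \<Longrightarrow> u \<in> UO U \<Longrightarrow> u \<otimes>\<^bsub>sec P U\<^esub> inv\<^bsub>sec P U\<^esub> u = \<one>\<^bsub>sec P U\<^esub>"
  using monoid.Units_l_inv[OF monoid_sec] monoid.Units_r_inv[OF monoid_sec] by blast+

lemma UO_cancel: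
  "Op U \<Longrightarrow> u \<in> UO U \<Longrightarrow> a \<in> Sec U \<Longrightarrow> b \<in> Sec U \<Longrightarrow>
    u \<otimes>\<^bsub>sec P U\<^esub> a = u \<otimes>\<^bsub>sec P U\<^esub> b \<longleftrightarrow> a = b"
  using monoid.Units_l_cancel[OF monoid_sec] by blast

abbreviation coc :: "('a, 's) cochain \<Rightarrow> bool" where "coc \<equiv> cocycle (unit_sheaf P)"

abbreviation coh :: "('a, 's) cochain \<Rightarrow> ('a, 's) cochain \<Rightarrow> bool" where
  "coh \<equiv> cohomologous (unit_sheaf P)"

abbreviation cls :: "('a, 's) cochain \<Rightarrow> ('a, 's) cochain set" where
  "cls \<equiv> cech_class (unit_sheaf P)"

lemma cocD:
  assumes "coc (U, g)" "x \<in> T" "y \<in> T"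
  shows "cover U" "g x y \<in> UO (U x \<inter> U y)" "Op (U x)" "x \<in> U x" "g x y \<in> Sec (U x \<inter> U y)"
proof -
  show c: "cover U" and "Op (U x)" "x \<in> U x" and g: "g x y \<in> UO (U x \<inter> U y)"
    using assms unfolding cocycle_def point_cover_def by (auto simp: units_of_carrier)
  then show "g x y \<in> Sec (U x \<inter> U y)" using Units_Sec[of "U x \<inter> U y"] coverD(1)[OF c] assms by simp
qed

text \<open>The definition gives the cocycle identity on the triple intersection only. Restricted to
  an arbitrary smaller open set it can be combined with other identities without matching the
  domains first.\<close>

lemma coc_at:
  assumes "coc (U, g)" "x \<in> T" "y \<in> T" "z \<in> T" "Op V" "V \<subseteq> U x" "V \<subseteq> U y" "V \<subseteq> U z"
  shows "res P (U x \<inter> U y) V (g x y) \<otimes>\<^bsub>sec P V\<^esub> res P (U y \<inter> U z) V (g y z)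
    = res P (U x \<inter> U z) V (g x z)"
proof -
  let ?W = "U x \<inter> U y \<inter> U z"
  have W: "Op ?W" "V \<subseteq> ?W" using cocD[OF assms(1)] assms by auto
  have "res P (U x \<inter> U y) ?W (g x y) \<otimes>\<^bsub>sec P ?W\<^esub> res P (U y \<inter> U z) ?W (g y z)
    = res P (U x \<inter> U z) ?W (g x z)"
    using assms(1-4) unfolding cocycle_def by (simp add: units_of_mult Let_def)
  from arg_cong[OF this, of "res P ?W V"] show ?thesis
    using assms W cocD(3,5)[OF assms(1)] by (simp add: res_simps)
qed

text \<open>The triple intersection enters as a variable \<open>V\<close> with a defining equation,
  so that a proof may treat it as an opaque open set below three members of the cover.\<close>

lemma cocI:
  assumes "cover U" "\<And>x y. x \<in> T \<Longrightarrow> y \<in> T \<Longrightarrow> g x y \<in> UO (U x \<inter> U y)"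
    and "\<And>x y z V. x \<in> T \<Longrightarrow> y \<in> T \<Longrightarrow> z \<in> T \<Longrightarrow> V = U x \<inter> U y \<inter> U z \<Longrightarrow>
      Op V \<Longrightarrow> V \<subseteq> U x \<Longrightarrow> V \<subseteq> U y \<Longrightarrow> V \<subseteq> U z \<Longrightarrow>
      res P (U x \<inter> U y) V (g x y) \<otimes>\<^bsub>sec P V\<^esub> res P (U y \<inter> U z) V (g y z) = res P (U x \<inter> U z) V (g x z)"
  shows "coc (U, g)"
proof -
  have "res P (U x \<inter> U y) (U x \<inter> U y \<inter> U z) (g x y) \<otimes>\<^bsub>sec P (U x \<inter> U y \<inter> U z)\<^esub>
      res P (U y \<inter> U z) (U x \<inter> U y \<inter> U z) (g y z) = res P (U x \<inter> U z) (U x \<inter> U y \<inter> U z) (g x z)"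
    if "x \<in> T" "y \<in> T" "z \<in> T" for x y z
    by (rule assms(3)[OF that refl]) (use that coverD(1)[OF assms(1)] in auto)
  then show ?thesis
    using assms(1,2) unfolding cocycle_def by (simp add: units_of_carrier units_of_mult Let_def)
qed

lemma cohE:
  assumes "coh (U, g) (U', g')" "coc (U, g)" "coc (U', g')"
  obtains W h where "cover W" "\<And>x. x \<in> T \<Longrightarrow> W x \<subseteq> U x" "\<And>x. x \<in> T \<Longrightarrow> W x \<subseteq> U' x"
    "\<And>x. x \<in> T \<Longrightarrow> h x \<in> UO (W x)" "\<And>x. x \<in> T \<Longrightarrow> h x \<in> Sec (W x)"
    "\<And>x y V. x \<in> T \<Longrightarrow> y \<in> T \<Longrightarrow> Op V \<Longrightarrow> V \<subseteq> W x \<Longrightarrow> V \<subseteq> W y \<Longrightarrow>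
      res P (U' x \<inter> U' y) V (g' x y) \<otimes>\<^bsub>sec P V\<^esub> res P (W x) V (h x)
        = res P (U x \<inter> U y) V (g x y) \<otimes>\<^bsub>sec P V\<^esub> res P (W y) V (h y)"
proof -
  obtain W h where W: "cover W" "\<And>x. x \<in> T \<Longrightarrow> W x \<subseteq> U x \<inter> U' x \<and> h x \<in> UO (W x)"
    and eq: "\<And>x y. x \<in> T \<Longrightarrow> y \<in> T \<Longrightarrow>
      res P (U' x \<inter> U' y) (W x \<inter> W y) (g' x y) \<otimes>\<^bsub>sec P (W x \<inter> W y)\<^esub> res P (W x) (W x \<inter> W y) (h x)
        = res P (U x \<inter> U y) (W x \<inter> W y) (g x y) \<otimes>\<^bsub>sec P (W x \<inter> W y)\<^esub> res P (W y) (W x \<inter> W y) (h y)"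
  proof -
    have "\<exists>W h. cover W \<and> (\<forall>x\<in>T. W x \<subseteq> U x \<inter> U' x \<and> h x \<in> UO (W x)) \<and> (\<forall>x\<in>T. \<forall>y\<in>T.
      res P (U' x \<inter> U' y) (W x \<inter> W y) (g' x y) \<otimes>\<^bsub>sec P (W x \<inter> W y)\<^esub> res P (W x) (W x \<inter> W y) (h x)
        = res P (U x \<inter> U y) (W x \<inter> W y) (g x y) \<otimes>\<^bsub>sec P (W x \<inter> W y)\<^esub> res P (W y) (W x \<inter> W y) (h y))"
      using assms(1) unfolding cohomologous_def
      by (simp only: case_prod_conv Let_def unit_sheaf_simps units_of_mult units_of_carrier)
    then show thesis using that by blast
  qed
  have h: "h x \<in> Sec (W x)" if "x \<in> T" for x using W coverD(1)[OF W(1) that] Units_Sec that by blast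
  have "res P (U' x \<inter> U' y) V (g' x y) \<otimes>\<^bsub>sec P V\<^esub> res P (W x) V (h x)
        = res P (U x \<inter> U y) V (g x y) \<otimes>\<^bsub>sec P V\<^esub> res P (W y) V (h y)"
    if xy: "x \<in> T" "y \<in> T" and V: "Op V" "V \<subseteq> W x" "V \<subseteq> W y" for x y V
  proof -
    have "W x \<subseteq> U x" "W x \<subseteq> U' x" "W y \<subseteq> U y" "W y \<subseteq> U' y" using W xy by auto
    then show ?thesis
      using arg_cong[OF eq[OF xy], of "res P (W x \<inter> W y) V"] V xy coverD(1)[OF W(1)]
        cocD(3,5)[OF assms(2)] cocD(3,5)[OF assms(3)] h
      by (simp add: res_simps)
  qed
  then show thesis using that[of W h] W h by blast
qed

lemma cohI:
  assumes "cover W" "\<And>x. x \<in> T \<Longrightarrow> W x \<subseteq> U x" "\<And>x. x \<in> T \<Longrightarrow> W x \<subseteq> U' x"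
    "\<And>x. x \<in> T \<Longrightarrow> h x \<in> UO (W x)"
    "\<And>x y V. x \<in> T \<Longrightarrow> y \<in> T \<Longrightarrow> V = W x \<inter> W y \<Longrightarrow> Op V \<Longrightarrow> V \<subseteq> W x \<Longrightarrow> V \<subseteq> W y \<Longrightarrow>
      res P (U' x \<inter> U' y) V (g' x y) \<otimes>\<^bsub>sec P V\<^esub> res P (W x) V (h x)
        = res P (U x \<inter> U y) V (g x y) \<otimes>\<^bsub>sec P V\<^esub> res P (W y) V (h y)"
  shows "coh (U, g) (U', g')"
proof -
  have "res P (U' x \<inter> U' y) (W x \<inter> W y) (g' x y) \<otimes>\<^bsub>sec P (W x \<inter> W y)\<^esub> res P (W x) (W x \<inter> W y) (h x)
      = res P (U x \<inter> U y) (W x \<inter> W y) (g x y) \<otimes>\<^bsub>sec P (W x \<inter> W y)\<^esub> res P (W y) (W x \<inter> W y) (h y)"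
    if "x \<in> T" "y \<in> T" for x y
    by (rule assms(5)[OF that refl]) (use that coverD(1)[OF assms(1)] in auto)
  then show ?thesis
    unfolding cohomologous_def case_prod_conv Let_def unit_sheaf_simps units_of_mult units_of_carrier
    by (intro exI[of _ W] exI[of _ h]) (use assms(1-4) in auto)
qed

lemma coh_refl:
  assumes "coc (U, g)" shows "coh (U, g) (U, g)"
proof (rule cohI[of U _ _ "\<lambda>x. \<one>\<^bsub>sec P (U x)\<^esub>"])
  have O: "Op (U x)" if "x \<in> T" for x using cocD(3)[OF assms that that] .
  show "cover U" using O cocD(4)[OF assms] by (simp add: point_cover_def)
  show "\<one>\<^bsub>sec P (U x)\<^esub> \<in> UO (U x)" if "x \<in> T" for x using UO_one O that by blast
  show "res P (U x \<inter> U y) V (g x y) \<otimes>\<^bsub>sec P V\<^esub> res P (U x) V \<one>\<^bsub>sec P (U x)\<^esub> =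
      res P (U x \<inter> U y) V (g x y) \<otimes>\<^bsub>sec P V\<^esub> res P (U y) V \<one>\<^bsub>sec P (U y)\<^esub>"
    if "x \<in> T" "y \<in> T" "Op V" "V \<subseteq> U x" "V \<subseteq> U y" for x y V
    using that O by simp
qed auto

text \<open>The inverses of the units \<open>h x\<close> witness the reversed relation.\<close>

lemma coh_sym:
  assumes "coh (U, g) (U', g')" "coc (U, g)" "coc (U', g')"
  shows "coh (U', g') (U, g)"
proof -
  obtain W h where W: "cover W" "\<And>x. x \<in> T \<Longrightarrow> W x \<subseteq> U x" "\<And>x. x \<in> T \<Longrightarrow> W x \<subseteq> U' x"
    and h: "\<And>x. x \<in> T \<Longrightarrow> h x \<in> UO (W x)" "\<And>x. x \<in> T \<Longrightarrow> h x \<in> Sec (W x)"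
    and eq: "\<And>x y V. x \<in> T \<Longrightarrow> y \<in> T \<Longrightarrow> Op V \<Longrightarrow> V \<subseteq> W x \<Longrightarrow> V \<subseteq> W y \<Longrightarrow>
      res P (U' x \<inter> U' y) V (g' x y) \<otimes>\<^bsub>sec P V\<^esub> res P (W x) V (h x)
        = res P (U x \<inter> U y) V (g x y) \<otimes>\<^bsub>sec P V\<^esub> res P (W y) V (h y)"
    using cohE[OF assms] by blast
  show ?thesis
  proof (rule cohI[of W _ _ "\<lambda>x. inv\<^bsub>sec P (W x)\<^esub> (h x)", OF W(1,3,2)])
    show "inv\<^bsub>sec P (W x)\<^esub> h x \<in> UO (W x)" if "x \<in> T" for x
      using UO_inv coverD(1)[OF W(1)] h(1) that by blast
    fix x y V assume xy: "x \<in> T" "y \<in> T" and V: "Op V" "V \<subseteq> W x" "V \<subseteq> W y"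
    have r: "res P (W z) V (inv\<^bsub>sec P (W z)\<^esub> h z) = inv\<^bsub>sec P V\<^esub> (res P (W z) V (h z))"
      "res P (W z) V (h z) \<in> UO V" if "z \<in> T" "V \<subseteq> W z" for z
      using that V h coverD(1)[OF W(1)] res_inv Units_res by auto
    have s: "V \<subseteq> U x \<inter> U y" "V \<subseteq> U' x \<inter> U' y" using V W xy by blast+
    define a b c d where "a = res P (U x \<inter> U y) V (g x y)" and "b = res P (U' x \<inter> U' y) V (g' x y)"
      and "c = res P (W x) V (h x)" and "d = res P (W y) V (h y)"
    have u: "c \<in> UO V" "d \<in> UO V" using r xy V unfolding c_def d_def by auto
    have m: "a \<in> Sec V" "b \<in> Sec V" "c \<in> Sec V" "d \<in> Sec V"
      "inv\<^bsub>sec P V\<^esub> c \<in> Sec V" "inv\<^bsub>sec P V\<^esub> d \<in> Sec V"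
      using cocD(3,5)[OF assms(2)] cocD(3,5)[OF assms(3)] xy s V u UO_inv Units_Sec[OF V(1)]
      unfolding a_def b_def by (simp_all add: res_closed)
    have "b \<otimes>\<^bsub>sec P V\<^esub> c = a \<otimes>\<^bsub>sec P V\<^esub> d" using eq[OF xy V] unfolding a_def b_def c_def d_def .
    \<comment> \<open>Multiplying \<open>b c = a d\<close> by the inverses of \<open>c\<close> and
      \<open>d\<close> yields the relation for the inverses, with the roles of \<open>a\<close> and
      \<open>b\<close> exchanged.\<close>
    then have "inv\<^bsub>sec P V\<^esub> c \<otimes>\<^bsub>sec P V\<^esub> (inv\<^bsub>sec P V\<^esub> d \<otimes>\<^bsub>sec P V\<^esub> (b \<otimes>\<^bsub>sec P V\<^esub> c)) =
        inv\<^bsub>sec P V\<^esub> c \<otimes>\<^bsub>sec P V\<^esub> (inv\<^bsub>sec P V\<^esub> d \<otimes>\<^bsub>sec P V\<^esub> (a \<otimes>\<^bsub>sec P V\<^esub> d))" by simp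
    moreover have "inv\<^bsub>sec P V\<^esub> c \<otimes>\<^bsub>sec P V\<^esub> (inv\<^bsub>sec P V\<^esub> d \<otimes>\<^bsub>sec P V\<^esub> (b \<otimes>\<^bsub>sec P V\<^esub> c)) =
        (inv\<^bsub>sec P V\<^esub> c \<otimes>\<^bsub>sec P V\<^esub> c) \<otimes>\<^bsub>sec P V\<^esub> (b \<otimes>\<^bsub>sec P V\<^esub> inv\<^bsub>sec P V\<^esub> d)"
      using m V(1) by (simp add: ac del: one_mult)
    moreover have "inv\<^bsub>sec P V\<^esub> c \<otimes>\<^bsub>sec P V\<^esub> (inv\<^bsub>sec P V\<^esub> d \<otimes>\<^bsub>sec P V\<^esub> (a \<otimes>\<^bsub>sec P V\<^esub> d)) =
        (inv\<^bsub>sec P V\<^esub> d \<otimes>\<^bsub>sec P V\<^esub> d) \<otimes>\<^bsub>sec P V\<^esub> (a \<otimes>\<^bsub>sec P V\<^esub> inv\<^bsub>sec P V\<^esub> c)"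
      using m V(1) by (simp add: ac del: one_mult)
    ultimately have "b \<otimes>\<^bsub>sec P V\<^esub> inv\<^bsub>sec P V\<^esub> d = a \<otimes>\<^bsub>sec P V\<^esub> inv\<^bsub>sec P V\<^esub> c"
      using m V(1) UO_inv_mult(1)[OF V(1)] u by simp
    then show "res P (U x \<inter> U y) V (g x y) \<otimes>\<^bsub>sec P V\<^esub> res P (W x) V (inv\<^bsub>sec P (W x)\<^esub> h x) =
      res P (U' x \<inter> U' y) V (g' x y) \<otimes>\<^bsub>sec P V\<^esub> res P (W y) V (inv\<^bsub>sec P (W y)\<^esub> h y)"
      using r xy V unfolding a_def b_def c_def d_def by simp
  qed
qed

text \<open>The product of the two witnessing cochains, taken over the intersection of their
  refinements, is a witness.\<close>

lemma coh_trans: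
  assumes "coh (U, g) (U', g')" "coh (U', g') (U'', g'')" "coc (U, g)" "coc (U', g')" "coc (U'', g'')"
  shows "coh (U, g) (U'', g'')"
proof -
  obtain W h where W: "cover W" "\<And>x. x \<in> T \<Longrightarrow> W x \<subseteq> U x" "\<And>x. x \<in> T \<Longrightarrow> W x \<subseteq> U' x"
    and h: "\<And>x. x \<in> T \<Longrightarrow> h x \<in> UO (W x)" "\<And>x. x \<in> T \<Longrightarrow> h x \<in> Sec (W x)"
    and eq: "\<And>x y V. x \<in> T \<Longrightarrow> y \<in> T \<Longrightarrow> Op V \<Longrightarrow> V \<subseteq> W x \<Longrightarrow> V \<subseteq> W y \<Longrightarrow>
      res P (U' x \<inter> U' y) V (g' x y) \<otimes>\<^bsub>sec P V\<^esub> res P (W x) V (h x)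
        = res P (U x \<inter> U y) V (g x y) \<otimes>\<^bsub>sec P V\<^esub> res P (W y) V (h y)"
    using cohE[OF assms(1,3,4)] by blast
  obtain W' h' where W': "cover W'" "\<And>x. x \<in> T \<Longrightarrow> W' x \<subseteq> U' x" "\<And>x. x \<in> T \<Longrightarrow> W' x \<subseteq> U'' x"
    and h': "\<And>x. x \<in> T \<Longrightarrow> h' x \<in> UO (W' x)" "\<And>x. x \<in> T \<Longrightarrow> h' x \<in> Sec (W' x)"
    and eq': "\<And>x y V. x \<in> T \<Longrightarrow> y \<in> T \<Longrightarrow> Op V \<Longrightarrow> V \<subseteq> W' x \<Longrightarrow> V \<subseteq> W' y \<Longrightarrow>
      res P (U'' x \<inter> U'' y) V (g'' x y) \<otimes>\<^bsub>sec P V\<^esub> res P (W' x) V (h' x)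
        = res P (U' x \<inter> U' y) V (g' x y) \<otimes>\<^bsub>sec P V\<^esub> res P (W' y) V (h' y)"
    using cohE[OF assms(2,4,5)] by blast
  define Z where "Z = (\<lambda>x. W x \<inter> W' x)"
  have Z: "Op (Z x)" "Op (W x)" "Op (W' x)" "Z x \<subseteq> W x" "Z x \<subseteq> W' x" if "x \<in> T" for x
    using coverD(1)[OF W(1)] coverD(1)[OF W'(1)] that unfolding Z_def by auto
  show ?thesis
  proof (rule cohI[of Z _ _ "\<lambda>x. res P (W x) (Z x) (h x) \<otimes>\<^bsub>sec P (Z x)\<^esub> res P (W' x) (Z x) (h' x)"])
    show "cover Z" using W(1) W'(1) unfolding point_cover_def Z_def by auto
    show "Z x \<subseteq> U x" "Z x \<subseteq> U'' x" if "x \<in> T" for x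
      using W(2)[OF that] W'(3)[OF that] unfolding Z_def by auto
    show "res P (W x) (Z x) (h x) \<otimes>\<^bsub>sec P (Z x)\<^esub> res P (W' x) (Z x) (h' x) \<in> UO (Z x)" if "x \<in> T" for x
      using Z[OF that] h h' that by (intro UO_mult Units_res[of _ "Z x"]) auto
    fix x y V assume xy: "x \<in> T" "y \<in> T" and V: "Op V" "V \<subseteq> Z x" "V \<subseteq> Z y"
    have VW: "V \<subseteq> W x" "V \<subseteq> W y" "V \<subseteq> W' x" "V \<subseteq> W' y" using V unfolding Z_def by auto
    define a b c where "a = res P (U x \<inter> U y) V (g x y)" and "b = res P (U' x \<inter> U' y) V (g' x y)"
      and "c = res P (U'' x \<inter> U'' y) V (g'' x y)"
    define k l k' l' where "k = res P (W x) V (h x)" and "l = res P (W y) V (h y)"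
      and "k' = res P (W' x) V (h' x)" and "l' = res P (W' y) V (h' y)"
    have e: "b \<otimes>\<^bsub>sec P V\<^esub> k = a \<otimes>\<^bsub>sec P V\<^esub> l" "c \<otimes>\<^bsub>sec P V\<^esub> k' = b \<otimes>\<^bsub>sec P V\<^esub> l'"
      using eq[OF xy V(1) VW(1,2)] eq'[OF xy V(1) VW(3,4)]
      unfolding a_def b_def c_def k_def l_def k'_def l'_def by simp_all
    have s: "V \<subseteq> U x \<inter> U y" "V \<subseteq> U' x \<inter> U' y" "V \<subseteq> U'' x \<inter> U'' y" using VW W W' xy by blast+
    have m: "a \<in> Sec V" "b \<in> Sec V" "c \<in> Sec V" "k \<in> Sec V" "l \<in> Sec V" "k' \<in> Sec V" "l' \<in> Sec V"
      using cocD(3,5)[OF assms(3)] cocD(3,5)[OF assms(4)] cocD(3,5)[OF assms(5)] xy s V h h' Z VW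
      unfolding a_def b_def c_def k_def l_def k'_def l'_def by (simp_all add: res_closed)
    have "c \<otimes>\<^bsub>sec P V\<^esub> (k \<otimes>\<^bsub>sec P V\<^esub> k') = k \<otimes>\<^bsub>sec P V\<^esub> (c \<otimes>\<^bsub>sec P V\<^esub> k')" using m V by (simp add: ac)
    also have "\<dots> = l' \<otimes>\<^bsub>sec P V\<^esub> (b \<otimes>\<^bsub>sec P V\<^esub> k)" unfolding e(2) using m V by (simp add: ac)
    also have "\<dots> = a \<otimes>\<^bsub>sec P V\<^esub> (l \<otimes>\<^bsub>sec P V\<^esub> l')" unfolding e(1) using m V by (simp add: ac)
    finally show "res P (U'' x \<inter> U'' y) V (g'' x y) \<otimes>\<^bsub>sec P V\<^esub>
        res P (Z x) V (res P (W x) (Z x) (h x) \<otimes>\<^bsub>sec P (Z x)\<^esub> res P (W' x) (Z x) (h' x)) =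
      res P (U x \<inter> U y) V (g x y) \<otimes>\<^bsub>sec P V\<^esub>
        res P (Z y) V (res P (W y) (Z y) (h y) \<otimes>\<^bsub>sec P (Z y)\<^esub> res P (W' y) (Z y) (h' y))"
      using xy V Z h h' unfolding a_def c_def k_def l_def k'_def l'_def by (simp add: res_closed res_res)
  qed
qed

text \<open>Reflexivity, symmetry and transitivity of \<open>coh\<close> hold among cocycles, and a
  class contains only cocycles, so classes behave as equivalence classes.\<close>

lemma cls_eq_iff:
  assumes "coc c" "coc d"
  shows "cls c = cls d \<longleftrightarrow> coh c d"
proof -
  obtain U g V h where c: "c = (U, g)" "d = (V, h)" by (metis surj_pair)
  have "d \<in> cls d" using assms coh_refl unfolding cech_class_def c by simp
  then have "coh c d" if "cls c = cls d" using that unfolding cech_class_def by blast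
  moreover have "cls c = cls d" if cd: "coh c d"
  proof -
    have "coh c e \<longleftrightarrow> coh d e" if e: "coc e" for e
    proof -
      obtain W k where e': "e = (W, k)" by (metis surj_pair)
      show ?thesis
        using coh_trans[of U g V h W k] coh_trans[of V h U g W k] coh_sym[of U g V h] cd assms e
        unfolding c e' by blast
    qed
    then show ?thesis unfolding cech_class_def by blast
  qed
  ultimately show ?thesis by blast
qed

section \<open>Refinement and multiplication of cochains\<close>

definition restrict_cochain :: "('a \<Rightarrow> 'a set) \<Rightarrow> ('a, 's) cochain \<Rightarrow> ('a, 's) cochain" where
  "restrict_cochain V c = (V, \<lambda>x y. res P (fst c x \<inter> fst c y) (V x \<inter> V y) (snd c x y))"

lemma coc_restrict:
  assumes "coc (U, g)" "cover V" "\<And>x. x \<in> T \<Longrightarrow> V x \<subseteq> U x"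
  shows "coc (restrict_cochain V (U, g))"
  unfolding restrict_cochain_def fst_conv snd_conv
proof (rule cocI[OF assms(2)])
  have V: "Op (V x)" if "x \<in> T" for x using coverD(1)[OF assms(2) that] .
  show "res P (U x \<inter> U y) (V x \<inter> V y) (g x y) \<in> UO (V x \<inter> V y)" if "x \<in> T" "y \<in> T" for x y
    using cocD(2,3)[OF assms(1)] that assms(3)[of x] assms(3)[of y] V
    by (intro Units_res[of "U x \<inter> U y"]) auto
  fix x y z W assume a: "x \<in> T" "y \<in> T" "z \<in> T" "Op W" "W \<subseteq> V x" "W \<subseteq> V y" "W \<subseteq> V z"
  then have i: "V x \<subseteq> U x" "V y \<subseteq> U y" "V z \<subseteq> U z" "W \<subseteq> U x" "W \<subseteq> U y" "W \<subseteq> U z"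
    using assms(3)[of x] assms(3)[of y] assms(3)[of z] by auto
  show "res P (V x \<inter> V y) W (res P (U x \<inter> U y) (V x \<inter> V y) (g x y)) \<otimes>\<^bsub>sec P W\<^esub>
       res P (V y \<inter> V z) W (res P (U y \<inter> U z) (V y \<inter> V z) (g y z)) =
       res P (V x \<inter> V z) W (res P (U x \<inter> U z) (V x \<inter> V z) (g x z))"
    using coc_at[OF assms(1) a(1-4) i(4-6)] a i cocD(3,5)[OF assms(1)] V
    by (simp add: res_simps)
qed

text \<open>The cochain constantly equal to one is the witness: passing to a finer cover does not
  change the cohomology class.\<close>

lemma coh_restrict:
  assumes "coc (U, g)" "cover V" "\<And>x. x \<in> T \<Longrightarrow> V x \<subseteq> U x"
  shows "coh (U, g) (restrict_cochain V (U, g))"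
  unfolding restrict_cochain_def fst_conv snd_conv
proof (rule cohI[OF assms(2) assms(3) subset_refl, where h = "\<lambda>x. \<one>\<^bsub>sec P (V x)\<^esub>"])
  have V: "Op (V x)" if "x \<in> T" for x using coverD(1)[OF assms(2) that] .
  show "\<one>\<^bsub>sec P (V x)\<^esub> \<in> UO (V x)" if "x \<in> T" for x using UO_one V that by blast
  fix x y W assume a: "x \<in> T" "y \<in> T" "Op W" "W \<subseteq> V x" "W \<subseteq> V y"
  then have i: "V x \<subseteq> U x" "V y \<subseteq> U y" using assms(3)[of x] assms(3)[of y] by auto
  show "res P (V x \<inter> V y) W (res P (U x \<inter> U y) (V x \<inter> V y) (g x y)) \<otimes>\<^bsub>sec P W\<^esub> res P (V x) W \<one>\<^bsub>sec P (V x)\<^esub> =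
       res P (U x \<inter> U y) W (g x y) \<otimes>\<^bsub>sec P W\<^esub> res P (V y) W \<one>\<^bsub>sec P (V y)\<^esub>"
    using a i cocD(3,5)[OF assms(1)] V by (simp add: res_simps)
qed

definition cmul :: "('a, 's) cochain \<Rightarrow> ('a, 's) cochain \<Rightarrow> ('a, 's) cochain" where
  "cmul c d = (\<lambda>x. fst c x \<inter> fst d x, \<lambda>x y.
    res P (fst c x \<inter> fst c y) (fst c x \<inter> fst d x \<inter> (fst c y \<inter> fst d y)) (snd c x y)
      \<otimes>\<^bsub>sec P (fst c x \<inter> fst d x \<inter> (fst c y \<inter> fst d y))\<^esub>
    res P (fst d x \<inter> fst d y) (fst c x \<inter> fst d x \<inter> (fst c y \<inter> fst d y)) (snd d x y))"

lemma coc_cmul: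
  assumes "coc (U, g)" "coc (U', g')"
  shows "coc (cmul (U, g) (U', g'))"
proof -
  define Z where "Z = (\<lambda>x. U x \<inter> U' x)"
  have O: "Op (U x)" "Op (U' x)" "Op (Z x)" "Z x \<subseteq> U x" "Z x \<subseteq> U' x" if "x \<in> T" for x
    using cocD(3)[OF assms(1)] cocD(3)[OF assms(2)] that unfolding Z_def by auto
  note gS = cocD(5)[OF assms(1)] cocD(5)[OF assms(2)]
  have "coc (Z, \<lambda>x y. res P (U x \<inter> U y) (Z x \<inter> Z y) (g x y) \<otimes>\<^bsub>sec P (Z x \<inter> Z y)\<^esub>
      res P (U' x \<inter> U' y) (Z x \<inter> Z y) (g' x y))"
  proof (rule cocI)
    show "cover Z" using O cocD(4)[OF assms(1)] cocD(4)[OF assms(2)] unfolding point_cover_def Z_def by auto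
    show "res P (U x \<inter> U y) (Z x \<inter> Z y) (g x y) \<otimes>\<^bsub>sec P (Z x \<inter> Z y)\<^esub> res P (U' x \<inter> U' y) (Z x \<inter> Z y) (g' x y)
        \<in> UO (Z x \<inter> Z y)" if "x \<in> T" "y \<in> T" for x y
      using that O[of x] O[of y] cocD(2)[OF assms(1)] cocD(2)[OF assms(2)]
      by (intro UO_mult Units_res[of _ "Z x \<inter> Z y"]) auto
    fix x y z W assume a: "x \<in> T" "y \<in> T" "z \<in> T" "Op W" "W \<subseteq> Z x" "W \<subseteq> Z y" "W \<subseteq> Z z"
    then have i: "W \<subseteq> U x" "W \<subseteq> U y" "W \<subseteq> U z" "W \<subseteq> U' x" "W \<subseteq> U' y" "W \<subseteq> U' z"
      unfolding Z_def by auto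
    show "res P (Z x \<inter> Z y) W (res P (U x \<inter> U y) (Z x \<inter> Z y) (g x y) \<otimes>\<^bsub>sec P (Z x \<inter> Z y)\<^esub>
          res P (U' x \<inter> U' y) (Z x \<inter> Z y) (g' x y)) \<otimes>\<^bsub>sec P W\<^esub>
        res P (Z y \<inter> Z z) W (res P (U y \<inter> U z) (Z y \<inter> Z z) (g y z) \<otimes>\<^bsub>sec P (Z y \<inter> Z z)\<^esub>
          res P (U' y \<inter> U' z) (Z y \<inter> Z z) (g' y z)) =
        res P (Z x \<inter> Z z) W (res P (U x \<inter> U z) (Z x \<inter> Z z) (g x z) \<otimes>\<^bsub>sec P (Z x \<inter> Z z)\<^esub>
          res P (U' x \<inter> U' z) (Z x \<inter> Z z) (g' x z))"
      using a i O[of x] O[of y] O[of z] gS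
      by (simp add: res_simps ac coc_at[OF assms(1) a(1-4) i(1-3), symmetric] coc_at[OF assms(2) a(1-4) i(4-6), symmetric])
  qed
  then show ?thesis unfolding cmul_def Z_def by simp
qed

end

section \<open>Trivializations and transition functions of line bundles\<close>

text \<open>The conditions of \<open>oset_sheaf\<close> without gluing. Generators and coefficients
  are already needed for the presheaf tensor product, before its associated sheaf is formed.\<close>

definition oset_presheaf :: "('a, 's) monoidal_space \<Rightarrow> ('a, 's, 't) oset \<Rightarrow> bool" where
  "oset_presheaf X L \<longleftrightarrow> presheaf (sp X) (osec L) (ores L) \<and>
     (\<forall>U. openin (sp X) U \<longrightarrow>
        oact L U \<in> carrier (sec X U) \<rightarrow> osec L U \<rightarrow> osec L U \<and>
        (\<forall>l\<in>osec L U. oact L U \<one>\<^bsub>sec X U\<^esub> l = l \<and>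
           (\<forall>a\<in>carrier (sec X U). \<forall>b\<in>carrier (sec X U).
              oact L U (a \<otimes>\<^bsub>sec X U\<^esub> b) l = oact L U a (oact L U b l)))) \<and>
     (\<forall>U V. openin (sp X) U \<and> openin (sp X) V \<and> V \<subseteq> U \<longrightarrow>
        (\<forall>a\<in>carrier (sec X U). \<forall>l\<in>osec L U.
           ores L U V (oact L U a l) = oact L V (res X U V a) (ores L U V l)))"

lemma oset_sheaf_iff: "oset_sheaf X L \<longleftrightarrow> oset_presheaf X L \<and> sheaf (sp X) (osec L) (ores L)"
proof -
  have "sheaf (sp X) (osec L) (ores L) \<Longrightarrow> presheaf (sp X) (osec L) (ores L)"
    by (simp add: sheaf_def)
  then show ?thesis unfolding oset_sheaf_def oset_presheaf_def by argo
qed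

lemma isomorphic_on_refl: "isomorphic_on X U L L"
  unfolding isomorphic_on_def by (intro exI[of _ "\<lambda>V l. l"]) (simp add: bij_betw_def)

definition oset_iso ::
  "('a, 's) monoidal_space \<Rightarrow> 'a set \<Rightarrow> ('a, 's, 't) oset \<Rightarrow> ('a, 's, 'u) oset \<Rightarrow> ('a set \<Rightarrow> 't \<Rightarrow> 'u) \<Rightarrow> bool"
  where "oset_iso X U L N h \<longleftrightarrow> (\<forall>V. openin (sp X) V \<and> V \<subseteq> U \<longrightarrow>
        bij_betw (h V) (osec L V) (osec N V) \<and>
        (\<forall>a\<in>carrier (sec X V). \<forall>l\<in>osec L V. h V (oact L V a l) = oact N V a (h V l)) \<and>
        (\<forall>W. openin (sp X) W \<and> W \<subseteq> V \<longrightarrow>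
           (\<forall>l\<in>osec L V. h W (ores L V W l) = ores N V W (h V l))))"

lemma isomorphic_on_iff: "isomorphic_on X U L N \<longleftrightarrow> (\<exists>h. oset_iso X U L N h)"
  by (simp add: isomorphic_on_def oset_iso_def)

lemma oset_isoD:
  assumes "oset_iso X U L N h" "openin (sp X) V" "V \<subseteq> U"
  shows "bij_betw (h V) (osec L V) (osec N V)"
    and "a \<in> carrier (sec X V) \<Longrightarrow> l \<in> osec L V \<Longrightarrow> h V (oact L V a l) = oact N V a (h V l)"
    and "openin (sp X) W \<Longrightarrow> W \<subseteq> V \<Longrightarrow> l \<in> osec L V \<Longrightarrow> h W (ores L V W l) = ores N V W (h V l)"
    and "l \<in> osec L V \<Longrightarrow> h V l \<in> osec N V"
proof -
  note H = assms(1)[unfolded oset_iso_def, THEN spec, THEN mp, OF conjI, OF assms(2,3)]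
  show "bij_betw (h V) (osec L V) (osec N V)" using H by (rule conjunct1)
  from bij_betwE[OF this] show "l \<in> osec L V \<Longrightarrow> h V l \<in> osec N V" by (rule bspec)
  show "a \<in> carrier (sec X V) \<Longrightarrow> l \<in> osec L V \<Longrightarrow> h V (oact L V a l) = oact N V a (h V l)"
    using H[THEN conjunct2, THEN conjunct1] by simp
  show "openin (sp X) W \<Longrightarrow> W \<subseteq> V \<Longrightarrow> l \<in> osec L V \<Longrightarrow> h W (ores L V W l) = ores N V W (h V l)"
    using H[THEN conjunct2, THEN conjunct2] by simp
qed

lemma oset_isoI:
  assumes "\<And>V. openin (sp X) V \<Longrightarrow> V \<subseteq> U \<Longrightarrow> bij_betw (h V) (osec L V) (osec N V)"
    "\<And>V a l. openin (sp X) V \<Longrightarrow> V \<subseteq> U \<Longrightarrow> a \<in> carrier (sec X V) \<Longrightarrow> l \<in> osec L V \<Longrightarrow>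
      h V (oact L V a l) = oact N V a (h V l)"
    "\<And>V W l. openin (sp X) V \<Longrightarrow> openin (sp X) W \<Longrightarrow> V \<subseteq> U \<Longrightarrow> W \<subseteq> V \<Longrightarrow> l \<in> osec L V \<Longrightarrow>
      h W (ores L V W l) = ores N V W (h V l)"
  shows "oset_iso X U L N h"
  unfolding oset_iso_def by (intro allI impI conjI ballI; elim conjE; intro assms)

locale oset_pre = monoid_sheaf P for P :: "('a, 's) monoidal_space" +
  fixes L :: "('a, 's, 't) oset"
  assumes oset_presheaf: "oset_presheaf P L"
begin

sublocale L: set_presheaf "sp P" "osec L" "ores L"
  by (rule set_presheaf.intro) (use oset_presheaf in \<open>simp add: oset_presheaf_def\<close>)

lemma act_closed: "Op U \<Longrightarrow> a \<in> Sec U \<Longrightarrow> l \<in> osec L U \<Longrightarrow> oact L U a l \<in> osec L U"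
  using oset_presheaf unfolding oset_presheaf_def by (meson PiE)

lemma act_one: "Op U \<Longrightarrow> l \<in> osec L U \<Longrightarrow> oact L U \<one>\<^bsub>sec P U\<^esub> l = l"
  using oset_presheaf unfolding oset_presheaf_def by simp

lemma act_mult: "Op U \<Longrightarrow> a \<in> Sec U \<Longrightarrow> b \<in> Sec U \<Longrightarrow> l \<in> osec L U \<Longrightarrow>
    oact L U (a \<otimes>\<^bsub>sec P U\<^esub> b) l = oact L U a (oact L U b l)"
  using oset_presheaf unfolding oset_presheaf_def by simp

lemma act_res: "Op U \<Longrightarrow> Op V \<Longrightarrow> V \<subseteq> U \<Longrightarrow> a \<in> Sec U \<Longrightarrow> l \<in> osec L U \<Longrightarrow>
    ores L U V (oact L U a l) = oact L V (res P U V a) (ores L U V l)"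
  using oset_presheaf unfolding oset_presheaf_def by simp

abbreviation tr :: "'a set \<Rightarrow> 't \<Rightarrow> bool" where "tr \<equiv> trivializes P L"

text \<open>The coefficient with respect to a generator: over \<open>V \<subseteq> U\<close> it is
  the unique \<open>a\<close> with \<open>l = a e\<close> when \<open>e\<close> trivializes
  \<open>L\<close> on \<open>U\<close>.\<close>

definition coord :: "'a set \<Rightarrow> 't \<Rightarrow> 'a set \<Rightarrow> 't \<Rightarrow> 's" where
  "coord U e V = inv_into (Sec V) (\<lambda>a. oact L V a (ores L U V e))"

lemma trD: "tr U e \<Longrightarrow> e \<in> osec L U"
  "tr U e \<Longrightarrow> Op V \<Longrightarrow> V \<subseteq> U \<Longrightarrow> bij_betw (\<lambda>a. oact L V a (ores L U V e)) (Sec V) (osec L V)"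
  by (simp_all add: trivializes_def)

lemma tr_cancel:
  assumes "tr U e" "Op V" "V \<subseteq> U" "a \<in> Sec V" "b \<in> Sec V"
    "oact L V a (ores L U V e) = oact L V b (ores L U V e)"
  shows "a = b"
  using bij_betw_imp_inj_on[OF trD(2)[OF assms(1-3)]] assms(4-6) by (simp add: inj_on_def)

lemma coord_closed: "tr U e \<Longrightarrow> Op V \<Longrightarrow> V \<subseteq> U \<Longrightarrow> l \<in> osec L V \<Longrightarrow> coord U e V l \<in> Sec V"
  unfolding coord_def using trD(2)[of U e V] by (metis bij_betw_imp_surj_on inv_into_into)

lemma coord_act: "tr U e \<Longrightarrow> Op V \<Longrightarrow> V \<subseteq> U \<Longrightarrow> l \<in> osec L V \<Longrightarrow>
    oact L V (coord U e V l) (ores L U V e) = l"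
  unfolding coord_def using bij_betw_inv_into_right[OF trD(2)[of U e V]] by simp

lemma coord_unique:
  assumes "tr U e" "Op V" "V \<subseteq> U" "a \<in> Sec V" "l = oact L V a (ores L U V e)"
  shows "coord U e V l = a"
  unfolding coord_def assms(5) using bij_betw_inv_into_left[OF trD(2)[OF assms(1-3)]] assms(4) by simp

lemma tr_res:
  assumes "tr U e" "Op U" "Op V" "V \<subseteq> U"
  shows "tr V (ores L U V e)"
  unfolding trivializes_def
proof (intro conjI allI impI)
  show "ores L U V e \<in> osec L V" using assms trD(1) L.res_closed by blast
  fix W assume W: "Op W \<and> W \<subseteq> V"
  then have "ores L V W (ores L U V e) = ores L U W e"
    using L.res_res assms trD(1) by simp
  then show "bij_betw (\<lambda>a. oact L W a (ores L V W (ores L U V e))) (Sec W) (osec L W)"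
    using trD(2)[OF assms(1), of W] W assms(4) by auto
qed

lemma tr_unit:
  assumes "tr U e" "Op U" "u \<in> UO U"
  shows "tr U (oact L U u e)"
  unfolding trivializes_def
proof (intro conjI allI impI)
  have u: "u \<in> Sec U" using assms Units_Sec by blast
  show "oact L U u e \<in> osec L U" using assms trD(1) act_closed u by blast
  fix V assume V: "Op V \<and> V \<subseteq> U"
  have uV: "res P U V u \<in> UO V" "res P U V u \<in> Sec V" "inv\<^bsub>sec P V\<^esub> (res P U V u) \<in> Sec V"
    using V assms Units_res[of U V u] Units_Sec UO_inv[of V "res P U V u"] by auto
  have eV: "ores L U V e \<in> osec L V" using V assms trD(1) L.res_closed by blast
  have "bij_betw (\<lambda>a. a \<otimes>\<^bsub>sec P V\<^esub> res P U V u) (Sec V) (Sec V)"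
    by (rule bij_betw_byWitness[where f' = "\<lambda>a. a \<otimes>\<^bsub>sec P V\<^esub> inv\<^bsub>sec P V\<^esub> (res P U V u)"])
      (use uV V in \<open>auto simp: ac(1) UO_inv_mult\<close>)
  from bij_betw_trans[OF this trD(2)[OF assms(1), of V]]
  have "bij_betw (\<lambda>a. oact L V (a \<otimes>\<^bsub>sec P V\<^esub> res P U V u) (ores L U V e)) (Sec V) (osec L V)"
    using V by (simp add: comp_def)
  moreover have "oact L V (a \<otimes>\<^bsub>sec P V\<^esub> res P U V u) (ores L U V e) = oact L V a (ores L U V (oact L U u e))"
    if "a \<in> Sec V" for a
    using that V assms trD(1)[OF assms(1)] uV eV u by (simp add: act_mult act_res)
  ultimately show "bij_betw (\<lambda>a. oact L V a (ores L U V (oact L U u e))) (Sec V) (osec L V)"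
    using bij_betw_cong[of "Sec V" "\<lambda>a. oact L V (a \<otimes>\<^bsub>sec P V\<^esub> res P U V u) (ores L U V e)"] by simp
qed

text \<open>Each of two generators is a multiple of the other over \<open>V\<close>. The product of
  the two coefficients fixes a generator, so it is one by uniqueness of coefficients.\<close>

lemma coord_UO:
  assumes "tr U e" "tr U' e'" "Op U" "Op U'" "Op V" "V \<subseteq> U" "V \<subseteq> U'"
  shows "coord U e V (ores L U' V e') \<in> UO V"
proof -
  have e: "ores L U V e \<in> osec L V" "ores L U' V e' \<in> osec L V"
    using assms trD(1) L.res_closed by blast+
  define a b where "a = coord U e V (ores L U' V e')" and "b = coord U' e' V (ores L U V e)"
  have ab: "a \<in> Sec V" "b \<in> Sec V" using coord_closed assms e unfolding a_def b_def by auto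
  have "oact L V a (ores L U V e) = ores L U' V e'" "oact L V b (ores L U' V e') = ores L U V e"
    using coord_act assms e unfolding a_def b_def by auto
  then have "oact L V (b \<otimes>\<^bsub>sec P V\<^esub> a) (ores L U V e) = oact L V \<one>\<^bsub>sec P V\<^esub> (ores L U V e)"
    using ab e assms by (simp add: act_mult act_one)
  then have "b \<otimes>\<^bsub>sec P V\<^esub> a = \<one>\<^bsub>sec P V\<^esub>" using tr_cancel[OF assms(1,5,6)] ab assms by simp
  moreover from this have "a \<otimes>\<^bsub>sec P V\<^esub> b = \<one>\<^bsub>sec P V\<^esub>" using ac(2)[OF assms(5)] ab by simp
  ultimately show ?thesis unfolding Units_def a_def[symmetric] using ab by blast
qed

section \<open>Frames and their transition cocycles\<close>

definition frame :: "('a \<Rightarrow> 'a set) \<Rightarrow> ('a \<Rightarrow> 't) \<Rightarrow> bool" where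
  "frame U e \<longleftrightarrow> cover U \<and> (\<forall>x\<in>T. tr (U x) (e x))"

text \<open>The convention is \<open>e y = g x y e x\<close> with \<open>g\<close> the transition
  function, as in \<open>has_transition_functions\<close>.\<close>

definition transition :: "('a \<Rightarrow> 'a set) \<Rightarrow> ('a \<Rightarrow> 't) \<Rightarrow> 'a \<Rightarrow> 'a \<Rightarrow> 's" where
  "transition U e x y = coord (U x) (e x) (U x \<inter> U y) (ores L (U y) (U x \<inter> U y) (e y))"

lemma frameD:
  assumes "frame U e" "x \<in> T"
  shows "cover U" "Op (U x)" "x \<in> U x" "tr (U x) (e x)" "e x \<in> osec L (U x)"
  using assms coverD trD unfolding frame_def by auto

lemma transition_UO: "frame U e \<Longrightarrow> x \<in> T \<Longrightarrow> y \<in> T \<Longrightarrow> transition U e x y \<in> UO (U x \<inter> U y)"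
  unfolding transition_def by (rule coord_UO) (auto dest: frameD)

lemma transition_Sec: "frame U e \<Longrightarrow> x \<in> T \<Longrightarrow> y \<in> T \<Longrightarrow> transition U e x y \<in> Sec (U x \<inter> U y)"
  using transition_UO Units_Sec frameD(2) by (metis openin_Int)

lemma transition_at:
  assumes "frame U e" "x \<in> T" "y \<in> T" "Op V" "V \<subseteq> U x" "V \<subseteq> U y"
  shows "ores L (U y) V (e y) = oact L V (res P (U x \<inter> U y) V (transition U e x y)) (ores L (U x) V (e x))"
proof -
  note x = frameD[OF assms(1,2)] and y = frameD[OF assms(1,3)]
  let ?I = "U x \<inter> U y"
  have I: "Op ?I" "?I \<subseteq> U x" "?I \<subseteq> U y" "V \<subseteq> ?I" using x y assms by auto
  have ey: "ores L (U y) ?I (e y) \<in> osec L ?I" and ex: "ores L (U x) ?I (e x) \<in> osec L ?I"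
    using L.res_closed[OF y(2) I(1,3) y(5)] L.res_closed[OF x(2) I(1,2) x(5)] .
  have "ores L (U y) V (e y) = ores L ?I V (ores L (U y) ?I (e y))"
    using L.res_res[OF y(2) I(1) assms(4) I(3,4) y(5)] by simp
  also have "\<dots> = ores L ?I V (oact L ?I (transition U e x y) (ores L (U x) ?I (e x)))"
    unfolding transition_def using coord_act[OF x(4) I(1,2) ey] by simp
  also have "\<dots> = oact L V (res P ?I V (transition U e x y)) (ores L (U x) V (e x))"
    using act_res[OF I(1) assms(4) I(4) transition_Sec[OF assms(1-3)] ex]
      L.res_res[OF x(2) I(1) assms(4) I(2,4) x(5)] by simp
  finally show ?thesis .
qed

lemma transition_unique:
  assumes "frame U e" "x \<in> T" "y \<in> T" "a \<in> Sec (U x \<inter> U y)"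
    "ores L (U y) (U x \<inter> U y) (e y) = oact L (U x \<inter> U y) a (ores L (U x) (U x \<inter> U y) (e x))"
  shows "transition U e x y = a"
  unfolding transition_def using frameD[OF assms(1,2)] frameD[OF assms(1,3)] assms
  by (intro coord_unique) auto

text \<open>Both sides are coefficients of \<open>e z\<close> with respect to \<open>e x\<close>:
  one read off directly, the other by way of \<open>e y\<close>. By the convention the second comes
  out as \<open>g y z\<close> times \<open>g x y\<close>, so commutativity enters.\<close>

lemma coc_trans:
  assumes "frame U e"
  shows "coc (U, transition U e)"
proof (rule cocI)
  show "cover U" using assms by (simp add: frame_def)
  show "transition U e x y \<in> UO (U x \<inter> U y)" if "x \<in> T" "y \<in> T" for x y using transition_UO[OF assms that] .
  fix x y z V assume a: "x \<in> T" "y \<in> T" "z \<in> T" "Op V" "V \<subseteq> U x" "V \<subseteq> U y" "V \<subseteq> U z"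
  note x = frameD[OF assms a(1)] and y = frameD[OF assms a(2)] and z = frameD[OF assms a(3)]
  have S: "res P (U x \<inter> U y) V (transition U e x y) \<in> Sec V" "res P (U y \<inter> U z) V (transition U e y z) \<in> Sec V"
    "res P (U x \<inter> U z) V (transition U e x z) \<in> Sec V"
    using transition_Sec[OF assms] a x y z by (auto intro!: res_closed)
  have "oact L V (res P (U x \<inter> U z) V (transition U e x z)) (ores L (U x) V (e x)) =
      oact L V (res P (U y \<inter> U z) V (transition U e y z) \<otimes>\<^bsub>sec P V\<^esub> res P (U x \<inter> U y) V (transition U e x y))
        (ores L (U x) V (e x))"
    using transition_at[OF assms a(1,3,4,5,7)] transition_at[OF assms a(2,3,4,6,7)] transition_at[OF assms a(1,2,4,5,6)]
      act_mult[OF a(4) S(2,1) L.res_closed[OF x(2) a(4,5) x(5)]] by simp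
  then have "res P (U x \<inter> U z) V (transition U e x z) =
      res P (U y \<inter> U z) V (transition U e y z) \<otimes>\<^bsub>sec P V\<^esub> res P (U x \<inter> U y) V (transition U e x y)"
    by (rule tr_cancel[OF x(4) a(4,5) S(3), rotated]) (use S a in simp)
  then show "res P (U x \<inter> U y) V (transition U e x y) \<otimes>\<^bsub>sec P V\<^esub> res P (U y \<inter> U z) V (transition U e y z) =
      res P (U x \<inter> U z) V (transition U e x z)"
    using ac(2)[OF a(4) S(1,2)] by simp
qed

text \<open>Coefficients with respect to a generator are unique, so a relation
  \<open>e y = g x y e x\<close> between generators is the same as an equation for
  \<open>transition\<close>.\<close>

lemma has_trans_iff:
  assumes "cover U" "\<And>x y. x \<in> T \<Longrightarrow> y \<in> T \<Longrightarrow> g x y \<in> Sec (U x \<inter> U y)"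
  shows "has_transition_functions P L (U, g) \<longleftrightarrow>
    (\<exists>e. frame U e \<and> (\<forall>x\<in>T. \<forall>y\<in>T. transition U e x y = g x y))"
proof
  assume "has_transition_functions P L (U, g)"
  then obtain e where e: "\<forall>x\<in>T. tr (U x) (e x)" "\<forall>x\<in>T. \<forall>y\<in>T. ores L (U y) (U x \<inter> U y) (e y) =
      oact L (U x \<inter> U y) (g x y) (ores L (U x) (U x \<inter> U y) (e x))"
    unfolding has_transition_functions_def by (auto simp: Let_def)
  then have f: "frame U e" using assms(1) by (simp add: frame_def)
  then show "\<exists>e. frame U e \<and> (\<forall>x\<in>T. \<forall>y\<in>T. transition U e x y = g x y)"
    using transition_unique[OF f _ _ assms(2)] e(2) by (intro exI[of _ e] conjI ballI) simp_all
next
  assume "\<exists>e. frame U e \<and> (\<forall>x\<in>T. \<forall>y\<in>T. transition U e x y = g x y)"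
  then obtain e where e: "frame U e" "\<forall>x\<in>T. \<forall>y\<in>T. transition U e x y = g x y" by blast
  have "ores L (U y) (U x \<inter> U y) (e y) = oact L (U x \<inter> U y) (g x y) (ores L (U x) (U x \<inter> U y) (e x))"
    if "x \<in> T" "y \<in> T" for x y
    using transition_at[OF e(1) that, of "U x \<inter> U y"] e(2) that assms(2)[OF that]
      frameD(2)[OF e(1)] by (simp add: res_id)
  then show "has_transition_functions P L (U, g)"
    unfolding has_transition_functions_def using frameD(4)[OF e(1)] by (auto simp: Let_def)
qed

lemma has_trans_coc:
  "coc (U, g) \<Longrightarrow> has_transition_functions P L (U, g) \<longleftrightarrow>
    (\<exists>e. frame U e \<and> (\<forall>x\<in>T. \<forall>y\<in>T. transition U e x y = g x y))"
  using cocD(5)[of U g] by (intro has_trans_iff) (auto simp: cocycle_def)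

lemma frame_res:
  assumes "frame U e" "cover V" "\<And>x. x \<in> T \<Longrightarrow> V x \<subseteq> U x"
  shows "frame V (\<lambda>x. ores L (U x) (V x) (e x))"
    "x \<in> T \<Longrightarrow> y \<in> T \<Longrightarrow> transition V (\<lambda>x. ores L (U x) (V x) (e x)) x y =
      res P (U x \<inter> U y) (V x \<inter> V y) (transition U e x y)"
proof -
  show f: "frame V (\<lambda>x. ores L (U x) (V x) (e x))"
    unfolding frame_def using assms(2) tr_res[OF frameD(4,2)[OF assms(1)] coverD(1)[OF assms(2)] assms(3)]
    by blast
  show "transition V (\<lambda>x. ores L (U x) (V x) (e x)) x y = res P (U x \<inter> U y) (V x \<inter> V y) (transition U e x y)"
    if xy: "x \<in> T" "y \<in> T"
  proof (rule transition_unique[OF f xy])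
    note x = frameD[OF assms(1) xy(1)] and y = frameD[OF assms(1) xy(2)]
    note vx = coverD(1)[OF assms(2) xy(1)] assms(3)[OF xy(1)]
      and vy = coverD(1)[OF assms(2) xy(2)] assms(3)[OF xy(2)]
    have I: "Op (V x \<inter> V y)" "V x \<inter> V y \<subseteq> U x" "V x \<inter> V y \<subseteq> U y" "V x \<inter> V y \<subseteq> U x \<inter> U y"
      using vx vy by auto
    show "res P (U x \<inter> U y) (V x \<inter> V y) (transition U e x y) \<in> Sec (V x \<inter> V y)"
      using res_closed[OF _ I(1,4) transition_Sec[OF assms(1) xy]] x y by simp
    show "ores L (V y) (V x \<inter> V y) (ores L (U y) (V y) (e y)) =
      oact L (V x \<inter> V y) (res P (U x \<inter> U y) (V x \<inter> V y) (transition U e x y))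
       (ores L (V x) (V x \<inter> V y) (ores L (U x) (V x) (e x)))"
      using transition_at[OF assms(1) xy I(1-3)] L.res_res[OF x(2) vx(1) I(1) vx(2) _ x(5)]
        L.res_res[OF y(2) vy(1) I(1) vy(2) _ y(5)] by simp
  qed
qed

text \<open>The witness \<open>h x\<close> is the coefficient of \<open>e' x\<close> with respect to
  \<open>e x\<close>. Expressing \<open>e' y\<close> in terms of \<open>e x\<close>, once through
  \<open>e' x\<close> and once through \<open>e y\<close>, gives the coboundary relation.\<close>

lemma frames_coh:
  assumes "frame U e" "frame U' e'"
  shows "coh (U, transition U e) (U', transition U' e')"
proof (rule cohI[of "\<lambda>x. U x \<inter> U' x" _ _
      "\<lambda>x. coord (U x) (e x) (U x \<inter> U' x) (ores L (U' x) (U x \<inter> U' x) (e' x))"])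
  show "cover (\<lambda>x. U x \<inter> U' x)"
    using assms unfolding frame_def point_cover_def by auto
  show "coord (U x) (e x) (U x \<inter> U' x) (ores L (U' x) (U x \<inter> U' x) (e' x)) \<in> UO (U x \<inter> U' x)"
    if "x \<in> T" for x
    using frameD[OF assms(1) that] frameD[OF assms(2) that] by (intro coord_UO) auto
  fix x y V assume xy: "x \<in> T" "y \<in> T" and V: "Op V" "V \<subseteq> U x \<inter> U' x" "V \<subseteq> U y \<inter> U' y"
  define h where "h = (\<lambda>x. coord (U x) (e x) (U x \<inter> U' x) (ores L (U' x) (U x \<inter> U' x) (e' x)))"
  have h: "ores L (U' z) V (e' z) = oact L V (res P (U z \<inter> U' z) V (h z)) (ores L (U z) V (e z))"
    "res P (U z \<inter> U' z) V (h z) \<in> Sec V" if z: "z \<in> T" "V \<subseteq> U z \<inter> U' z" for z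
  proof -
    note f = frameD[OF assms(1) z(1)] and f' = frameD[OF assms(2) z(1)]
    have o: "Op (U z \<inter> U' z)" using f f' by simp
    have c: "ores L (U' z) (U z \<inter> U' z) (e' z) \<in> osec L (U z \<inter> U' z)"
      "ores L (U z) (U z \<inter> U' z) (e z) \<in> osec L (U z \<inter> U' z)"
      using L.res_closed[OF f'(2) o _ f'(5)] L.res_closed[OF f(2) o _ f(5)] by auto
    have hz: "h z \<in> Sec (U z \<inter> U' z)" "oact L (U z \<inter> U' z) (h z) (ores L (U z) (U z \<inter> U' z) (e z)) =
        ores L (U' z) (U z \<inter> U' z) (e' z)"
      unfolding h_def using coord_closed[OF f(4) o _ c(1)] coord_act[OF f(4) o _ c(1)] by auto
    show "res P (U z \<inter> U' z) V (h z) \<in> Sec V" using res_closed[OF o V(1) z(2) hz(1)] .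
    show "ores L (U' z) V (e' z) = oact L V (res P (U z \<inter> U' z) V (h z)) (ores L (U z) V (e z))"
      using arg_cong[OF hz(2), of "ores L (U z \<inter> U' z) V"] act_res[OF o V(1) z(2) hz(1) c(2)]
        L.res_res[OF f(2) o V(1) _ z(2) f(5)] L.res_res[OF f'(2) o V(1) _ z(2) f'(5)] by simp
  qed
  have i: "V \<subseteq> U x" "V \<subseteq> U y" "V \<subseteq> U' x" "V \<subseteq> U' y" using V by auto
  note x = frameD[OF assms(1) xy(1)] and y = frameD[OF assms(1) xy(2)]
    and x' = frameD[OF assms(2) xy(1)] and y' = frameD[OF assms(2) xy(2)]
  have S: "res P (U x \<inter> U y) V (transition U e x y) \<in> Sec V" "res P (U' x \<inter> U' y) V (transition U' e' x y) \<in> Sec V"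
    using transition_Sec[OF assms(1) xy] transition_Sec[OF assms(2) xy] V x y x' y' by (auto intro!: res_closed)
  have E: "ores L (U x) V (e x) \<in> osec L V" using L.res_closed[OF x(2) V(1) i(1) x(5)] .
  have "oact L V (res P (U' x \<inter> U' y) V (transition U' e' x y) \<otimes>\<^bsub>sec P V\<^esub> res P (U x \<inter> U' x) V (h x))
      (ores L (U x) V (e x)) =
    oact L V (res P (U y \<inter> U' y) V (h y) \<otimes>\<^bsub>sec P V\<^esub> res P (U x \<inter> U y) V (transition U e x y))
      (ores L (U x) V (e x))"
    using transition_at[OF assms(1) xy V(1) i(1,2)] transition_at[OF assms(2) xy V(1) i(3,4)]
      h[OF xy(1) V(2)] h[OF xy(2) V(3)]
      act_mult[OF V(1) S(2) h(2)[OF xy(1) V(2)] E] act_mult[OF V(1) h(2)[OF xy(2) V(3)] S(1) E] by simp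
  then have "res P (U' x \<inter> U' y) V (transition U' e' x y) \<otimes>\<^bsub>sec P V\<^esub> res P (U x \<inter> U' x) V (h x) =
    res P (U y \<inter> U' y) V (h y) \<otimes>\<^bsub>sec P V\<^esub> res P (U x \<inter> U y) V (transition U e x y)"
    by (rule tr_cancel[OF x(4) V(1) i(1), rotated 2])
      (use S h(2)[OF xy(1) V(2)] h(2)[OF xy(2) V(3)] V(1) in simp_all)
  then show "res P (U' x \<inter> U' y) V (transition U' e' x y) \<otimes>\<^bsub>sec P V\<^esub>
      res P (U x \<inter> U' x) V (coord (U x) (e x) (U x \<inter> U' x) (ores L (U' x) (U x \<inter> U' x) (e' x))) =
    res P (U x \<inter> U y) V (transition U e x y) \<otimes>\<^bsub>sec P V\<^esub>
      res P (U y \<inter> U' y) V (coord (U y) (e y) (U y \<inter> U' y) (ores L (U' y) (U y \<inter> U' y) (e' y)))"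
    using ac(2)[OF V(1) S(1) h(2)[OF xy(2) V(3)]] unfolding h_def by simp
qed auto

text \<open>Conversely a coboundary is realized by the change of frame
  \<open>e' x = h x e x\<close>. The units \<open>h x\<close> exist only over a refinement
  \<open>W\<close>, so the cocycle \<open>g'\<close> is obtained only after restriction to
  \<open>W\<close>.\<close>

lemma frame_coh:
  assumes "frame U e" "coh (U, transition U e) (U', g')" "coc (U', g')"
  obtains W e' where "frame W e'" "\<And>x. x \<in> T \<Longrightarrow> W x \<subseteq> U' x"
    "\<And>x y. x \<in> T \<Longrightarrow> y \<in> T \<Longrightarrow> transition W e' x y = res P (U' x \<inter> U' y) (W x \<inter> W y) (g' x y)"
proof -
  obtain W h where W: "cover W" "\<And>x. x \<in> T \<Longrightarrow> W x \<subseteq> U x" "\<And>x. x \<in> T \<Longrightarrow> W x \<subseteq> U' x"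
    and h: "\<And>x. x \<in> T \<Longrightarrow> h x \<in> UO (W x)" "\<And>x. x \<in> T \<Longrightarrow> h x \<in> Sec (W x)"
    and eq: "\<And>x y V. x \<in> T \<Longrightarrow> y \<in> T \<Longrightarrow> Op V \<Longrightarrow> V \<subseteq> W x \<Longrightarrow> V \<subseteq> W y \<Longrightarrow>
      res P (U' x \<inter> U' y) V (g' x y) \<otimes>\<^bsub>sec P V\<^esub> res P (W x) V (h x)
        = res P (U x \<inter> U y) V (transition U e x y) \<otimes>\<^bsub>sec P V\<^esub> res P (W y) V (h y)"
    using cohE[OF assms(2) coc_trans[OF assms(1)] assms(3)] by blast
  define e' where "e' = (\<lambda>x. oact L (W x) (h x) (ores L (U x) (W x) (e x)))"
  have WO: "Op (W x)" if "x \<in> T" for x using coverD(1)[OF W(1) that] .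
  have f: "frame W e'"
    unfolding frame_def e'_def using W(1) WO tr_unit[OF tr_res[OF frameD(4,2)[OF assms(1)] WO W(2)] WO h(1)]
    by blast
  have e'V: "ores L (W x) V (e' x) = oact L V (res P (W x) V (h x)) (ores L (U x) V (e x))"
    if x: "x \<in> T" "Op V" "V \<subseteq> W x" for x V
    unfolding e'_def
    using act_res[OF WO[OF x(1)] x(2,3) h(2)[OF x(1)]
        L.res_closed[OF frameD(2)[OF assms(1) x(1)] WO[OF x(1)] W(2)[OF x(1)] frameD(5)[OF assms(1) x(1)]]]
      L.res_res[OF frameD(2)[OF assms(1) x(1)] WO[OF x(1)] x(2) W(2)[OF x(1)] x(3) frameD(5)[OF assms(1) x(1)]]
    by simp
  have "transition W e' x y = res P (U' x \<inter> U' y) (W x \<inter> W y) (g' x y)" if xy: "x \<in> T" "y \<in> T" for x y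
  proof (rule transition_unique[OF f xy])
    let ?V = "W x \<inter> W y"
    have V: "Op ?V" "?V \<subseteq> W x" "?V \<subseteq> W y" using WO xy by auto
    have i: "?V \<subseteq> U x" "?V \<subseteq> U y" "?V \<subseteq> U' x \<inter> U' y" "?V \<subseteq> U x \<inter> U y" using W xy by blast+
    have S: "res P (U' x \<inter> U' y) ?V (g' x y) \<in> Sec ?V" "res P (U x \<inter> U y) ?V (transition U e x y) \<in> Sec ?V"
      "res P (W x) ?V (h x) \<in> Sec ?V" "res P (W y) ?V (h y) \<in> Sec ?V"
      using cocD(3,5)[OF assms(3)] frameD(2)[OF assms(1)] transition_Sec[OF assms(1)] h WO V i xy
      by (auto intro!: res_closed)
    show "res P (U' x \<inter> U' y) ?V (g' x y) \<in> Sec ?V" using S by simp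
    have E: "ores L (U x) ?V (e x) \<in> osec L ?V"
      using L.res_closed[OF frameD(2)[OF assms(1) xy(1)] V(1) i(1) frameD(5)[OF assms(1) xy(1)]] .
    show "ores L (W y) ?V (e' y) = oact L ?V (res P (U' x \<inter> U' y) ?V (g' x y)) (ores L (W x) ?V (e' x))"
      unfolding e'V[OF xy(1) V(1,2)] e'V[OF xy(2) V(1,3)] transition_at[OF assms(1) xy V(1) i(1,2)]
        act_mult[OF V(1) S(1,3) E, symmetric] act_mult[OF V(1) S(4,2) E, symmetric] eq[OF xy V]
        ac(2)[OF V(1) S(4,2)] by (rule refl)
  qed
  then show thesis using that[OF f W(3)] by blast
qed

lemma iso_of_tr:
  assumes "tr U e" "Op U"
  shows "isomorphic_on P U (structure_oset P) L"
  unfolding isomorphic_on_def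
proof (intro exI[of _ "\<lambda>V a. oact L V a (ores L U V e)"] allI impI conjI ballI)
  fix V assume V: "Op V \<and> V \<subseteq> U"
  then have E: "ores L U V e \<in> osec L V" using assms trD(1) L.res_closed by blast
  show "bij_betw (\<lambda>a. oact L V a (ores L U V e)) (osec (structure_oset P) V) (osec L V)"
    using trD(2)[OF assms(1)] V by (simp add: structure_oset_def)
  show "oact L V (oact (structure_oset P) V a l) (ores L U V e) = oact L V a (oact L V l (ores L U V e))"
    if "a \<in> Sec V" "l \<in> osec (structure_oset P) V" for a l
    using that V E by (simp add: structure_oset_def act_mult)
  fix W l assume "Op W \<and> W \<subseteq> V" "l \<in> osec (structure_oset P) V"
  then show "oact L W (ores (structure_oset P) V W l) (ores L U W e) = ores L V W (oact L V l (ores L U V e))"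
    using V E assms trD(1) by (simp add: structure_oset_def act_res L.res_res)
qed

text \<open>The image of the section one under an isomorphism with \<open>O_X\<close> is a
  generator. Together with \<open>iso_of_tr\<close> this identifies local isomorphisms with
  \<open>O_X\<close> and generators.\<close>

lemma tr_of_iso:
  assumes "isomorphic_on P U (structure_oset P) L" "Op U"
  shows "\<exists>e. tr U e"
proof -
  obtain h where h: "oset_iso P U (structure_oset P) L h" using assms(1) isomorphic_on_iff by blast
  note st = structure_oset_def oset.simps
  note h = oset_isoD(1-3)[OF h, unfolded st] oset_isoD(4)[OF h, unfolded st]
  have "tr U (h U \<one>\<^bsub>sec P U\<^esub>)"
    unfolding trivializes_def
  proof (intro conjI allI impI)
    show "h U \<one>\<^bsub>sec P U\<^esub> \<in> osec L U" using h(4)[of U] assms(2) by simp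
    fix V assume V: "Op V \<and> V \<subseteq> U"
    have "h V a = oact L V a (ores L U V (h U \<one>\<^bsub>sec P U\<^esub>))" if "a \<in> Sec V" for a
      using h(2)[of V a "\<one>\<^bsub>sec P V\<^esub>"] h(3)[of U V "\<one>\<^bsub>sec P U\<^esub>"] V assms(2) that by simp
    then show "bij_betw (\<lambda>a. oact L V a (ores L U V (h U \<one>\<^bsub>sec P U\<^esub>))) (Sec V) (osec L V)"
      using h(1)[of V] V bij_betw_cong[of "Sec V" "h V"] by simp
  qed
  then show ?thesis by blast
qed

lemma ex_frame_iff: "(\<exists>U e. frame U e) \<longleftrightarrow>
  (\<forall>x\<in>T. \<exists>U. Op U \<and> x \<in> U \<and> isomorphic_on P U (structure_oset P) L)"
proof
  assume "\<exists>U e. frame U e"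
  then show "\<forall>x\<in>T. \<exists>U. Op U \<and> x \<in> U \<and> isomorphic_on P U (structure_oset P) L"
    using frameD(2,3,4) iso_of_tr by (elim exE) metis
next
  assume "\<forall>x\<in>T. \<exists>U. Op U \<and> x \<in> U \<and> isomorphic_on P U (structure_oset P) L"
  then have "\<forall>x\<in>T. \<exists>U e. Op U \<and> x \<in> U \<and> tr U e" using tr_of_iso by blast
  then obtain U e where "\<forall>x\<in>T. Op (U x) \<and> x \<in> U x \<and> tr (U x) (e x)" by metis
  then show "\<exists>U e. frame U e" unfolding frame_def point_cover_def by blast
qed

end

section \<open>Line bundles and cocycles\<close>

lemma isomorphic_on_trans:
  assumes "isomorphic_on X U L M" "isomorphic_on X U M N"
  shows "isomorphic_on X U L N"
proof -
  obtain h k where "oset_iso X U L M h" "oset_iso X U M N k" using assms isomorphic_on_iff by metis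
  note h = oset_isoD[OF this(1)] and k = oset_isoD[OF this(2)]
  have "oset_iso X U L N (\<lambda>V. k V \<circ> h V)"
  proof (rule oset_isoI)
    show "bij_betw (k V \<circ> h V) (osec L V) (osec N V)" if "openin (sp X) V" "V \<subseteq> U" for V
      using bij_betw_trans[OF h(1)[OF that] k(1)[OF that]] .
    show "(k V \<circ> h V) (oact L V a l) = oact N V a ((k V \<circ> h V) l)"
      if "openin (sp X) V" "V \<subseteq> U" "a \<in> carrier (sec X V)" "l \<in> osec L V" for V a l
      using h(2)[OF that] k(2)[OF that(1-3) h(4)[OF that(1,2,4)]] by simp
    show "(k W \<circ> h W) (ores L V W l) = ores N V W ((k V \<circ> h V) l)"
      if "openin (sp X) V" "openin (sp X) W" "V \<subseteq> U" "W \<subseteq> V" "l \<in> osec L V" for V W l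
      using h(3)[OF that(1,3,2,4,5)] k(3)[OF that(1,3,2,4) h(4)[OF that(1,3,5)]] by simp
  qed
  then show ?thesis using isomorphic_on_iff by blast
qed

context monoid_sheaf
begin

lemma isomorphic_on_sym:
  assumes "isomorphic_on P U L N" "oset_presheaf P L" "oset_presheaf P N"
  shows "isomorphic_on P U N L"
proof -
  interpret L: oset_pre P L by unfold_locales fact
  interpret N: oset_pre P N by unfold_locales fact
  obtain h where "oset_iso P U L N h" using assms(1) isomorphic_on_iff by blast
  note h = oset_isoD[OF this]
  define k where "k = (\<lambda>V. inv_into (osec L V) (h V))"
  have k: "k V n \<in> osec L V" "h V (k V n) = n" if "Op V" "V \<subseteq> U" "n \<in> osec N V" for V n
    unfolding k_def using h(1)[OF that(1,2)] that(3)
    by (auto simp: bij_betw_inv_into_right inv_into_into bij_betw_imp_surj_on)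
  have kh: "k V (h V l) = l" if "Op V" "V \<subseteq> U" "l \<in> osec L V" for V l
    unfolding k_def using h(1)[OF that(1,2)] that(3) by (simp add: bij_betw_inv_into_left)
  have "oset_iso P U N L k"
  proof (rule oset_isoI)
    show "bij_betw (k V) (osec N V) (osec L V)" if "Op V" "V \<subseteq> U" for V
      unfolding k_def using bij_betw_inv_into[OF h(1)[OF that]] .
    show "k V (oact N V a n) = oact L V a (k V n)" if "Op V" "V \<subseteq> U" "a \<in> Sec V" "n \<in> osec N V" for V a n
      using kh[OF that(1,2) L.act_closed[OF that(1,3) k(1)[OF that(1,2,4)]]] h(2)[OF that(1-3) k(1)[OF that(1,2,4)]]
        k(2)[OF that(1,2,4)] by simp
    show "k W (ores N V W n) = ores L V W (k V n)" if "Op V" "Op W" "V \<subseteq> U" "W \<subseteq> V" "n \<in> osec N V" for V W n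
      using kh[OF that(2) subset_trans[OF that(4,3)] L.L.res_closed[OF that(1,2,4) k(1)[OF that(1,3,5)]]]
        h(3)[OF that(1,3,2,4) k(1)[OF that(1,3,5)]] k(2)[OF that(1,3,5)] by simp
  qed
  then show ?thesis using isomorphic_on_iff by blast
qed

text \<open>An isomorphism carries generators to generators and preserves coefficients, hence the
  transition functions as well.\<close>

lemma has_trans_iso:
  assumes iso: "isomorphic_osets P L N" and L: "oset_presheaf P L" and N: "oset_presheaf P N"
    and c: "coc (U, g)" and tr: "has_transition_functions P L (U, g)"
  shows "has_transition_functions P N (U, g)"
proof -
  interpret L: oset_pre P L by unfold_locales fact
  interpret N: oset_pre P N by unfold_locales fact
  obtain h where "oset_iso P T L N h" using iso isomorphic_on_iff by blast
  note h = oset_isoD[OF this]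
  obtain e where e: "L.frame U e" "\<And>x y. x \<in> T \<Longrightarrow> y \<in> T \<Longrightarrow> L.transition U e x y = g x y"
    using tr L.has_trans_coc[OF c] by blast
  have top: "V \<subseteq> T" if "Op V" for V using openin_subset[OF that] .
  have h3: "ores N V W (h V l) = h W (ores L V W l)" if "Op V" "Op W" "W \<subseteq> V" "l \<in> osec L V" for V W l
    using h(3)[OF that(1) top[OF that(1)] that(2,3,4)] by simp
  have tN: "N.tr V (h V d)" if d: "L.tr V d" and V: "Op V" for V d
    unfolding trivializes_def
  proof (intro conjI allI impI)
    have dL: "d \<in> osec L V" using L.trD(1)[OF d] .
    show "h V d \<in> osec N V" using bij_betwE[OF h(1)[OF V top[OF V]]] dL by blast
    fix W assume W: "Op W \<and> W \<subseteq> V"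
    then have dW: "ores L V W d \<in> osec L W" using L.L.res_closed V dL by blast
    have "bij_betw (h W \<circ> (\<lambda>a. oact L W a (ores L V W d))) (Sec W) (osec N W)"
      using bij_betw_trans[OF L.trD(2)[OF d] h(1)] W top by blast
    moreover have "(h W \<circ> (\<lambda>a. oact L W a (ores L V W d))) a = oact N W a (ores N V W (h V d))"
      if "a \<in> Sec W" for a
      using h(2)[of W a "ores L V W d"] W top that dW h3[OF V _ _ dL, of W] by simp
    ultimately show "bij_betw (\<lambda>a. oact N W a (ores N V W (h V d))) (Sec W) (osec N W)"
      by (simp cong: bij_betw_cong)
  qed
  define f where "f = (\<lambda>x. h (U x) (e x))"
  have f: "N.frame U f"
    unfolding N.frame_def f_def using L.frameD[OF e(1)] tN cocycle_def e(1) by (simp add: L.frame_def)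
  have "N.transition U f x y = g x y" if xy: "x \<in> T" "y \<in> T" for x y
  proof (rule N.transition_unique[OF f xy])
    note x = L.frameD[OF e(1) xy(1)] and y = L.frameD[OF e(1) xy(2)]
    show g: "g x y \<in> Sec (U x \<inter> U y)" using cocD(5)[OF c xy] .
    have I: "Op (U x \<inter> U y)" "U x \<inter> U y \<subseteq> U x" "U x \<inter> U y \<subseteq> U y" using x y by auto
    have "ores N (U y) (U x \<inter> U y) (f y) = h (U x \<inter> U y) (ores L (U y) (U x \<inter> U y) (e y))"
      unfolding f_def using h3[OF y(2) I(1,3) y(5)] .
    also have "\<dots> = h (U x \<inter> U y) (oact L (U x \<inter> U y) (g x y) (ores L (U x) (U x \<inter> U y) (e x)))"
      using L.transition_at[OF e(1) xy I] e(2)[OF xy] g I(1) by (simp add: res_id)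
    also have "\<dots> = oact N (U x \<inter> U y) (g x y) (ores N (U x) (U x \<inter> U y) (f x))"
      unfolding f_def h3[OF x(2) I(1,2) x(5)]
      using h(2)[OF I(1) top[OF I(1)] g L.L.res_closed[OF x(2) I(1,2) x(5)]] .
    finally show "ores N (U y) (U x \<inter> U y) (f y) =
      oact N (U x \<inter> U y) (g x y) (ores N (U x) (U x \<inter> U y) (f x))" .
  qed
  then show ?thesis using N.has_trans_coc[OF c] f by blast
qed

text \<open>The line bundle glued from trivial bundles along a cocycle. A section \<open>l\<close> is stored as the family
  of its coordinates \<open>s x\<close> with \<open>l = s x \<cdot> e x\<close>, so \<open>e y = g x y \<cdot> e x\<close> gives \<open>s x = s y \<cdot> g x y\<close>.\<close>

definition model :: "('a \<Rightarrow> 'a set) \<Rightarrow> ('a \<Rightarrow> 'a \<Rightarrow> 's) \<Rightarrow> ('a, 's) pic_bundle" where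
  "model U g =
    \<lparr>osec = (\<lambda>V. {s \<in> extensional T. \<forall>x\<in>T. s x \<in> Sec (V \<inter> U x) \<and> (\<forall>y\<in>T.
        res P (V \<inter> U x) (V \<inter> U x \<inter> U y) (s x) = res P (V \<inter> U y) (V \<inter> U x \<inter> U y) (s y)
          \<otimes>\<^bsub>sec P (V \<inter> U x \<inter> U y)\<^esub> res P (U x \<inter> U y) (V \<inter> U x \<inter> U y) (g x y))}),
     ores = (\<lambda>V W s. \<lambda>x\<in>T. res P (V \<inter> U x) (W \<inter> U x) (s x)),
     oact = (\<lambda>V a s. \<lambda>x\<in>T. res P V (V \<inter> U x) a \<otimes>\<^bsub>sec P (V \<inter> U x)\<^esub> s x)\<rparr>"

lemma model_simps:
  "ores (model U g) V W s = (\<lambda>x\<in>T. res P (V \<inter> U x) (W \<inter> U x) (s x))"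
  "oact (model U g) V a s = (\<lambda>x\<in>T. res P V (V \<inter> U x) a \<otimes>\<^bsub>sec P (V \<inter> U x)\<^esub> s x)"
  by (simp_all add: model_def)

context
  fixes U :: "'a \<Rightarrow> 'a set" and g :: "'a \<Rightarrow> 'a \<Rightarrow> 's"
  assumes c: "coc (U, g)"
begin

lemma OpU: "x \<in> T \<Longrightarrow> Op (U x)"
  using cocD(3)[OF c] by blast

lemma gS: "x \<in> T \<Longrightarrow> y \<in> T \<Longrightarrow> g x y \<in> Sec (U x \<inter> U y)"
  using cocD(5)[OF c] .

lemma model_D: "s \<in> osec (model U g) V \<Longrightarrow> s \<in> extensional T"
  "s \<in> osec (model U g) V \<Longrightarrow> x \<in> T \<Longrightarrow> s x \<in> Sec (V \<inter> U x)"
  by (simp_all add: model_def)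

lemma model_at:
  assumes "s \<in> osec (model U g) V" "Op V" "x \<in> T" "y \<in> T" "Op W" "W \<subseteq> V" "W \<subseteq> U x" "W \<subseteq> U y"
  shows "res P (V \<inter> U x) W (s x) = res P (V \<inter> U y) W (s y) \<otimes>\<^bsub>sec P W\<^esub> res P (U x \<inter> U y) W (g x y)"
proof -
  let ?I = "V \<inter> U x \<inter> U y"
  have "res P (V \<inter> U x) ?I (s x) =
      res P (V \<inter> U y) ?I (s y) \<otimes>\<^bsub>sec P ?I\<^esub> res P (U x \<inter> U y) ?I (g x y)"
    using assms(1,3,4) by (simp add: model_def)
  from arg_cong[OF this, of "res P ?I W"] show ?thesis
    using assms model_D(2)[OF assms(1)] OpU gS by (simp add: res_simps)
qed

lemma model_I:
  assumes "s \<in> extensional T" "Op V" "\<And>x. x \<in> T \<Longrightarrow> s x \<in> Sec (V \<inter> U x)"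
    "\<And>x y W. x \<in> T \<Longrightarrow> y \<in> T \<Longrightarrow> W = V \<inter> U x \<inter> U y \<Longrightarrow> Op W \<Longrightarrow> W \<subseteq> V \<Longrightarrow> W \<subseteq> U x \<Longrightarrow> W \<subseteq> U y \<Longrightarrow>
      res P (V \<inter> U x) W (s x) = res P (V \<inter> U y) W (s y) \<otimes>\<^bsub>sec P W\<^esub> res P (U x \<inter> U y) W (g x y)"
  shows "s \<in> osec (model U g) V"
proof -
  have "res P (V \<inter> U x) (V \<inter> U x \<inter> U y) (s x) = res P (V \<inter> U y) (V \<inter> U x \<inter> U y) (s y)
      \<otimes>\<^bsub>sec P (V \<inter> U x \<inter> U y)\<^esub> res P (U x \<inter> U y) (V \<inter> U x \<inter> U y) (g x y)"
    if "x \<in> T" "y \<in> T" for x y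
    by (rule assms(4)[OF that refl]) (use that OpU assms(2) in auto)
  then show ?thesis using assms(1,3) by (simp add: model_def)
qed

lemma model_res:
  assumes "s \<in> osec (model U g) V" "Op V" "Op W" "W \<subseteq> V"
  shows "ores (model U g) V W s \<in> osec (model U g) W"
proof (rule model_I[OF _ assms(3)])
  have i: "Op (V \<inter> U x)" "Op (W \<inter> U x)" "W \<inter> U x \<subseteq> V \<inter> U x" if "x \<in> T" for x
    using that OpU assms by auto
  show "ores (model U g) V W s \<in> extensional T" by (simp add: model_simps)
  show "ores (model U g) V W s x \<in> Sec (W \<inter> U x)" if "x \<in> T" for x
    using that i[OF that] model_D(2)[OF assms(1) that] by (simp add: model_simps res_closed)
  fix x y Z assume a: "x \<in> T" "y \<in> T" "Op Z" "Z \<subseteq> W" "Z \<subseteq> U x" "Z \<subseteq> U y"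
  then show "res P (W \<inter> U x) Z (ores (model U g) V W s x) =
      res P (W \<inter> U y) Z (ores (model U g) V W s y) \<otimes>\<^bsub>sec P Z\<^esub> res P (U x \<inter> U y) Z (g x y)"
    using model_at[OF assms(1,2) a(1-3) _ a(5,6)] assms(4) i[OF a(1)] i[OF a(2)]
      model_D(2)[OF assms(1) a(1)] model_D(2)[OF assms(1) a(2)]
    by (simp add: model_simps res_res)
qed

lemma model_act:
  assumes "s \<in> osec (model U g) V" "Op V" "a \<in> Sec V"
  shows "oact (model U g) V a s \<in> osec (model U g) V"
proof (rule model_I[OF _ assms(2)])
  have i: "Op (V \<inter> U x)" if "x \<in> T" for x using that OpU assms by auto
  show "oact (model U g) V a s \<in> extensional T" by (simp add: model_simps)
  show "oact (model U g) V a s x \<in> Sec (V \<inter> U x)" if "x \<in> T" for x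
    using that i[OF that] model_D(2)[OF assms(1) that] assms by (simp add: model_simps res_closed)
  fix x y Z assume z: "x \<in> T" "y \<in> T" "Op Z" "Z \<subseteq> V" "Z \<subseteq> U x" "Z \<subseteq> U y"
  have S: "res P (V \<inter> U y) Z (s y) \<in> Sec Z" "res P (U x \<inter> U y) Z (g x y) \<in> Sec Z" "res P V Z a \<in> Sec Z"
    using z i OpU model_D(2)[OF assms(1)] gS assms by (auto intro!: res_closed)
  then show "res P (V \<inter> U x) Z (oact (model U g) V a s x) =
      res P (V \<inter> U y) Z (oact (model U g) V a s y) \<otimes>\<^bsub>sec P Z\<^esub> res P (U x \<inter> U y) Z (g x y)"
    using model_at[OF assms(1,2) z] z i[OF z(1)] i[OF z(2)] assms
      model_D(2)[OF assms(1) z(1)] model_D(2)[OF assms(1) z(2)]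
    by (simp add: model_simps res_res res_closed ac(1))
qed

lemma model_presheaf: "oset_presheaf P (model U g)"
  unfolding oset_presheaf_def presheaf_def
proof (intro conjI allI impI ballI funcsetI; (elim conjE)?)
  fix V assume V: "Op V"
  fix s assume s: "s \<in> osec (model U g) V"
  have i: "Op (V \<inter> U x)" if "x \<in> T" for x using that OpU V by auto
  show "ores (model U g) V V s = s"
    using model_D[OF s] i by (intro extensionalityI[of _ T]) (simp_all add: model_simps res_id)
  show "oact (model U g) V \<one>\<^bsub>sec P V\<^esub> s = s"
    using model_D[OF s] i V by (intro extensionalityI[of _ T]) (simp_all add: model_simps)
  show "oact (model U g) V (a \<otimes>\<^bsub>sec P V\<^esub> b) s = oact (model U g) V a (oact (model U g) V b s)"
    if "a \<in> Sec V" "b \<in> Sec V" for a b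
    using model_D[OF s] i V that
    by (intro extensionalityI[of _ T]) (simp_all add: model_simps res_closed ac(1))
next
  fix V W s assume V: "Op V" "Op W" "W \<subseteq> V" and s: "s \<in> osec (model U g) V"
  show "ores (model U g) V W s \<in> osec (model U g) W" using model_res s V by blast
  fix a assume a: "a \<in> Sec V"
  have i: "Op (V \<inter> U x)" "Op (W \<inter> U x)" "W \<inter> U x \<subseteq> V \<inter> U x" if "x \<in> T" for x
    using that OpU V by auto
  show "ores (model U g) V W (oact (model U g) V a s) = oact (model U g) W (res P V W a) (ores (model U g) V W s)"
    using model_D[OF s] i V a
    by (intro extensionalityI[of _ T]) (simp_all add: model_simps res_closed res_simps)
next
  fix V W Z s assume V: "Op V" "Op W" "Op Z" "Z \<subseteq> W" "W \<subseteq> V" and s: "s \<in> osec (model U g) V"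
  have i: "Op (V \<inter> U x)" "Op (W \<inter> U x)" "Op (Z \<inter> U x)" "W \<inter> U x \<subseteq> V \<inter> U x" "Z \<inter> U x \<subseteq> W \<inter> U x"
    if "x \<in> T" for x using that OpU V by auto
  show "ores (model U g) W Z (ores (model U g) V W s) = ores (model U g) V Z s"
    using model_D[OF s] i V
    by (intro extensionalityI[of _ T]) (simp_all add: model_simps res_res)
next
  fix V a s assume "Op V" "a \<in> Sec V" "s \<in> osec (model U g) V"
  then show "oact (model U g) V a s \<in> osec (model U g) V" by (simp add: model_act)
qed

text \<open>Gluing is done one coordinate at a time, in \<open>O_X\<close> over the sets
  \<open>V \<inter> U x\<close>. It remains to see that the glued coordinates satisfy the transition
  relations, which may be tested on the members of the cover.\<close>

lemma model_sheaf: "oset_sheaf P (model U g)"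
  unfolding oset_sheaf_iff sheaf_def
proof (intro conjI allI impI model_presheaf)
  show "presheaf (sp P) (osec (model U g)) (ores (model U g))"
    using model_presheaf by (simp add: oset_presheaf_def)
  fix \<C> s
  assume a: "(\<forall>V\<in>\<C>. Op V \<and> s V \<in> osec (model U g) V) \<and>
    (\<forall>V\<in>\<C>. \<forall>W\<in>\<C>. ores (model U g) V (V \<inter> W) (s V) = ores (model U g) W (V \<inter> W) (s W))"
  let ?C = "\<Union>\<C>"
  have OC: "Op ?C" using a by blast
  have sS: "s V x \<in> Sec (V \<inter> U x)" "Op V" "Op (V \<inter> U x)" "V \<subseteq> ?C" if "V \<in> \<C>" "x \<in> T" for V x
    using a that model_D(2) OpU by auto
  have UC: "(\<Union>V\<in>\<C>. V \<inter> U x) = ?C \<inter> U x" for x by blast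
  have "\<exists>t. t \<in> Sec (?C \<inter> U x) \<and> (\<forall>V\<in>\<C>. res P (?C \<inter> U x) (V \<inter> U x) t = s V x)" if x: "x \<in> T" for x
  proof -
    have eq: "res P (V \<inter> U x) (V \<inter> U x \<inter> (W \<inter> U x)) (s V x) = res P (W \<inter> U x) (V \<inter> U x \<inter> (W \<inter> U x)) (s W x)"
      if "V \<in> \<C>" "W \<in> \<C>" for V W
    proof -
      have "ores (model U g) V (V \<inter> W) (s V) x = ores (model U g) W (V \<inter> W) (s W) x"
        using a[THEN conjunct2, THEN bspec, OF that(1), THEN bspec, OF that(2)] by (rule fun_cong)
      moreover have "V \<inter> U x \<inter> (W \<inter> U x) = V \<inter> W \<inter> U x" by blast
      ultimately show ?thesis using x by (simp add: model_simps)
    qed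
    show ?thesis using glue[of \<C> "\<lambda>V. V \<inter> U x" "\<lambda>V. s V x"] sS x eq unfolding UC by metis
  qed
  then obtain t0 where t0: "\<And>x. x \<in> T \<Longrightarrow> t0 x \<in> Sec (?C \<inter> U x)"
    "\<And>x V. x \<in> T \<Longrightarrow> V \<in> \<C> \<Longrightarrow> res P (?C \<inter> U x) (V \<inter> U x) (t0 x) = s V x" by metis
  define t where "t = restrict t0 T"
  have t: "t x \<in> Sec (?C \<inter> U x)" "V \<in> \<C> \<Longrightarrow> res P (?C \<inter> U x) (V \<inter> U x) (t x) = s V x" if "x \<in> T" for x V
    using t0 that by (simp_all add: t_def)
  show "\<exists>!t. t \<in> osec (model U g) ?C \<and> (\<forall>V\<in>\<C>. ores (model U g) ?C V t = s V)"
  proof (rule ex1I[of _ t], intro conjI ballI)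
    show "t \<in> osec (model U g) ?C"
    proof (rule model_I[OF _ OC])
      show "t \<in> extensional T" by (simp add: t_def)
      show "t x \<in> Sec (?C \<inter> U x)" if "x \<in> T" for x using t(1)[OF that] .
      fix x y W assume w: "x \<in> T" "y \<in> T" "Op W" "W \<subseteq> ?C" "W \<subseteq> U x" "W \<subseteq> U y"
      have o: "Op (?C \<inter> U x)" "Op (?C \<inter> U y)" "Op (U x \<inter> U y)" using OC OpU w by auto
      have i: "W \<subseteq> ?C \<inter> U x" "W \<subseteq> ?C \<inter> U y" "W \<subseteq> U x \<inter> U y" using w by auto
      show "res P (?C \<inter> U x) W (t x) = res P (?C \<inter> U y) W (t y) \<otimes>\<^bsub>sec P W\<^esub> res P (U x \<inter> U y) W (g x y)"
      \<comment> \<open>On each member \<open>V\<close> of the cover the glued coordinates restrict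
        to those of \<open>s V\<close>, for which the relation is known.\<close>
      proof (rule eqI_family[where I = \<C> and A = "\<lambda>V. V"])
        show "res P (?C \<inter> U x) W (t x) \<in> Sec W"
          "res P (?C \<inter> U y) W (t y) \<otimes>\<^bsub>sec P W\<^esub> res P (U x \<inter> U y) W (g x y) \<in> Sec W"
          using w t(1)[OF w(1)] t(1)[OF w(2)] gS[OF w(1,2)] o i by (simp_all add: res_closed)
        fix V assume V: "V \<in> \<C>"
        then have OV: "Op V" "V \<subseteq> ?C" "s V \<in> osec (model U g) V" using a by auto
        let ?Z = "W \<inter> V"
        have Z: "Op ?Z" "?Z \<subseteq> W" "?Z \<subseteq> V \<inter> U x" "?Z \<subseteq> V \<inter> U y" "?Z \<subseteq> U x \<inter> U y"
          "V \<inter> U x \<subseteq> ?C \<inter> U x" "V \<inter> U y \<subseteq> ?C \<inter> U y" "Op (V \<inter> U x)" "Op (V \<inter> U y)"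
          using w OV OpU by auto
        have "res P W ?Z (res P (?C \<inter> U x) W (t x)) = res P (V \<inter> U x) ?Z (s V x)"
          unfolding t(2)[OF w(1) V, symmetric]
          using res_res[OF o(1) w(3) Z(1) i(1) Z(2) t(1)[OF w(1)]]
            res_res[OF o(1) Z(8,1,6,3) t(1)[OF w(1)]] by simp
        moreover have "res P W ?Z (res P (?C \<inter> U y) W (t y)) = res P (V \<inter> U y) ?Z (s V y)"
          unfolding t(2)[OF w(2) V, symmetric]
          using res_res[OF o(2) w(3) Z(1) i(2) Z(2) t(1)[OF w(2)]]
            res_res[OF o(2) Z(9,1,7,4) t(1)[OF w(2)]] by simp
        moreover have "res P W ?Z (res P (U x \<inter> U y) W (g x y)) = res P (U x \<inter> U y) ?Z (g x y)"
          using res_res[OF o(3) w(3) Z(1) i(3) Z(2) gS[OF w(1,2)]] .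
        moreover have "res P (?C \<inter> U y) W (t y) \<in> Sec W" "res P (U x \<inter> U y) W (g x y) \<in> Sec W"
          using w t(1)[OF w(2)] gS[OF w(1,2)] o i by (simp_all add: res_closed)
        ultimately show "res P W ?Z (res P (?C \<inter> U x) W (t x)) =
            res P W ?Z (res P (?C \<inter> U y) W (t y) \<otimes>\<^bsub>sec P W\<^esub> res P (U x \<inter> U y) W (g x y))"
          using model_at[OF OV(3,1) w(1,2) Z(1)] Z w by simp
      qed (use w a in auto)
    qed
    show "ores (model U g) ?C V t = s V" if "V \<in> \<C>" for V
    proof (rule extensionalityI[of _ T])
      show "s V \<in> extensional T" using a that model_D(1) by blast
    qed (use t(2) that in \<open>simp_all add: model_simps\<close>)
    fix r assume r: "r \<in> osec (model U g) ?C \<and> (\<forall>V\<in>\<C>. ores (model U g) ?C V r = s V)"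
    show "r = t"
    proof (rule extensionalityI[of _ T])
      show "r \<in> extensional T" "t \<in> extensional T" using r model_D(1) by (auto simp: t_def)
      fix x assume x: "x \<in> T"
      have o: "Op (?C \<inter> U x)" using OC OpU x by auto
      show "r x = t x"
      proof (rule eqI_family[OF o _ t(1)[OF x], where I = \<C> and A = "\<lambda>V. V"])
        show "r x \<in> Sec (?C \<inter> U x)" using r model_D(2) x by blast
        fix V assume V: "V \<in> \<C>"
        then have e: "?C \<inter> U x \<inter> V = V \<inter> U x" by blast
        have "ores (model U g) ?C V r x = s V x" using r V by simp
        then show "res P (?C \<inter> U x) (?C \<inter> U x \<inter> V) (r x) = res P (?C \<inter> U x) (?C \<inter> U x \<inter> V) (t x)"
          unfolding e t(2)[OF x V] using x by (simp add: model_simps)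
      qed (use a in auto)
    qed
  qed
qed

lemma oset_pre_model: "oset_pre P (model U g)"
  by unfold_locales (rule model_presheaf)

end

end

context oset_pre
begin

lemma coord_res:
  assumes "tr U e" "Op U" "Op V" "Op W" "V \<subseteq> U" "W \<subseteq> V" "l \<in> osec L V"
  shows "res P V W (coord U e V l) = coord U e W (ores L V W l)"
proof (rule coord_unique[symmetric, OF assms(1,4)])
  have c: "coord U e V l \<in> Sec V" using coord_closed assms by blast
  show "W \<subseteq> U" using assms by blast
  show "res P V W (coord U e V l) \<in> Sec W" using res_closed c assms by blast
  have e: "e \<in> osec L U" using trD(1) assms by blast
  have "ores L V W l = ores L V W (oact L V (coord U e V l) (ores L U V e))"
    using coord_act[OF assms(1,3,5,7)] by simp
  also have "\<dots> = oact L W (res P V W (coord U e V l)) (ores L U W e)"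
    using act_res[OF assms(3,4,6) c L.res_closed[OF assms(2,3,5) e]] L.res_res[OF assms(2-6) e] by simp
  finally show "ores L V W l = oact L W (res P V W (coord U e V l)) (ores L U W e)" .
qed

lemma coord_mult:
  assumes "tr U e" "Op U" "Op V" "V \<subseteq> U" "l \<in> osec L V" "a \<in> Sec V"
  shows "coord U e V (oact L V a l) = a \<otimes>\<^bsub>sec P V\<^esub> coord U e V l"
proof (rule coord_unique[OF assms(1,3,4)])
  have c: "coord U e V l \<in> Sec V" using coord_closed assms by blast
  then show "a \<otimes>\<^bsub>sec P V\<^esub> coord U e V l \<in> Sec V" using assms by simp
  show "oact L V a l = oact L V (a \<otimes>\<^bsub>sec P V\<^esub> coord U e V l) (ores L U V e)"
    using act_mult[OF assms(3,6) c L.res_closed[OF assms(2-4) trD(1)[OF assms(1)]]]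
      coord_act[OF assms(1,3,4,5)] by simp
qed

end

context monoid_sheaf
begin

text \<open>The cocycle identity at \<open>x, x, x\<close> makes \<open>g x x\<close> an idempotent
  unit.\<close>

lemma coc_diag:
  assumes "coc (U, g)" "x \<in> T" "Op V" "V \<subseteq> U x"
  shows "res P (U x \<inter> U x) V (g x x) = \<one>\<^bsub>sec P V\<^esub>"
proof -
  have u: "res P (U x \<inter> U x) V (g x x) \<in> UO V"
    using Units_res[of "U x \<inter> U x" V] cocD[OF assms(1,2,2)] assms by simp
  then have S: "res P (U x \<inter> U x) V (g x x) \<in> Sec V" using Units_Sec assms by blast
  have "res P (U x \<inter> U x) V (g x x) \<otimes>\<^bsub>sec P V\<^esub> res P (U x \<inter> U x) V (g x x) =
      res P (U x \<inter> U x) V (g x x) \<otimes>\<^bsub>sec P V\<^esub> \<one>\<^bsub>sec P V\<^esub>"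
    using coc_at[OF assms(1,2,2,2,3,4,4,4)] S assms(3) by simp
  then show ?thesis using UO_cancel[OF assms(3) u S one_closed[OF assms(3)]] by simp
qed

text \<open>The existence half of the classification: each cocycle occurs as the transition
  functions of a line bundle whose sections have the type used for the Picard group.\<close>

lemma has_trans_model:
  assumes c: "coc (U, g)"
  shows "has_transition_functions P (model U g) (U, g)"
proof -
  interpret M: oset_pre P "model U g" using oset_pre_model[OF c] .
  note OpU = OpU[OF c] and gS = gS[OF c]
  \<comment> \<open>Since \<open>e x = g z x e z\<close> is to hold, the coordinate of the generator
    \<open>e x\<close> at the index \<open>z\<close> must be \<open>g z x\<close>.\<close>
  define e where "e = (\<lambda>x. \<lambda>z\<in>T. g z x)"
  have em: "e x \<in> osec (model U g) (U x)" if x: "x \<in> T" for x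
  proof (rule model_I[OF c _ OpU[OF x]])
    show "e x \<in> extensional T" by (simp add: e_def)
    show "e x z \<in> Sec (U x \<inter> U z)" if "z \<in> T" for z
      using gS[OF that x] that by (simp add: e_def Int_commute)
    fix z y W assume a: "z \<in> T" "y \<in> T" "Op W" "W \<subseteq> U x" "W \<subseteq> U z" "W \<subseteq> U y"
    have S: "res P (U z \<inter> U y) W (g z y) \<in> Sec W" "res P (U y \<inter> U x) W (g y x) \<in> Sec W"
      using gS a x OpU by (auto intro!: res_closed)
    show "res P (U x \<inter> U z) W (e x z) = res P (U x \<inter> U y) W (e x y) \<otimes>\<^bsub>sec P W\<^esub> res P (U z \<inter> U y) W (g z y)"
      using coc_at[OF c a(1,2) x a(3,5,6,4)] ac(2)[OF a(3) S] a by (simp add: e_def Int_commute)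
  qed
  have eV: "oact (model U g) V a (ores (model U g) (U x) V (e x)) =
      (\<lambda>z\<in>T. res P V (V \<inter> U z) a \<otimes>\<^bsub>sec P (V \<inter> U z)\<^esub> res P (U z \<inter> U x) (V \<inter> U z) (g z x))"
    if "x \<in> T" for x V a
    by (rule ext) (simp add: model_simps e_def Int_commute)
  have f: "M.frame U e"
    unfolding M.frame_def
  proof (intro conjI ballI)
    show "cover U" using c by (simp add: cocycle_def)
    fix x assume x: "x \<in> T"
    show "trivializes P (model U g) (U x) (e x)"
      unfolding trivializes_def
    proof (intro conjI allI impI)
      show "e x \<in> osec (model U g) (U x)" using em[OF x] .
      fix V assume V': "Op V \<and> V \<subseteq> U x"
      then have V: "Op V" "V \<subseteq> U x" "V \<inter> U x = V" by auto
      show "bij_betw (\<lambda>a. oact (model U g) V a (ores (model U g) (U x) V (e x))) (Sec V) (osec (model U g) V)"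
      \<comment> \<open>Over \<open>V \<subseteq> U x\<close> a section is determined by its
        coordinate at \<open>x\<close>, which lies in \<open>O_X(V)\<close>. This coordinate inverts
        \<open>a \<mapsto> a e x\<close> because \<open>g x x\<close> restricts to one.\<close>
      proof (rule bij_betw_byWitness[where f' = "\<lambda>s. s x"])
        show "\<forall>a\<in>Sec V. oact (model U g) V a (ores (model U g) (U x) V (e x)) x = a"
          unfolding eV[OF x] using x V coc_diag[OF c x V(1,2)] by (simp add: res_id)
        show "(\<lambda>s. s x) ` osec (model U g) V \<subseteq> Sec V"
          using model_D(2)[OF c _ x, of _ V] V(3) by auto
        show "(\<lambda>a. oact (model U g) V a (ores (model U g) (U x) V (e x))) ` Sec V \<subseteq> osec (model U g) V"
          using M.act_closed[OF V(1) _ M.L.res_closed[OF OpU[OF x] V(1,2) em[OF x]]] by blast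
        show "\<forall>s\<in>osec (model U g) V. oact (model U g) V (s x) (ores (model U g) (U x) V (e x)) = s"
        proof
          fix s assume s: "s \<in> osec (model U g) V"
          show "oact (model U g) V (s x) (ores (model U g) (U x) V (e x)) = s"
            unfolding eV[OF x]
          proof (rule extensionalityI[of _ T])
            show "s \<in> extensional T" using model_D(1)[OF c s] .
            fix z assume z: "z \<in> T"
            have W: "Op (V \<inter> U z)" "V \<inter> U z \<subseteq> V" "V \<inter> U z \<subseteq> U z" "V \<inter> U z \<subseteq> U x" using V OpU z by auto
            show "(\<lambda>z\<in>T. res P V (V \<inter> U z) (s x) \<otimes>\<^bsub>sec P (V \<inter> U z)\<^esub> res P (U z \<inter> U x) (V \<inter> U z) (g z x)) z = s z"
              using model_at[OF c s V(1) z x W] z res_id[OF W(1) model_D(2)[OF c s z]] V(3) by simp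
          qed simp
        qed
      qed
    qed
  qed
  have "M.transition U e x y = g x y" if xy: "x \<in> T" "y \<in> T" for x y
  proof (rule M.transition_unique[OF f xy gS[OF xy]])
    let ?I = "U x \<inter> U y"
    have I: "Op ?I" "?I \<subseteq> U x" "?I \<subseteq> U y" using OpU xy by auto
    have "ores (model U g) (U y) ?I (e y) = (\<lambda>z\<in>T. res P (U z \<inter> U y) (?I \<inter> U z) (g z y))"
      by (rule ext) (simp add: model_simps e_def Int_commute)
    also have "\<dots> = (\<lambda>z\<in>T. res P ?I (?I \<inter> U z) (g x y) \<otimes>\<^bsub>sec P (?I \<inter> U z)\<^esub> res P (U z \<inter> U x) (?I \<inter> U z) (g z x))"
    proof (rule restrict_ext)
      fix z assume z: "z \<in> T"
      let ?W = "?I \<inter> U z"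
      have W: "Op ?W" "?W \<subseteq> U z" "?W \<subseteq> U x" "?W \<subseteq> U y" "?W \<subseteq> ?I" "?W \<subseteq> U z \<inter> U x" using OpU xy z by auto
      have "res P ?I ?W (g x y) \<in> Sec ?W" "res P (U z \<inter> U x) ?W (g z x) \<in> Sec ?W"
        using res_closed[OF I(1) W(1,5) gS[OF xy]] res_closed[OF _ W(1,6) gS[OF z xy(1)]] OpU z xy by auto
      then show "res P (U z \<inter> U y) ?W (g z y) = res P ?I ?W (g x y) \<otimes>\<^bsub>sec P ?W\<^esub> res P (U z \<inter> U x) ?W (g z x)"
        using coc_at[OF c z xy W(1-4)] ac(2)[OF W(1)] by simp
    qed
    finally show "ores (model U g) (U y) ?I (e y) = oact (model U g) ?I (g x y) (ores (model U g) (U x) ?I (e x))"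
      unfolding eV[OF xy(1)] .
  qed
  then show ?thesis using M.has_trans_coc[OF c] f by blast
qed

text \<open>A section is sent to the family of its coefficients with respect to the frame.
  Injectivity and surjectivity are the two halves of the sheaf axiom for \<open>L\<close>: the sets
  \<open>U x\<close> cover, and the local sections with prescribed coefficients are compatible
  exactly by the transition relations.\<close>

lemma iso_model:
  assumes L: "oset_sheaf P L" and c: "coc (U, g)" and t: "has_transition_functions P L (U, g)"
  shows "isomorphic_osets P L (model U g)"
proof -
  interpret L: oset_pre P L by unfold_locales (use L in \<open>simp add: oset_sheaf_iff\<close>)
  interpret LS: set_sheaf "sp P" "osec L" "ores L" by unfold_locales (use L in \<open>simp add: oset_sheaf_iff\<close>)
  obtain e where e: "L.frame U e" "\<And>x y. x \<in> T \<Longrightarrow> y \<in> T \<Longrightarrow> L.transition U e x y = g x y"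
    using t L.has_trans_coc[OF c] by blast
  note OpU = OpU[OF c] and gS = gS[OF c]
  note tr = L.frameD(4)[OF e(1)] and eS = L.frameD(5)[OF e(1)]
  have cov: "V \<subseteq> (\<Union>x\<in>T. U x)" if "Op V" for V
    using openin_subset[OF that] cocD(4)[OF c] by blast
  define h where "h = (\<lambda>V l. \<lambda>x\<in>T. L.coord (U x) (e x) (V \<inter> U x) (ores L V (V \<inter> U x) l))"
  have i: "Op (V \<inter> U x)" "V \<inter> U x \<subseteq> V" "V \<inter> U x \<subseteq> U x" if "Op V" "x \<in> T" for V x using that OpU by auto
  have lr: "ores L V (V \<inter> U x) l \<in> osec L (V \<inter> U x)" if "Op V" "x \<in> T" "l \<in> osec L V" for V x l
    using L.L.res_closed[OF that(1) i(1,2)[OF that(1,2)] that(3)] .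
  have hS: "h V l x \<in> Sec (V \<inter> U x)" if "Op V" "x \<in> T" "l \<in> osec L V" for V x l
    using L.coord_closed[OF tr i(1,3) lr] that by (simp add: h_def)
  have hr: "res P (V \<inter> U x) W (h V l x) = L.coord (U x) (e x) W (ores L V W l)"
    if "Op V" "x \<in> T" "l \<in> osec L V" "Op W" "W \<subseteq> V" "W \<subseteq> U x" for V x l W
    using L.coord_res[OF tr OpU i(1) that(4) i(3) _ lr] that L.L.res_res[OF that(1) i(1) that(4) i(2) _ that(3)]
    by (simp add: h_def)
  have ha: "oact L W (res P (V \<inter> U x) W (h V l x)) (ores L (U x) W (e x)) = ores L V W l"
    if "Op V" "x \<in> T" "l \<in> osec L V" "Op W" "W \<subseteq> V" "W \<subseteq> U x" for V x l W
    unfolding hr[OF that] using L.coord_act[OF tr[OF that(2)] that(4,6)] L.L.res_closed[OF that(1,4,5,3)] by simp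
  have "oset_iso P T L (model U g) h"
  proof (rule oset_isoI)
    fix V assume V: "Op V"
    have hm: "h V l \<in> osec (model U g) V" if l: "l \<in> osec L V" for l
    proof (rule model_I[OF c _ V])
      show "h V l \<in> extensional T" by (simp add: h_def)
      show "h V l x \<in> Sec (V \<inter> U x)" if "x \<in> T" for x using hS[OF V that l] .
      fix x y W assume a: "x \<in> T" "y \<in> T" "Op W" "W \<subseteq> V" "W \<subseteq> U x" "W \<subseteq> U y"
      have S: "res P (V \<inter> U x) W (h V l x) \<in> Sec W" "res P (V \<inter> U y) W (h V l y) \<in> Sec W"
        "res P (U x \<inter> U y) W (g x y) \<in> Sec W"
        using a i[OF V a(1)] i[OF V a(2)] hS[OF V a(1) l] hS[OF V a(2) l] gS[OF a(1,2)] OpU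
        by (auto intro!: res_closed)
      have E: "ores L (U x) W (e x) \<in> osec L W" using L.L.res_closed[OF OpU[OF a(1)] a(3,5) eS[OF a(1)]] .
      show "res P (V \<inter> U x) W (h V l x) = res P (V \<inter> U y) W (h V l y) \<otimes>\<^bsub>sec P W\<^esub> res P (U x \<inter> U y) W (g x y)"
      proof (rule L.tr_cancel[OF tr[OF a(1)] a(3,5) S(1)])
        show "oact L W (res P (V \<inter> U x) W (h V l x)) (ores L (U x) W (e x)) =
          oact L W (res P (V \<inter> U y) W (h V l y) \<otimes>\<^bsub>sec P W\<^esub> res P (U x \<inter> U y) W (g x y)) (ores L (U x) W (e x))"
          using ha[OF V a(1) l a(3-5)] ha[OF V a(2) l a(3,4,6)] L.transition_at[OF e(1) a(1-3,5,6)] e(2)[OF a(1,2)]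
            L.act_mult[OF a(3) S(2,3) E] by simp
      qed (use S a in simp)
    qed
    show "bij_betw (h V) (osec L V) (osec (model U g) V)"
      unfolding bij_betw_def
    proof (intro conjI equalityI subsetI)
      show "inj_on (h V) (osec L V)"
      proof (rule inj_onI)
        fix l m assume lm: "l \<in> osec L V" "m \<in> osec L V" "h V l = h V m"
        show "l = m"
        proof (rule LS.eqI_family[OF V lm(1,2) cov[OF V]])
          fix x assume x: "x \<in> T"
          show "Op (U x)" using OpU x .
          show "ores L V (V \<inter> U x) l = ores L V (V \<inter> U x) m"
            using ha[OF V x lm(1) i[OF V x]] ha[OF V x lm(2) i[OF V x]] lm(3) by simp
        qed
      qed
      show "s \<in> osec (model U g) V" if "s \<in> h V ` osec L V" for s using that hm by blast
      fix s assume s: "s \<in> osec (model U g) V"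
      \<comment> \<open>The local sections with the prescribed coordinates; the relations satisfied
        by \<open>s\<close> make them agree on overlaps, so they glue to a preimage of
        \<open>s\<close>.\<close>
      define f where "f = (\<lambda>x. oact L (V \<inter> U x) (s x) (ores L (U x) (V \<inter> U x) (e x)))"
      have sS: "s x \<in> Sec (V \<inter> U x)" "ores L (U x) (V \<inter> U x) (e x) \<in> osec L (V \<inter> U x)" if "x \<in> T" for x
        using model_D(2)[OF c s that] L.L.res_closed[OF OpU i(1,3) eS] V that by auto
      have fr: "ores L (V \<inter> U x) W (f x) = oact L W (res P (V \<inter> U x) W (s x)) (ores L (U x) W (e x))"
        if "x \<in> T" "Op W" "W \<subseteq> V \<inter> U x" for x W
        unfolding f_def using L.act_res[OF i(1)[OF V that(1)] that(2,3) sS[OF that(1)]]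
          L.L.res_res[OF OpU[OF that(1)] i(1)[OF V that(1)] that(2) i(3)[OF V that(1)] that(3) eS[OF that(1)]] by simp
      have UV: "(\<Union>x\<in>T. V \<inter> U x) = V" using cov[OF V] by blast
      obtain l where l: "l \<in> osec L V" "\<And>x. x \<in> T \<Longrightarrow> ores L V (V \<inter> U x) l = f x"
      proof (rule LS.glue[of T "\<lambda>x. V \<inter> U x" f])
        show "Op (V \<inter> U x)" "f x \<in> osec L (V \<inter> U x)" if "x \<in> T" for x
          using i[OF V that] L.act_closed[OF i(1)[OF V that] sS[OF that]] unfolding f_def by auto
        fix x y assume xy: "x \<in> T" "y \<in> T"
        let ?W = "V \<inter> U x \<inter> (V \<inter> U y)"
        have W: "Op ?W" "?W \<subseteq> V" "?W \<subseteq> U x" "?W \<subseteq> U y" "?W \<subseteq> V \<inter> U x" "?W \<subseteq> V \<inter> U y" "?W \<subseteq> U x \<inter> U y"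
          using i[OF V xy(1)] i[OF V xy(2)] by auto
        have S: "res P (V \<inter> U y) ?W (s y) \<in> Sec ?W" "res P (U x \<inter> U y) ?W (g x y) \<in> Sec ?W"
          using res_closed[OF i(1)[OF V xy(2)] W(1,6) sS(1)[OF xy(2)]] res_closed[OF _ W(1,7) gS[OF xy]] OpU xy
          by auto
        show "ores L (V \<inter> U x) ?W (f x) = ores L (V \<inter> U y) ?W (f y)"
          unfolding fr[OF xy(1) W(1,5)] fr[OF xy(2) W(1,6)] model_at[OF c s V xy W(1-4)]
            L.transition_at[OF e(1) xy W(1,3,4)] e(2)[OF xy]
          using L.act_mult[OF W(1) S L.L.res_closed[OF OpU[OF xy(1)] W(1,3) eS[OF xy(1)]]] .
      qed (use that UV in auto)
      have "h V l = s"
      proof (rule extensionalityI[of _ T])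
        show "h V l \<in> extensional T" by (simp add: h_def)
        show "s \<in> extensional T" using model_D(1)[OF c s] .
        fix x assume x: "x \<in> T"
        show "h V l x = s x"
          using L.coord_unique[OF tr[OF x] i(1,3)[OF V x] sS(1)[OF x]] l(2)[OF x] x
          by (simp add: h_def f_def)
      qed
      then show "s \<in> h V ` osec L V" using l(1) by blast
    qed
    show "h V (oact L V a l) = oact (model U g) V a (h V l)" if a: "a \<in> Sec V" "l \<in> osec L V" for a l
    proof (rule extensionalityI[of _ T])
      show "h V (oact L V a l) \<in> extensional T" "oact (model U g) V a (h V l) \<in> extensional T"
        by (simp_all add: h_def model_simps)
      fix x assume x: "x \<in> T"
      note ix = i[OF V x]
      show "h V (oact L V a l) x = oact (model U g) V a (h V l) x"
        using L.act_res[OF V ix(1,2) a] L.coord_mult[OF tr[OF x] OpU[OF x] ix(1,3) lr[OF V x a(2)] res_closed[OF V ix(1,2) a(1)]] x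
        by (simp add: h_def model_simps)
    qed
    show "h W (ores L V W l) = ores (model U g) V W (h V l)" if W: "Op W" "W \<subseteq> V" "l \<in> osec L V" for W l
    proof (rule extensionalityI[of _ T])
      show "h W (ores L V W l) \<in> extensional T" "ores (model U g) V W (h V l) \<in> extensional T"
        by (simp_all add: h_def model_simps)
      fix x assume x: "x \<in> T"
      note ix = i[OF W(1) x]
      have "W \<inter> U x \<subseteq> V" using W by blast
      then show "h W (ores L V W l) x = ores (model U g) V W (h V l) x"
        using hr[OF V x W(3) ix(1) _ ix(3)] L.L.res_res[OF V W(1) ix(1) W(2) ix(2) W(3)] x
        by (simp add: h_def model_simps)
    qed
  qed
  then show ?thesis using isomorphic_on_iff by blast
qed

section \<open>Classification of line bundles by cohomology classes\<close>

lemma line_bundle_iff: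
  "line_bundle P L \<longleftrightarrow> oset_sheaf P L \<and> (\<exists>U g. coc (U, g) \<and> has_transition_functions P L (U, g))"
proof (cases "oset_sheaf P L")
  case True
  interpret L: oset_pre P L by unfold_locales (use True in \<open>simp add: oset_sheaf_iff\<close>)
  have "(\<exists>U g. coc (U, g) \<and> has_transition_functions P L (U, g)) \<longleftrightarrow> (\<exists>U e. L.frame U e)"
    using L.has_trans_coc L.coc_trans by metis
  then show ?thesis unfolding line_bundle_def L.ex_frame_iff by blast
qed (simp add: line_bundle_def)

lemma has_trans_coh:
  assumes "oset_presheaf P L" "coc (U, g)" "coc (V, k)"
    "has_transition_functions P L (U, g)" "has_transition_functions P L (V, k)"
  shows "coh (U, g) (V, k)"
proof -
  interpret L: oset_pre P L by unfold_locales fact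
  obtain e where e: "L.frame U e" "\<And>x y. x \<in> T \<Longrightarrow> y \<in> T \<Longrightarrow> L.transition U e x y = g x y"
    using assms(4) L.has_trans_coc[OF assms(2)] by blast
  obtain f where f: "L.frame V f" "\<And>x y. x \<in> T \<Longrightarrow> y \<in> T \<Longrightarrow> L.transition V f x y = k x y"
    using assms(5) L.has_trans_coc[OF assms(3)] by blast
  have "coh (U, L.transition U e) (V, L.transition V f)" using L.frames_coh[OF e(1) f(1)] .
  then show ?thesis unfolding cohomologous_def by (simp add: e(2) f(2) cong: conj_cong ball_cong)
qed

text \<open>A bundle need not have generators over the whole sets \<open>V x\<close>, since the
  units relating the two cocycles are given on a refinement only. Hence the conclusion is about a
  restriction of \<open>k\<close>.\<close>

lemma has_trans_of_coh:
  assumes "oset_presheaf P L" "coc (U, g)" "coc (V, k)"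
    "has_transition_functions P L (U, g)" "coh (U, g) (V, k)"
  obtains W where "cover W" "\<And>x. x \<in> T \<Longrightarrow> W x \<subseteq> V x" "has_transition_functions P L (restrict_cochain W (V, k))"
proof -
  interpret L: oset_pre P L by unfold_locales fact
  obtain e where e: "L.frame U e" "\<And>x y. x \<in> T \<Longrightarrow> y \<in> T \<Longrightarrow> L.transition U e x y = g x y"
    using assms(4) L.has_trans_coc[OF assms(2)] by blast
  have "coh (U, L.transition U e) (V, k)"
    using assms(5) unfolding cohomologous_def by (simp add: e(2) cong: conj_cong ball_cong)
  then obtain W f where W: "L.frame W f" "\<And>x. x \<in> T \<Longrightarrow> W x \<subseteq> V x"
    "\<And>x y. x \<in> T \<Longrightarrow> y \<in> T \<Longrightarrow> L.transition W f x y = res P (V x \<inter> V y) (W x \<inter> W y) (k x y)"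
    using L.frame_coh[OF e(1) _ assms(3)] by metis
  have "cover W" using W(1) L.frame_def by blast
  moreover have "has_transition_functions P L (restrict_cochain W (V, k))"
    using L.has_trans_coc[of W "\<lambda>x y. res P (V x \<inter> V y) (W x \<inter> W y) (k x y)"]
      coc_restrict[OF assms(3) \<open>cover W\<close> W(2)] W(1,3)
    unfolding restrict_cochain_def fst_conv snd_conv by blast
  ultimately show thesis using that W(2) by blast
qed

lemma has_trans_rest:
  assumes "oset_presheaf P L" "coc (U, g)" "cover W" "\<And>x. x \<in> T \<Longrightarrow> W x \<subseteq> U x"
    "has_transition_functions P L (U, g)"
  shows "has_transition_functions P L (restrict_cochain W (U, g))"
proof -
  interpret L: oset_pre P L by unfold_locales fact
  obtain e where e: "L.frame U e" "\<And>x y. x \<in> T \<Longrightarrow> y \<in> T \<Longrightarrow> L.transition U e x y = g x y"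
    using assms(5) L.has_trans_coc[OF assms(2)] by blast
  have "coc (W, \<lambda>x y. res P (U x \<inter> U y) (W x \<inter> W y) (g x y))"
    using coc_restrict[OF assms(2,3,4)] unfolding restrict_cochain_def by simp
  then show ?thesis
    using L.has_trans_coc L.frame_res[OF e(1) assms(3,4)] e(2)
    unfolding restrict_cochain_def fst_conv snd_conv by simp blast
qed

text \<open>Both bundles have transition functions equal to one common restriction of
  \<open>k\<close>, so both are isomorphic to the model of that restriction.\<close>

lemma iso_of_coh:
  assumes L: "oset_sheaf P L" and N: "oset_sheaf P N" and c: "coc (U, g)" "coc (V, k)"
    and t: "has_transition_functions P L (U, g)" "has_transition_functions P N (V, k)" and "coh (U, g) (V, k)"
  shows "isomorphic_osets P L N"
proof -
  have pre: "oset_presheaf P L" "oset_presheaf P N" using L N by (simp_all add: oset_sheaf_iff)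
  obtain W where W: "cover W" "\<And>x. x \<in> T \<Longrightarrow> W x \<subseteq> V x" "has_transition_functions P L (restrict_cochain W (V, k))"
    using has_trans_of_coh[OF pre(1) c t(1) assms(7)] by blast
  define m where "m = snd (restrict_cochain W (V, k))"
  have r: "restrict_cochain W (V, k) = (W, m)" by (simp add: restrict_cochain_def m_def)
  have cW: "coc (W, m)" using coc_restrict[OF c(2) W(1,2)] unfolding r .
  have "isomorphic_osets P L (model W m)" using iso_model[OF L cW] W(3) unfolding r by blast
  moreover have "isomorphic_osets P N (model W m)"
    using iso_model[OF N cW] has_trans_rest[OF pre(2) c(2) W(1,2) t(2)] unfolding r by blast
  ultimately show ?thesis
    by (rule isomorphic_on_trans[OF _ isomorphic_on_sym[OF _ pre(2) model_presheaf[OF cW]]])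
qed

text \<open>The bridge between the two descriptions of the Picard group. \<open>L\<close> may have
  sections of any type, so the statement applies to the structure sheaf and to tensor products,
  whose sections are not of the type fixed for Picard bundles.\<close>

lemma bundles_of_class_eq:
  assumes L: "oset_sheaf P L" and c: "coc c" and t: "has_transition_functions P L c"
  shows "bundles_of_class P (cls c) = iso_class P L"
proof -
  obtain U g where c': "c = (U, g)" by (metis surj_pair)
  note c = c[unfolded c'] and t = t[unfolded c']
  have pre: "oset_presheaf P L" using L by (simp add: oset_sheaf_iff)
  show ?thesis
    unfolding bundles_of_class_def iso_class_def c'
  proof (intro Collect_cong conj_cong refl iffI)
    fix N :: "('a, 's) pic_bundle" assume N: "line_bundle P N"
    then have sN: "oset_sheaf P N" by (simp add: line_bundle_def)
    show "isomorphic_osets P N L" if ex: "\<exists>(V, k)\<in>cls (U, g). has_transition_functions P N (V, k)"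
    proof -
      obtain d where d: "d \<in> cls (U, g)" "case d of (V, k) \<Rightarrow> has_transition_functions P N (V, k)"
        using ex by (rule bexE)
      moreover obtain V k where "d = (V, k)" by (metis surj_pair)
      ultimately have k: "coc (V, k)" "coh (U, g) (V, k)" "has_transition_functions P N (V, k)"
        unfolding cech_class_def by simp_all
      show ?thesis using iso_of_coh[OF sN L k(1) c k(3) t coh_sym[OF k(2) c k(1)]] .
    qed
    show "\<exists>(V, k)\<in>cls (U, g). has_transition_functions P N (V, k)" if iso: "isomorphic_osets P N L"
    proof -
      have preN: "oset_presheaf P N" using sN by (simp add: oset_sheaf_iff)
      have "has_transition_functions P N (U, g)"
        using has_trans_iso[OF isomorphic_on_sym[OF iso preN pre] pre preN c t] .
      then show ?thesis using c coh_refl[OF c] unfolding cech_class_def by blast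
    qed
  qed
qed

end

section \<open>Tensor products\<close>

context oset_pre
begin

abbreviation AL :: "('a, 's, 'a \<Rightarrow> ('a set \<times> 't) set) oset" where
  "AL \<equiv> associated_oset P L"

lemma AL_simps [simp]: "osec AL = L.as" "ores AL U V \<sigma> = restrict \<sigma> V"
  by (simp_all add: associated_oset_def)

text \<open>The action on the associated sheaf is a union over representatives of a germ. Two
  representatives agree on some \<open>Z\<close>, and so do their multiples, so any representative
  over a set \<open>W \<subseteq> U\<close> computes the result.\<close>

lemma AL_act_germ:
  assumes "Op U" "a \<in> Sec U" "Op W" "x \<in> W" "W \<subseteq> U" "t \<in> osec L W" "\<sigma> x = L.gm x W t"
  shows "oact AL U a \<sigma> x = L.gm x W (oact L W (res P U W a) t)"
proof -
  have "(\<Union>(V, t)\<in>L.gm x W t. L.gm x (U \<inter> V) (oact L (U \<inter> V) (res P U (U \<inter> V) a) (ores L V (U \<inter> V) t)))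
      = L.gm x W (oact L W (res P U W a) t)"
  proof (rule L.UN_germ[OF assms(3,4,6)])
    fix V r assume V: "Op V" "x \<in> V" "r \<in> osec L V" "L.gm x V r = L.gm x W t"
    obtain Z where Z: "Op Z" "x \<in> Z" "Z \<subseteq> V \<inter> W" "ores L V Z r = ores L W Z t"
      using L.germ_eq_iff[OF V(1-3) assms(3,4,6)] V(4) by blast
    have i: "Op (U \<inter> V)" "x \<in> U \<inter> V" "U \<inter> V \<subseteq> U" "U \<inter> V \<subseteq> V" "Z \<subseteq> U \<inter> V" "Z \<subseteq> W" "Z \<subseteq> V \<inter> U"
      using assms V Z by auto
    have r: "ores L V (U \<inter> V) r \<in> osec L (U \<inter> V)" using L.res_closed[OF V(1) i(1,4) V(3)] .
    have aS: "res P U (U \<inter> V) a \<in> Sec (U \<inter> V)" "res P U W a \<in> Sec W"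
      using res_closed[OF assms(1) i(1,3) assms(2)] res_closed[OF assms(1,3,5,2)] .
    show "L.gm x (U \<inter> V) (oact L (U \<inter> V) (res P U (U \<inter> V) a) (ores L V (U \<inter> V) r)) =
        L.gm x W (oact L W (res P U W a) t)"
      unfolding L.germ_eq_iff[OF i(1,2) act_closed[OF i(1) aS(1) r] assms(3,4) act_closed[OF assms(3) aS(2) assms(6)]]
    proof (intro exI[of _ Z] conjI)
      show "ores L (U \<inter> V) Z (oact L (U \<inter> V) (res P U (U \<inter> V) a) (ores L V (U \<inter> V) r)) =
          ores L W Z (oact L W (res P U W a) t)"
        using act_res[OF i(1) Z(1) i(5) aS(1) r] act_res[OF assms(3) Z(1) i(6) aS(2) assms(6)]
          res_res[OF assms(1) i(1) Z(1) i(3,5) assms(2)] res_res[OF assms(1,3) Z(1) assms(5) i(6) assms(2)]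
          L.res_res[OF V(1) i(1) Z(1) i(4,5) V(3)] Z(4) by simp
    qed (use Z i in auto)
  qed
  moreover have "x \<in> U" using assms(4,5) by blast
  ultimately show ?thesis unfolding associated_oset_def oset.simps by (simp only: restrict_apply' assms(7))
qed

lemma AL_act_ext: "oact AL U a \<sigma> \<in> extensional U"
  by (simp add: associated_oset_def)

lemma AL_act_closed:
  assumes "Op U" "a \<in> Sec U" "\<sigma> \<in> L.as U"
  shows "oact AL U a \<sigma> \<in> L.as U"
proof (rule L.as_I[OF AL_act_ext])
  fix x assume "x \<in> U"
  then obtain W t where W: "Op W" "x \<in> W" "W \<subseteq> U" "t \<in> osec L W" "\<forall>y\<in>W. \<sigma> y = L.gm y W t"
    using L.as_germ[OF assms(3)] by blast
  have "\<forall>y\<in>W. oact AL U a \<sigma> y = L.gm y W (oact L W (res P U W a) t)"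
    using AL_act_germ[where \<sigma> = \<sigma>, OF assms(1,2) W(1) _ W(3,4)] W(5) by simp
  moreover have "oact L W (res P U W a) t \<in> osec L W"
    using act_closed[OF W(1) res_closed[OF assms(1) W(1,3) assms(2)] W(4)] .
  ultimately show "\<exists>V s. Op V \<and> x \<in> V \<and> V \<subseteq> U \<and> s \<in> osec L V \<and> (\<forall>y\<in>V. oact AL U a \<sigma> y = L.gm y V s)"
    using W(1-3) by blast
qed

lemma AL_sheaf: "oset_sheaf P AL"
  unfolding oset_sheaf_def
proof (intro conjI allI impI ballI funcsetI; (elim conjE)?)
  have "ores AL = (\<lambda>U V \<sigma>. restrict \<sigma> V)" by (simp add: associated_oset_def)
  then show "sheaf (sp P) (osec AL) (ores AL)" using L.sheaf_as by simp
next
  fix U assume U: "Op U"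
  show "oact AL U a \<sigma> \<in> osec AL U" if "a \<in> Sec U" "\<sigma> \<in> osec AL U" for a \<sigma>
    using AL_act_closed U that by simp
  fix \<sigma> assume "\<sigma> \<in> osec AL U"
  then have \<sigma>: "\<sigma> \<in> L.as U" by simp
  show "oact AL U \<one>\<^bsub>sec P U\<^esub> \<sigma> = \<sigma>"
  proof (rule extensionalityI[OF AL_act_ext])
    show "\<sigma> \<in> extensional U" using \<sigma> by (simp add: associated_sections_def)
    fix x assume "x \<in> U"
    then obtain W t where W: "Op W" "x \<in> W" "W \<subseteq> U" "t \<in> osec L W" "\<forall>y\<in>W. \<sigma> y = L.gm y W t"
      using L.as_germ[OF \<sigma>] by blast
    then show "oact AL U \<one>\<^bsub>sec P U\<^esub> \<sigma> x = \<sigma> x"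
      using AL_act_germ[OF U one_closed[OF U] W(1-4)] U by (simp add: act_one)
  qed
  fix a b assume ab: "a \<in> Sec U" "b \<in> Sec U"
  show "oact AL U (a \<otimes>\<^bsub>sec P U\<^esub> b) \<sigma> = oact AL U a (oact AL U b \<sigma>)"
  proof (rule extensionalityI[OF AL_act_ext AL_act_ext])
    fix x assume "x \<in> U"
    then obtain W t where W: "Op W" "x \<in> W" "W \<subseteq> U" "t \<in> osec L W" "\<forall>y\<in>W. \<sigma> y = L.gm y W t"
      using L.as_germ[OF \<sigma>] by blast
    have abW: "res P U W a \<in> Sec W" "res P U W b \<in> Sec W" using res_closed[OF U W(1,3)] ab by auto
    have \<sigma>x: "\<sigma> x = L.gm x W t" using W(5) W(2) by blast
    show "oact AL U (a \<otimes>\<^bsub>sec P U\<^esub> b) \<sigma> x = oact AL U a (oact AL U b \<sigma>) x"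
      unfolding AL_act_germ[where \<sigma> = \<sigma>, OF U mult_closed[OF U ab] W(1-4) \<sigma>x]
        AL_act_germ[where \<sigma> = "oact AL U b \<sigma>", OF U ab(1) W(1-3) act_closed[OF W(1) abW(2) W(4)]
          AL_act_germ[where \<sigma> = \<sigma>, OF U ab(2) W(1-4) \<sigma>x]]
      using act_mult[OF W(1) abW W(4)] mult_res[OF U W(1,3) ab] by simp
  qed
next
  fix U V a \<sigma> assume U: "Op U" "Op V" "V \<subseteq> U" and a: "a \<in> Sec U" and "\<sigma> \<in> osec AL U"
  then have \<sigma>: "\<sigma> \<in> L.as U" by simp
  show "ores AL U V (oact AL U a \<sigma>) = oact AL V (res P U V a) (ores AL U V \<sigma>)"
    unfolding AL_simps
  proof (rule extensionalityI[OF _ AL_act_ext])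
    fix x assume x: "x \<in> V"
    then obtain W t where W: "Op W" "x \<in> W" "W \<subseteq> V" "t \<in> osec L W" "\<forall>y\<in>W. restrict \<sigma> V y = L.gm y W t"
      using L.as_germ[OF L.as_restrict[OF \<sigma> U(2,3)]] by blast
    have "\<sigma> x = L.gm x W t" using W(5) x W(2) by auto
    then show "restrict (oact AL U a \<sigma>) V x = oact AL V (res P U V a) (restrict \<sigma> V) x"
      using AL_act_germ[OF U(2) res_closed[OF U a] W(1-4), of "restrict \<sigma> V"]
        AL_act_germ[OF U(1) a W(1,2) _ W(4), of \<sigma>] x W U res_res[OF U(1,2) W(1) U(3) W(3) a] by auto
  qed simp
qed

lemma AL_to_as_act:
  assumes "Op U" "a \<in> Sec U" "l \<in> osec L U"
  shows "oact AL U a (L.to_as U l) = L.to_as U (oact L U a l)"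
proof (rule extensionalityI[OF AL_act_ext])
  fix x assume "x \<in> U"
  then show "oact AL U a (L.to_as U l) x = L.to_as U (oact L U a l) x"
    using AL_act_germ[OF assms(1,2,1) _ subset_refl assms(3), of x "L.to_as U l"] res_id[OF assms(1,2)] by simp
qed simp

text \<open>Where a presheaf has a generator, sections correspond to their coefficients in the sheaf
  \<open>O_X\<close>. So sections that agree locally are equal: the presheaf is separated
  there.\<close>

lemma tr_to_as_inj:
  assumes "tr U e" "Op U" "Op V" "V \<subseteq> U" "l \<in> osec L V" "m \<in> osec L V" "L.to_as V l = L.to_as V m"
  shows "l = m"
proof -
  define a b where "a = coord U e V l" and "b = coord U e V m"
  have ab: "a \<in> Sec V" "b \<in> Sec V" using coord_closed assms unfolding a_def b_def by auto
  have "a = b"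
  proof (rule eqI_cover[OF assms(3) ab])
    fix x assume "x \<in> V"
    then obtain W where W: "Op W" "x \<in> W" "W \<subseteq> V" "ores L V W l = ores L V W m"
      using assms(7) L.to_as_eq_iff[OF assms(3,5,6)] by blast
    then have "res P V W a = res P V W b"
      unfolding a_def b_def using coord_res[OF assms(1-3) W(1) assms(4) W(3)] assms(5,6) by simp
    then show "\<exists>W. Op W \<and> x \<in> W \<and> W \<subseteq> V \<and> res P V W a = res P V W b" using W by blast
  qed
  then show ?thesis
    using coord_act[OF assms(1,3,4,5)] coord_act[OF assms(1,3,4,6)] unfolding a_def b_def by metis
qed

text \<open>Below \<open>U\<close> the presheaf is a copy of \<open>O_X\<close>, hence already
  satisfies gluing, and passing to the associated sheaf changes nothing there. Concretely, a section
  of the associated sheaf has local coefficients, and these glue.\<close>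

lemma AL_tr:
  assumes tr: "tr U e" and U: "Op U"
  shows "trivializes P AL U (L.to_as U e)"
  unfolding trivializes_def
proof (intro conjI allI impI)
  have e: "e \<in> osec L U" using trD(1)[OF tr] .
  show "L.to_as U e \<in> osec AL U" using L.to_as_closed U e by simp
  fix V assume "Op V \<and> V \<subseteq> U"
  then have V: "Op V" "V \<subseteq> U" by auto
  have eV: "ores L U V e \<in> osec L V" using L.res_closed[OF U V e] .
  have act: "oact AL V a (ores AL U V (L.to_as U e)) = L.to_as V (oact L V a (ores L U V e))"
    if "a \<in> Sec V" for a
    using AL_to_as_act[OF V(1) that eV] L.to_as_res[OF U V e] by simp
  show "bij_betw (\<lambda>a. oact AL V a (ores AL U V (L.to_as U e))) (Sec V) (osec AL V)"
    unfolding bij_betw_def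
  proof (intro conjI equalityI subsetI)
    show "inj_on (\<lambda>a. oact AL V a (ores AL U V (L.to_as U e))) (Sec V)"
    proof (rule inj_onI)
      fix a b assume ab: "a \<in> Sec V" "b \<in> Sec V"
        "oact AL V a (ores AL U V (L.to_as U e)) = oact AL V b (ores AL U V (L.to_as U e))"
      then have "oact L V a (ores L U V e) = oact L V b (ores L U V e)"
        using tr_to_as_inj[OF tr U V] act_closed[OF V(1) _ eV] act by simp
      then show "a = b" using tr_cancel[OF tr V] ab by blast
    qed
    show "\<sigma> \<in> osec AL V" if "\<sigma> \<in> (\<lambda>a. oact AL V a (ores AL U V (L.to_as U e))) ` Sec V" for \<sigma>
      using that act L.to_as_closed[OF V(1)] act_closed[OF V(1) _ eV] by auto
    fix \<sigma> assume "\<sigma> \<in> osec AL V"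
    then have \<sigma>: "\<sigma> \<in> L.as V" by simp
    have "\<forall>x\<in>V. \<exists>W l. Op W \<and> x \<in> W \<and> W \<subseteq> V \<and> l \<in> osec L W \<and> restrict \<sigma> W = L.to_as W l"
      using L.as_locally[OF \<sigma>] by metis
    then obtain W l where W: "\<And>x. x \<in> V \<Longrightarrow> Op (W x) \<and> x \<in> W x \<and> W x \<subseteq> V \<and> l x \<in> osec L (W x) \<and>
        restrict \<sigma> (W x) = L.to_as (W x) (l x)" by metis
    define a where "a = (\<lambda>x. coord U e (W x) (l x))"
    have WU: "W x \<subseteq> U" if "x \<in> V" for x using W[OF that] V by blast
    have aS: "a x \<in> Sec (W x)" if "x \<in> V" for x
      unfolding a_def using coord_closed[OF tr] W[OF that] WU[OF that] by blast
    have VW: "(\<Union>x\<in>V. W x) = V" using W by blast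
    \<comment> \<open>Local representatives may differ on overlaps a priori.
      \<open>tr_to_as_inj\<close> shows that they agree, so their coefficients are compatible and
      glue to \<open>b\<close>.\<close>
    obtain b where b: "b \<in> Sec V" "\<And>x. x \<in> V \<Longrightarrow> res P V (W x) b = a x"
    proof (rule glue[of V W a])
      fix x y assume xy: "x \<in> V" "y \<in> V"
      let ?I = "W x \<inter> W y"
      have I: "Op ?I" "?I \<subseteq> W x" "?I \<subseteq> W y" "?I \<subseteq> U" using W xy WU by auto
      have lI: "ores L (W x) ?I (l x) \<in> osec L ?I" "ores L (W y) ?I (l y) \<in> osec L ?I"
        using L.res_closed W xy I by auto
      have "L.to_as ?I (ores L (W x) ?I (l x)) = restrict \<sigma> ?I"
        using L.to_as_res[of "W x" ?I "l x"] W[OF xy(1)] I(1,2) by (metis restrict_restrict inf.absorb_iff2)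
      moreover have "L.to_as ?I (ores L (W y) ?I (l y)) = restrict \<sigma> ?I"
        using L.to_as_res[of "W y" ?I "l y"] W[OF xy(2)] I(1,3) by (metis restrict_restrict inf.absorb_iff2)
      ultimately have "ores L (W x) ?I (l x) = ores L (W y) ?I (l y)"
        using tr_to_as_inj[OF tr U I(1,4) lI] by simp
      then show "res P (W x) ?I (a x) = res P (W y) ?I (a y)"
        unfolding a_def using coord_res[OF tr U _ I(1) WU[OF xy(1)] I(2)] coord_res[OF tr U _ I(1) WU[OF xy(2)] I(3)]
          W xy by simp
    qed (use W aS VW in auto)
    have "\<sigma> = L.to_as V (oact L V b (ores L U V e))"
    proof (rule extensionalityI[of _ V])
      show "\<sigma> \<in> extensional V" using \<sigma> by (simp add: associated_sections_def)
      fix x assume x: "x \<in> V"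
      have "\<sigma> x = L.gm x (W x) (l x)" using W[OF x] by (metis restrict_apply')
      also have "l x = ores L V (W x) (oact L V b (ores L U V e))"
        using act_res[OF V(1) _ _ b(1) eV, of "W x"] b(2)[OF x] W[OF x] L.res_res[OF U V(1) _ V(2) _ e, of "W x"]
          coord_act[OF tr _ WU[OF x], of "l x"] unfolding a_def by simp
      also have "L.gm x (W x) \<dots> = L.gm x V (oact L V b (ores L U V e))"
        using L.germ_res[OF V(1)] W[OF x] act_closed[OF V(1) b(1) eV] by blast
      finally show "\<sigma> x = L.to_as V (oact L V b (ores L U V e)) x" using x by simp
    qed simp
    then show "\<sigma> \<in> (\<lambda>a. oact AL V a (ores AL U V (L.to_as U e))) ` Sec V"
      by (intro image_eqI[OF _ b(1)]) (simp only: act[OF b(1)])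
  qed
qed

end

section \<open>The presheaf tensor product of two sheaves of \<open>O_X\<close>-sets\<close>

locale two_osets = monoid_sheaf P for P :: "('a, 's) monoidal_space" +
  fixes L :: "('a, 's, 't) oset" and N :: "('a, 's, 'u) oset"
  assumes L: "oset_presheaf P L" and N: "oset_presheaf P N"
begin

sublocale L: oset_pre P L by unfold_locales (rule L)

sublocale N: oset_pre P N by unfold_locales (rule N)

abbreviation pt :: "'a set \<Rightarrow> 't \<Rightarrow> 'u \<Rightarrow> ('t \<times> 'u) set" where "pt \<equiv> pure_tensor P L N"

abbreviation trel :: "'a set \<Rightarrow> 't \<times> 'u \<Rightarrow> 't \<times> 'u \<Rightarrow> bool" where "trel U \<equiv> equivclp (tensor_rel P L N U)"

lemma trel_base: "a \<in> Sec U \<Longrightarrow> l \<in> osec L U \<Longrightarrow> n \<in> osec N U \<Longrightarrow> trel U (oact L U a l, n) (l, oact N U a n)"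
  by (rule r_into_equivclp) (auto simp: tensor_rel_def)

text \<open>To prove that a construction is compatible with the generated equivalence it suffices to
  treat one move of a scalar across the tensor sign, provided that \<open>Q\<close> is itself
  reflexive, symmetric and transitive.\<close>

lemma trel_induct:
  assumes "trel U v w" "\<And>v. Q v v" "\<And>v w. Q v w \<Longrightarrow> Q w v" "\<And>u v w. Q u v \<Longrightarrow> Q v w \<Longrightarrow> Q u w"
    "\<And>a l n. a \<in> Sec U \<Longrightarrow> l \<in> osec L U \<Longrightarrow> n \<in> osec N U \<Longrightarrow> Q (oact L U a l, n) (l, oact N U a n)"
  shows "Q v w"
  using assms(1)
proof (induction rule: equivclp_induct)
  case base
  show ?case using assms(2) .
next
  case (step y z)
  have "Q y z" using step(2) assms(3,5) unfolding tensor_rel_def by auto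
  with step(3) show ?case using assms(4) by blast
qed

text \<open>The generated equivalence is reflexive on the whole type of pairs, including pairs that
  are not sections. A move relates pairs of sections only, so an equivalence class never mixes the
  two kinds.\<close>

lemma trel_osec:
  assumes "trel U v w" "Op U"
  shows "fst v \<in> osec L U \<and> snd v \<in> osec N U \<longleftrightarrow> fst w \<in> osec L U \<and> snd w \<in> osec N U"
  using assms(1) by (rule trel_induct) (use L.act_closed N.act_closed assms(2) in auto)

lemma pt_eq_iff: "pt U l n = pt U l' n' \<longleftrightarrow> trel U (l, n) (l', n')"
proof
  assume "pt U l n = pt U l' n'"
  moreover have "(l', n') \<in> pt U l' n'" by (simp add: pure_tensor_def equivclp_refl)
  ultimately have "(l', n') \<in> pt U l n" by simp
  then show "trel U (l, n) (l', n')" by (simp add: pure_tensor_def)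
next
  assume r: "trel U (l, n) (l', n')"
  have "trel U (l, n) w \<longleftrightarrow> trel U (l', n') w" for w
    using equivclp_trans[OF r, of w] equivclp_trans[OF equivclp_sym[OF r], of w] by blast
  then show "pt U l n = pt U l' n'" by (simp add: pure_tensor_def)
qed

lemma UN_pt:
  assumes "Op U" "l \<in> osec L U" "n \<in> osec N U"
    "\<And>l' n'. l' \<in> osec L U \<Longrightarrow> n' \<in> osec N U \<Longrightarrow> trel U (l, n) (l', n') \<Longrightarrow> F l' n' = c"
  shows "(\<Union>(l', n')\<in>pt U l n. F l' n') = c"
proof (rule SUP_eq_const)
  have "(l, n) \<in> pt U l n" by (simp add: pure_tensor_def equivclp_refl)
  then show "pt U l n \<noteq> {}" by blast
  fix z assume z: "z \<in> pt U l n"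
  obtain l' n' where z': "z = (l', n')" by (cases z)
  have "trel U (l, n) (l', n')" using z unfolding pure_tensor_def z' by blast
  then show "(case z of (l', n') \<Rightarrow> F l' n') = c"
    unfolding z' using assms(4)[of l' n'] trel_osec[of U "(l, n)" "(l', n')"] assms(1-3) by simp
qed

abbreviation TP :: "('a, 's, ('t \<times> 'u) set) oset" where "TP \<equiv> tensor_presheaf P L N"

lemma TP_osec: "osec TP U = {pt U l n | l n. l \<in> osec L U \<and> n \<in> osec N U}"
  by (simp add: tensor_presheaf_def)

lemma TP_cases:
  assumes "A \<in> osec TP U"
  obtains l n where "l \<in> osec L U" "n \<in> osec N U" "A = pt U l n"
  using assms unfolding TP_osec by blast

lemma TP_closed: "l \<in> osec L U \<Longrightarrow> n \<in> osec N U \<Longrightarrow> pt U l n \<in> osec TP U"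
  unfolding TP_osec by blast

lemma TP_res:
  assumes "Op U" "Op V" "V \<subseteq> U" "l \<in> osec L U" "n \<in> osec N U"
  shows "ores TP U V (pt U l n) = pt V (ores L U V l) (ores N U V n)"
proof -
  have "trel V (ores L U V (fst v), ores N U V (snd v)) (ores L U V (fst w), ores N U V (snd w))"
    if "trel U v w" for v w
    using that
  proof (rule trel_induct)
    show "trel V (ores L U V (fst v), ores N U V (snd v)) (ores L U V (fst v), ores N U V (snd v))" for v
      by (rule equivclp_refl)
    show "trel V (ores L U V (fst w), ores N U V (snd w)) (ores L U V (fst v), ores N U V (snd v))"
      if "trel V (ores L U V (fst v), ores N U V (snd v)) (ores L U V (fst w), ores N U V (snd w))" for v w
      using that by (rule equivclp_sym)
    show "trel V (ores L U V (fst u), ores N U V (snd u)) (ores L U V (fst w), ores N U V (snd w))"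
      if "trel V (ores L U V (fst u), ores N U V (snd u)) (ores L U V (fst v), ores N U V (snd v))"
        "trel V (ores L U V (fst v), ores N U V (snd v)) (ores L U V (fst w), ores N U V (snd w))" for u v w
      using that by (rule equivclp_trans)
    show "trel V (ores L U V (fst (oact L U a l, n)), ores N U V (snd (oact L U a l, n)))
        (ores L U V (fst (l, oact N U a n)), ores N U V (snd (l, oact N U a n)))"
      if a: "a \<in> Sec U" "l \<in> osec L U" "n \<in> osec N U" for a l n
      using trel_base[OF res_closed[OF assms(1-3) a(1)] L.L.res_closed[OF assms(1-3) a(2)]
          N.L.res_closed[OF assms(1-3) a(3)]]
        L.act_res[OF assms(1-3) a(1,2)] N.act_res[OF assms(1-3) a(1,3)] by simp
  qed
  note tr = this[of "(l, n)" "(l', n')" for l' n', simplified]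
  have "(\<Union>(l', n')\<in>pt U l n. pt V (ores L U V l') (ores N U V n')) = pt V (ores L U V l) (ores N U V n)"
    by (rule UN_pt[OF assms(1,4,5)]) (use tr pt_eq_iff in metis)
  then show ?thesis by (simp add: tensor_presheaf_def)
qed

lemma TP_act:
  assumes "Op U" "a \<in> Sec U" "l \<in> osec L U" "n \<in> osec N U"
  shows "oact TP U a (pt U l n) = pt U (oact L U a l) n"
proof -
  have "trel U (oact L U a (fst v), snd v) (oact L U a (fst w), snd w)" if "trel U v w" for v w
    using that
  proof (rule trel_induct)
    show "trel U (oact L U a (fst v), snd v) (oact L U a (fst v), snd v)" for v by (rule equivclp_refl)
    show "trel U (oact L U a (fst w), snd w) (oact L U a (fst v), snd v)"
      if "trel U (oact L U a (fst v), snd v) (oact L U a (fst w), snd w)" for v w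
      using that by (rule equivclp_sym)
    show "trel U (oact L U a (fst u), snd u) (oact L U a (fst w), snd w)"
      if "trel U (oact L U a (fst u), snd u) (oact L U a (fst v), snd v)"
        "trel U (oact L U a (fst v), snd v) (oact L U a (fst w), snd w)" for u v w
      using that by (rule equivclp_trans)
    show "trel U (oact L U a (fst (oact L U b l, n)), snd (oact L U b l, n))
        (oact L U a (fst (l, oact N U b n)), snd (l, oact N U b n))"
      if b: "b \<in> Sec U" "l \<in> osec L U" "n \<in> osec N U" for b l n
    proof -
      have "oact L U a (oact L U b l) = oact L U b (oact L U a l)"
        using L.act_mult[OF assms(1,2) b(1,2)] L.act_mult[OF assms(1) b(1) assms(2) b(2)]
          ac(2)[OF assms(1,2) b(1)] by simp
      then show ?thesis
        using trel_base[OF b(1) L.act_closed[OF assms(1,2) b(2)] b(3)] by simp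
    qed
  qed
  note tr = this[of "(l, n)" "(l', n')" for l' n', simplified]
  have "(\<Union>(l', n')\<in>pt U l n. pt U (oact L U a l') n') = pt U (oact L U a l) n"
    by (rule UN_pt[OF assms(1,3,4)]) (use tr pt_eq_iff in metis)
  then show ?thesis by (simp add: tensor_presheaf_def)
qed

lemma TP_presheaf: "oset_presheaf P TP"
  unfolding oset_presheaf_def presheaf_def
proof (intro conjI allI impI ballI funcsetI; (elim conjE)?)
  fix U V A assume U: "Op U" "Op V" "V \<subseteq> U" and A: "A \<in> osec TP U"
  obtain l n where ln: "l \<in> osec L U" "n \<in> osec N U" "A = pt U l n" using A by (rule TP_cases)
  show "ores TP U V A \<in> osec TP V"
    unfolding ln(3) TP_res[OF U ln(1,2)] using TP_closed L.L.res_closed[OF U ln(1)] N.L.res_closed[OF U ln(2)] .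
  fix a assume a: "a \<in> Sec U"
  show "ores TP U V (oact TP U a A) = oact TP V (res P U V a) (ores TP U V A)"
    unfolding ln(3) TP_act[OF U(1) a ln(1,2)] TP_res[OF U ln(1,2)] TP_res[OF U L.act_closed[OF U(1) a ln(1)] ln(2)]
      TP_act[OF U(2) res_closed[OF U a] L.L.res_closed[OF U ln(1)] N.L.res_closed[OF U ln(2)]] L.act_res[OF U a ln(1)] ..
next
  fix U A assume U: "Op U" and A: "A \<in> osec TP U"
  obtain l n where ln: "l \<in> osec L U" "n \<in> osec N U" "A = pt U l n" using A by (rule TP_cases)
  show "ores TP U U A = A"
    unfolding ln(3) TP_res[OF U U subset_refl ln(1,2)] L.L.res_id[OF U ln(1)] N.L.res_id[OF U ln(2)] ..
  show "oact TP U \<one>\<^bsub>sec P U\<^esub> A = A"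
    unfolding ln(3) TP_act[OF U one_closed[OF U] ln(1,2)] L.act_one[OF U ln(1)] ..
  fix a b assume ab: "a \<in> Sec U" "b \<in> Sec U"
  show "oact TP U (a \<otimes>\<^bsub>sec P U\<^esub> b) A = oact TP U a (oact TP U b A)"
    unfolding ln(3) TP_act[OF U mult_closed[OF U ab] ln(1,2)] TP_act[OF U ab(2) ln(1,2)]
      TP_act[OF U ab(1) L.act_closed[OF U ab(2) ln(1)] ln(2)] L.act_mult[OF U ab ln(1)] ..
next
  fix U V W A assume U: "Op U" "Op V" "Op W" "W \<subseteq> V" "V \<subseteq> U" and A: "A \<in> osec TP U"
  obtain l n where ln: "l \<in> osec L U" "n \<in> osec N U" "A = pt U l n" using A by (rule TP_cases)
  have WU: "W \<subseteq> U" using U by blast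
  show "ores TP V W (ores TP U V A) = ores TP U W A"
    unfolding ln(3) TP_res[OF U(1,2,5) ln(1,2)] TP_res[OF U(1,3) WU ln(1,2)]
      TP_res[OF U(2,3,4) L.L.res_closed[OF U(1,2,5) ln(1)] N.L.res_closed[OF U(1,2,5) ln(2)]]
      L.L.res_res[OF U(1,2,3,5,4) ln(1)] N.L.res_res[OF U(1,2,3,5,4) ln(2)] ..
next
  fix U a A assume U: "Op U" and a: "a \<in> Sec U" and A: "A \<in> osec TP U"
  obtain l n where ln: "l \<in> osec L U" "n \<in> osec N U" "A = pt U l n" using A by (rule TP_cases)
  show "oact TP U a A \<in> osec TP U"
    unfolding ln(3) TP_act[OF U a ln(1,2)] using TP_closed L.act_closed[OF U a ln(1)] ln(2) .
qed

sublocale TP: oset_pre P TP by unfold_locales (rule TP_presheaf)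

text \<open>The scalar \<open>b\<close> moves to the left factor, where the two scalars multiply.
  This is why transition functions of a tensor product are products.\<close>

lemma pt_act_act:
  assumes "Op U" "a \<in> Sec U" "b \<in> Sec U" "l \<in> osec L U" "n \<in> osec N U"
  shows "pt U (oact L U a l) (oact N U b n) = oact TP U (a \<otimes>\<^bsub>sec P U\<^esub> b) (pt U l n)"
proof -
  have "pt U (oact L U a l) (oact N U b n) = pt U (oact L U b (oact L U a l)) n"
    using trel_base[OF assms(3) L.act_closed[OF assms(1,2,4)] assms(5)] pt_eq_iff by metis
  then show ?thesis
    using TP_act[OF assms(1) mult_closed[OF assms(1-3)] assms(4,5)] ac(2)[OF assms(1-3)]
      L.act_mult[OF assms(1,3,2,4)] by simp
qed

text \<open>\<open>e \<otimes> f\<close> generates because both scalars can be collected on one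
  side. Its multiples are distinct because the product of the coefficients of the two factors is an
  invariant of tensors.\<close>

lemma TP_tr:
  assumes tL: "trivializes P L U e" and tN: "trivializes P N U f" and U: "Op U"
  shows "trivializes P TP U (pt U e f)"
  unfolding trivializes_def
proof (intro conjI allI impI)
  have ef: "e \<in> osec L U" "f \<in> osec N U" using L.trD(1)[OF tL] N.trD(1)[OF tN] .
  show "pt U e f \<in> osec TP U" using TP_closed[OF ef] .
  fix V assume "Op V \<and> V \<subseteq> U"
  then have V: "Op V" "V \<subseteq> U" by auto
  define e' f' where "e' = ores L U V e" and "f' = ores N U V f"
  have ef': "e' \<in> osec L V" "f' \<in> osec N V"
    unfolding e'_def f'_def using L.L.res_closed[OF U V ef(1)] N.L.res_closed[OF U V ef(2)] .
  have act: "oact TP V a (ores TP U V (pt U e f)) = pt V (oact L V a e') f'" if "a \<in> Sec V" for a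
    unfolding TP_res[OF U V ef] using TP_act[OF V(1) that ef'] unfolding e'_def f'_def .
  show "bij_betw (\<lambda>a. oact TP V a (ores TP U V (pt U e f))) (Sec V) (osec TP V)"
    unfolding bij_betw_def
  proof (intro conjI equalityI subsetI)
    show "A \<in> osec TP V" if "A \<in> (\<lambda>a. oact TP V a (ores TP U V (pt U e f))) ` Sec V" for A
      using that act TP_closed[OF L.act_closed[OF V(1) _ ef'(1)] ef'(2)] by auto
    show "A \<in> (\<lambda>a. oact TP V a (ores TP U V (pt U e f))) ` Sec V" if A: "A \<in> osec TP V" for A
    proof -
      obtain l n where ln: "l \<in> osec L V" "n \<in> osec N V" "A = pt V l n" using A by (rule TP_cases)
      define a b where "a = L.coord U e V l" and "b = N.coord U f V n"
      have ab: "a \<in> Sec V" "b \<in> Sec V"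
        unfolding a_def b_def using L.coord_closed[OF tL V ln(1)] N.coord_closed[OF tN V ln(2)] .
      have "l = oact L V a e'" "n = oact N V b f'"
        unfolding a_def b_def e'_def f'_def using L.coord_act[OF tL V ln(1)] N.coord_act[OF tN V ln(2)] by simp_all
      then have "A = oact TP V (a \<otimes>\<^bsub>sec P V\<^esub> b) (pt V e' f')"
        using pt_act_act[OF V(1) ab ef'] ln(3) by simp
      then show ?thesis
        using mult_closed[OF V(1) ab] TP_res[OF U V ef] unfolding e'_def f'_def by auto
    qed
    show "inj_on (\<lambda>a. oact TP V a (ores TP U V (pt U e f))) (Sec V)"
    proof (rule inj_onI)
      fix a b assume ab: "a \<in> Sec V" "b \<in> Sec V"
        "oact TP V a (ores TP U V (pt U e f)) = oact TP V b (ores TP U V (pt U e f))"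
      \<comment> \<open>The invariant: moving a scalar across the tensor sign multiplies one
        coefficient where it used to multiply the other, so the product is unchanged. On
        \<open>d e \<otimes> f\<close> its value is \<open>d\<close>.\<close>
      define c where "c = (\<lambda>v. L.coord U e V (fst v) \<otimes>\<^bsub>sec P V\<^esub> N.coord U f V (snd v))"
      have inv: "c v = c w" if "trel V v w" for v w
        using that
      proof (rule trel_induct)
        show "c v = c v" for v ..
        show "c w = c v" if "c v = c w" for v w using that ..
        show "c u = c w" if "c u = c v" "c v = c w" for u v w using that by simp
        show "c (oact L V a l, n) = c (l, oact N V a n)" if "a \<in> Sec V" "l \<in> osec L V" "n \<in> osec N V" for a l n
          unfolding c_def
          using L.coord_mult[OF tL U V that(2,1)] N.coord_mult[OF tN U V that(3,1)]
            L.coord_closed[OF tL V that(2)] N.coord_closed[OF tN V that(3)] that(1) V(1)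
          by (simp add: ac)
      qed
      have cf: "N.coord U f V f' = \<one>\<^bsub>sec P V\<^esub>"
        by (rule N.coord_unique[OF tN V]) (use V N.act_one[OF V(1) ef'(2)] in \<open>simp_all add: f'_def\<close>)
      have ce: "L.coord U e V (oact L V d e') = d" if "d \<in> Sec V" for d
        by (rule L.coord_unique[OF tL V that]) (simp add: e'_def)
      have "trel V (oact L V a e', f') (oact L V b e', f')"
        using ab act pt_eq_iff by metis
      from inv[OF this] show "a = b" unfolding c_def using cf ce ab V by simp
    qed
  qed
qed

text \<open>On the common refinement the tensors of the two frames form a frame of the tensor
  presheaf, and by \<open>pt_act_act\<close> its transition functions multiply. \<open>AL_tr\<close>
  carries the frame over to the associated sheaf.\<close>

lemma has_trans_tensor:
  assumes c: "coc (U, g)" "coc (V, k)"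
    and t: "has_transition_functions P L (U, g)" "has_transition_functions P N (V, k)"
  shows "has_transition_functions P (tensor P L N) (cmul (U, g) (V, k))"
proof -
  obtain e where e: "L.frame U e" "\<And>x y. x \<in> T \<Longrightarrow> y \<in> T \<Longrightarrow> L.transition U e x y = g x y"
    using t(1) L.has_trans_coc[OF c(1)] by blast
  obtain f where f: "N.frame V f" "\<And>x y. x \<in> T \<Longrightarrow> y \<in> T \<Longrightarrow> N.transition V f x y = k x y"
    using t(2) N.has_trans_coc[OF c(2)] by blast
  define Z where "Z = (\<lambda>x. U x \<inter> V x)"
  have cZ: "cover Z"
    using cocD(3,4)[OF c(1)] cocD(3,4)[OF c(2)] unfolding point_cover_def Z_def by auto
  note O = coverD(1)[OF cZ]
  have ZU: "Z x \<subseteq> U x" "Z x \<subseteq> V x" for x unfolding Z_def by auto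
  define e' f' where "e' = (\<lambda>x. ores L (U x) (Z x) (e x))" and "f' = (\<lambda>x. ores N (V x) (Z x) (f x))"
  note fe = L.frame_res[OF e(1) cZ ZU(1), folded e'_def] and ff = N.frame_res[OF f(1) cZ ZU(2), folded f'_def]
  define E where "E = (\<lambda>x. pt (Z x) (e' x) (f' x))"
  have tE: "trivializes P TP (Z x) (E x)" if "x \<in> T" for x
    unfolding E_def using TP_tr[OF L.frameD(4)[OF fe(1) that] N.frameD(4)[OF ff(1) that] O[OF that]] .
  have eq: "ores (tensor P L N) (Z y) (Z x \<inter> Z y) (TP.L.to_as (Z y) (E y)) =
      oact (tensor P L N) (Z x \<inter> Z y) (snd (cmul (U, g) (V, k)) x y)
        (ores (tensor P L N) (Z x) (Z x \<inter> Z y) (TP.L.to_as (Z x) (E x)))" if xy: "x \<in> T" "y \<in> T" for x y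
  proof -
    let ?I = "Z x \<inter> Z y"
    have I: "Op ?I" "?I \<subseteq> Z x" "?I \<subseteq> Z y" using O xy by auto
    define a b where "a = res P (U x \<inter> U y) ?I (g x y)" and "b = res P (V x \<inter> V y) ?I (k x y)"
    have ab: "L.transition Z e' x y = a" "N.transition Z f' x y = b"
      unfolding a_def b_def using fe(2)[OF xy] ff(2)[OF xy] e(2)[OF xy] f(2)[OF xy] by auto
    have abS: "a \<in> Sec ?I" "b \<in> Sec ?I" using L.transition_Sec[OF fe(1) xy] N.transition_Sec[OF ff(1) xy] ab by auto
    have m: "snd (cmul (U, g) (V, k)) x y = a \<otimes>\<^bsub>sec P ?I\<^esub> b"
      unfolding cmul_def a_def b_def Z_def by simp
    note ex = L.frameD(5)[OF fe(1) xy(1)] and ey = L.frameD(5)[OF fe(1) xy(2)]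
      and fx = N.frameD(5)[OF ff(1) xy(1)] and fy = N.frameD(5)[OF ff(1) xy(2)]
    note Ox = O[OF xy(1)] and Oy = O[OF xy(2)]
    define ex' fx' where "ex' = ores L (Z x) ?I (e' x)" and "fx' = ores N (Z x) ?I (f' x)"
    have x': "ex' \<in> osec L ?I" "fx' \<in> osec N ?I"
      unfolding ex'_def fx'_def using L.L.res_closed[OF Ox I(1,2) ex] N.L.res_closed[OF Ox I(1,2) fx] .
    have "ores TP (Z y) ?I (E y) = pt ?I (oact L ?I a ex') (oact N ?I b fx')"
      unfolding E_def TP_res[OF Oy I(1,3) ey fy] L.transition_at[OF fe(1) xy I] N.transition_at[OF ff(1) xy I] ab
        res_id[OF I(1) abS(1)] res_id[OF I(1) abS(2)] ex'_def fx'_def ..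
    also have "\<dots> = oact TP ?I (a \<otimes>\<^bsub>sec P ?I\<^esub> b) (ores TP (Z x) ?I (E x))"
      using pt_act_act[OF I(1) abS x'] TP_res[OF Ox I(1,2) ex fx] unfolding E_def ex'_def fx'_def by simp
    finally have "TP.L.to_as ?I (ores TP (Z y) ?I (E y)) =
        oact TP.AL ?I (a \<otimes>\<^bsub>sec P ?I\<^esub> b) (TP.L.to_as ?I (ores TP (Z x) ?I (E x)))"
      using TP.AL_to_as_act[OF I(1) mult_closed[OF I(1) abS] TP.L.res_closed[OF Ox I(1,2) TP.trD(1)[OF tE[OF xy(1)]]]]
      by simp
    moreover have "ores TP.AL (Z z) ?I (TP.L.to_as (Z z) (E z)) = TP.L.to_as ?I (ores TP (Z z) ?I (E z))"
      if "z \<in> T" "?I \<subseteq> Z z" for z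
      unfolding TP.AL_simps(2) by (rule TP.L.to_as_res[OF O[OF that(1)] I(1) that(2) TP.trD(1)[OF tE[OF that(1)]], symmetric])
    from this[OF xy(1) I(2)] this[OF xy(2) I(3)]
    have "ores TP.AL (Z x) ?I (TP.L.to_as (Z x) (E x)) = TP.L.to_as ?I (ores TP (Z x) ?I (E x))"
      "ores TP.AL (Z y) ?I (TP.L.to_as (Z y) (E y)) = TP.L.to_as ?I (ores TP (Z y) ?I (E y))" .
    ultimately show ?thesis unfolding tensor_def m by (simp only:)
  qed
  have "fst (cmul (U, g) (V, k)) = Z" by (simp add: cmul_def Z_def)
  then have cm: "cmul (U, g) (V, k) = (Z, snd (cmul (U, g) (V, k)))" by (metis prod.collapse)
  have tt: "trivializes P (tensor P L N) (Z x) (TP.L.to_as (Z x) (E x))" if "x \<in> T" for x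
    unfolding tensor_def using TP.AL_tr[OF tE[OF that] O[OF that]] .
  have "has_transition_functions P (tensor P L N) (Z, snd (cmul (U, g) (V, k)))"
    unfolding has_transition_functions_def case_prod_conv Let_def
    by (intro exI[of _ "\<lambda>x. TP.L.to_as (Z x) (E x)"] conjI ballI tt eq)
  then show ?thesis by (subst cm)
qed

lemma tensor_sheaf: "oset_sheaf P (tensor P L N)"
  unfolding tensor_def by (rule TP.AL_sheaf)

end

section \<open>The Picard group\<close>

context monoid_sheaf
begin

text \<open>The unit cochain, on the cover each of whose members is the whole space.\<close>

definition cone :: "('a, 's) cochain" where
  "cone = (\<lambda>_. T, \<lambda>_ _. \<one>\<^bsub>sec P T\<^esub>)"

definition cinv :: "('a, 's) cochain \<Rightarrow> ('a, 's) cochain" where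
  "cinv c = (fst c, \<lambda>x y. inv\<^bsub>sec P (fst c x \<inter> fst c y)\<^esub> (snd c x y))"

lemma OpT: "Op T" by simp

lemma cover_T: "cover (\<lambda>_. T)"
  by (simp add: point_cover_def)

lemma coc_cone: "coc cone"
  unfolding cone_def
proof (rule cocI[OF cover_T])
  show "\<one>\<^bsub>sec P T\<^esub> \<in> UO (T \<inter> T)" using UO_one[OF OpT] by simp
  show "res P (T \<inter> T) V \<one>\<^bsub>sec P T\<^esub> \<otimes>\<^bsub>sec P V\<^esub> res P (T \<inter> T) V \<one>\<^bsub>sec P T\<^esub> = res P (T \<inter> T) V \<one>\<^bsub>sec P T\<^esub>"
    if "Op V" "V \<subseteq> T" for V
    using that by simp
qed

lemma coc_cinv:
  assumes "coc (U, g)" shows "coc (cinv (U, g))"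
  unfolding cinv_def fst_conv snd_conv
proof (rule cocI)
  show "cover U" using assms by (simp add: cocycle_def)
  have O: "Op (U x)" if "x \<in> T" for x using cocD(3)[OF assms that that] .
  show "inv\<^bsub>sec P (U x \<inter> U y)\<^esub> g x y \<in> UO (U x \<inter> U y)" if "x \<in> T" "y \<in> T" for x y
    using UO_inv cocD(2)[OF assms that] O that by simp
  fix x y z V assume a: "x \<in> T" "y \<in> T" "z \<in> T" "Op V" "V \<subseteq> U x" "V \<subseteq> U y" "V \<subseteq> U z"
  have r: "res P (U u \<inter> U v) V (inv\<^bsub>sec P (U u \<inter> U v)\<^esub> g u v) = inv\<^bsub>sec P V\<^esub> (res P (U u \<inter> U v) V (g u v))"
    "res P (U u \<inter> U v) V (g u v) \<in> UO V" if "u \<in> T" "v \<in> T" "V \<subseteq> U u" "V \<subseteq> U v" for u v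
    using res_inv[of "U u \<inter> U v" V "g u v"] Units_res[of "U u \<inter> U v" V "g u v"] cocD(2)[OF assms that(1,2)] O that a(4) by auto
  define u v w where "u = res P (U x \<inter> U y) V (g x y)" and "v = res P (U y \<inter> U z) V (g y z)"
    and "w = res P (U x \<inter> U z) V (g x z)"
  have uv: "u \<in> UO V" "v \<in> UO V" "w = u \<otimes>\<^bsub>sec P V\<^esub> v"
    unfolding u_def v_def w_def using r a coc_at[OF assms a] by auto
  interpret comm_monoid "sec P V" using comm_monoid_sec a(4) .
  have S: "u \<in> Sec V" "v \<in> Sec V" "inv\<^bsub>sec P V\<^esub> u \<in> Sec V" "inv\<^bsub>sec P V\<^esub> v \<in> Sec V" using uv by auto
  have "inv\<^bsub>sec P V\<^esub> w = inv\<^bsub>sec P V\<^esub> u \<otimes>\<^bsub>sec P V\<^esub> inv\<^bsub>sec P V\<^esub> v"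
  proof -
    have "w \<otimes>\<^bsub>sec P V\<^esub> (inv\<^bsub>sec P V\<^esub> u \<otimes>\<^bsub>sec P V\<^esub> inv\<^bsub>sec P V\<^esub> v) =
        (u \<otimes>\<^bsub>sec P V\<^esub> inv\<^bsub>sec P V\<^esub> u) \<otimes>\<^bsub>sec P V\<^esub> (v \<otimes>\<^bsub>sec P V\<^esub> inv\<^bsub>sec P V\<^esub> v)"
      unfolding uv(3) using S by (simp only: m_ac m_closed)
    then have 1: "w \<otimes>\<^bsub>sec P V\<^esub> (inv\<^bsub>sec P V\<^esub> u \<otimes>\<^bsub>sec P V\<^esub> inv\<^bsub>sec P V\<^esub> v) = \<one>\<^bsub>sec P V\<^esub>"
      using uv(1,2) by simp
    have c: "w \<in> Sec V" "inv\<^bsub>sec P V\<^esub> u \<otimes>\<^bsub>sec P V\<^esub> inv\<^bsub>sec P V\<^esub> v \<in> Sec V" using S uv by auto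
    show ?thesis using inv_unique'[OF c 1] 1 m_comm[OF c] by simp
  qed
  then show "res P (U x \<inter> U y) V (inv\<^bsub>sec P (U x \<inter> U y)\<^esub> g x y) \<otimes>\<^bsub>sec P V\<^esub>
      res P (U y \<inter> U z) V (inv\<^bsub>sec P (U y \<inter> U z)\<^esub> g y z) = res P (U x \<inter> U z) V (inv\<^bsub>sec P (U x \<inter> U z)\<^esub> g x z)"
    using r a unfolding u_def v_def w_def by simp
qed

text \<open>Cochains that coincide on a refinement are cohomologous, with constant witness one. The
  group laws for cochains hold only in this sense, since the two sides may be given over different
  covers.\<close>

lemma coh_agree:
  assumes "coc (U, g)" "coc (V, k)" "cover W" "\<And>x. x \<in> T \<Longrightarrow> W x \<subseteq> U x" "\<And>x. x \<in> T \<Longrightarrow> W x \<subseteq> V x"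
    and "\<And>x y I. x \<in> T \<Longrightarrow> y \<in> T \<Longrightarrow> I = W x \<inter> W y \<Longrightarrow> Op I \<Longrightarrow> I \<subseteq> W x \<Longrightarrow> I \<subseteq> W y \<Longrightarrow>
      res P (U x \<inter> U y) I (g x y) = res P (V x \<inter> V y) I (k x y)"
  shows "coh (U, g) (V, k)"
proof (rule cohI[OF assms(3-5), where h = "\<lambda>x. \<one>\<^bsub>sec P (W x)\<^esub>"])
  have O: "Op (W x)" if "x \<in> T" for x using coverD(1)[OF assms(3) that] .
  show "\<one>\<^bsub>sec P (W x)\<^esub> \<in> UO (W x)" if "x \<in> T" for x using UO_one O that by blast
  fix x y I assume a: "x \<in> T" "y \<in> T" "I = W x \<inter> W y" "Op I" "I \<subseteq> W x" "I \<subseteq> W y"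
  then show "res P (V x \<inter> V y) I (k x y) \<otimes>\<^bsub>sec P I\<^esub> res P (W x) I \<one>\<^bsub>sec P (W x)\<^esub> =
      res P (U x \<inter> U y) I (g x y) \<otimes>\<^bsub>sec P I\<^esub> res P (W y) I \<one>\<^bsub>sec P (W y)\<^esub>"
    using assms(6)[OF a] O by simp
qed

lemma cmul_at:
  assumes "coc (U, g)" "coc (V, k)" "x \<in> T" "y \<in> T" "Op I" "I \<subseteq> U x" "I \<subseteq> U y" "I \<subseteq> V x" "I \<subseteq> V y"
  shows "res P (fst (cmul (U, g) (V, k)) x \<inter> fst (cmul (U, g) (V, k)) y) I (snd (cmul (U, g) (V, k)) x y) =
    res P (U x \<inter> U y) I (g x y) \<otimes>\<^bsub>sec P I\<^esub> res P (V x \<inter> V y) I (k x y)"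
proof -
  have "Op (U x)" "Op (U y)" "Op (V x)" "Op (V y)" using cocD(3) assms by blast+
  then show ?thesis
    using assms cocD(5)[OF assms(1,3,4)] cocD(5)[OF assms(2,3,4)] unfolding cmul_def
    by (simp add: res_simps)
qed

lemma coh_cmul_assoc:
  assumes "coc c" "coc d" "coc e"
  shows "coh (cmul (cmul c d) e) (cmul c (cmul d e))"
proof -
  obtain U g V k W m where eq: "c = (U, g)" "d = (V, k)" "e = (W, m)" by (metis surj_pair)
  note a = assms[unfolded eq]
  obtain Z1 z1 where cd: "cmul (U, g) (V, k) = (Z1, z1)" by (metis surj_pair)
  obtain Z2 z2 where de: "cmul (V, k) (W, m) = (Z2, z2)" by (metis surj_pair)
  obtain Y1 y1 where l: "cmul (Z1, z1) (W, m) = (Y1, y1)" by (metis surj_pair)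
  obtain Y2 y2 where r: "cmul (U, g) (Z2, z2) = (Y2, y2)" by (metis surj_pair)
  have Z: "Z1 x = U x \<inter> V x" "Z2 x = V x \<inter> W x" "Y1 x = Z1 x \<inter> W x" "Y2 x = U x \<inter> Z2 x" for x
    using cd de l r unfolding cmul_def by auto
  have c1: "coc (Z1, z1)" "coc (Z2, z2)" using coc_cmul[OF a(1,2)] coc_cmul[OF a(2,3)] cd de by auto
  have c2: "coc (Y1, y1)" "coc (Y2, y2)" using coc_cmul[OF c1(1) a(3)] coc_cmul[OF a(1) c1(2)] l r by auto
  have "coh (Y1, y1) (Y2, y2)"
  proof (rule coh_agree[OF c2, where W = Y1])
    show "cover Y1" using c2 by (simp add: cocycle_def)
    show "Y1 x \<subseteq> Y2 x" for x unfolding Z by blast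
    fix x y I assume i: "x \<in> T" "y \<in> T" "Op I" "I \<subseteq> Y1 x" "I \<subseteq> Y1 y"
    then have j: "I \<subseteq> U x" "I \<subseteq> U y" "I \<subseteq> V x" "I \<subseteq> V y" "I \<subseteq> W x" "I \<subseteq> W y"
      "I \<subseteq> Z1 x" "I \<subseteq> Z1 y" "I \<subseteq> Z2 x" "I \<subseteq> Z2 y" unfolding Z by auto
    have S: "res P (U x \<inter> U y) I (g x y) \<in> Sec I" "res P (V x \<inter> V y) I (k x y) \<in> Sec I"
      "res P (W x \<inter> W y) I (m x y) \<in> Sec I"
      using i j cocD(3,5)[OF a(1)] cocD(3,5)[OF a(2)] cocD(3,5)[OF a(3)] by (auto intro!: res_closed)
    show "res P (Y1 x \<inter> Y1 y) I (y1 x y) = res P (Y2 x \<inter> Y2 y) I (y2 x y)"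
      using cmul_at[OF c1(1) a(3) i(1-3) j(7,8,5,6), unfolded l fst_conv snd_conv]
        cmul_at[OF a(1) c1(2) i(1-3) j(1,2,9,10), unfolded r fst_conv snd_conv]
        cmul_at[OF a(1,2) i(1-3) j(1-4), unfolded cd fst_conv snd_conv]
        cmul_at[OF a(2,3) i(1-3) j(3-6), unfolded de fst_conv snd_conv] S i(3)
      by (simp add: ac(1))
  qed auto
  then show ?thesis unfolding eq cd de l r .
qed

lemma coh_cmul_comm:
  assumes "coc c" "coc d"
  shows "coh (cmul c d) (cmul d c)"
proof -
  obtain U g V k where eq: "c = (U, g)" "d = (V, k)" by (metis surj_pair)
  note a = assms[unfolded eq]
  obtain Z1 z1 where l: "cmul (U, g) (V, k) = (Z1, z1)" by (metis surj_pair)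
  obtain Z2 z2 where r: "cmul (V, k) (U, g) = (Z2, z2)" by (metis surj_pair)
  have Z: "Z1 x = U x \<inter> V x" "Z2 x = V x \<inter> U x" for x using l r unfolding cmul_def by auto
  have c: "coc (Z1, z1)" "coc (Z2, z2)" using coc_cmul[OF a(1,2)] coc_cmul[OF a(2,1)] l r by auto
  have "coh (Z1, z1) (Z2, z2)"
  proof (rule coh_agree[OF c, where W = Z1])
    show "cover Z1" using c by (simp add: cocycle_def)
    show "Z1 x \<subseteq> Z2 x" for x unfolding Z by blast
    fix x y I assume i: "x \<in> T" "y \<in> T" "Op I" "I \<subseteq> Z1 x" "I \<subseteq> Z1 y"
    then have j: "I \<subseteq> U x" "I \<subseteq> U y" "I \<subseteq> V x" "I \<subseteq> V y" unfolding Z by auto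
    have S: "res P (U x \<inter> U y) I (g x y) \<in> Sec I" "res P (V x \<inter> V y) I (k x y) \<in> Sec I"
      using i j cocD(3,5)[OF a(1)] cocD(3,5)[OF a(2)] by (auto intro!: res_closed)
    show "res P (Z1 x \<inter> Z1 y) I (z1 x y) = res P (Z2 x \<inter> Z2 y) I (z2 x y)"
      using cmul_at[OF a i(1-3) j, unfolded l fst_conv snd_conv]
        cmul_at[OF a(2,1) i(1-3) j(3,4,1,2), unfolded r fst_conv snd_conv] ac(2)[OF i(3) S] by simp
  qed auto
  then show ?thesis unfolding eq l r .
qed

lemma coh_cone_cmul:
  assumes "coc c"
  shows "coh (cmul cone c) c"
proof -
  obtain V k where eq: "c = (V, k)" by (metis surj_pair)
  note a = assms[unfolded eq] and o = coc_cone[unfolded cone_def]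
  obtain Z z where l: "cmul (\<lambda>_. T, \<lambda>_ _. \<one>\<^bsub>sec P T\<^esub>) (V, k) = (Z, z)" by (metis surj_pair)
  have Z: "Z x = T \<inter> V x" for x using l unfolding cmul_def by auto
  have c: "coc (Z, z)" using coc_cmul[OF o a] l by auto
  have "coh (Z, z) (V, k)"
  proof (rule coh_agree[OF c a, where W = Z])
    show "cover Z" using c by (simp add: cocycle_def)
    show "Z x \<subseteq> V x" for x unfolding Z by blast
    fix x y I assume i: "x \<in> T" "y \<in> T" "Op I" "I \<subseteq> Z x" "I \<subseteq> Z y"
    then have j: "I \<subseteq> T" "I \<subseteq> V x" "I \<subseteq> V y" unfolding Z by auto
    have "res P (V x \<inter> V y) I (k x y) \<in> Sec I"
      using i j cocD(3,5)[OF a] by (auto intro!: res_closed)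
    then show "res P (Z x \<inter> Z y) I (z x y) = res P (V x \<inter> V y) I (k x y)"
      using cmul_at[OF o a i(1-3) j(1,1,2,3), unfolded l fst_conv snd_conv] i(3) j(1) by simp
  qed auto
  then show ?thesis unfolding eq cone_def l .
qed

lemma coh_cinv_cmul:
  assumes "coc c"
  shows "coh (cmul (cinv c) c) cone"
proof -
  obtain V k where eq: "c = (V, k)" by (metis surj_pair)
  note a = assms[unfolded eq]
  obtain k' where v: "cinv (V, k) = (V, k')" unfolding cinv_def by simp
  have k': "k' x y = inv\<^bsub>sec P (V x \<inter> V y)\<^esub> k x y" for x y using v unfolding cinv_def by auto
  have b: "coc (V, k')" using coc_cinv[OF a] v by simp
  obtain Z z where l: "cmul (V, k') (V, k) = (Z, z)" by (metis surj_pair)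
  have Z: "Z x = V x" for x using l unfolding cmul_def by auto
  have c: "coc (Z, z)" using coc_cmul[OF b a] l by auto
  have "coh (Z, z) (\<lambda>_. T, \<lambda>_ _. \<one>\<^bsub>sec P T\<^esub>)"
  proof (rule coh_agree[OF c coc_cone[unfolded cone_def], where W = Z])
    show "cover Z" using c by (simp add: cocycle_def)
    show "Z x \<subseteq> T" if "x \<in> T" for x using openin_subset[OF cocD(3)[OF c that that]] .
    fix x y I assume i: "x \<in> T" "y \<in> T" "Op I" "I \<subseteq> Z x" "I \<subseteq> Z y"
    then have j: "I \<subseteq> V x" "I \<subseteq> V y" "I \<subseteq> T" "I \<subseteq> V x \<inter> V y"
      unfolding Z using openin_subset[OF i(3)] by auto
    have V: "Op (V x \<inter> V y)" using cocD(3)[OF a] i by blast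
    have "res P (V x \<inter> V y) I (k' x y) \<otimes>\<^bsub>sec P I\<^esub> res P (V x \<inter> V y) I (k x y) = \<one>\<^bsub>sec P I\<^esub>"
      unfolding k' res_inv[OF V i(3) j(4) cocD(2)[OF a i(1,2)]]
      using UO_inv_mult(1)[OF i(3) Units_res[OF V i(3) j(4) cocD(2)[OF a i(1,2)]]] .
    then show "res P (Z x \<inter> Z y) I (z x y) = res P (T \<inter> T) I \<one>\<^bsub>sec P T\<^esub>"
      using cmul_at[OF b a i(1-3) j(1,2,1,2), unfolded l fst_conv snd_conv] i(3) j(3) by simp
  qed auto
  then show ?thesis unfolding eq v cone_def l .
qed

lemma structure_oset_sheaf: "oset_sheaf P (structure_oset P)"
  unfolding oset_sheaf_def structure_oset_def using sheaf by (auto simp: ac)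

lemma structure_oset_cone: "has_transition_functions P (structure_oset P) cone"
proof -
  have "trivializes P (structure_oset P) T \<one>\<^bsub>sec P T\<^esub>"
    unfolding trivializes_def structure_oset_def
    by (auto simp: bij_betw_def inj_on_def image_iff)
  then show ?thesis
    unfolding has_transition_functions_def cone_def
    by (auto simp: structure_oset_def Let_def intro!: exI[of _ "\<lambda>_. \<one>\<^bsub>sec P T\<^esub>"])
qed

section \<open>From cohomology classes to isomorphism classes of bundles\<close>

abbreviation bundles :: "('a, 's) cochain \<Rightarrow> ('a, 's) pic_bundle set" where
  "bundles c \<equiv> bundles_of_class P (cls c)"

lemma line_bundle_model:
  assumes "coc (U, g)"
  shows "line_bundle P (model U g)"
  using line_bundle_iff model_sheaf[OF assms] has_trans_model[OF assms] assms by blast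

lemma bundles_cocycle:
  assumes "coc (U, g)"
  shows "bundles (U, g) = iso_class P (model U g)"
  using bundles_of_class_eq[OF model_sheaf[OF assms] assms has_trans_model[OF assms]] .

text \<open>By definition a member has transition functions given by some cocycle of the class.
  Being isomorphic to the model of \<open>c\<close>, it has \<open>c\<close> itself.\<close>

lemma bundles_D:
  assumes "L \<in> bundles c" "coc c"
  shows "oset_sheaf P L" "has_transition_functions P L c"
proof -
  obtain U g where c: "c = (U, g)" by (metis surj_pair)
  have L: "line_bundle P L" "isomorphic_osets P L (model U g)"
    using assms bundles_cocycle[of U g] unfolding c iso_class_def by auto
  show "oset_sheaf P L" using L by (simp add: line_bundle_def)
  then have pre: "oset_presheaf P L" by (simp add: oset_sheaf_iff)
  note preM = model_presheaf[OF assms(2)[unfolded c]]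
  show "has_transition_functions P L c"
    unfolding c using has_trans_iso[OF isomorphic_on_sym[OF L(2) pre preM] preM pre] assms(2)
      has_trans_model unfolding c by blast
qed

lemma bundles_nonempty: "coc c \<Longrightarrow> bundles c \<noteq> {}"
  using bundles_cocycle line_bundle_model isomorphic_on_refl unfolding iso_class_def
  by (metis (mono_tags, lifting) empty_iff mem_Collect_eq surj_pair)

text \<open>A bundle lying in both classes has \<open>c\<close> and \<open>d\<close> as transition
  functions, and two frames of one bundle give cohomologous cocycles. Nonemptiness of the classes,
  supplied by the model, makes this apply.\<close>

lemma bundles_eq_iff:
  assumes "coc c" "coc d"
  shows "bundles c = bundles d \<longleftrightarrow> coh c d"
proof
  assume "bundles c = bundles d"
  then obtain L where L: "L \<in> bundles c" "L \<in> bundles d" using bundles_nonempty[OF assms(1)] by blast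
  obtain U g V k where eq: "c = (U, g)" "d = (V, k)" by (metis surj_pair)
  have pre: "oset_presheaf P L" using bundles_D(1)[OF L(1) assms(1)] by (simp add: oset_sheaf_iff)
  show "coh c d"
    using has_trans_coh[OF pre] bundles_D(2)[OF L(1) assms(1)] bundles_D(2)[OF L(2) assms(2)] assms unfolding eq by blast
next
  assume "coh c d"
  then show "bundles c = bundles d" using cls_eq_iff[OF assms] by simp
qed

lemma Pic_carrier: "carrier (Pic P) = bundles ` Collect coc"
proof (intro equalityI subsetI)
  fix C assume "C \<in> carrier (Pic P)"
  then obtain L :: "('a, 's) pic_bundle" where L: "line_bundle P L" "C = iso_class P L"
    by (auto simp: Pic_def)
  then obtain U g where "coc (U, g)" "has_transition_functions P L (U, g)" "oset_sheaf P L"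
    using line_bundle_iff by blast
  then show "C \<in> bundles ` Collect coc" using bundles_of_class_eq L(2) by blast
next
  fix C assume "C \<in> bundles ` Collect coc"
  then obtain U g where "coc (U, g)" "C = bundles (U, g)" by auto
  then show "C \<in> carrier (Pic P)" using bundles_cocycle line_bundle_model by (auto simp: Pic_def)
qed

text \<open>The product in \<open>Pic\<close> is a union over all pairs of members. Every such pair
  has a tensor product with transition functions \<open>cmul c d\<close>, so the union consists of
  copies of one class.\<close>

lemma Pic_mult:
  assumes "coc c" "coc d"
  shows "bundles c \<otimes>\<^bsub>Pic P\<^esub> bundles d = bundles (cmul c d)"
proof -
  obtain U g V k where eq: "c = (U, g)" "d = (V, k)" by (metis surj_pair)
  have t: "iso_class P (tensor P L N) = bundles (cmul c d)" if LN: "L \<in> bundles c" "N \<in> bundles d"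
    for L N :: "('a, 's) pic_bundle"
  proof -
    note l = bundles_D[OF LN(1) assms(1)] and n = bundles_D[OF LN(2) assms(2)]
    interpret two_osets P L N by unfold_locales (use l n in \<open>simp_all add: oset_sheaf_iff\<close>)
    show ?thesis
      using bundles_of_class_eq[OF tensor_sheaf] coc_cmul has_trans_tensor l(2) n(2) assms unfolding eq by metis
  qed
  have "(\<Union>L\<in>bundles c. \<Union>N\<in>bundles d. iso_class P (tensor P L N)) = bundles (cmul c d)"
    using t bundles_nonempty[OF assms(1)] bundles_nonempty[OF assms(2)] by (intro SUP_eq_const) auto
  then show ?thesis by (simp add: Pic_def)
qed

lemma Pic_one: "\<one>\<^bsub>Pic P\<^esub> = bundles cone"
  using bundles_of_class_eq[OF structure_oset_sheaf coc_cone structure_oset_cone] by (simp add: Pic_def)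

lemma coc_cmul': "coc c \<Longrightarrow> coc d \<Longrightarrow> coc (cmul c d)"
  using coc_cmul by (metis surj_pair)

text \<open>Each element is represented by a cocycle, and each group law is the image under
  \<open>bundles\<close> of the corresponding cohomology relation between cochains. Inverse bundles
  come from the inverted transition functions.\<close>

lemma comm_group_Pic: "comm_group (Pic P)"
proof (rule comm_groupI)
  show "\<one>\<^bsub>Pic P\<^esub> \<in> carrier (Pic P)" using coc_cone unfolding Pic_carrier Pic_one by blast
  fix C assume "C \<in> carrier (Pic P)"
  then obtain c where c: "coc c" "C = bundles c" unfolding Pic_carrier by blast
  show "\<one>\<^bsub>Pic P\<^esub> \<otimes>\<^bsub>Pic P\<^esub> C = C"
    unfolding Pic_one c(2) Pic_mult[OF coc_cone c(1)]
    using bundles_eq_iff[OF coc_cmul'[OF coc_cone c(1)] c(1)] coh_cone_cmul[OF c(1)] by blast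
  have ci: "coc (cinv c)" using coc_cinv c(1) by (metis surj_pair)
  have "bundles (cinv c) \<otimes>\<^bsub>Pic P\<^esub> C = \<one>\<^bsub>Pic P\<^esub>"
    unfolding Pic_one c(2) Pic_mult[OF ci c(1)]
    using bundles_eq_iff[OF coc_cmul'[OF ci c(1)] coc_cone] coh_cinv_cmul[OF c(1)] by blast
  then show "\<exists>D\<in>carrier (Pic P). D \<otimes>\<^bsub>Pic P\<^esub> C = \<one>\<^bsub>Pic P\<^esub>"
    using ci unfolding Pic_carrier by blast
  fix D assume "D \<in> carrier (Pic P)"
  then obtain d where d: "coc d" "D = bundles d" unfolding Pic_carrier by blast
  show "C \<otimes>\<^bsub>Pic P\<^esub> D \<in> carrier (Pic P)"
    unfolding c(2) d(2) Pic_mult[OF c(1) d(1)] Pic_carrier using coc_cmul'[OF c(1) d(1)] by blast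
  show "C \<otimes>\<^bsub>Pic P\<^esub> D = D \<otimes>\<^bsub>Pic P\<^esub> C"
    unfolding c(2) d(2) Pic_mult[OF c(1) d(1)] Pic_mult[OF d(1) c(1)]
    using bundles_eq_iff[OF coc_cmul'[OF c(1) d(1)] coc_cmul'[OF d(1) c(1)]] coh_cmul_comm[OF c(1) d(1)] by blast
  fix E assume "E \<in> carrier (Pic P)"
  then obtain e where e: "coc e" "E = bundles e" unfolding Pic_carrier by blast
  note cd = coc_cmul'[OF c(1) d(1)] and de = coc_cmul'[OF d(1) e(1)]
  show "C \<otimes>\<^bsub>Pic P\<^esub> D \<otimes>\<^bsub>Pic P\<^esub> E = C \<otimes>\<^bsub>Pic P\<^esub> (D \<otimes>\<^bsub>Pic P\<^esub> E)"
    unfolding c(2) d(2) e(2) Pic_mult[OF c(1) d(1)] Pic_mult[OF d(1) e(1)] Pic_mult[OF cd e(1)] Pic_mult[OF c(1) de]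
    using bundles_eq_iff[OF coc_cmul'[OF cd e(1)] coc_cmul'[OF c(1) de]] coh_cmul_assoc[OF c(1) d(1) e(1)] by blast
qed

end

section \<open>The connecting homomorphism\<close>

context mero
begin

text \<open>Collects the witnesses that are quantified in \<open>connecting\<close>: a cover, local
  equations \<open>f\<close> of the divisor, and the cocycle \<open>g\<close> of their
  quotients.\<close>

definition lifting :: "('a, 's) divisor \<Rightarrow> ('a \<Rightarrow> 'a set) \<Rightarrow> ('a \<Rightarrow> ('a, 's) mero) \<Rightarrow> ('a \<Rightarrow> 'a \<Rightarrow> 's) \<Rightarrow> bool" where
  "lifting D U f g \<longleftrightarrow> lifts_divisor X D U f \<and> coc (U, g) \<and>
    (\<forall>x\<in>T. \<forall>y\<in>T. tm (U x \<inter> U y) (g x y) \<otimes>\<^bsub>sec MS (U x \<inter> U y)\<^esub> res MS (U x) (U x \<inter> U y) (f x)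
      = res MS (U y) (U x \<inter> U y) (f y))"

lemma lifts_divisor_iff:
  "lifts_divisor X D U f \<longleftrightarrow> cover U \<and> (\<forall>x\<in>T. f x \<in> Units (sec MS (U x)) \<and> LD (U x) (f x) = res CS T (U x) D)"
  by (simp add: lifts_divisor_def)

lemma MS_mult [simp]: "Op U \<Longrightarrow> a \<in> carrier (sec MS U) \<Longrightarrow> b \<in> carrier (sec MS U) \<Longrightarrow> a \<otimes>\<^bsub>sec MS U\<^esub> b \<in> carrier (sec MS U)"
  using MS.mult_closed by simp

lemma liftingD:
  assumes "lifting D U f g" "x \<in> T"
  shows "cover U" "coc (U, g)" "Op (U x)" "x \<in> U x" "f x \<in> Units (sec MS (U x))" "f x \<in> carrier (sec MS (U x))"
    "LD (U x) (f x) = res CS T (U x) D"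
proof -
  show "cover U" "coc (U, g)" "f x \<in> Units (sec MS (U x))" "LD (U x) (f x) = res CS T (U x) D"
    using assms by (auto simp: lifting_def lifts_divisor_iff)
  then show "Op (U x)" "x \<in> U x" "f x \<in> carrier (sec MS (U x))"
    using coverD assms(2) by (auto simp: Units_def)
qed

lemma MS_res:
  assumes "Op U" "Op V" "V \<subseteq> U" "f \<in> Units (sec MS U)"
  shows "res MS U V f \<in> Units (sec MS V)" "res MS U V f \<in> carrier (sec MS V)"
  using MS.Units_res[of U V f] assms by (auto simp: Units_def)

lemma MS_cancel:
  assumes "Op V" "a \<in> Sec V" "b \<in> Sec V" "f \<in> Units (sec MS V)" "tm V a \<otimes>\<^bsub>sec MS V\<^esub> f = tm V b \<otimes>\<^bsub>sec MS V\<^esub> f"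
  shows "a = b"
proof -
  have f: "f \<in> carrier (sec MS V)" using assms(4) by (simp add: Units_def)
  have "f \<otimes>\<^bsub>sec MS V\<^esub> tm V a = f \<otimes>\<^bsub>sec MS V\<^esub> tm V b"
    using assms(5) MS.ac(2)[of V f "tm V a"] MS.ac(2)[of V f "tm V b"] assms(1-3) f by simp
  then show ?thesis
    using monoid.Units_l_cancel[OF MS.monoid_sec assms(4)] assms(1-3) tm_inj by simp
qed

lemma lifting_at:
  assumes "lifting D U f g" "x \<in> T" "y \<in> T" "Op V" "V \<subseteq> U x" "V \<subseteq> U y"
  shows "tm V (res X (U x \<inter> U y) V (g x y)) \<otimes>\<^bsub>sec MS V\<^esub> res MS (U x) V (f x) = res MS (U y) V (f y)"
proof -
  note x = liftingD[OF assms(1,2)] and y = liftingD[OF assms(1,3)]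
  let ?I = "U x \<inter> U y"
  have I: "Op ?I" "V \<subseteq> ?I" "?I \<subseteq> U x" "?I \<subseteq> U y" using x y assms by auto
  have g: "g x y \<in> Sec ?I" using cocD(5)[OF x(2) assms(2,3)] .
  have "tm ?I (g x y) \<otimes>\<^bsub>sec MS ?I\<^esub> res MS (U x) ?I (f x) = res MS (U y) ?I (f y)"
    using assms(1-3) by (simp add: lifting_def)
  from arg_cong[OF this, of "res MS ?I V"] show ?thesis
    using I g x(3,5,6) y(3,5,6) assms(4) MS_res(2)[OF x(3) I(1,3) x(5)]
      MS.res_res[of "U x" ?I V "f x"] MS.res_res[of "U y" ?I V "f y"] by (simp add: tm_res)
qed

text \<open>On an overlap two local equations define the same divisor, so by
  \<open>LD_eq_iff\<close> they differ by a unit of \<open>O_X\<close>. The cocycle identity for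
  these units holds after multiplication with the invertible \<open>f x\<close>, hence, by
  \<open>MS_cancel\<close>, in \<open>O_X\<close>.\<close>

lemma ex_lifting:
  assumes D: "D \<in> carrier (sec CS T)"
  shows "\<exists>U f g. lifting D U f g"
proof -
  have "\<forall>x\<in>T. \<exists>V f. Op V \<and> x \<in> V \<and> f \<in> Units (sec MS V) \<and> res CS T V D = LD V f"
    using CS_locally[OF D] by metis
  then obtain U f where Uf: "\<And>x. x \<in> T \<Longrightarrow> Op (U x) \<and> x \<in> U x \<and> f x \<in> Units (sec MS (U x)) \<and>
      res CS T (U x) D = LD (U x) (f x)" by metis
  have cov: "cover U" using Uf by (simp add: point_cover_def)
  have fc: "f x \<in> carrier (sec MS (U x))" if "x \<in> T" for x using Uf[OF that] by (simp add: Units_def)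
  have "\<exists>u\<in>UO (U x \<inter> U y). res MS (U y) (U x \<inter> U y) (f y) =
      tm (U x \<inter> U y) u \<otimes>\<^bsub>sec MS (U x \<inter> U y)\<^esub> res MS (U x) (U x \<inter> U y) (f x)" if xy: "x \<in> T" "y \<in> T" for x y
  proof -
    let ?I = "U x \<inter> U y"
    have I: "Op ?I" "?I \<subseteq> U x" "?I \<subseteq> U y" using Uf xy by auto
    have L: "LD ?I (res MS (U z) ?I (f z)) = res CS T ?I D" if z: "z \<in> T" "?I \<subseteq> U z" for z
    proof -
      have "LD ?I (res MS (U z) ?I (f z)) = res CS (U z) ?I (res CS T (U z) D)"
        using LD_res[of "U z" ?I "f z"] Uf[OF z(1)] I(1) z(2) by simp
      then show ?thesis
        using CS.res_res[of T "U z" ?I D] D Uf[OF z(1)] I(1) z(2) openin_subset[of "sp X" "U z"] by simp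
    qed
    show ?thesis
      using LD_eq_iff[OF I(1), of "res MS (U x) ?I (f x)" "res MS (U y) ?I (f y)"] L[OF xy(1) I(2)] L[OF xy(2) I(3)]
        MS_res(1) I Uf xy by simp
  qed
  then obtain g where g: "\<And>x y. x \<in> T \<Longrightarrow> y \<in> T \<Longrightarrow> g x y \<in> UO (U x \<inter> U y) \<and>
      res MS (U y) (U x \<inter> U y) (f y) = tm (U x \<inter> U y) (g x y) \<otimes>\<^bsub>sec MS (U x \<inter> U y)\<^esub> res MS (U x) (U x \<inter> U y) (f x)"
    by metis
  have gS: "g x y \<in> Sec (U x \<inter> U y)" if "x \<in> T" "y \<in> T" for x y
    using g[OF that] by (simp add: Units_def)
  have at: "res MS (U y) V (f y) = tm V (res X (U x \<inter> U y) V (g x y)) \<otimes>\<^bsub>sec MS V\<^esub> res MS (U x) V (f x)"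
    if a: "x \<in> T" "y \<in> T" "Op V" "V \<subseteq> U x" "V \<subseteq> U y" for x y V
  proof -
    let ?I = "U x \<inter> U y"
    have I: "Op ?I" "V \<subseteq> ?I" "?I \<subseteq> U x" "?I \<subseteq> U y" using Uf a by auto
    show ?thesis
      using arg_cong[OF conjunct2[OF g[OF a(1,2)]], of "res MS ?I V"] I gS[OF a(1,2)] Uf[OF a(1)] Uf[OF a(2)] fc a
        MS_res(2)[of "U x" ?I "f x"]
        MS.res_res[of "U x" ?I V "f x"] MS.res_res[of "U y" ?I V "f y"] by (simp add: tm_res)
  qed
  have "coc (U, g)"
  proof (rule cocI[OF cov])
    show "g x y \<in> UO (U x \<inter> U y)" if "x \<in> T" "y \<in> T" for x y using g[OF that] by simp
    fix x y z V assume a: "x \<in> T" "y \<in> T" "z \<in> T" "Op V" "V \<subseteq> U x" "V \<subseteq> U y" "V \<subseteq> U z"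
    define p q r where "p = res X (U x \<inter> U y) V (g x y)" and "q = res X (U y \<inter> U z) V (g y z)"
      and "r = res X (U x \<inter> U z) V (g x z)"
    have S: "p \<in> Sec V" "q \<in> Sec V" "r \<in> Sec V"
      unfolding p_def q_def r_def using a Uf gS by (auto intro!: res_closed)
    have F: "res MS (U x) V (f x) \<in> Units (sec MS V)" "res MS (U x) V (f x) \<in> carrier (sec MS V)"
      using MS_res[of "U x" V "f x"] Uf a by auto
    \<comment> \<open>Both \<open>q p\<close> and \<open>r\<close> carry \<open>f x\<close> to
      \<open>f z\<close>, the first by way of \<open>f y\<close>.\<close>
    have "tm V (q \<otimes>\<^bsub>sec X V\<^esub> p) \<otimes>\<^bsub>sec MS V\<^esub> res MS (U x) V (f x) =
        tm V q \<otimes>\<^bsub>sec MS V\<^esub> (tm V p \<otimes>\<^bsub>sec MS V\<^esub> res MS (U x) V (f x))"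
      using S F(2) a(4) MS.ac(1)[of V] by (simp add: tm_mult)
    also have "\<dots> = tm V r \<otimes>\<^bsub>sec MS V\<^esub> res MS (U x) V (f x)"
      unfolding p_def q_def r_def using at[OF a(1,2,4,5,6)] at[OF a(2,3,4,6,7)] at[OF a(1,3,4,5,7)] by simp
    finally have "q \<otimes>\<^bsub>sec X V\<^esub> p = r" using MS_cancel[OF a(4) _ S(3) F(1)] S a(4) by simp
    then show "res X (U x \<inter> U y) V (g x y) \<otimes>\<^bsub>sec X V\<^esub> res X (U y \<inter> U z) V (g y z) = res X (U x \<inter> U z) V (g x z)"
      using ac(2)[OF a(4) S(1,2)] unfolding p_def q_def r_def by simp
  qed
  then have "lifting D U f g"
    using cov Uf g unfolding lifting_def lifts_divisor_iff by simp
  then show ?thesis by blast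
qed

text \<open>The two local equations at \<open>x\<close> define the same divisor, so they differ by a
  unit \<open>h x\<close>. Comparing \<open>f' y\<close> with \<open>f x\<close> through
  \<open>f' x\<close> and through \<open>f y\<close> gives the coboundary relation.\<close>

lemma lifting_coh:
  assumes l: "lifting D U f g" and l': "lifting D U' f' g'" and D: "D \<in> carrier (sec CS T)"
  shows "coh (U, g) (U', g')"
proof -
  define W where "W = (\<lambda>x. U x \<inter> U' x)"
  have O: "Op (W x)" "W x \<subseteq> U x" "W x \<subseteq> U' x" "Op (U x)" "Op (U' x)" if "x \<in> T" for x
    using liftingD(3)[OF l that] liftingD(3)[OF l' that] unfolding W_def by auto
  have "\<exists>u\<in>UO (W x). res MS (U' x) (W x) (f' x) = tm (W x) u \<otimes>\<^bsub>sec MS (W x)\<^esub> res MS (U x) (W x) (f x)"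
    if x: "x \<in> T" for x
  proof -
    note o = O[OF x] and d = liftingD[OF l x] and d' = liftingD[OF l' x]
    have "LD (W x) (res MS (U x) (W x) (f x)) = res CS T (W x) D"
      using LD_res[OF o(4,1,2) d(5)] d(7) CS.res_res[of T "U x" "W x" D] o D openin_subset[OF o(4)] by simp
    moreover have "LD (W x) (res MS (U' x) (W x) (f' x)) = res CS T (W x) D"
      using LD_res[OF o(5,1,3) d'(5)] d'(7) CS.res_res[of T "U' x" "W x" D] o D openin_subset[OF o(5)] by simp
    ultimately show ?thesis
      using LD_eq_iff[OF o(1) MS_res(1)[OF o(4,1,2) d(5)] MS_res(1)[OF o(5,1,3) d'(5)]] by simp
  qed
  then obtain h where h: "\<And>x. x \<in> T \<Longrightarrow> h x \<in> UO (W x) \<and>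
      res MS (U' x) (W x) (f' x) = tm (W x) (h x) \<otimes>\<^bsub>sec MS (W x)\<^esub> res MS (U x) (W x) (f x)" by metis
  have hS: "h x \<in> Sec (W x)" if "x \<in> T" for x using h[OF that] by (simp add: Units_def)
  have hat: "res MS (U' x) V (f' x) = tm V (res X (W x) V (h x)) \<otimes>\<^bsub>sec MS V\<^esub> res MS (U x) V (f x)"
    if x: "x \<in> T" "Op V" "V \<subseteq> W x" for x V
    using arg_cong[OF conjunct2[OF h[OF x(1)]], of "res MS (W x) V"] O[OF x(1)] x hS[OF x(1)]
      liftingD(5,6)[OF l x(1)] liftingD(5,6)[OF l' x(1)] MS_res(2)[of "U x" "W x" "f x"]
      MS.res_res[of "U x" "W x" V "f x"] MS.res_res[of "U' x" "W x" V "f' x"] by (simp add: tm_res)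
  show ?thesis
  proof (rule cohI[of W _ _ h])
    show "cover W" using O liftingD(4)[OF l] liftingD(4)[OF l'] unfolding point_cover_def W_def by simp
    show "W x \<subseteq> U x" "W x \<subseteq> U' x" "h x \<in> UO (W x)" if "x \<in> T" for x using O h that by auto
    fix x y V assume a: "x \<in> T" "y \<in> T" "Op V" "V \<subseteq> W x" "V \<subseteq> W y"
    have i: "V \<subseteq> U x" "V \<subseteq> U y" "V \<subseteq> U' x" "V \<subseteq> U' y" using a O(2,3) by blast+
    define p p' k k' F where "p = res X (U x \<inter> U y) V (g x y)" and "p' = res X (U' x \<inter> U' y) V (g' x y)"
      and "k = res X (W x) V (h x)" and "k' = res X (W y) V (h y)" and "F = res MS (U x) V (f x)"
    have S: "p \<in> Sec V" "p' \<in> Sec V" "k \<in> Sec V" "k' \<in> Sec V"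
      unfolding p_def p'_def k_def k'_def
      using a i O hS cocD(5)[OF liftingD(2)[OF l a(1)] a(1,2)] cocD(5)[OF liftingD(2)[OF l' a(1)] a(1,2)]
      by (auto intro!: res_closed)
    have F: "F \<in> Units (sec MS V)" "F \<in> carrier (sec MS V)"
      unfolding F_def using MS_res[OF O(4)[OF a(1)] a(3) i(1) liftingD(5)[OF l a(1)]] by auto
    have "tm V (p' \<otimes>\<^bsub>sec X V\<^esub> k) \<otimes>\<^bsub>sec MS V\<^esub> F = tm V p' \<otimes>\<^bsub>sec MS V\<^esub> (tm V k \<otimes>\<^bsub>sec MS V\<^esub> F)"
      using S F(2) a(3) MS.ac(1)[of V] by (simp add: tm_mult)
    also have "\<dots> = tm V k' \<otimes>\<^bsub>sec MS V\<^esub> (tm V p \<otimes>\<^bsub>sec MS V\<^esub> F)"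
      unfolding p_def p'_def k_def k'_def F_def
      using hat[OF a(1,3,4)] hat[OF a(2,3,5)] lifting_at[OF l a(1-3) i(1,2)] lifting_at[OF l' a(1-3) i(3,4)] by simp
    also have "\<dots> = tm V (k' \<otimes>\<^bsub>sec X V\<^esub> p) \<otimes>\<^bsub>sec MS V\<^esub> F"
      using S F(2) a(3) MS.ac(1)[of V] by (simp add: tm_mult)
    finally have "p' \<otimes>\<^bsub>sec X V\<^esub> k = k' \<otimes>\<^bsub>sec X V\<^esub> p" using MS_cancel[OF a(3) _ _ F(1)] S a(3) by simp
    then show "res X (U' x \<inter> U' y) V (g' x y) \<otimes>\<^bsub>sec X V\<^esub> res X (W x) V (h x) =
        res X (U x \<inter> U y) V (g x y) \<otimes>\<^bsub>sec X V\<^esub> res X (W y) V (h y)"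
      using ac(2)[OF a(3) S(1,4)] unfolding p_def p'_def k_def k'_def by simp
  qed
qed

text \<open>\<open>connecting\<close> is the union of the classes obtained from all choices; by
  \<open>lifting_coh\<close> these classes are equal, so a single lifting computes it.\<close>

lemma connecting_eq:
  assumes "lifting D U f g" "D \<in> carrier (sec CS T)"
  shows "connecting X D = cls (U, g)"
proof -
  have "connecting X D = \<Union>{cls (V, k) | V k. \<exists>e. lifting D V e k}"
    unfolding connecting_def lifting_def Let_def by (intro arg_cong[of _ _ Union] Collect_cong) blast
  also have "\<dots> = cls (U, g)"
  proof -
    have "cls (V, k) = cls (U, g)" if "lifting D V e k" for V e k
    proof -
      have "coc (V, k)" "coc (U, g)" using that assms(1) unfolding lifting_def by auto
      then show ?thesis using lifting_coh[OF that assms] cls_eq_iff by blast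
    qed
    then show ?thesis using assms(1) by blast
  qed
  finally show ?thesis .
qed

section \<open>The homomorphism from Cartier divisors to line bundles\<close>

abbreviation Div :: "('a, 's) divisor monoid" where "Div \<equiv> cartier_divisors X"

text \<open>The map of the theorem before passing to cosets. As a homomorphism defined on divisors
  it is accessible to the first isomorphism theorem.\<close>

definition \<kappa> :: "('a, 's) divisor \<Rightarrow> ('a, 's) pic_bundle set" where
  "\<kappa> D = bundles_of_class X (connecting X D)"

lemma Div_eq: "Div = sec CS T"
  by (simp add: cartier_divisors_def)

lemma comm_group_Div: "comm_group Div"
  unfolding Div_eq using comm_group_CS by simp

lemma \<kappa>_eq: "lifting D U f g \<Longrightarrow> D \<in> carrier Div \<Longrightarrow> \<kappa> D = bundles (U, g)"
  unfolding \<kappa>_def Div_eq using connecting_eq by simp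

text \<open>Products of local equations on the common refinement are local equations of the product
  divisor, and their quotients are the products of the two cocycles. The cochains
  \<open>cmul\<close> and \<open>F\<close> use the same intersections, so no further refinement is
  made.\<close>

lemma lifting_mult:
  assumes l: "lifting D U f g" and l': "lifting D' U' f' g'" and D: "D \<in> carrier Div" "D' \<in> carrier Div"
  shows "\<exists>F. lifting (D \<otimes>\<^bsub>Div\<^esub> D') (fst (cmul (U, g) (U', g'))) F (snd (cmul (U, g) (U', g')))"
proof -
  define Z where "Z = (\<lambda>x. U x \<inter> U' x)"
  define F where "F = (\<lambda>x. res MS (U x) (Z x) (f x) \<otimes>\<^bsub>sec MS (Z x)\<^esub> res MS (U' x) (Z x) (f' x))"
  define m where "m = snd (cmul (U, g) (U', g'))"
  have cm: "fst (cmul (U, g) (U', g')) = Z" by (simp add: cmul_def Z_def)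
  have O: "Op (Z x)" "Z x \<subseteq> U x" "Z x \<subseteq> U' x" "Op (U x)" "Op (U' x)" if "x \<in> T" for x
    using liftingD(3)[OF l that] liftingD(3)[OF l' that] unfolding Z_def by auto
  have r: "res MS (U x) V (f x) \<in> Units (sec MS V)" "res MS (U' x) V (f' x) \<in> Units (sec MS V)"
    "res MS (U x) V (f x) \<in> carrier (sec MS V)" "res MS (U' x) V (f' x) \<in> carrier (sec MS V)"
    if "x \<in> T" "Op V" "V \<subseteq> Z x" for x V
    using MS_res[of "U x" V "f x"] MS_res[of "U' x" V "f' x"] O[OF that(1)] that(2,3)
      liftingD(5)[OF l that(1)] liftingD(5)[OF l' that(1)] by auto
  have "cover Z" using O liftingD(4)[OF l] liftingD(4)[OF l'] unfolding point_cover_def Z_def by simp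
  moreover have "F x \<in> Units (sec MS (Z x))" if x: "x \<in> T" for x
    unfolding F_def using monoid.Units_m_closed[OF MS.monoid_sec r(1,2)[OF x _ subset_refl]] O(1)[OF x] by simp
  moreover have "LD (Z x) (F x) = res CS T (Z x) (D \<otimes>\<^bsub>Div\<^esub> D')" if x: "x \<in> T" for x
  proof -
    note o = O[OF x]
    have "res CS T (Z x) (D \<otimes>\<^bsub>Div\<^esub> D') = res CS T (Z x) D \<otimes>\<^bsub>sec CS (Z x)\<^esub> res CS T (Z x) D'"
      using D o openin_subset[OF o(1)] unfolding Div_eq by simp
    moreover have "res CS T (Z x) D = LD (Z x) (res MS (U x) (Z x) (f x))"
      using LD_res[OF o(4,1,2) liftingD(5)[OF l x]] liftingD(7)[OF l x] CS.res_res[of T "U x" "Z x" D] o D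
        openin_subset[OF o(4)] unfolding Div_eq by simp
    moreover have "res CS T (Z x) D' = LD (Z x) (res MS (U' x) (Z x) (f' x))"
      using LD_res[OF o(5,1,3) liftingD(5)[OF l' x]] liftingD(7)[OF l' x] CS.res_res[of T "U' x" "Z x" D'] o D
        openin_subset[OF o(5)] unfolding Div_eq by simp
    ultimately show ?thesis
      unfolding F_def using LD_mult[OF o(1) r(1,2)[OF x o(1) subset_refl]] by simp
  qed
  moreover have cc: "coc (Z, m)"
  proof -
    have "cmul (U, g) (U', g') = (Z, m)" using cm unfolding m_def by (metis prod.collapse)
    then show ?thesis using coc_cmul[of U g U' g'] l l' by (simp add: lifting_def)
  qed
  moreover have "tm (Z x \<inter> Z y) (m x y) \<otimes>\<^bsub>sec MS (Z x \<inter> Z y)\<^esub> res MS (Z x) (Z x \<inter> Z y) (F x) =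
      res MS (Z y) (Z x \<inter> Z y) (F y)" if xy: "x \<in> T" "y \<in> T" for x y
  proof -
    let ?V = "Z x \<inter> Z y"
    have V: "Op ?V" "?V \<subseteq> Z x" "?V \<subseteq> Z y" using O xy by auto
    have i: "?V \<subseteq> U x" "?V \<subseteq> U y" "?V \<subseteq> U' x" "?V \<subseteq> U' y" unfolding Z_def by auto
    define p q where "p = res X (U x \<inter> U y) ?V (g x y)" and "q = res X (U' x \<inter> U' y) ?V (g' x y)"
    have S: "p \<in> Sec ?V" "q \<in> Sec ?V"
      unfolding p_def q_def
      using V i O xy cocD(5)[OF liftingD(2)[OF l xy(1)] xy] cocD(5)[OF liftingD(2)[OF l' xy(1)] xy]
      by (auto intro!: res_closed)
    have m: "m x y = p \<otimes>\<^bsub>sec X ?V\<^esub> q" unfolding m_def p_def q_def cmul_def Z_def by simp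
    have Fr: "res MS (Z z) ?V (F z) = res MS (U z) ?V (f z) \<otimes>\<^bsub>sec MS ?V\<^esub> res MS (U' z) ?V (f' z)"
      if "z \<in> T" "?V \<subseteq> Z z" for z
      unfolding F_def using O[OF that(1)] that V(1) r(3,4)[OF that(1), of "Z z"]
        liftingD(6)[OF l that(1)] liftingD(6)[OF l' that(1)]
        MS.res_res[of "U z" "Z z" ?V "f z"] MS.res_res[of "U' z" "Z z" ?V "f' z"] by simp
    define u v where "u = res MS (U x) ?V (f x)" and "v = res MS (U' x) ?V (f' x)"
    have uv: "u \<in> carrier (sec MS ?V)" "v \<in> carrier (sec MS ?V)"
      unfolding u_def v_def using r(3,4)[OF xy(1) V(1,2)] .
    have "tm ?V (p \<otimes>\<^bsub>sec X ?V\<^esub> q) \<otimes>\<^bsub>sec MS ?V\<^esub> (u \<otimes>\<^bsub>sec MS ?V\<^esub> v) =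
        (tm ?V p \<otimes>\<^bsub>sec MS ?V\<^esub> u) \<otimes>\<^bsub>sec MS ?V\<^esub> (tm ?V q \<otimes>\<^bsub>sec MS ?V\<^esub> v)"
      using S V(1) uv MS.ac[of ?V] by (simp add: tm_mult)
    then show ?thesis
      unfolding m Fr[OF xy(1) V(2)] Fr[OF xy(2) V(3)] lifting_at[OF l xy V(1) i(1,2), symmetric]
        lifting_at[OF l' xy V(1) i(3,4), symmetric] u_def v_def p_def q_def .
  qed
  ultimately have "lifting (D \<otimes>\<^bsub>Div\<^esub> D') Z F m" unfolding lifting_def lifts_divisor_iff by blast
  then show ?thesis unfolding cm m_def by blast
qed

lemma \<kappa>_hom: "\<kappa> \<in> hom Div (Pic X)"
proof (rule homI)
  fix D assume D: "D \<in> carrier Div"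
  then obtain U f g where l: "lifting D U f g" using ex_lifting unfolding Div_eq by blast
  then have c: "coc (U, g)" by (simp add: lifting_def)
  then show "\<kappa> D \<in> carrier (Pic X)" unfolding \<kappa>_eq[OF l D] Pic_carrier by blast
  fix D' assume D': "D' \<in> carrier Div"
  then obtain U' f' g' where l': "lifting D' U' f' g'" using ex_lifting unfolding Div_eq by blast
  then have c': "coc (U', g')" by (simp add: lifting_def)
  obtain F where F: "lifting (D \<otimes>\<^bsub>Div\<^esub> D') (fst (cmul (U, g) (U', g'))) F (snd (cmul (U, g) (U', g')))"
    using lifting_mult[OF l l' D D'] by blast
  have DD: "D \<otimes>\<^bsub>Div\<^esub> D' \<in> carrier Div" using D D' unfolding Div_eq by simp
  show "\<kappa> (D \<otimes>\<^bsub>Div\<^esub> D') = \<kappa> D \<otimes>\<^bsub>Pic X\<^esub> \<kappa> D'"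
    unfolding \<kappa>_eq[OF F DD] \<kappa>_eq[OF l D] \<kappa>_eq[OF l' D'] Pic_mult[OF c c'] by simp
qed

lemma lifting_principal:
  assumes F: "F \<in> Units (sec MS T)"
  shows "lifting (LD T F) (\<lambda>_. T) (\<lambda>_. F) (\<lambda>_ _. \<one>\<^bsub>sec X T\<^esub>)"
proof -
  have "LD T F \<in> carrier (sec CS T)" "F \<in> carrier (sec MS T)"
    using LD_closed[OF OpT F] F by (auto simp: Units_def)
  then show ?thesis
    unfolding lifting_def lifts_divisor_iff
    using F coc_cone[unfolded cone_def] cover_T CS.res_id[of T "LD T F"] MS.res_id[of T F] by (simp add: tm_one)
qed

text \<open>Triviality of the class means \<open>h x = g x y h y\<close> for suitable units. Then
  \<open>h x f x = h y g x y f x = h y f y\<close>, so the corrected local equations glue to one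
  global meromorphic function with divisor \<open>D\<close>.\<close>

lemma principal_of_coh:
  assumes l: "lifting D U f g" and D: "D \<in> carrier (sec CS T)" and co: "coh (U, g) cone"
  shows "\<exists>F\<in>Units (sec MS T). D = LD T F"
proof -
  have c: "coc (U, g)" using l by (simp add: lifting_def)
  obtain W h where W: "cover W" "\<And>x. x \<in> T \<Longrightarrow> W x \<subseteq> U x" "\<And>x. x \<in> T \<Longrightarrow> W x \<subseteq> T"
    and h: "\<And>x. x \<in> T \<Longrightarrow> h x \<in> UO (W x)" "\<And>x. x \<in> T \<Longrightarrow> h x \<in> Sec (W x)"
    and eq: "\<And>x y V. x \<in> T \<Longrightarrow> y \<in> T \<Longrightarrow> Op V \<Longrightarrow> V \<subseteq> W x \<Longrightarrow> V \<subseteq> W y \<Longrightarrow>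
      res X (T \<inter> T) V \<one>\<^bsub>sec X T\<^esub> \<otimes>\<^bsub>sec X V\<^esub> res X (W x) V (h x)
        = res X (U x \<inter> U y) V (g x y) \<otimes>\<^bsub>sec X V\<^esub> res X (W y) V (h y)"
    using cohE[OF co[unfolded cone_def] c coc_cone[unfolded cone_def]] by blast
  \<comment> \<open>The corrected equation still defines \<open>D\<close> locally, because
    multiplication with the image of a unit of \<open>O_X\<close> leaves the local divisor
    unchanged.\<close>
  define F where "F = (\<lambda>x. tm (W x) (h x) \<otimes>\<^bsub>sec MS (W x)\<^esub> res MS (U x) (W x) (f x))"
  have O: "Op (W x)" "Op (U x)" "x \<in> W x" if "x \<in> T" for x
    using coverD[OF W(1) that] liftingD(3)[OF l that] by auto
  have r: "res MS (U x) V (f x) \<in> Units (sec MS V)" "res MS (U x) V (f x) \<in> carrier (sec MS V)"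
    if "x \<in> T" "Op V" "V \<subseteq> W x" for x V
    using MS_res[of "U x" V "f x"] O[OF that(1)] W(2)[OF that(1)] that liftingD(5)[OF l that(1)] by auto
  have FU: "F x \<in> Units (sec MS (W x))" "F x \<in> carrier (sec MS (W x))" if x: "x \<in> T" for x
    using monoid.Units_m_closed[OF MS.monoid_sec tm_Units[OF O(1)[OF x] h(1)[OF x]] r(1)[OF x O(1)[OF x] subset_refl]] O(1)[OF x]
    unfolding F_def by (simp_all add: Units_def)
  have Fr: "res MS (W x) V (F x) = tm V (res X (W x) V (h x)) \<otimes>\<^bsub>sec MS V\<^esub> res MS (U x) V (f x)"
    if "x \<in> T" "Op V" "V \<subseteq> W x" for x V
    unfolding F_def using O[OF that(1)] that h(2)[OF that(1)] r(2)[OF that(1), of "W x"] W(2)[OF that(1)]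
      liftingD(6)[OF l that(1)] MS.res_res[of "U x" "W x" V "f x"] by (simp add: tm_res)
  have WT: "(\<Union>x\<in>T. W x) = T" using W(3) O(3) by blast
  obtain G where G: "G \<in> carrier (sec MS T)" "\<And>x. x \<in> T \<Longrightarrow> res MS T (W x) G = F x"
  proof (rule MS.glue[of T W F])
    fix x y assume xy: "x \<in> T" "y \<in> T"
    let ?V = "W x \<inter> W y"
    have V: "Op ?V" "?V \<subseteq> W x" "?V \<subseteq> W y" using O xy by auto
    have i: "?V \<subseteq> U x" "?V \<subseteq> U y" "?V \<subseteq> T" "?V \<subseteq> U x \<inter> U y" using V W xy by blast+
    define p k k' u where "p = res X (U x \<inter> U y) ?V (g x y)" and "k = res X (W x) ?V (h x)"
      and "k' = res X (W y) ?V (h y)" and "u = res MS (U x) ?V (f x)"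
    have S: "p \<in> Sec ?V" "k' \<in> Sec ?V" "u \<in> carrier (sec MS ?V)" "k \<in> Sec ?V"
      unfolding p_def k'_def k_def u_def using V i O xy h(2) cocD(5)[OF c xy] r(2)[OF xy(1) V(1,2)] by (auto intro!: res_closed)
    have "k = p \<otimes>\<^bsub>sec X ?V\<^esub> k'"
      using eq[OF xy V] i(3) V(1) S unfolding p_def k_def k'_def by simp
    then have "tm ?V k \<otimes>\<^bsub>sec MS ?V\<^esub> u = tm ?V k' \<otimes>\<^bsub>sec MS ?V\<^esub> (tm ?V p \<otimes>\<^bsub>sec MS ?V\<^esub> u)"
      using S V(1) MS.ac[of ?V] by (simp add: tm_mult)
    then show "res MS (W x) ?V (F x) = res MS (W y) ?V (F y)"
      unfolding Fr[OF xy(1) V(1,2)] Fr[OF xy(2) V(1,3)] lifting_at[OF l xy V(1) i(1,2), symmetric]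
        p_def k_def k'_def u_def .
  qed (use O FU WT that in auto)
  have "G \<in> Units (sec MS T)"
  proof (rule MS.Units_local)
    show "\<exists>V. openin (sp MS) V \<and> x \<in> V \<and> V \<subseteq> T \<and> res MS T V G \<in> Units (sec MS V)" if "x \<in> T" for x
      using O[OF that] FU(1)[OF that] W(3)[OF that] G(2)[OF that] by (intro exI[of _ "W x"]) simp
  qed (use G in simp_all)
  moreover have "D = LD T G"
  proof (rule CS.eqI_cover[of T])
    show "D \<in> carrier (sec CS T)" "LD T G \<in> carrier (sec CS T)" using D LD_closed[OF OpT \<open>G \<in> Units (sec MS T)\<close>] by auto
    fix x assume x: "x \<in> T"
    have "res CS T (W x) (LD T G) = LD (W x) (F x)"
      using LD_res[OF OpT O(1)[OF x] W(3)[OF x] \<open>G \<in> Units (sec MS T)\<close>] G(2)[OF x] by simp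
    also have "\<dots> = LD (W x) (res MS (U x) (W x) (f x))"
      using LD_eq_iff[OF O(1)[OF x] r(1)[OF x O(1)[OF x] subset_refl] FU(1)[OF x]] h(1)[OF x] unfolding F_def by auto
    also have "\<dots> = res CS T (W x) D"
      using LD_res[OF O(2,1)[OF x] W(2)[OF x] liftingD(5)[OF l x]] liftingD(7)[OF l x]
        CS.res_res[of T "U x" "W x" D] O[OF x] W(2)[OF x] D openin_subset[OF O(2)[OF x]] by simp
    finally show "\<exists>V. openin (sp CS) V \<and> x \<in> V \<and> V \<subseteq> T \<and> res CS T V D = res CS T V (LD T G)"
      using O[OF x] W(3)[OF x] by (intro exI[of _ "W x"]) simp
  qed simp
  ultimately show ?thesis by blast
qed

text \<open>A divisor with trivial bundle has a cocycle cohomologous to \<open>cone\<close>, since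
  \<open>bundles\<close> separates cohomology classes, and is then principal. Conversely a principal
  divisor has a lifting whose cochain is \<open>cone\<close> itself.\<close>

lemma kernel_\<kappa>: "kernel Div (Pic X) \<kappa> = principal_divisors X"
proof -
  have pd: "principal_divisors X = LD T ` Units (sec MS T)"
    by (simp add: principal_divisors_def units_of_carrier unit_sheaf_def)
  have "\<kappa> D = \<one>\<^bsub>Pic X\<^esub> \<longleftrightarrow> D \<in> principal_divisors X" if D: "D \<in> carrier Div" for D
  proof
    obtain U f g where l: "lifting D U f g" using ex_lifting D unfolding Div_eq by blast
    then have c: "coc (U, g)" by (simp add: lifting_def)
    assume "\<kappa> D = \<one>\<^bsub>Pic X\<^esub>"
    then have "coh (U, g) cone" using \<kappa>_eq[OF l D] Pic_one bundles_eq_iff[OF c coc_cone] by simp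
    then show "D \<in> principal_divisors X"
      unfolding pd using principal_of_coh[OF l] D unfolding Div_eq by blast
  next
    assume "D \<in> principal_divisors X"
    then obtain F where F: "F \<in> Units (sec MS T)" "D = LD T F" unfolding pd by blast
    show "\<kappa> D = \<one>\<^bsub>Pic X\<^esub>"
      using \<kappa>_eq[OF lifting_principal[OF F(1)]] D F(2) Pic_one unfolding cone_def by simp
  qed
  moreover have "principal_divisors X \<subseteq> carrier Div"
    unfolding pd Div_eq using LD_closed[OF OpT] by blast
  ultimately show ?thesis unfolding kernel_def by blast
qed

lemma group_hom_\<kappa>: "group_hom Div (Pic X) \<kappa>"
  unfolding group_hom_def group_hom_axioms_def
  using comm_group_Div comm_group_Pic \<kappa>_hom by (simp add: comm_group.axioms)

lemma CaCl_eq: "CaCl X = Div Mod kernel Div (Pic X) \<kappa>"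
  by (simp add: CaCl_def kernel_\<kappa>)

lemma comm_group_CaCl: "comm_group (CaCl X)"
  unfolding CaCl_eq
  by (rule comm_group.abelian_FactGroup[OF comm_group_Div group_hom.subgroup_kernel[OF group_hom_\<kappa>]])

text \<open>The map of the theorem takes the common value of \<open>connecting\<close> on a coset
  and then forms bundles, whereas the factor homomorphism takes the common value of
  \<open>\<kappa>\<close>. That \<open>connecting\<close> is constant follows from constancy of
  \<open>\<kappa>\<close> because distinct cohomology classes give distinct classes of
  bundles.\<close>

lemma cacl_to_pic_eq:
  assumes "C \<in> carrier (CaCl X)"
  shows "cacl_to_pic X C = the_elem (\<kappa> ` C)"
proof -
  interpret group_hom Div "Pic X" \<kappa> by (rule group_hom_\<kappa>)
  obtain D where D: "D \<in> carrier Div" "C = kernel Div (Pic X) \<kappa> #>\<^bsub>Div\<^esub> D"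
    using assms unfolding CaCl_eq carrier_FactGroup by blast
  have CD: "E \<in> carrier Div \<and> \<kappa> E = \<kappa> D" if "E \<in> C" for E
    using that D(1) unfolding D(2) r_coset_def kernel_def by auto
  have "connecting X E = connecting X D" if E: "E \<in> C" for E
  proof -
    obtain U f g where l: "lifting D U f g" using ex_lifting D(1) unfolding Div_eq by blast
    obtain V e k where l': "lifting E V e k" using ex_lifting CD[OF E] unfolding Div_eq by blast
    have c: "coc (U, g)" "coc (V, k)" using l l' by (simp_all add: lifting_def)
    have "coh (V, k) (U, g)" using CD[OF E] \<kappa>_eq[OF l D(1)] \<kappa>_eq[OF l'] bundles_eq_iff[OF c(2,1)] by simp
    then show ?thesis
      using connecting_eq[OF l] connecting_eq[OF l'] D(1) CD[OF E] cls_eq_iff[OF c(2,1)] unfolding Div_eq by simp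
  qed
  moreover have "D \<in> C"
    unfolding D(2) by (rule G.rcos_self[OF D(1) subgroup_kernel])
  ultimately have "connecting X ` C = {connecting X D}" "\<kappa> ` C = {\<kappa> D}"
    using CD by (metis image_cong image_constant, metis image_cong image_constant)
  then show ?thesis by (simp add: cacl_to_pic_def \<kappa>_def)
qed

text \<open>First isomorphism theorem for \<open>\<kappa>\<close>, whose kernel is the subgroup
  divided out in \<open>CaCl\<close>.\<close>

lemma cacl_to_pic_mon: "cacl_to_pic X \<in> mon (CaCl X) (Pic X)"
proof -
  interpret group_hom Div "Pic X" \<kappa> by (rule group_hom_\<kappa>)
  note FactGroup_hom[folded CaCl_eq] FactGroup_inj_on[folded CaCl_eq]
  moreover have "monoid (CaCl X)" using comm_group_CaCl by (simp add: comm_group.axioms group.is_monoid comm_monoid.axioms)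
  ultimately show ?thesis
    using cacl_to_pic_eq unfolding mon_def hom_def inj_on_def by (auto simp: monoid.m_closed)
qed

lemma cacl_to_pic_iso:
  assumes "\<kappa> ` carrier Div = carrier (Pic X)"
  shows "cacl_to_pic X \<in> iso (CaCl X) (Pic X)"
proof -
  interpret group_hom Div "Pic X" \<kappa> by (rule group_hom_\<kappa>)
  have "(\<lambda>C. the_elem (\<kappa> ` C)) ` carrier (CaCl X) = carrier (Pic X)"
    using FactGroup_onto[OF assms] unfolding CaCl_eq .
  then have "cacl_to_pic X ` carrier (CaCl X) = carrier (Pic X)"
    using cacl_to_pic_eq by (simp cong: image_cong)
  then show ?thesis
    using cacl_to_pic_mon by (auto simp: iso_def mon_def bij_betw_def)
qed

text \<open>A splitting of the cocycle by invertible meromorphic functions is all that is needed for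
  surjectivity: since the quotients \<open>g x y\<close> are units of \<open>O_X\<close>, the local
  divisors of the \<open>f x\<close> agree on overlaps and glue to a divisor of which
  \<open>f\<close> is a lifting.\<close>

lemma \<kappa>_surj:
  assumes "coc (U, g)" "\<And>x. x \<in> T \<Longrightarrow> f x \<in> Units (sec MS (U x))"
    and eq: "\<And>x y. x \<in> T \<Longrightarrow> y \<in> T \<Longrightarrow>
      tm (U x \<inter> U y) (g x y) \<otimes>\<^bsub>sec MS (U x \<inter> U y)\<^esub> res MS (U x) (U x \<inter> U y) (f x) = res MS (U y) (U x \<inter> U y) (f y)"
  shows "bundles (U, g) \<in> \<kappa> ` carrier Div"
proof -
  have O: "Op (U x)" "x \<in> U x" if "x \<in> T" for x using cocD(3,4)[OF assms(1) that that] by auto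
  have UT: "(\<Union>x\<in>T. U x) = T" using O openin_subset by blast
  obtain D where D: "D \<in> carrier (sec CS T)" "\<And>x. x \<in> T \<Longrightarrow> res CS T (U x) D = LD (U x) (f x)"
  proof (rule CS.glue[of T U "\<lambda>x. LD (U x) (f x)"])
    fix x y assume xy: "x \<in> T" "y \<in> T"
    let ?V = "U x \<inter> U y"
    have V: "Op ?V" "?V \<subseteq> U x" "?V \<subseteq> U y" using O xy by auto
    have "LD ?V (res MS (U x) ?V (f x)) = LD ?V (res MS (U y) ?V (f y))"
      using LD_eq_iff[OF V(1)] MS_res(1)[OF O(1) V(1)] V xy assms(2) cocD(2)[OF assms(1) xy] eq[OF xy, symmetric] by blast
    then show "res CS (U x) ?V (LD (U x) (f x)) = res CS (U y) ?V (LD (U y) (f y))"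
      using LD_res[OF O(1) V(1)] V xy assms(2) by simp
  qed (use O LD_closed assms(2) UT that in auto)
  have "lifting D U f g"
    unfolding lifting_def lifts_divisor_iff using assms D(2) by (auto simp: cocycle_def)
  then show ?thesis using \<kappa>_eq D(1) unfolding Div_eq by blast
qed

end

section \<open>Cancellative monoid schemes\<close>

locale cancel_spec =
  fixes M :: "'s monoid"
  assumes cancel: "comm_monoid_cancel M"
begin

sublocale comm_monoid_cancel M by (rule cancel)

abbreviation OpS :: "'s set set \<Rightarrow> bool" where "OpS \<equiv> openin (spec_topology M)"

abbreviation SS :: "'s set set \<Rightarrow> ('s set \<Rightarrow> ('s \<times> 's) set) set" where
  "SS U \<equiv> carrier (sec (Spec M) U)"

text \<open>The empty ideal is prime since its complement is the whole monoid. It serves as the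
  generic point.\<close>

lemma empty_spec: "{} \<in> spec_points M"
  by (auto simp: spec_points_def prime_monoid_ideal_def monoid_ideal_def intro!: submonoid.intro)

lemma empty_basic: "{} \<in> basic_open M f"
  using empty_spec by (simp add: basic_open_def)

text \<open>No element belongs to the empty ideal, so every basic open set contains it; the property
  passes to finite intersections and to unions.\<close>

lemma empty_in_open:
  assumes "OpS V" "V \<noteq> {}"
  shows "{} \<in> V"
proof -
  have "generate_topology_on {basic_open M f | f. f \<in> carrier M} V"
    using assms(1) unfolding spec_topology_def openin_topology_generated_by_iff .
  then have "p \<in> V \<longrightarrow> {} \<in> V" for p
  proof induction
    case (UN K)
    then show ?case by blast
  qed (auto simp: empty_basic)
  then show ?thesis using assms(2) by blast
qed

lemma OpS_points: "OpS V \<Longrightarrow> V \<subseteq> spec_points M"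
  using openin_subset[of "spec_topology M" V]
  unfolding spec_topology_def by (auto simp: basic_open_def)

lemma prime_submonoid: "p \<in> spec_points M \<Longrightarrow> submonoid (carrier M - p) M"
  by (simp add: spec_points_def prime_monoid_ideal_def)

text \<open>After cancellation the criterion no longer refers to \<open>p\<close>. An equality of
  fractions at the empty prime is therefore an equality at every prime at which both denominators
  are allowed.\<close>

lemma prime_frac_eq_iff:
  assumes "p \<in> spec_points M" "a \<in> carrier M" "b \<in> carrier M" "s \<in> carrier M - p" "t \<in> carrier M - p"
  shows "prime_frac M p a s = prime_frac M p b t \<longleftrightarrow> a \<otimes>\<^bsub>M\<^esub> t = b \<otimes>\<^bsub>M\<^esub> s"
proof -
  interpret S: submonoid "carrier M - p" M using prime_submonoid assms(1) .
  have "a \<otimes>\<^bsub>M\<^esub> t \<in> carrier M" "b \<otimes>\<^bsub>M\<^esub> s \<in> carrier M" using assms by auto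
  then show ?thesis
    unfolding prime_frac_def
      fraction_eq_iff[OF comm_monoid_axioms prime_submonoid[OF assms(1)] assms(2-5)]
    using S.one_closed l_cancel[of _ "a \<otimes>\<^bsub>M\<^esub> t" "b \<otimes>\<^bsub>M\<^esub> s"] by auto
qed

lemma prime_frac_mult:
  assumes "p \<in> spec_points M" "a \<in> carrier M" "b \<in> carrier M" "s \<in> carrier M - p" "t \<in> carrier M - p"
  shows "prime_frac M p a s \<otimes>\<^bsub>prime_localization M p\<^esub> prime_frac M p b t = prime_frac M p (a \<otimes>\<^bsub>M\<^esub> b) (s \<otimes>\<^bsub>M\<^esub> t)"
  unfolding prime_frac_def prime_localization_def
  by (rule localization_mult[OF comm_monoid_axioms prime_submonoid[OF assms(1)] assms(2-5)])

lemma SS_ext: "\<sigma> \<in> SS U \<Longrightarrow> \<sigma> \<in> extensional U"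
  by (simp add: Spec_def)

lemma SS_locally:
  assumes "\<sigma> \<in> SS U" "p \<in> U"
  obtains V a s where "OpS V" "p \<in> V" "V \<subseteq> U" "a \<in> carrier M" "s \<in> carrier M"
    "\<forall>q\<in>V. s \<notin> q" "\<forall>q\<in>V. \<sigma> q = prime_frac M q a s"
proof -
  have "\<exists>V a s. OpS V \<and> p \<in> V \<and> V \<subseteq> U \<and> a \<in> carrier M \<and> s \<in> carrier M \<and> (\<forall>q\<in>V. s \<notin> q \<and> \<sigma> q = prime_frac M q a s)"
    using assms by (simp add: Spec_def)
  then obtain V a s where "OpS V \<and> p \<in> V \<and> V \<subseteq> U \<and> a \<in> carrier M \<and> s \<in> carrier M \<and>
    (\<forall>q\<in>V. s \<notin> q \<and> \<sigma> q = prime_frac M q a s)" by (elim exE)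
  then show thesis using that[of V a s] by simp
qed

lemma Spec_mult: "\<sigma> \<otimes>\<^bsub>sec (Spec M) U\<^esub> \<tau> = (\<lambda>p\<in>U. \<sigma> p \<otimes>\<^bsub>prime_localization M p\<^esub> \<tau> p)"
  by (simp add: Spec_def)

lemma Spec_res: "res (Spec M) U V \<sigma> = restrict \<sigma> V"
  by (simp add: Spec_def)

lemma Spec_sp: "sp (Spec M) = spec_topology M"
  by (simp add: Spec_def)

text \<open>Near a point \<open>p\<close> both sections are given by single fractions on open sets
  that contain the empty prime. They agree at the empty prime because it lies in \<open>V\<close>,
  and by \<open>prime_frac_eq_iff\<close> the cross-multiplied identity carries over to
  \<open>p\<close>.\<close>

lemma Spec_res_inj:
  assumes "OpS U" "OpS V" "V \<subseteq> U" "V \<noteq> {}" "\<sigma> \<in> SS U" "\<tau> \<in> SS U" "restrict \<sigma> V = restrict \<tau> V"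
  shows "\<sigma> = \<tau>"
proof (rule extensionalityI[OF SS_ext[OF assms(5)] SS_ext[OF assms(6)]])
  fix p assume p: "p \<in> U"
  obtain A a s where A: "OpS A" "p \<in> A" "A \<subseteq> U" "a \<in> carrier M" "s \<in> carrier M"
    "\<forall>q\<in>A. s \<notin> q" "\<forall>q\<in>A. \<sigma> q = prime_frac M q a s" using SS_locally[OF assms(5) p] .
  obtain B b t where B: "OpS B" "p \<in> B" "B \<subseteq> U" "b \<in> carrier M" "t \<in> carrier M"
    "\<forall>q\<in>B. t \<notin> q" "\<forall>q\<in>B. \<tau> q = prime_frac M q b t" using SS_locally[OF assms(6) p] .
  have e: "{} \<in> A" "{} \<in> B" "{} \<in> V" using empty_in_open A(1,2) B(1,2) assms(2,4) by blast+
  have "\<sigma> {} = \<tau> {}" using assms(7) e(3) by (metis restrict_apply')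
  then have "prime_frac M {} a s = prime_frac M {} b t" using bspec[OF A(7) e(1)] bspec[OF B(7) e(2)] by simp
  then have "a \<otimes>\<^bsub>M\<^esub> t = b \<otimes>\<^bsub>M\<^esub> s" using prime_frac_eq_iff[OF empty_spec A(4) B(4)] A(5) B(5) by simp
  then show "\<sigma> p = \<tau> p"
    using prime_frac_eq_iff[of p a b s t] OpS_points[OF A(1)] A B by auto
qed

text \<open>Near the empty prime \<open>\<tau>\<close> is a single fraction \<open>a/s\<close>.
  Numerator and denominator are elements of \<open>M\<close> and so define sections over all of
  \<open>U\<close>.\<close>

lemma Spec_fraction:
  assumes "OpS U" "OpS V" "V \<subseteq> U" "V \<noteq> {}" "\<tau> \<in> SS V"
  shows "\<exists>\<alpha>\<in>SS U. \<exists>\<beta>\<in>SS U. \<exists>W. OpS W \<and> W \<noteq> {} \<and> W \<subseteq> V \<and>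
    restrict \<beta> W \<otimes>\<^bsub>sec (Spec M) W\<^esub> restrict \<tau> W = restrict \<alpha> W"
proof -
  have "{} \<in> V" using empty_in_open assms(2,4) .
  from SS_locally[OF assms(5) this] obtain W a s where W: "OpS W" "{} \<in> W" "W \<subseteq> V" "a \<in> carrier M" "s \<in> carrier M"
    "\<forall>q\<in>W. s \<notin> q" "\<forall>q\<in>W. \<tau> q = prime_frac M q a s" by metis
  have one: "\<one>\<^bsub>M\<^esub> \<notin> p" if "p \<in> spec_points M" for p
    using submonoid.one_closed[OF prime_submonoid[OF that]] by simp
  \<comment> \<open>The section given by an element \<open>b\<close> of \<open>M\<close>; one is an
    admissible denominator at every prime.\<close>
  have c: "(\<lambda>p\<in>U. prime_frac M p b \<one>\<^bsub>M\<^esub>) \<in> SS U" if "b \<in> carrier M" for b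
  proof -
    have "OpS U \<and> p \<in> U \<and> U \<subseteq> U \<and> b \<in> carrier M \<and> \<one>\<^bsub>M\<^esub> \<in> carrier M \<and>
        (\<forall>q\<in>U. \<one>\<^bsub>M\<^esub> \<notin> q \<and> (\<lambda>p\<in>U. prime_frac M p b \<one>\<^bsub>M\<^esub>) q = prime_frac M q b \<one>\<^bsub>M\<^esub>)" if "p \<in> U" for p
      using that \<open>b \<in> carrier M\<close> one OpS_points[OF assms(1)] assms(1) by auto
    then show ?thesis unfolding Spec_def by (simp only: monoidal_space.simps partial_object.simps) blast
  qed
  have WU: "W \<subseteq> U" using W(3) assms(3) by blast
  have "prime_frac M q s \<one>\<^bsub>M\<^esub> \<otimes>\<^bsub>prime_localization M q\<^esub> prime_frac M q a s = prime_frac M q a \<one>\<^bsub>M\<^esub>" if q: "q \<in> W" for q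
  proof -
    have qp: "q \<in> spec_points M" using OpS_points[OF W(1)] q by blast
    have "prime_frac M q (s \<otimes>\<^bsub>M\<^esub> a) (\<one>\<^bsub>M\<^esub> \<otimes>\<^bsub>M\<^esub> s) = prime_frac M q a \<one>\<^bsub>M\<^esub>"
      by (subst prime_frac_eq_iff[OF qp]) (use W(4,5) bspec[OF W(6) q] one[OF qp] in \<open>simp_all add: m_comm\<close>)
    then show ?thesis
      using prime_frac_mult[OF qp W(5,4), of "\<one>\<^bsub>M\<^esub>" s] W(5) bspec[OF W(6) q] one[OF qp] by simp
  qed
  then have "restrict (\<lambda>p\<in>U. prime_frac M p s \<one>\<^bsub>M\<^esub>) W \<otimes>\<^bsub>sec (Spec M) W\<^esub> restrict \<tau> W =
      restrict (\<lambda>p\<in>U. prime_frac M p a \<one>\<^bsub>M\<^esub>) W"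
    unfolding Spec_mult using WU W(7) by (auto simp: restrict_def fun_eq_iff)
  then show ?thesis using c[OF W(4)] c[OF W(5)] W(1,2,3) by blast
qed

lemma Spec_mult_closed:
  assumes "\<sigma> \<in> SS U" "\<tau> \<in> SS U"
  shows "\<sigma> \<otimes>\<^bsub>sec (Spec M) U\<^esub> \<tau> \<in> SS U"
proof -
  have "\<exists>V a s. OpS V \<and> p \<in> V \<and> V \<subseteq> U \<and> a \<in> carrier M \<and> s \<in> carrier M \<and>
      (\<forall>q\<in>V. s \<notin> q \<and> (\<lambda>p\<in>U. \<sigma> p \<otimes>\<^bsub>prime_localization M p\<^esub> \<tau> p) q = prime_frac M q a s)" if p: "p \<in> U" for p
  proof -
    obtain A a s where A: "OpS A" "p \<in> A" "A \<subseteq> U" "a \<in> carrier M" "s \<in> carrier M"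
      "\<forall>q\<in>A. s \<notin> q" "\<forall>q\<in>A. \<sigma> q = prime_frac M q a s" using SS_locally[OF assms(1) p] .
    obtain B b t where B: "OpS B" "p \<in> B" "B \<subseteq> U" "b \<in> carrier M" "t \<in> carrier M"
      "\<forall>q\<in>B. t \<notin> q" "\<forall>q\<in>B. \<tau> q = prime_frac M q b t" using SS_locally[OF assms(2) p] .
    have "s \<otimes>\<^bsub>M\<^esub> t \<notin> q \<and> (\<lambda>p\<in>U. \<sigma> p \<otimes>\<^bsub>prime_localization M p\<^esub> \<tau> p) q = prime_frac M q (a \<otimes>\<^bsub>M\<^esub> b) (s \<otimes>\<^bsub>M\<^esub> t)"
      if q: "q \<in> A \<inter> B" for q
    proof -
      have qp: "q \<in> spec_points M" "q \<in> U" using OpS_points[OF A(1)] A(3) q by auto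
      have st: "s \<in> carrier M - q" "t \<in> carrier M - q" using A B q by auto
      have "\<sigma> q = prime_frac M q a s" "\<tau> q = prime_frac M q b t" using A(7) B(7) q by blast+
      then show ?thesis
        using submonoid.m_closed[OF prime_submonoid[OF qp(1)] st] prime_frac_mult[OF qp(1) A(4) B(4) st] qp(2)
        by simp
    qed
    then show ?thesis
      using A B by (intro exI[of _ "A \<inter> B"] exI[of _ "a \<otimes>\<^bsub>M\<^esub> b"] exI[of _ "s \<otimes>\<^bsub>M\<^esub> t"]) auto
  qed
  then show ?thesis unfolding Spec_mult by (simp add: Spec_def)
qed

text \<open>Pointwise: after cross-multiplication both sides carry the factor \<open>a s\<close>
  built from numerator and denominator of \<open>\<sigma>\<close>, and it cancels in
  \<open>M\<close>.\<close>

lemma Spec_cancel: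
  assumes "\<sigma> \<in> SS U" "\<tau> \<in> SS U" "\<upsilon> \<in> SS U" "\<sigma> \<otimes>\<^bsub>sec (Spec M) U\<^esub> \<tau> = \<sigma> \<otimes>\<^bsub>sec (Spec M) U\<^esub> \<upsilon>"
  shows "\<tau> = \<upsilon>"
proof (rule extensionalityI[OF SS_ext[OF assms(2)] SS_ext[OF assms(3)]])
  fix p assume p: "p \<in> U"
  have "\<sigma> p \<otimes>\<^bsub>prime_localization M p\<^esub> \<tau> p = \<sigma> p \<otimes>\<^bsub>prime_localization M p\<^esub> \<upsilon> p"
    using fun_cong[OF assms(4)[unfolded Spec_mult], of p] p by simp
  moreover obtain A a s where A: "OpS A" "p \<in> A" "a \<in> carrier M" "s \<in> carrier M - p" "\<sigma> p = prime_frac M p a s"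
    using SS_locally[OF assms(1) p] by (metis DiffI)
  moreover obtain b t where b: "b \<in> carrier M" "t \<in> carrier M - p" "\<tau> p = prime_frac M p b t"
    using SS_locally[OF assms(2) p] by (metis DiffI)
  moreover obtain c u where c: "c \<in> carrier M" "u \<in> carrier M - p" "\<upsilon> p = prime_frac M p c u"
    using SS_locally[OF assms(3) p] by (metis DiffI)
  ultimately have pp: "p \<in> spec_points M" and
    e: "prime_frac M p (a \<otimes>\<^bsub>M\<^esub> b) (s \<otimes>\<^bsub>M\<^esub> t) = prime_frac M p (a \<otimes>\<^bsub>M\<^esub> c) (s \<otimes>\<^bsub>M\<^esub> u)"
    using OpS_points[OF A(1)] by (auto simp: prime_frac_mult)
  interpret S: submonoid "carrier M - p" M using prime_submonoid[OF pp] .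
  note st = A(4) b(2) c(2)
  have car: "s \<in> carrier M" "t \<in> carrier M" "u \<in> carrier M" using st by auto
  have "(a \<otimes>\<^bsub>M\<^esub> b) \<otimes>\<^bsub>M\<^esub> (s \<otimes>\<^bsub>M\<^esub> u) = (a \<otimes>\<^bsub>M\<^esub> c) \<otimes>\<^bsub>M\<^esub> (s \<otimes>\<^bsub>M\<^esub> t)"
    using e prime_frac_eq_iff[OF pp m_closed[OF A(3) b(1)] m_closed[OF A(3) c(1)] S.m_closed[OF st(1,2)] S.m_closed[OF st(1,3)]]
    by blast
  then have "(a \<otimes>\<^bsub>M\<^esub> s) \<otimes>\<^bsub>M\<^esub> (b \<otimes>\<^bsub>M\<^esub> u) = (a \<otimes>\<^bsub>M\<^esub> s) \<otimes>\<^bsub>M\<^esub> (c \<otimes>\<^bsub>M\<^esub> t)"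
    using A(3) b(1) c(1) car by (simp add: m_ac)
  then have "b \<otimes>\<^bsub>M\<^esub> u = c \<otimes>\<^bsub>M\<^esub> t"
    using l_cancel[of "a \<otimes>\<^bsub>M\<^esub> s" "b \<otimes>\<^bsub>M\<^esub> u" "c \<otimes>\<^bsub>M\<^esub> t"] A(3) b(1) c(1) car by simp
  then show "\<tau> p = \<upsilon> p" using prime_frac_eq_iff[OF pp b(1) c(1) st(2,3)] b(3) c(3) by simp
qed

end

context mero
begin

section \<open>Integral open sets of a monoid scheme\<close>

definition generic :: "'a set \<Rightarrow> 'a \<Rightarrow> bool" where
  "generic E z \<longleftrightarrow> Op E \<and> z \<in> E \<and> (\<forall>V. Op V \<and> V \<noteq> {} \<and> V \<subseteq> E \<longrightarrow> z \<in> V)"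

text \<open>The properties of \<open>Spec M\<close> for cancellative \<open>M\<close> that make \<open>M\<^sub>X\<^sup>*\<close> constant: sections are determined
  on any smaller nonempty open set, and sections over a nonempty open subset are, generically,
  fractions of sections over the whole set.\<close>

definition integral_open :: "'a set \<Rightarrow> bool" where
  "integral_open E \<longleftrightarrow> Op E \<and> (\<exists>z. generic E z) \<and>
    (\<forall>U V s t. Op U \<and> Op V \<and> U \<subseteq> E \<and> V \<subseteq> U \<and> V \<noteq> {} \<and> s \<in> Sec U \<and> t \<in> Sec U \<and>
      res X U V s = res X U V t \<longrightarrow> s = t) \<and>
    (\<forall>U V t. Op U \<and> Op V \<and> U \<subseteq> E \<and> V \<subseteq> U \<and> V \<noteq> {} \<and> t \<in> Sec V \<longrightarrow>
      (\<exists>a\<in>Sec U. \<exists>b\<in>Sec U. \<exists>W. Op W \<and> W \<noteq> {} \<and> W \<subseteq> V \<and>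
        res X U W b \<otimes>\<^bsub>sec X W\<^esub> res X V W t = res X U W a)) \<and>
    (\<forall>U s t u. Op U \<and> U \<subseteq> E \<and> s \<in> Sec U \<and> t \<in> Sec U \<and> u \<in> Sec U \<and>
      s \<otimes>\<^bsub>sec X U\<^esub> t = s \<otimes>\<^bsub>sec X U\<^esub> u \<longrightarrow> t = u)"

text \<open>All four properties have been established, or follow directly, for
  \<open>Spec M\<close>. The homeomorphism translates open sets, and \<open>\<psi>\<close>
  translates sections compatibly with restriction and multiplication.\<close>

lemma integral_open_affine:
  fixes M :: "'s monoid"
  assumes E: "Op E" and M: "comm_monoid_cancel M"
    and iso: "isomorphic_spaces (open_subspace X E) (Spec M)"
  shows "integral_open E"
proof -
  interpret cancel_spec M by (rule cancel_spec.intro) fact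
  let ?Y = "open_subspace X E"
  have Y: "sp ?Y = subtopology (sp X) E" "sec ?Y = sec X" "res ?Y = res X"
    by (simp_all add: open_subspace_def)
  have tY: "topspace (sp ?Y) = E" unfolding Y using openin_subset[OF E] by auto
  have OY: "openin (sp ?Y) U \<longleftrightarrow> Op U \<and> U \<subseteq> E" for U
    unfolding Y using openin_open_subtopology[OF E] .
  obtain \<phi> \<psi> where m: "morphism ?Y (Spec M) \<phi> \<psi>" and h: "homeomorphic_map (sp ?Y) (spec_topology M) \<phi>"
    and i: "\<And>V. OpS V \<Longrightarrow> \<psi> V \<in> iso (sec (Spec M) V) (sec X (preim ?Y \<phi> V))"
    using iso unfolding isomorphic_spaces_def Spec_sp Y(2) by blast
  have inj: "inj_on \<phi> E" using homeomorphic_imp_injective_map[OF h] unfolding tY .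
  have img: "OpS (\<phi> ` U)" if "Op U" "U \<subseteq> E" for U
    using homeomorphic_map_openness[OF h, of U] that OY tY by blast
  have pre: "preim ?Y \<phi> (\<phi> ` U) = U" if "U \<subseteq> E" for U
    unfolding preim_def tY using inj that by (auto simp: inj_on_def)
  have ps: "\<psi> (\<phi> ` U) \<in> iso (sec (Spec M) (\<phi> ` U)) (sec X U)" if "Op U" "U \<subseteq> E" for U
    using i[OF img[OF that]] pre[OF that(2)] by simp
  have nat: "res X U V (\<psi> (\<phi> ` U) t) = \<psi> (\<phi> ` V) (restrict t (\<phi> ` V))"
    if "Op U" "U \<subseteq> E" "Op V" "V \<subseteq> U" "t \<in> SS (\<phi> ` U)" for U V t
  proof -
    have VA: "V \<subseteq> E" using that by blast
    have "\<psi> (\<phi> ` V) (res (Spec M) (\<phi> ` U) (\<phi> ` V) t) =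
        res X (preim ?Y \<phi> (\<phi> ` U)) (preim ?Y \<phi> (\<phi> ` V)) (\<psi> (\<phi> ` U) t)"
      using m img[OF that(1,2)] img[OF that(3) VA] that(4,5) unfolding morphism_def Spec_sp Y(3)
      by (meson image_mono)
    then show ?thesis unfolding pre[OF that(2)] pre[OF VA] Spec_res by simp
  qed
  have surj: "\<exists>\<sigma>\<in>SS (\<phi> ` U). s = \<psi> (\<phi> ` U) \<sigma>" if "Op U" "U \<subseteq> E" "s \<in> Sec U" for U s
    using ps[OF that(1,2)] that(3) by (auto simp: iso_iff)
  have pinj: "\<sigma> = \<tau>" if "Op U" "U \<subseteq> E" "\<sigma> \<in> SS (\<phi> ` U)" "\<tau> \<in> SS (\<phi> ` U)" "\<psi> (\<phi> ` U) \<sigma> = \<psi> (\<phi> ` U) \<tau>" for U \<sigma> \<tau>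
    using ps[OF that(1,2)] that(3-5) by (auto simp: iso_iff inj_on_def)
  have pmult: "\<psi> (\<phi> ` U) (\<sigma> \<otimes>\<^bsub>sec (Spec M) (\<phi> ` U)\<^esub> \<tau>) = \<psi> (\<phi> ` U) \<sigma> \<otimes>\<^bsub>sec X U\<^esub> \<psi> (\<phi> ` U) \<tau>"
    if "Op U" "U \<subseteq> E" "\<sigma> \<in> SS (\<phi> ` U)" "\<tau> \<in> SS (\<phi> ` U)" for U \<sigma> \<tau>
    using ps[OF that(1,2)] that(3,4) by (auto simp: iso_iff hom_mult)
  have pc: "\<psi> (\<phi> ` U) \<sigma> \<in> Sec U" if "Op U" "U \<subseteq> E" "\<sigma> \<in> SS (\<phi> ` U)" for U \<sigma>
    using ps[OF that(1,2)] that(3) by (auto simp: iso_iff hom_def)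
  have rS: "restrict \<sigma> W \<in> SS W" if "OpS U" "OpS W" "W \<subseteq> U" "\<sigma> \<in> SS U" for U W \<sigma>
  proof -
    have "\<exists>V a s. OpS V \<and> p \<in> V \<and> V \<subseteq> W \<and> a \<in> carrier M \<and> s \<in> carrier M \<and>
        (\<forall>q\<in>V. s \<notin> q \<and> restrict \<sigma> W q = prime_frac M q a s)" if p: "p \<in> W" for p
    proof -
      obtain V a s where "OpS V" "p \<in> V" "V \<subseteq> U" "a \<in> carrier M" "s \<in> carrier M"
        "\<forall>q\<in>V. s \<notin> q" "\<forall>q\<in>V. \<sigma> q = prime_frac M q a s"
        using SS_locally[OF \<open>\<sigma> \<in> SS U\<close>, of p] p \<open>W \<subseteq> U\<close> by blast
      then show ?thesis
        using p \<open>OpS W\<close> by (intro exI[of _ "V \<inter> W"] exI[of _ a] exI[of _ s]) auto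
    qed
    then show ?thesis by (simp add: Spec_def)
  qed
  have gen: "\<exists>z. generic E z"
  proof -
    have "topspace (spec_topology M) \<noteq> {}"
      unfolding spec_topology_def using empty_basic[of "\<one>\<^bsub>M\<^esub>"] by auto
    then have "{} \<in> topspace (spec_topology M)" using empty_in_open[OF openin_topspace] by blast
    \<comment> \<open>The point of \<open>E\<close> that corresponds to the empty prime.\<close>
    then obtain z where z: "z \<in> E" "\<phi> z = {}"
      using homeomorphic_imp_surjective_map[OF h] unfolding tY by (metis image_iff)
    have "z \<in> V" if V: "Op V" "V \<noteq> {}" "V \<subseteq> E" for V
    proof -
      have "{} \<in> \<phi> ` V" using empty_in_open[OF img[OF V(1,3)]] V(2) by blast
      then obtain v where "v \<in> V" "\<phi> v = {}" by (metis image_iff)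
      then have "v = z" using z inj V(3) unfolding inj_on_def by (metis subsetD)
      then show ?thesis using \<open>v \<in> V\<close> by simp
    qed
    then show ?thesis using E z(1) unfolding generic_def by blast
  qed
  \<comment> \<open>Injectivity of restriction, generic fractions (\<open>K2\<close>) and
    cancellation (\<open>K3\<close>) are moved along \<open>\<psi>\<close> one after the
    other.\<close>
  have K1: "s = t" if a: "Op U" "Op V" "U \<subseteq> E" "V \<subseteq> U" "V \<noteq> {}" "s \<in> Sec U" "t \<in> Sec U" "res X U V s = res X U V t"
    for U V s t
  proof -
    have VA: "V \<subseteq> E" using a by blast
    obtain \<sigma> where \<sigma>: "\<sigma> \<in> SS (\<phi> ` U)" "s = \<psi> (\<phi> ` U) \<sigma>" using surj[OF a(1,3,6)] by blast
    obtain \<tau> where \<tau>: "\<tau> \<in> SS (\<phi> ` U)" "t = \<psi> (\<phi> ` U) \<tau>" using surj[OF a(1,3,7)] by blast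
    have i: "OpS (\<phi> ` U)" "OpS (\<phi> ` V)" "\<phi> ` V \<subseteq> \<phi> ` U" "\<phi> ` V \<noteq> {}" using img a VA by auto
    have "restrict \<sigma> (\<phi> ` V) = restrict \<tau> (\<phi> ` V)"
      by (rule pinj[OF a(2) VA rS[OF i(1-3) \<sigma>(1)] rS[OF i(1-3) \<tau>(1)]])
        (use nat[OF a(1,3,2,4) \<sigma>(1)] nat[OF a(1,3,2,4) \<tau>(1)] a(8) \<sigma>(2) \<tau>(2) in simp)
    then show ?thesis using Spec_res_inj[OF i \<sigma>(1) \<tau>(1)] \<sigma>(2) \<tau>(2) by simp
  qed
  have K2: "\<exists>a\<in>Sec U. \<exists>b\<in>Sec U. \<exists>W. Op W \<and> W \<noteq> {} \<and> W \<subseteq> V \<and> res X U W b \<otimes>\<^bsub>sec X W\<^esub> res X V W t = res X U W a"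
    if a: "Op U" "Op V" "U \<subseteq> E" "V \<subseteq> U" "V \<noteq> {}" "t \<in> Sec V" for U V t
  proof -
    have VA: "V \<subseteq> E" using a by blast
    obtain \<tau> where \<tau>: "\<tau> \<in> SS (\<phi> ` V)" "t = \<psi> (\<phi> ` V) \<tau>" using surj[OF a(2) VA a(6)] by blast
    have i: "OpS (\<phi> ` U)" "OpS (\<phi> ` V)" "\<phi> ` V \<subseteq> \<phi> ` U" "\<phi> ` V \<noteq> {}" using img a VA by auto
    obtain \<alpha> \<beta> W' where W': "\<alpha> \<in> SS (\<phi> ` U)" "\<beta> \<in> SS (\<phi> ` U)" "OpS W'" "W' \<noteq> {}" "W' \<subseteq> \<phi> ` V"
      "restrict \<beta> W' \<otimes>\<^bsub>sec (Spec M) W'\<^esub> restrict \<tau> W' = restrict \<alpha> W'"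
      using Spec_fraction[OF i \<tau>(1)] by blast
    define W where "W = {x \<in> V. \<phi> x \<in> W'}"
    have W: "\<phi> ` W = W'" "W \<subseteq> V" "W \<noteq> {}" using W'(4,5) unfolding W_def by auto
    have WA: "W \<subseteq> E" "W \<subseteq> U" using W VA a by auto
    have OW: "Op W" using homeomorphic_map_openness[OF h, of W] WA W(1) W'(3) OY tY by simp
    note iW = W'(3)[folded W(1)]
    have sub: "\<phi> ` W \<subseteq> \<phi> ` U" "\<phi> ` W \<subseteq> \<phi> ` V" using WA W by auto
    have "res X U W (\<psi> (\<phi> ` U) \<beta>) \<otimes>\<^bsub>sec X W\<^esub> res X V W t = res X U W (\<psi> (\<phi> ` U) \<alpha>)"
      unfolding \<tau>(2) nat[OF a(1,3) OW WA(2) W'(2)] nat[OF a(1,3) OW WA(2) W'(1)] nat[OF a(2) VA OW W(2) \<tau>(1)]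
        pmult[OF OW WA(1) rS[OF i(1) iW sub(1) W'(2)] rS[OF i(2) iW sub(2) \<tau>(1)], symmetric]
        W'(6)[folded W(1)] ..
    then show ?thesis using pc[OF a(1,3) W'(1)] pc[OF a(1,3) W'(2)] OW W(2,3) by blast
  qed
  have K3: "t = u" if a: "Op U" "U \<subseteq> E" "s \<in> Sec U" "t \<in> Sec U" "u \<in> Sec U" "s \<otimes>\<^bsub>sec X U\<^esub> t = s \<otimes>\<^bsub>sec X U\<^esub> u" for U s t u
  proof -
    obtain \<sigma> where \<sigma>: "\<sigma> \<in> SS (\<phi> ` U)" "s = \<psi> (\<phi> ` U) \<sigma>" using surj[OF a(1,2,3)] by blast
    obtain \<tau> where \<tau>: "\<tau> \<in> SS (\<phi> ` U)" "t = \<psi> (\<phi> ` U) \<tau>" using surj[OF a(1,2,4)] by blast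
    obtain \<upsilon> where \<upsilon>: "\<upsilon> \<in> SS (\<phi> ` U)" "u = \<psi> (\<phi> ` U) \<upsilon>" using surj[OF a(1,2,5)] by blast
    have "\<sigma> \<otimes>\<^bsub>sec (Spec M) (\<phi> ` U)\<^esub> \<tau> = \<sigma> \<otimes>\<^bsub>sec (Spec M) (\<phi> ` U)\<^esub> \<upsilon>"
      by (rule pinj[OF a(1,2) Spec_mult_closed[OF \<sigma>(1) \<tau>(1)] Spec_mult_closed[OF \<sigma>(1) \<upsilon>(1)]])
        (use pmult[OF a(1,2) \<sigma>(1)] \<tau> \<upsilon> \<sigma>(2) a(6) in simp)
    then show ?thesis using Spec_cancel[OF \<sigma>(1) \<tau>(1) \<upsilon>(1)] \<tau>(2) \<upsilon>(2) by simp
  qed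
  show ?thesis
    unfolding integral_open_def
  proof (intro conjI allI impI E gen)
    show "s = t" if "Op U \<and> Op V \<and> U \<subseteq> E \<and> V \<subseteq> U \<and> V \<noteq> {} \<and> s \<in> Sec U \<and> t \<in> Sec U \<and> res X U V s = res X U V t"
      for U V s t using K1[of U V s t] that by simp
    show "\<exists>a\<in>Sec U. \<exists>b\<in>Sec U. \<exists>W. Op W \<and> W \<noteq> {} \<and> W \<subseteq> V \<and> res X U W b \<otimes>\<^bsub>sec X W\<^esub> res X V W t = res X U W a"
      if "Op U \<and> Op V \<and> U \<subseteq> E \<and> V \<subseteq> U \<and> V \<noteq> {} \<and> t \<in> Sec V" for U V t using K2[of U V t] that by simp
    show "t = u" if "Op U \<and> U \<subseteq> E \<and> s \<in> Sec U \<and> t \<in> Sec U \<and> u \<in> Sec U \<and> s \<otimes>\<^bsub>sec X U\<^esub> t = s \<otimes>\<^bsub>sec X U\<^esub> u"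
      for U s t u using K3[of U s t u] that by simp
  qed
qed


section \<open>Fractions and regularity on integral open sets\<close>

lemma integral_inj:
  "integral_open E \<Longrightarrow> Op U \<Longrightarrow> Op V \<Longrightarrow> U \<subseteq> E \<Longrightarrow> V \<subseteq> U \<Longrightarrow> V \<noteq> {} \<Longrightarrow> s \<in> Sec U \<Longrightarrow> t \<in> Sec U \<Longrightarrow>
    res X U V s = res X U V t \<Longrightarrow> s = t"
  unfolding integral_open_def by (elim conjE) metis

text \<open>The definition provides the identity on some smaller nonempty open set \<open>W\<close>;
  injectivity of restriction from \<open>V\<close> to \<open>W\<close> extends it to
  \<open>V\<close>.\<close>

lemma integral_fraction:
  assumes E: "integral_open E" and a: "Op U" "Op V" "U \<subseteq> E" "V \<subseteq> U" "V \<noteq> {}" "t \<in> Sec V"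
  shows "\<exists>a\<in>Sec U. \<exists>b\<in>Sec U. res X U V b \<otimes>\<^bsub>sec X V\<^esub> t = res X U V a"
proof -
  obtain a b W where W: "a \<in> Sec U" "b \<in> Sec U" "Op W" "W \<noteq> {}" "W \<subseteq> V"
    "res X U W b \<otimes>\<^bsub>sec X W\<^esub> res X V W t = res X U W a"
    using E a unfolding integral_open_def by (elim conjE) metis
  have "res X U V b \<otimes>\<^bsub>sec X V\<^esub> t = res X U V a"
    by (rule integral_inj[OF E a(2) W(3) _ W(5,4)])
      (use a W in \<open>auto simp: res_closed res_res\<close>)
  then show ?thesis using W by blast
qed

lemma integral_cancel:
  "integral_open E \<Longrightarrow> Op U \<Longrightarrow> U \<subseteq> E \<Longrightarrow> s \<in> Sec U \<Longrightarrow> t \<in> Sec U \<Longrightarrow> u \<in> Sec U \<Longrightarrow>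
    s \<otimes>\<^bsub>sec X U\<^esub> t = s \<otimes>\<^bsub>sec X U\<^esub> u \<Longrightarrow> t = u"
  unfolding integral_open_def by (elim conjE) metis

text \<open>An equation of germs holds on some small open set inside \<open>E\<close>, where the
  section \<open>s\<close> can be cancelled. Consequently every section over an open subset of
  \<open>E\<close> may serve as a denominator.\<close>

lemma integral_regular:
  assumes E: "integral_open E" and U: "Op U" "U \<subseteq> E" and s: "s \<in> Sec U"
  shows "s \<in> R U"
proof -
  have "G = H"
    if x: "x \<in> U" and G: "G \<in> carrier (stalk X x)" and H: "H \<in> carrier (stalk X x)"
      and eq: "ger x U s \<otimes>\<^bsub>stalk X x\<^esub> G = ger x U s \<otimes>\<^bsub>stalk X x\<^esub> H" for x G H
  proof -
    obtain A1 a where a: "Op A1" "x \<in> A1" "a \<in> Sec A1" "G = ger x A1 a" using stalk_cases[OF G] .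
    obtain B1 b where b: "Op B1" "x \<in> B1" "b \<in> Sec B1" "H = ger x B1 b" using stalk_cases[OF H] .
    let ?W = "U \<inter> (A1 \<inter> B1)"
    have W: "Op ?W" "x \<in> ?W" "?W \<subseteq> U" "?W \<subseteq> A1" "?W \<subseteq> B1" using U a b x by auto
    define s' a' b' where "s' = res X U ?W s" and "a' = res X A1 ?W a" and "b' = res X B1 ?W b"
    have S: "s' \<in> Sec ?W" "a' \<in> Sec ?W" "b' \<in> Sec ?W"
      unfolding s'_def a'_def b'_def using res_closed[OF U(1) W(1,3) s] res_closed[OF a(1) W(1,4) a(3)]
        res_closed[OF b(1) W(1,5) b(3)] .
    have g: "ger x U s = ger x ?W s'" "G = ger x ?W a'" "H = ger x ?W b'"
      unfolding s'_def a'_def b'_def a(4) b(4) germ_at_eq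
      using germ_res[OF U(1) W(1,3,2) s] germ_res[OF a(1) W(1,4,2) a(3)] germ_res[OF b(1) W(1,5,2) b(3)] by simp_all
    have "gm x ?W (s' \<otimes>\<^bsub>sec X ?W\<^esub> a') = gm x ?W (s' \<otimes>\<^bsub>sec X ?W\<^esub> b')"
      using eq unfolding g germ_mult[OF W(1,2) S(1,2)] germ_mult[OF W(1,2) S(1,3)] unfolding germ_at_eq .
    then obtain Z where Z: "Op Z" "x \<in> Z" "Z \<subseteq> ?W"
      "res X ?W Z (s' \<otimes>\<^bsub>sec X ?W\<^esub> a') = res X ?W Z (s' \<otimes>\<^bsub>sec X ?W\<^esub> b')"
      using germ_eq_iff[OF W(1,2) mult_closed[OF W(1) S(1,2)] W(1,2) mult_closed[OF W(1) S(1,3)]] by blast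
    have "res X ?W Z a' = res X ?W Z b'"
    proof (rule integral_cancel[OF E Z(1)])
      show "Z \<subseteq> E" using Z(3) U(2) by blast
      show "res X ?W Z s' \<otimes>\<^bsub>sec X Z\<^esub> res X ?W Z a' = res X ?W Z s' \<otimes>\<^bsub>sec X Z\<^esub> res X ?W Z b'"
        using Z(4) mult_res[OF W(1) Z(1,3) S(1,2)] mult_res[OF W(1) Z(1,3) S(1,3)] by simp
    qed (use res_closed[OF W(1) Z(1,3)] S in auto)
    then show "G = H"
      unfolding g germ_at_eq using germ_eq_iff[OF W(1,2) S(2) W(1,2) S(3)] Z(1-3) by auto
  qed
  then show ?thesis
    using s germ_closed[OF U(1) _ s] unfolding regular_sections_def regular_elements_def by blast
qed

text \<open>An open set that contains one of the two points meets \<open>E \<inter> E'\<close> in a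
  nonempty open set, which contains the other point as well. The conclusion is that the points lie
  in the same open sets, not that they are equal; this is why a common representative is chosen
  below.\<close>

lemma generic_iff:
  assumes E: "generic E w" "generic E' v" "E \<inter> E' \<noteq> {}" and O: "Op V"
  shows "w \<in> V \<longleftrightarrow> v \<in> V"
proof -
  have o: "Op (E \<inter> E')" "w \<in> E \<inter> E'" "v \<in> E \<inter> E'"
    using E unfolding generic_def by auto
  have "Op (V \<inter> (E \<inter> E'))" using o(1) O by simp
  then show ?thesis
    using E(1,2) o(2,3) unfolding generic_def
    by (metis IntI Int_iff empty_iff inf_le1 inf_le2 le_infI2)
qed

definition near_generic :: "'a \<Rightarrow> 'a \<Rightarrow> bool" where
  "near_generic x z \<longleftrightarrow> (\<exists>E. x \<in> E \<and> generic E z)"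

text \<open>The choice of \<open>z\<close> depends on \<open>x\<close> only through the predicate \<^term>\<open>near_generic x\<close>, which is
  the same for any two points that lie in intersecting irreducible open sets.\<close>

definition generic_point :: "'a \<Rightarrow> 'a" where
  "generic_point x = (SOME z. near_generic x z)"

text \<open>The neighbourhood \<open>F\<close> witnessing \<open>near_generic x z\<close> meets
  \<open>E\<close> in \<open>x\<close>, and \<open>E\<close> meets \<open>E'\<close>. Along this
  chain \<open>z\<close> lies in the same open sets as \<open>v\<close> and inherits genericity for
  \<open>E'\<close>.\<close>

lemma near_generic_generic:
  assumes "near_generic x z" "x \<in> E" "generic E w" "generic E' v" "E \<inter> E' \<noteq> {}"
  shows "generic E' z"
proof -
  obtain F where F: "x \<in> F" "generic F z" using assms(1) unfolding near_generic_def by blast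
  have z: "z \<in> V \<longleftrightarrow> v \<in> V" if "Op V" for V
    using generic_iff[OF F(2) assms(3) _ that] generic_iff[OF assms(3,4,5) that] F(1) assms(2) by blast
  then show ?thesis using assms(4) unfolding generic_def by blast
qed

lemma generic_point_generic:
  assumes "x \<in> E" "generic E w"
  shows "generic E (generic_point x)"
proof -
  have "near_generic x (generic_point x)"
    unfolding generic_point_def by (rule someI[of _ w]) (use assms in \<open>auto simp: near_generic_def\<close>)
  then show ?thesis using near_generic_generic[OF _ assms(1,2,2)] assms(1) by blast
qed

lemma generic_point_eq:
  assumes "x \<in> E" "generic E w" "y \<in> E'" "generic E' v" "E \<inter> E' \<noteq> {}"
  shows "generic_point x = generic_point y"
proof -
  have "near_generic x z \<longleftrightarrow> near_generic y z" for z
    using near_generic_generic[OF _ assms(1,2,4,5)] near_generic_generic[OF _ assms(3,4,2)] assms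
    unfolding near_generic_def by (metis Int_commute)
  then have "near_generic x = near_generic y" by (rule ext)
  then show ?thesis unfolding generic_point_def by simp
qed

text \<open>Near its generic point the cocycle is split by the units \<open>g (\<eta> x) x\<close>.
  These are defined only near \<open>\<eta> x\<close>, but as fractions of sections over a
  neighbourhood of \<open>x\<close> they become invertible meromorphic functions there, which is
  what \<open>\<kappa>_surj\<close> asks for.\<close>

lemma \<kappa>_onto:
  assumes cov: "\<And>x. x \<in> T \<Longrightarrow> \<exists>E. x \<in> E \<and> integral_open E" and c: "coc (U, g)"
  shows "bundles (U, g) \<in> \<kappa> ` carrier Div"
proof -
  obtain E where E: "\<And>x. x \<in> T \<Longrightarrow> x \<in> E x" "\<And>x. x \<in> T \<Longrightarrow> integral_open (E x)" using cov by metis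
  define \<eta> where "\<eta> = generic_point"
  have gen: "\<exists>w. generic (E x) w" "Op (E x)" if "x \<in> T" for x
    using E(2)[OF that] unfolding integral_open_def by auto
  have \<eta>: "generic (E x) (\<eta> x)" if x: "x \<in> T" for x
    using generic_point_generic[OF E(1)[OF x]] gen(1)[OF x] unfolding \<eta>_def by blast
  have \<eta>V: "\<eta> x \<in> V" if "x \<in> T" "Op V" "V \<noteq> {}" "V \<subseteq> E x" for x V
    using \<eta>[OF that(1)] that(2-4) unfolding generic_def by blast
  have \<eta>eq: "\<eta> x = \<eta> y" if "x \<in> T" "y \<in> T" "E x \<inter> E y \<noteq> {}" for x y
    unfolding \<eta>_def using generic_point_eq[OF E(1)[OF that(1)] \<eta>[OF that(1)] E(1)[OF that(2)] \<eta>[OF that(2)] that(3)] .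
  \<comment> \<open>The cover is refined into the integral neighbourhoods; the class of the cocycle
    does not change.\<close>
  define V where "V = (\<lambda>x. E x \<inter> U x)"
  have V: "Op (V x)" "V x \<subseteq> U x" "V x \<subseteq> E x" "x \<in> V x" "Op (U x)" if "x \<in> T" for x
    using gen(2)[OF that] cocD(3,4)[OF c that that] E(1)[OF that] unfolding V_def by auto
  \<comment> \<open>The generic point is a point of \<open>X\<close>, hence an index of the cover,
    so that \<open>U (\<eta> x)\<close> and \<open>g (\<eta> x) x\<close> make sense.\<close>
  have \<eta>T: "\<eta> x \<in> T" "\<eta> x \<in> V x" if x: "x \<in> T" for x
    using \<eta>V[OF x V(1)[OF x] _ V(3)[OF x]] V(1,4)[OF x] openin_subset by fast+
  \<comment> \<open>The part of \<open>V x\<close> on which \<open>g (\<eta> x) x\<close> is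
    defined. It contains \<open>\<eta> x\<close>, hence is nonempty.\<close>
  define N where "N = (\<lambda>x. U (\<eta> x) \<inter> V x)"
  have N: "Op (N x)" "N x \<subseteq> V x" "N x \<noteq> {}" "N x \<subseteq> U (\<eta> x) \<inter> U x" if x: "x \<in> T" for x
    using V(1,2)[OF x] cocD(3,4)[OF c \<eta>T(1)[OF x] \<eta>T(1)[OF x]] \<eta>T(2)[OF x] unfolding N_def by auto
  have gS: "g (\<eta> x) x \<in> Sec (U (\<eta> x) \<inter> U x)" "Op (U (\<eta> x) \<inter> U x)" if x: "x \<in> T" for x
    using cocD(3,5)[OF c \<eta>T(1)[OF x] x] V(5)[OF x] by auto
  have "\<exists>a\<in>Sec (V x). \<exists>b\<in>Sec (V x). res X (V x) (N x) b \<otimes>\<^bsub>sec X (N x)\<^esub> res X (U (\<eta> x) \<inter> U x) (N x) (g (\<eta> x) x)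
      = res X (V x) (N x) a" if x: "x \<in> T" for x
    using integral_fraction[OF E(2)[OF x] V(1)[OF x] N(1)[OF x] V(3)[OF x] N(2,3)[OF x] res_closed[OF gS(2)[OF x] N(1,4)[OF x] gS(1)[OF x]]] .
  then obtain a b where ab: "\<And>x. x \<in> T \<Longrightarrow> a x \<in> Sec (V x)" "\<And>x. x \<in> T \<Longrightarrow> b x \<in> Sec (V x)"
    "\<And>x. x \<in> T \<Longrightarrow> res X (V x) (N x) (b x) \<otimes>\<^bsub>sec X (N x)\<^esub> res X (U (\<eta> x) \<inter> U x) (N x) (g (\<eta> x) x) = res X (V x) (N x) (a x)"
    by metis
  have abat: "res X (V x) W (b x) \<otimes>\<^bsub>sec X W\<^esub> res X (U (\<eta> x) \<inter> U x) W (g (\<eta> x) x) = res X (V x) W (a x)"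
    if x: "x \<in> T" "Op W" "W \<subseteq> N x" for x W
    using arg_cong[OF ab(3)[OF x(1)], of "res X (N x) W"] N[OF x(1)] V(1)[OF x(1)] x gS[OF x(1)] ab(1,2)[OF x(1)]
      res_res[OF gS(2)[OF x(1)] N(1)[OF x(1)] x(2) N(4)[OF x(1)] x(3) gS(1)[OF x(1)]]
    by (simp add: res_closed res_res)
  \<comment> \<open>Numerator and denominator are both regular, so the fraction
    \<open>a x / b x\<close> is an invertible meromorphic function.\<close>
  have abR: "a x \<in> R (V x)" "b x \<in> R (V x)" if x: "x \<in> T" for x
    using integral_regular[OF E(2)[OF x] V(1,3)[OF x]] ab(1,2)[OF x] by auto
  define f where "f = (\<lambda>x. mero_frac (V x) (a x) (b x))"
  have fU: "f x \<in> Units (sec MS (V x))" if x: "x \<in> T" for x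
    unfolding f_def using mero_frac_Units[OF V(1)[OF x] abR[OF x]] .
  have cV: "cover V" using V unfolding point_cover_def by blast
  define k where "k = snd (restrict_cochain V (U, g))"
  have kr: "restrict_cochain V (U, g) = (V, k)" by (simp add: restrict_cochain_def k_def)
  have cc: "coc (V, k)" "coh (U, g) (V, k)" using coc_restrict[OF c cV V(2)] coh_restrict[OF c cV V(2)] unfolding kr by auto
  have "bundles (V, k) \<in> \<kappa> ` carrier Div"
  proof (rule \<kappa>_surj[OF cc(1) fU])
    fix x y assume xy: "x \<in> T" "y \<in> T"
    let ?I = "V x \<inter> V y"
    have I: "Op ?I" "?I \<subseteq> V x" "?I \<subseteq> V y" "?I \<subseteq> U x \<inter> U y" using V xy unfolding V_def by auto
    define p ax bx ay bv where "p = k x y" and "ax = res X (V x) ?I (a x)" and "bx = res X (V x) ?I (b x)"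
      and "ay = res X (V y) ?I (a y)" and "bv = res X (V y) ?I (b y)"
    have p: "p = res X (U x \<inter> U y) ?I (g x y)" unfolding p_def k_def restrict_cochain_def by simp
    have S: "p \<in> Sec ?I" "ax \<in> Sec ?I" "bx \<in> R ?I" "ay \<in> Sec ?I" "bv \<in> R ?I"
      unfolding p ax_def bx_def ay_def bv_def
      using res_closed[OF _ I(1,4) cocD(5)[OF c xy]] V(5) xy res_closed[OF V(1)[OF xy(1)] I(1,2) ab(1)[OF xy(1)]]
        res_closed[OF V(1)[OF xy(2)] I(1,3) ab(1)[OF xy(2)]] R_res[OF V(1)[OF xy(1)] I(1,2) abR(2)[OF xy(1)]]
        R_res[OF V(1)[OF xy(2)] I(1,3) abR(2)[OF xy(2)]] by auto
    have S': "bx \<in> Sec ?I" "bv \<in> Sec ?I" using S R_Sec by auto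
    \<comment> \<open>The relation \<open>f y = g x y f x\<close> in cross-multiplied form, as an
      identity of sections of \<open>O_X\<close>.\<close>
    have key: "p \<otimes>\<^bsub>sec X ?I\<^esub> ax \<otimes>\<^bsub>sec X ?I\<^esub> bv = ay \<otimes>\<^bsub>sec X ?I\<^esub> bx"
    proof (cases "?I = {}")
      \<comment> \<open>Disjoint neighbourhoods may have unrelated generic points, but all sections
        over the empty set coincide.\<close>
      case True
      have "p \<otimes>\<^bsub>sec X ?I\<^esub> ax \<otimes>\<^bsub>sec X ?I\<^esub> bv \<in> Sec ?I" "ay \<otimes>\<^bsub>sec X ?I\<^esub> bx \<in> Sec ?I" using S S' I(1) by simp_all
      then show ?thesis using empty_section unfolding True by blast
    next
      case False
      then have \<eta>xy: "\<eta> x = \<eta> y" using \<eta>eq[OF xy] V(3) xy by blast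
      \<comment> \<open>A neighbourhood of the common generic point on which the cocycle identity
        for the indices \<open>\<eta> x\<close>, \<open>x\<close>, \<open>y\<close> is available.
        The identity of sections is checked there and then extended to the whole overlap.\<close>
      let ?W = "U (\<eta> x) \<inter> ?I"
      have "\<eta> x \<in> ?I" using \<eta>V[OF xy(1) I(1) False] V(3)[OF xy(1)] by blast
      then have ne: "?W \<noteq> {}" using cocD(4)[OF c \<eta>T(1)[OF xy(1)] xy(1)] by blast
      have W: "Op ?W" "?W \<subseteq> ?I" "?W \<subseteq> N x" "?W \<subseteq> N y" "?W \<subseteq> U (\<eta> x)" "?W \<subseteq> U x" "?W \<subseteq> U y" "?W \<subseteq> V x" "?W \<subseteq> V y"
        using I cocD(3)[OF c \<eta>T(1)[OF xy(1)] xy(1)] V(2)[OF xy(1)] V(2)[OF xy(2)] unfolding N_def \<eta>xy[symmetric] by auto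
      define q ux uy where "q = res X (U x \<inter> U y) ?W (g x y)" and "ux = res X (U (\<eta> x) \<inter> U x) ?W (g (\<eta> x) x)"
        and "uy = res X (U (\<eta> y) \<inter> U y) ?W (g (\<eta> y) y)"
      define b1 b2 where "b1 = res X (V x) ?W (b x)" and "b2 = res X (V y) ?W (b y)"
      have e1: "b1 \<otimes>\<^bsub>sec X ?W\<^esub> ux = res X (V x) ?W (a x)" "b2 \<otimes>\<^bsub>sec X ?W\<^esub> uy = res X (V y) ?W (a y)"
        unfolding b1_def b2_def ux_def uy_def using abat[OF xy(1) W(1,3)] abat[OF xy(2) W(1,4)] .
      have e2: "ux \<otimes>\<^bsub>sec X ?W\<^esub> q = uy"
        \<comment> \<open>Here the equality of the two chosen generic points is indispensable: it
          makes \<open>g (\<eta> y) y\<close> the value of the cocycle at \<open>\<eta> x\<close>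
          and \<open>y\<close>.\<close>
        unfolding ux_def q_def uy_def using coc_at[OF c \<eta>T(1)[OF xy(1)] xy W(1,5,6,7)] unfolding \<eta>xy .
      have WS: "q \<in> Sec ?W" "ux \<in> Sec ?W" "b1 \<in> Sec ?W" "b2 \<in> Sec ?W"
        unfolding q_def ux_def b1_def b2_def
        using res_closed[OF _ W(1) _ cocD(5)[OF c xy]] res_closed[OF gS(2)[OF xy(1)] W(1) _ gS(1)[OF xy(1)]] W V(5) xy
          res_closed[OF V(1)[OF xy(1)] W(1,8) ab(2)[OF xy(1)]] res_closed[OF V(1)[OF xy(2)] W(1,9) ab(2)[OF xy(2)]] by auto
      have rr: "res X ?I ?W p = q" "res X ?I ?W ax = b1 \<otimes>\<^bsub>sec X ?W\<^esub> ux" "res X ?I ?W bv = b2"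
        "res X ?I ?W ay = b2 \<otimes>\<^bsub>sec X ?W\<^esub> uy" "res X ?I ?W bx = b1"
        unfolding p q_def ax_def bv_def ay_def bx_def b1_def b2_def e1[unfolded b1_def b2_def]
        using res_res[OF _ I(1) W(1) I(4) W(2) cocD(5)[OF c xy]] V(5) xy
          res_res[OF V(1)[OF xy(1)] I(1) W(1) I(2) W(2)] res_res[OF V(1)[OF xy(2)] I(1) W(1) I(3) W(2)] ab(1,2) by auto
      show ?thesis
      proof (rule integral_inj[OF E(2)[OF xy(1)] I(1) W(1) _ W(2) ne])
        show "?I \<subseteq> E x" using V(3)[OF xy(1)] by blast
        show "res X ?I ?W (p \<otimes>\<^bsub>sec X ?I\<^esub> ax \<otimes>\<^bsub>sec X ?I\<^esub> bv) = res X ?I ?W (ay \<otimes>\<^bsub>sec X ?I\<^esub> bx)"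
          using S S' I(1) W(1,2) WS by (simp add: rr e2[symmetric] ac)
      qed (use S S' I(1) in simp_all)
    qed
    have "tm ?I p \<otimes>\<^bsub>sec MS ?I\<^esub> mero_frac ?I ax bx = mero_frac ?I (p \<otimes>\<^bsub>sec X ?I\<^esub> ax) bx"
      using mero_frac_mult[OF I(1) S(1) R_one[OF I(1)] S(2,3)] S'(1) I(1) by (simp add: tm_eq)
    also have "\<dots> = mero_frac ?I ay bv"
      using mero_frac_eq_iff[OF I(1) mult_closed[OF I(1) S(1,2)] S(3,4,5)] key by simp
    finally show "tm ?I (k x y) \<otimes>\<^bsub>sec MS ?I\<^esub> res MS (V x) ?I (f x) = res MS (V y) ?I (f y)"
      unfolding f_def mero_frac_res[OF V(1)[OF xy(1)] I(1,2) ab(1)[OF xy(1)] abR(2)[OF xy(1)]]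
        mero_frac_res[OF V(1)[OF xy(2)] I(1,3) ab(1)[OF xy(2)] abR(2)[OF xy(2)]]
        p_def ax_def bx_def ay_def bv_def .
  qed
  then show ?thesis using bundles_eq_iff[OF c cc(1)] cc(2) by simp
qed

end

theorem proposition5p2:
  fixes X :: "('a, 's) monoidal_space"
  assumes "is_monoid_scheme X"
  shows "comm_group (CaCl X) \<and> comm_group (Pic X) \<and>
    cacl_to_pic X \<in> mon (CaCl X) (Pic X) \<and>
    (cancellative X \<longrightarrow> cacl_to_pic X \<in> iso (CaCl X) (Pic X))"
proof -
  interpret mero X
    by unfold_locales (use assms in \<open>simp add: is_monoid_scheme_def\<close>)
  have "cacl_to_pic X \<in> iso (CaCl X) (Pic X)" if c: "cancellative X"
  proof (rule cacl_to_pic_iso)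
    have cov: "\<exists>E. x \<in> E \<and> integral_open E" if x: "x \<in> T" for x
    proof -
      obtain E where E: "affine_open X E" "x \<in> E" using assms x unfolding is_monoid_scheme_def by blast
      \<comment> \<open>Affine neighbourhoods cover the scheme. Cancellativity of the scheme makes
        their monoids cancellative, which turns each of them into an integral open set.\<close>
      then obtain M :: "'s monoid" where M: "Op E" "comm_monoid M" "isomorphic_spaces (open_subspace X E) (Spec M)"
        unfolding affine_open_def is_affine_def by blast
      then have "comm_monoid_cancel M" using c unfolding cancellative_def by blast
      then show ?thesis using integral_open_affine[OF M(1) _ M(3)] E(2) by blast
    qed
    have "carrier (Pic X) \<subseteq> \<kappa> ` carrier Div"
      using \<kappa>_onto[OF cov] unfolding Pic_carrier by auto
    moreover have "\<kappa> ` carrier Div \<subseteq> carrier (Pic X)" using \<kappa>_hom by (auto simp: hom_def)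
    ultimately show "\<kappa> ` carrier Div = carrier (Pic X)" by blast
  qed
  then show ?thesis using comm_group_CaCl comm_group_Pic cacl_to_pic_mon by blast
qed

end
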